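(* Let $U:\mathbb R^d\to\mathbb R$ be a continuously differentiable potential satisfying Assumptions A.1 ($K$-strong convexity), A.2 ($L$-gradient Lipschitz, global minimum $0$ at $0$) and A.3 ($L_H$-Hessian Lipschitz), and let the hyperparameters $\varepsilon,\nu,\gamma,h$ satisfy Assumption A.4, all as spelled out in the context. Write $\kappa=L/K$. Then there exists $\bar h>0$ with $$\bar h^{-1}=\widetilde{\mathcal O}\Big[(L^{1/2}\gamma^{-1})^{-1/2}\,\kappa\,\log(1/\varepsilon)\Big(L_H^{1/2}K^{-1/4}d^{3/4}\,M^{3/4}+L^{1/2}d^{1/2}\,M^{1/2}\Big)\Big],$$ where $$M=\max\Big((L^{1/2}\gamma^{-1})^{-2},\,(\kappa d)^{-1}\log\nu(e^{H/8})\Big),$$ such that for all $h\le\bar h$ the mixing time of MAKLA satisfies $$\tau_{\operatorname{mix}}(\varepsilon,\nu)=\widetilde{\mathcal O}\big(h^{-1}K^{-1}\gamma\log(1/\varepsilon)\big).$$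
   Context: Target. $\mu(dx\,dv)\propto e^{-H(x,v)}dx\,dv$ on $\mathbb R^{2d}$, with $H(x,v)=\tfrac12|v|^2+U(x)$; i.e. $\mu=\mu_{target}\otimes\mathcal N(0,I_d)$ with $\mu_{target}(dx)\propto e^{-U(x)}dx$. Write $z=(x,v)$ and $\nu(e^{H/8})=\int e^{H/8}d\nu$. Assumptions. A.1: there is $K>0$ with $(\nabla U(x)-\nabla U(y))\cdot(x-y)\ge K|x-y|^2$ for all $x,y\in\mathbb R^d$. A.2: $U$ has a global minimum at $0$, $U(0)=0$, and there is $L>0$ with $|\nabla U(x)-\nabla U(y)|\le L|x-y|$ for all $x,y\in\mathbb R^d$. A.3: $U\in C^3(\mathbb R^d)$ and there is $L_H\ge0$ with $\big|\sum_{i,j,k=1}^d\partial^3_{ijk}U(x)a_ib_jc_k\big|\le L_H|a||b||c|$ for all $x,a,b,c\in\mathbb R^d$. A.4: $0<\varepsilon\le1/2$; $\nu\in\mathcal P(\mathbb R^{2d})$ is an initial distribution on phase space such that $\log\nu(e^{H/8})=\widetilde{\mathcal O}(d^{n_1}K^{n_2}L^{n_3}L_H^{n_4})$ for some constants $n_1,n_2,n_3,n_4\in\mathbb Z$; $\gamma,h>0$ satisfy $L^{1/2}\gamma^{-1}\le1/10$, $\gamma h\le1$, and $\log(1/h)=\widetilde{\mathcal O}(1)$. Notation $\widetilde{\mathcal O}$. The model parameters are $\{d,K,L,L_H\}$ and the hyperparameters are $\{\varepsilon,\nu,\gamma,h\}$. For real quantities $\mathsf x,\mathsf y$, $\mathsf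 x=\widetilde{\mathcal O}(\mathsf y)$ means that there exists $C>0$, depending at most logarithmically on any of the model parameters $d,K,L,L_H$, such that $\mathsf x\le C\mathsf y$. MAKLA (Metropolis-adjusted kinetic Langevin algorithm) with friction $\gamma$ and step size $h$. For $\mathsf b\in\mathbb R^d$ and $s>0$ let $O_s(\mathsf b)(x,v)=(x,\,e^{-\gamma s}v+(1-e^{-2\gamma s})^{1/2}\mathsf b)$, $\theta_s^{(B)}(x,v)=(x,\,v-s\nabla U(x))$, $\theta_s^{(A)}(x,v)=(x+sv,\,v)$, and $\theta_h=\theta_{h/2}^{(A)}\circ\theta_h^{(B)}\circ\theta_{h/2}^{(A)}$. For $\mathsf u\in(0,1)$ let $\hat\theta_h(\mathsf u)(z)=\theta_h(z)$ if $\mathsf u\le\exp(-\max(0,H(\theta_h(z))-H(z)))$ and $\hat\theta_h(\mathsf u)(x,v)=(x,-v)$ otherwise. One transition step of MAKLA is $$Z_1=O_{h/2}(\xi_2)\circ\hat\theta_h(\mathcal U)\circ O_{h/2}(\xi_1)(Z_0),$$ with $\xi_1,\xi_2\sim\mathcal N(0,I_d)$ and $\mathcal U\sim\mathrm{Unif}(0,1)$ independent of each other and of $Z_0$. Its transition kernel $\pi$ on $\mathbb R^{2d}$ leaves $\mu$ invariant. Mixing time. $\tau_{\operatorname{mix}}(\varepsilon,\nu)=\inf\{n\ge0:\|\nu\pi^n-\mu\|_{\mathsf{TV}}\le\varepsilon\}$, where $\|\eta_1-\eta_2\|_{\mathsf{TV}}=\sup_B|\eta_1(B)-\eta_2(B)|$.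 *)

theory Defs
  imports "HOL-Probability.Probability"
begin

(* The dimension d is quantified inside the statement (the constants hidden in the soft-O
   notation must be uniform in d up to logarithms), so R^d is not a type: it is the set of
   real functions on {..<d} that are undefined elsewhere, i.e. the space of the product
   measure over {..<d}.  The Euclidean norm is L2_set, and the topology on this set is the
   trace of the product topology on nat => real. *)

type_synonym rvec = "nat \<Rightarrow> real"
type_synonym phase = "rvec \<times> rvec"

definition Rd :: "nat \<Rightarrow> rvec set" where
  "Rd d = (\<Pi>\<^sub>E i\<in>{..<d}. UNIV)"

definition zero_vec :: "nat \<Rightarrow> rvec" where
  "zero_vec d = (\<lambda>i\<in>{..<d}. 0)"

definition diff_vec :: "nat \<Rightarrow> rvec \<Rightarrow> rvec \<Rightarrow> rvec" where
  "diff_vec d x y = (\<lambda>i\<in>{..<d}. x i - y i)"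

definition inner_vec :: "nat \<Rightarrow> rvec \<Rightarrow> rvec \<Rightarrow> real" where
  "inner_vec d x y = (\<Sum>i<d. x i * y i)"

definition norm_vec :: "nat \<Rightarrow> rvec \<Rightarrow> real" where
  "norm_vec d x = L2_set x {..<d}"

definition partial :: "nat \<Rightarrow> (rvec \<Rightarrow> real) \<Rightarrow> rvec \<Rightarrow> real" where
  "partial i f x = deriv (\<lambda>t. f (x(i := t))) (x i)"

definition grad :: "nat \<Rightarrow> (rvec \<Rightarrow> real) \<Rightarrow> rvec \<Rightarrow> rvec" where
  "grad d f x = (\<lambda>i\<in>{..<d}. partial i f x)"

(* C^k: all iterated partial derivatives up to order k exist everywhere and are continuous. *)
fun C_k :: "nat \<Rightarrow> nat \<Rightarrow> (rvec \<Rightarrow> real) \<Rightarrow> bool" where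
  "C_k d 0 f = continuous_on (Rd d) f"
| "C_k d (Suc k) f =
    (continuous_on (Rd d) f \<and>
     (\<forall>i<d. (\<forall>x\<in>Rd d. (\<lambda>t. f (x(i := t))) field_differentiable at (x i)) \<and>
            C_k d k (partial i f)))"


definition assumption_A1 :: "nat \<Rightarrow> real \<Rightarrow> (rvec \<Rightarrow> real) \<Rightarrow> bool" where
  "assumption_A1 d K U \<longleftrightarrow> K > 0 \<and>
    (\<forall>x\<in>Rd d. \<forall>y\<in>Rd d.
       inner_vec d (diff_vec d (grad d U x) (grad d U y)) (diff_vec d x y)
         \<ge> K * (norm_vec d (diff_vec d x y))\<^sup>2)"

definition assumption_A2 :: "nat \<Rightarrow> real \<Rightarrow> (rvec \<Rightarrow> real) \<Rightarrow> bool" where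
  "assumption_A2 d L U \<longleftrightarrow>
    (\<forall>x\<in>Rd d. U (zero_vec d) \<le> U x) \<and> U (zero_vec d) = 0 \<and> L > 0 \<and>
    (\<forall>x\<in>Rd d. \<forall>y\<in>Rd d.
       norm_vec d (diff_vec d (grad d U x) (grad d U y)) \<le> L * norm_vec d (diff_vec d x y))"

definition assumption_A3 :: "nat \<Rightarrow> real \<Rightarrow> (rvec \<Rightarrow> real) \<Rightarrow> bool" where
  "assumption_A3 d L\<^sub>H U \<longleftrightarrow> C_k d 3 U \<and> L\<^sub>H \<ge> 0 \<and>
    (\<forall>x\<in>Rd d. \<forall>a\<in>Rd d. \<forall>b\<in>Rd d. \<forall>c\<in>Rd d.
       \<bar>\<Sum>i<d. \<Sum>j<d. \<Sum>k<d. partial i (partial j (partial k U)) x * a i * b j * c k\<bar>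
         \<le> L\<^sub>H * norm_vec d a * norm_vec d b * norm_vec d c)"


definition lebesgue_Rd :: "nat \<Rightarrow> rvec measure" where
  "lebesgue_Rd d = (\<Pi>\<^sub>M i\<in>{..<d}. lborel)"

definition phase_space :: "nat \<Rightarrow> phase measure" where
  "phase_space d = lebesgue_Rd d \<Otimes>\<^sub>M lebesgue_Rd d"

definition hamiltonian :: "nat \<Rightarrow> (rvec \<Rightarrow> real) \<Rightarrow> phase \<Rightarrow> real" where
  "hamiltonian d U = (\<lambda>(x, v). (norm_vec d v)\<^sup>2 / 2 + U x)"

definition target :: "nat \<Rightarrow> (rvec \<Rightarrow> real) \<Rightarrow> phase measure" where
  "target d U = density (phase_space d)
     (\<lambda>z. ennreal (exp (- hamiltonian d U z)
                 / (\<integral>w. exp (- hamiltonian d U w) \<partial>phase_space d)))"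

definition std_gaussian :: "nat \<Rightarrow> rvec measure" where
  "std_gaussian d = (\<Pi>\<^sub>M i\<in>{..<d}. density lborel (\<lambda>x. ennreal (std_normal_density x)))"


definition O_step :: "nat \<Rightarrow> real \<Rightarrow> real \<Rightarrow> rvec \<Rightarrow> phase \<Rightarrow> phase" where
  "O_step d \<gamma> s b = (\<lambda>(x, v).
     (x, \<lambda>i\<in>{..<d}. exp (- \<gamma> * s) * v i + sqrt (1 - exp (- 2 * \<gamma> * s)) * b i))"

definition B_step :: "nat \<Rightarrow> (rvec \<Rightarrow> real) \<Rightarrow> real \<Rightarrow> phase \<Rightarrow> phase" where
  "B_step d U s = (\<lambda>(x, v). (x, \<lambda>i\<in>{..<d}. v i - s * grad d U x i))"

definition A_step :: "nat \<Rightarrow> real \<Rightarrow> phase \<Rightarrow> phase" where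
  "A_step d s = (\<lambda>(x, v). (\<lambda>i\<in>{..<d}. x i + s * v i, v))"

definition verlet :: "nat \<Rightarrow> (rvec \<Rightarrow> real) \<Rightarrow> real \<Rightarrow> phase \<Rightarrow> phase" where
  "verlet d U h = A_step d (h / 2) \<circ> B_step d U h \<circ> A_step d (h / 2)"

definition flip :: "nat \<Rightarrow> phase \<Rightarrow> phase" where
  "flip d = (\<lambda>(x, v). (x, \<lambda>i\<in>{..<d}. - v i))"

definition adjusted_verlet ::
  "nat \<Rightarrow> (rvec \<Rightarrow> real) \<Rightarrow> real \<Rightarrow> real \<Rightarrow> phase \<Rightarrow> phase" where
  "adjusted_verlet d U h u z =
     (if u \<le> exp (- max 0 (hamiltonian d U (verlet d U h z) - hamiltonian d U z))
      then verlet d U h z else flip d z)"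

definition makla_kernel ::
  "nat \<Rightarrow> (rvec \<Rightarrow> real) \<Rightarrow> real \<Rightarrow> real \<Rightarrow> phase \<Rightarrow> phase measure" where
  "makla_kernel d U \<gamma> h z =
     distr (std_gaussian d \<Otimes>\<^sub>M (uniform_measure lborel {0<..<1} \<Otimes>\<^sub>M std_gaussian d))
       (phase_space d)
       (\<lambda>(\<xi>\<^sub>1, u, \<xi>\<^sub>2).
          (O_step d \<gamma> (h / 2) \<xi>\<^sub>2 \<circ> adjusted_verlet d U h u \<circ> O_step d \<gamma> (h / 2) \<xi>\<^sub>1) z)"

definition makla_law ::
  "nat \<Rightarrow> (rvec \<Rightarrow> real) \<Rightarrow> real \<Rightarrow> real \<Rightarrow> phase measure \<Rightarrow> nat \<Rightarrow> phase measure" where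
  "makla_law d U \<gamma> h \<nu> n = ((\<lambda>\<eta>. \<eta> \<bind> makla_kernel d U \<gamma> h) ^^ n) \<nu>"

definition tv_dist :: "'a measure \<Rightarrow> 'a measure \<Rightarrow> real" where
  "tv_dist \<eta>\<^sub>1 \<eta>\<^sub>2 = (SUP B\<in>sets \<eta>\<^sub>1. \<bar>measure \<eta>\<^sub>1 B - measure \<eta>\<^sub>2 B\<bar>)"

(* The infimum is taken in the extended naturals, so it is infinite if the chain never
   comes within \<epsilon> of the target. *)
definition mixing_time ::
  "nat \<Rightarrow> (rvec \<Rightarrow> real) \<Rightarrow> real \<Rightarrow> real \<Rightarrow> real \<Rightarrow> phase measure \<Rightarrow> enat" where
  "mixing_time d U \<gamma> h \<epsilon> \<nu> =
     (INF n \<in> {n. tv_dist (makla_law d U \<gamma> h \<nu> n) (target d U) \<le> \<epsilon>}. enat n)"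


(* The factor C in "x = soft-O(y) iff x <= C y", as a positive function of the model
   parameters d, K, L, L_H only, of at most polylogarithmic size in them.  Logarithms are
   taken in absolute value because K, L, L_H may be small; for L_H = 0 the term
   \<bar>ln L_H\<bar> is 0, as ln 0 = 0. *)
definition at_most_log :: "(nat \<Rightarrow> real \<Rightarrow> real \<Rightarrow> real \<Rightarrow> real) \<Rightarrow> bool" where
  "at_most_log C \<longleftrightarrow> (\<exists>(c::real) (p::nat). \<forall>d K L L\<^sub>H.
     d \<ge> 1 \<and> K > 0 \<and> L > 0 \<and> L\<^sub>H \<ge> 0 \<longrightarrow>
       0 < C d K L L\<^sub>H \<and>
       C d K L L\<^sub>H \<le> c * (1 + ln (real d) + \<bar>ln K\<bar> + \<bar>ln L\<bar> + \<bar>ln L\<^sub>H\<bar>) ^ p)"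

definition log_exp_moment :: "nat \<Rightarrow> (rvec \<Rightarrow> real) \<Rightarrow> phase measure \<Rightarrow> real" where
  "log_exp_moment d U \<nu> = ln (\<integral>z. exp (hamiltonian d U z / 8) \<partial>\<nu>)"

definition M_const ::
  "nat \<Rightarrow> real \<Rightarrow> real \<Rightarrow> (rvec \<Rightarrow> real) \<Rightarrow> real \<Rightarrow> phase measure \<Rightarrow> real" where
  "M_const d K L U \<gamma> \<nu> =
     max ((sqrt L / \<gamma>) powr (- 2)) (log_exp_moment d U \<nu> / ((L / K) * real d))"

end

(* The unadjusted chain (Metropolis filter switched off) contracts under synchronous coupling:
   in the coordinates w = x + alpha v and p = eta beta v the squared distance of two copies
   shrinks by the factor 1 - h K / (2 gamma) per step, because the force difference G at the
   midpoint y = w - p is cocoercive, |G|^2 <= L G . y.  One further step turns distance into total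
   variation, since the two positions reached can be matched by a map of the Gaussian noise that is
   close to the identity.  The adjusted and the unadjusted chain differ by the rejections, and
   the energy error of a Verlet step from {H <= R} is at most h^3 (2 L_H R^(3/2) + 2 L^(3/2) R).
   For h <= hbar an epoch of order gamma / (h K) steps therefore halves the oscillation of every
   bounded function, up to excursions of H above R.  No dissipation is needed to exclude these:
   on {H <= R} the expectation of exp (H / 8) grows per step by the factor
   exp (d gamma h / 4 + small), hence over all steps by a power of exp (kappa d M), and
   R of the order kappa d M log(1/eps), up to logarithms, makes exp (- R / 8) dominate. *)
theory Submission
  imports Defs
begin

section \<open>Calculus on the coordinate space\<close>

text \<open>The first entry of \<open>M\<close> is what permits energy growth without dissipation:
  \<gamma> / (h K) steps at the rate d \<gamma> h accumulate d \<gamma>^2 / K = \<kappa> d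
  \<gamma>^2 / L, and \<open>M\<close> \<ge> \<gamma>^2 / L. The second entry pays for the initial
  moment. With Q = \<kappa> d M, few rejections per epoch means that (\<gamma> / (h K)) h^3 (L_H
  Q^(3/2) + L^(3/2) Q) is small up to logarithms; solving for h gives \<open>hbar\<close>. All other
  losses are polynomial in the parameters and in 1 / h, so a longer epoch absorbs them at
  logarithmic cost; here log (1 / h) = soft-O(1) enters. Since d is a variable, Euclidean space is a
  set of functions. Volume preservation comes from shears and Fubini, and Gaussian noise is
  transported by comparing volumes of balls. Functions take values in \<open>ennreal\<close>, and
  excursions above R enter as an additive weight instead of through conditioning, so the operators
  stay linear and the target stays invariant.\<close>

lemma norm_vec_nonneg [simp]: "0 \<le> norm_vec d x"
  by (simp add: norm_vec_def)

lemma norm_vec_power2: "(norm_vec d x)\<^sup>2 = (\<Sum>i<d. (x i)\<^sup>2)"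
  by (simp add: norm_vec_def L2_set_def sum_nonneg)

lemma norm_vec_cong: "(\<And>i. i < d \<Longrightarrow> x i = y i) \<Longrightarrow> norm_vec d x = norm_vec d y"
  by (simp add: norm_vec_def L2_set_def)

lemma norm_vec_restrict [simp]: "norm_vec d (restrict f {..<d}) = norm_vec d f"
  by (rule norm_vec_cong) simp

lemma norm_vec_minus_commute: "norm_vec d (\<lambda>i. x i - y i) = norm_vec d (\<lambda>i. y i - x i)"
  by (simp add: norm_vec_def L2_set_def power2_commute)

lemma norm_vec_scale: "norm_vec d (\<lambda>i. c * x i) = \<bar>c\<bar> * norm_vec d x"
  by (simp add: norm_vec_def L2_set_def power_mult_distrib real_sqrt_mult flip: sum_distrib_left)

lemma norm_vec_triangle: "norm_vec d (\<lambda>i. x i + y i) \<le> norm_vec d x + norm_vec d y"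
  by (simp add: norm_vec_def L2_set_triangle_ineq)

lemma norm_vec_triangle_diff: "norm_vec d (\<lambda>i. x i - y i) \<le> norm_vec d x + norm_vec d y"
  using norm_vec_triangle[of d x "\<lambda>i. - 1 * y i"] unfolding norm_vec_scale by simp

lemma norm_vec_component: "i < d \<Longrightarrow> \<bar>x i\<bar> \<le> norm_vec d x"
  using member_le_L2_set[of "{..<d}" i "\<lambda>i. \<bar>x i\<bar>"]
  by (simp add: norm_vec_def L2_set_def)

lemma abs_sum_mult_le_norm_vec: "\<bar>\<Sum>i<d. x i * y i\<bar> \<le> norm_vec d x * norm_vec d y"
proof -
  have "\<bar>\<Sum>i<d. x i * y i\<bar> \<le> (\<Sum>i<d. \<bar>x i\<bar> * \<bar>y i\<bar>)"
    by (rule order_trans[OF sum_abs]) (simp add: abs_mult)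
  also have "\<dots> \<le> norm_vec d x * norm_vec d y"
    unfolding norm_vec_def by (rule L2_set_mult_ineq)
  finally show ?thesis .
qed

lemma sum_mult_le_norm_vec: "(\<Sum>i<d. x i * y i) \<le> norm_vec d x * norm_vec d y"
  using abs_sum_mult_le_norm_vec[of x y d] by linarith

lemma restrict_in_Rd [simp, intro]: "restrict f {..<d} \<in> Rd d"
  by (simp add: Rd_def)

lemma zero_vec_in_Rd [simp, intro]: "zero_vec d \<in> Rd d"
  by (simp add: zero_vec_def)

lemma grad_in_Rd [simp, intro]: "grad d U x \<in> Rd d"
  by (simp add: grad_def)

lemma grad_nth [simp]: "i < d \<Longrightarrow> grad d U x i = partial i U x"
  by (simp add: grad_def)

lemma fun_upd_in_Rd: "x \<in> Rd d \<Longrightarrow> i < d \<Longrightarrow> x(i := t) \<in> Rd d"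
  by (auto simp: Rd_def PiE_def extensional_def)

lemma Rd_eqI: "x \<in> Rd d \<Longrightarrow> y \<in> Rd d \<Longrightarrow> (\<And>i. i < d \<Longrightarrow> x i = y i) \<Longrightarrow> x = y"
  unfolding Rd_def by (rule PiE_ext) auto

lemma Rd_undefined: "x \<in> Rd d \<Longrightarrow> \<not> i < d \<Longrightarrow> x i = undefined"
  by (auto simp: Rd_def PiE_def extensional_def)

lemma restrict_Rd: "x \<in> Rd d \<Longrightarrow> restrict x {..<d} = x"
  by (auto simp: Rd_def PiE_def extensional_restrict)

text \<open>The topology on \<open>nat => real\<close> is the product topology, so convergence is
  checked at every index, including those outside \<open>{..<d}\<close>, where points of
  \<open>Rd d\<close> are constantly \<open>undefined\<close>.\<close>

lemma tendsto_componentwise_fun: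
  fixes g :: "'a \<Rightarrow> nat \<Rightarrow> real"
  assumes "\<And>i. ((\<lambda>s. g s i) \<longlongrightarrow> l i) F"
  shows "(g \<longlongrightarrow> l) F"
  using assms limitin_componentwise[of "\<lambda>_. euclidean" UNIV g l F]
  by (simp add: limitin_canonical_iff euclidean_product_topology)

text \<open>The affine reparametrisation puts every coordinate increment on the unit interval, so
  that one form of the mean value theorem serves increments b of either sign and b = 0.\<close>

lemma partial_DERIV:
  assumes "C_k d (Suc n) f" "j < d" "p \<in> Rd d"
  shows "((\<lambda>t. f (p(j := a + t * b))) has_real_derivative partial j f (p(j := a + s * b)) * b) (at s)"
proof -
  let ?p = "p(j := a + s * b)"
  have "?p \<in> Rd d" using assms by (intro fun_upd_in_Rd)
  then have "(\<lambda>t. f (?p(j := t))) field_differentiable at (?p j)"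
    using assms(1,2) unfolding C_k.simps by (elim conjE allE[of _ j]) auto
  then have "((\<lambda>t. f (?p(j := t))) has_field_derivative partial j f ?p) (at (a + s * b))"
    by (simp add: partial_def DERIV_deriv_iff_field_differentiable)
  moreover have "((\<lambda>t. a + t * b) has_field_derivative b) (at s)"
    by (auto intro!: derivative_eq_intros)
  ultimately have "((\<lambda>t. f (?p(j := a + t * b))) has_field_derivative partial j f ?p * b) (at s)"
    by (rule DERIV_chain2)
  then show ?thesis by simp
qed

text \<open>\<open>C_k\<close> only provides partial derivatives, so directional derivatives come
  from their continuity: the segment is replaced by a staircase that changes one coordinate at a
  time, the mean value theorem is applied on each stair, and the intermediate points converge to
  x.\<close>

lemma chain_rule_at_0:
  assumes f: "C_k d (Suc n) f" and x: "x \<in> Rd d"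
  shows "((\<lambda>t. f (\<lambda>i\<in>{..<d}. x i + t * w i)) has_real_derivative (\<Sum>i<d. partial i f x * w i)) (at 0)"
proof -
  \<comment> \<open>The first j coordinates have already been moved; \<open>q s 0\<close> is x and
    \<open>q s d\<close> is the end point.\<close>
  define q where "q s j = (\<lambda>i\<in>{..<d}. if i < j then x i + s * w i else x i)" for s j
  have qR: "q s j \<in> Rd d" for s j by (simp add: q_def)
  have "\<exists>\<theta>. 0 < \<theta> \<and> \<theta> < 1 \<and>
      f (q s (Suc j)) - f (q s j) = partial j f ((q s j)(j := x j + \<theta> * (s * w j))) * (s * w j)"
    if "j < d" for s j
  proof -
    have "\<exists>\<theta>. 0 < \<theta> \<and> \<theta> < 1 \<and>
      f ((q s j)(j := x j + 1 * (s * w j))) - f ((q s j)(j := x j + 0 * (s * w j)))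
       = (1 - 0) * (partial j f ((q s j)(j := x j + \<theta> * (s * w j))) * (s * w j))"
      by (rule MVT2[OF zero_less_one]) (rule partial_DERIV[OF f that qR])
    moreover have "(q s j)(j := x j + 1 * (s * w j)) = q s (Suc j)"
      using that by (auto simp: q_def fun_eq_iff)
    moreover have "(q s j)(j := x j + 0 * (s * w j)) = q s j"
      using that by (auto simp: q_def fun_eq_iff)
    ultimately show ?thesis by simp
  qed
  note ex = this
  define \<theta> where "\<theta> s j = (SOME \<theta>. 0 < \<theta> \<and> \<theta> < 1 \<and>
      f (q s (Suc j)) - f (q s j) = partial j f ((q s j)(j := x j + \<theta> * (s * w j))) * (s * w j))" for s j
  have \<theta>: "0 < \<theta> s j \<and> \<theta> s j < 1 \<and>
      f (q s (Suc j)) - f (q s j) = partial j f ((q s j)(j := x j + \<theta> s j * (s * w j))) * (s * w j)"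
    if "j < d" for s j
    unfolding \<theta>_def by (rule someI_ex[OF ex[OF that]])
  define r where "r s j = (q s j)(j := x j + \<theta> s j * (s * w j))" for s j
  have rR: "r s j \<in> Rd d" if "j < d" for s j
    unfolding r_def using qR that by (intro fun_upd_in_Rd)
  have quot: "(f (\<lambda>i\<in>{..<d}. x i + s * w i) - f x) / s = (\<Sum>j<d. partial j f (r s j) * w j)" if "s \<noteq> 0" for s
  proof -
    have "q s d = (\<lambda>i\<in>{..<d}. x i + s * w i)" "q s 0 = x"
      using restrict_Rd[OF x] by (auto simp: q_def fun_eq_iff restrict_def)
    then have "f (\<lambda>i\<in>{..<d}. x i + s * w i) - f x = f (q s d) - f (q s 0)" by simp
    also have "\<dots> = (\<Sum>j<d. f (q s (Suc j)) - f (q s j))"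
      by (rule sum_lessThan_telescope[of "\<lambda>j. f (q s j)", symmetric])
    also have "\<dots> = (\<Sum>j<d. partial j f (r s j) * w j) * s"
      unfolding sum_distrib_right by (rule sum.cong) (use \<theta> in \<open>simp_all add: r_def mult_ac\<close>)
    finally show ?thesis using that by simp
  qed
  have rx: "((\<lambda>s. r s j) \<longlongrightarrow> x) (at 0)" if j: "j < d" for j
  proof (rule tendsto_componentwise_fun)
    fix i
    have "((\<lambda>s. r s j i - x i) \<longlongrightarrow> 0) (at 0)"
    proof (rule Lim_null_comparison)
      show "\<forall>\<^sub>F s in at 0. norm (r s j i - x i) \<le> \<bar>s\<bar> * \<bar>w i\<bar>"
      proof (rule always_eventually, rule allI)
        fix s
        have "\<bar>\<theta> s j * (s * w j)\<bar> \<le> 1 * \<bar>s * w j\<bar>"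
          unfolding abs_mult using \<theta>[OF j, of s] by (intro mult_right_mono) auto
        then show "norm (r s j i - x i) \<le> \<bar>s\<bar> * \<bar>w i\<bar>"
          using j Rd_undefined[OF x, of i] unfolding r_def q_def
          by (cases "i < d"; cases "i = j"; cases "i < j") (simp_all add: abs_mult)
      qed
      show "((\<lambda>s. \<bar>s\<bar> * \<bar>w i\<bar>) \<longlongrightarrow> 0) (at 0)"
        by (auto intro!: tendsto_eq_intros)
    qed
    then show "((\<lambda>s. r s j i) \<longlongrightarrow> x i) (at 0)"
      by (simp add: LIM_zero_iff)
  qed
  have "((\<lambda>s. \<Sum>j<d. partial j f (r s j) * w j) \<longlongrightarrow> (\<Sum>j<d. partial j f x * w j)) (at 0)"
  proof (intro tendsto_sum tendsto_mult tendsto_const)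
    fix j assume "j \<in> {..<d}"
    then have j: "j < d" by simp
    have "C_k d n (partial j f)" using f j by simp
    then have "continuous_on (Rd d) (partial j f)" by (cases n) auto
    then show "((\<lambda>s. partial j f (r s j)) \<longlongrightarrow> partial j f x) (at 0)"
      by (rule continuous_on_tendsto_compose[OF _ rx[OF j] x]) (simp add: rR[OF j])
  qed
  then have "((\<lambda>s. (f (\<lambda>i\<in>{..<d}. x i + s * w i) - f x) / s) \<longlongrightarrow> (\<Sum>j<d. partial j f x * w j)) (at 0)"
    by (rule Lim_transform_eventually) (auto simp: quot eventually_at_filter)
  then show ?thesis
    using restrict_Rd[OF x] by (simp add: DERIV_def)
qed

lemma chain_rule:
  assumes f: "C_k d (Suc n) f" 
  shows "((\<lambda>t. f (\<lambda>i\<in>{..<d}. x i + t * w i)) has_real_derivative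
           (\<Sum>i<d. partial i f (\<lambda>i\<in>{..<d}. x i + s * w i) * w i)) (at s)"
proof -
  let ?y = "\<lambda>i\<in>{..<d}. x i + s * w i"
  have eq: "(\<lambda>i\<in>{..<d}. ?y i + t * w i) = (\<lambda>i\<in>{..<d}. x i + (t + s) * w i)" for t
    by (auto simp: fun_eq_iff algebra_simps)
  have "((\<lambda>t. f (\<lambda>i\<in>{..<d}. ?y i + t * w i)) has_real_derivative (\<Sum>i<d. partial i f ?y * w i)) (at 0)"
    by (rule chain_rule_at_0[OF f restrict_in_Rd])
  then have "((\<lambda>t. f (\<lambda>i\<in>{..<d}. x i + (t + s) * w i)) has_real_derivative (\<Sum>i<d. partial i f ?y * w i)) (at 0)"
    by (simp only: eq)
  then show ?thesis
    using DERIV_shift[of "\<lambda>t. f (\<lambda>i\<in>{..<d}. x i + t * w i)" _ 0 s] by simp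
qed

text \<open>Subtracting the tangent and c t^2 / 2 leaves a function that is nondecreasing on
  [0, 1].\<close>

lemma DERIV_quadratic_lower:
  fixes \<phi> \<phi>' :: "real \<Rightarrow> real"
  assumes "\<And>t. (\<phi> has_real_derivative \<phi>' t) (at t)"
    and "\<And>t. 0 \<le> t \<Longrightarrow> \<phi>' t \<ge> \<phi>' 0 + c * t"
  shows "\<phi> 1 \<ge> \<phi> 0 + \<phi>' 0 + c / 2"
proof -
  let ?g = "\<lambda>t. \<phi> t - \<phi>' 0 * t - c / 2 * t\<^sup>2"
  have "?g 0 \<le> ?g 1"
  proof (rule DERIV_nonneg_imp_nondecreasing[of 0 1 ?g])
    fix t :: real assume "0 \<le> t" "t \<le> 1"
    have "(?g has_real_derivative \<phi>' t - \<phi>' 0 - c * t) (at t)"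
      by (auto intro!: derivative_eq_intros assms(1))
    then show "\<exists>y. (?g has_real_derivative y) (at t) \<and> 0 \<le> y"
      using assms(2)[OF \<open>0 \<le> t\<close>] by (intro exI[of _ "\<phi>' t - \<phi>' 0 - c * t"]) auto
  qed simp
  then show ?thesis by simp
qed

lemma DERIV_quadratic_upper:
  fixes \<phi> \<phi>' :: "real \<Rightarrow> real"
  assumes "\<And>t. (\<phi> has_real_derivative \<phi>' t) (at t)"
    and "\<And>t. 0 \<le> t \<Longrightarrow> \<phi>' t \<le> \<phi>' 0 + c * t"
  shows "\<phi> 1 \<le> \<phi> 0 + \<phi>' 0 + c / 2"
  using DERIV_quadratic_lower[of "\<lambda>t. - \<phi> t" "\<lambda>t. - \<phi>' t" "- c"] assms
  by (force intro!: derivative_eq_intros simp: algebra_simps)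

section \<open>Convexity, smoothness and third-order estimates for the potential\<close>

locale potential =
  fixes d :: nat and K L L\<^sub>H :: real and U :: "rvec \<Rightarrow> real"
  assumes d_pos: "d \<ge> 1" and A1: "assumption_A1 d K U" and A2: "assumption_A2 d L U"
    and A3: "assumption_A3 d L\<^sub>H U"
begin

lemma K_pos: "K > 0" using A1 by (simp add: assumption_A1_def)
lemma L_pos: "L > 0" using A2 by (simp add: assumption_A2_def)
lemma LH_nonneg: "L\<^sub>H \<ge> 0" using A3 by (simp add: assumption_A3_def)
lemma C3: "C_k d (Suc (Suc (Suc 0))) U" using A3 by (simp add: assumption_A3_def numeral_3_eq_3)

abbreviation D :: "nat \<Rightarrow> rvec \<Rightarrow> real" where "D i x \<equiv> partial i U x"

lemma A1_sum:
  assumes "x \<in> Rd d" "y \<in> Rd d"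
  shows "K * (\<Sum>i<d. (x i - y i)\<^sup>2) \<le> (\<Sum>i<d. (D i x - D i y) * (x i - y i))"
  using A1 assms
  by (auto simp: assumption_A1_def diff_vec_def inner_vec_def norm_vec_power2)

lemma A2_norm:
  assumes "x \<in> Rd d" "y \<in> Rd d"
  shows "norm_vec d (\<lambda>i. D i x - D i y) \<le> L * norm_vec d (\<lambda>i. x i - y i)"
proof -
  have "norm_vec d (\<lambda>i. grad d U x i - grad d U y i) \<le> L * norm_vec d (\<lambda>i. x i - y i)"
    using A2 assms by (auto simp: assumption_A2_def diff_vec_def)
  moreover have "norm_vec d (\<lambda>i. grad d U x i - grad d U y i) = norm_vec d (\<lambda>i. D i x - D i y)"
    by (rule norm_vec_cong) simp
  ultimately show ?thesis by simp
qed

lemma A3_sum: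
  assumes "x \<in> Rd d" "a \<in> Rd d" "b \<in> Rd d" "c \<in> Rd d"
  shows "\<bar>\<Sum>i<d. \<Sum>j<d. \<Sum>k<d. partial i (partial j (partial k U)) x * a i * b j * c k\<bar>
         \<le> L\<^sub>H * norm_vec d a * norm_vec d b * norm_vec d c"
  using A3 assms unfolding assumption_A3_def by (elim conjE) (drule (1) bspec)+

lemma U_zero: "U (zero_vec d) = 0" and U_nonneg: "x \<in> Rd d \<Longrightarrow> U x \<ge> 0"
  using A2 by (auto simp: assumption_A2_def)

text \<open>Both constants are tested on one pair of points, the all-ones vector and zero, which are
  distinct because d \<ge> 1.\<close>

lemma K_le_L: "K \<le> L"
proof -
  let ?x = "\<lambda>i\<in>{..<d}. 1 :: real" and ?z = "zero_vec d"
  have n: "(norm_vec d (\<lambda>i. ?x i - ?z i))\<^sup>2 = d"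
    by (simp add: norm_vec_power2 zero_vec_def)
  have "K * (norm_vec d (\<lambda>i. ?x i - ?z i))\<^sup>2 \<le> (\<Sum>i<d. (D i ?x - D i ?z) * (?x i - ?z i))"
    unfolding norm_vec_power2 by (rule A1_sum[OF restrict_in_Rd zero_vec_in_Rd])
  also have "\<dots> \<le> norm_vec d (\<lambda>i. D i ?x - D i ?z) * norm_vec d (\<lambda>i. ?x i - ?z i)"
    by (rule sum_mult_le_norm_vec)
  also have "\<dots> \<le> L * norm_vec d (\<lambda>i. ?x i - ?z i) * norm_vec d (\<lambda>i. ?x i - ?z i)"
    by (intro mult_right_mono A2_norm[OF restrict_in_Rd zero_vec_in_Rd]) auto
  also have "\<dots> = L * (norm_vec d (\<lambda>i. ?x i - ?z i))\<^sup>2" by (simp add: power2_eq_square)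
  finally show ?thesis using d_pos unfolding n by simp
qed

lemma U_line_DERIV:
  "((\<lambda>t. U (\<lambda>i\<in>{..<d}. x i + t * w i)) has_real_derivative
     (\<Sum>i<d. D i (\<lambda>i\<in>{..<d}. x i + t * w i) * w i)) (at t)"
  by (rule chain_rule[OF C3])

lemma convex_lower:
  assumes x: "x \<in> Rd d" and y: "y \<in> Rd d"
  shows "U y \<ge> U x + (\<Sum>i<d. D i x * (y i - x i)) + K / 2 * (\<Sum>i<d. (y i - x i)\<^sup>2)"
proof -
  define w where "w = (\<lambda>i. y i - x i)"
  let ?p = "\<lambda>t. (\<lambda>i\<in>{..<d}. x i + t * w i)"
  have p0: "?p 0 = x" using restrict_Rd[OF x] by simp
  have p1: "?p 1 = y" using restrict_Rd[OF y] by (simp add: w_def)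
  have "U (?p 1) \<ge> U (?p 0) + (\<Sum>i<d. D i (?p 0) * w i) + (K * (\<Sum>i<d. (w i)\<^sup>2)) / 2"
  proof (rule DERIV_quadratic_lower[where \<phi> = "\<lambda>t. U (?p t)"])
    fix t :: real
    assume t: "0 \<le> t"
    show "(\<Sum>i<d. D i (?p t) * w i) \<ge> (\<Sum>i<d. D i (?p 0) * w i) + (K * (\<Sum>i<d. (w i)\<^sup>2)) * t"
    proof (cases "t = 0")
      case False
      have "K * (\<Sum>i<d. (?p t i - ?p 0 i)\<^sup>2) \<le> (\<Sum>i<d. (D i (?p t) - D i (?p 0)) * (?p t i - ?p 0 i))"
        by (rule A1_sum[OF restrict_in_Rd restrict_in_Rd])
      then have "t * (t * (K * (\<Sum>i<d. (w i)\<^sup>2))) \<le> t * (\<Sum>i<d. (D i (?p t) - D i (?p 0)) * w i)"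
        by (simp add: power_mult_distrib sum_distrib_left power2_eq_square mult_ac)
      then have "t * (K * (\<Sum>i<d. (w i)\<^sup>2)) \<le> (\<Sum>i<d. (D i (?p t) - D i (?p 0)) * w i)"
        using t False by simp
      then show ?thesis by (simp add: left_diff_distrib sum_subtractf mult.commute[of t])
    qed simp
  qed (rule U_line_DERIV)
  then show ?thesis unfolding p0 p1 by (simp add: w_def)
qed

lemma descent_upper:
  assumes x: "x \<in> Rd d" and y: "y \<in> Rd d"
  shows "U y \<le> U x + (\<Sum>i<d. D i x * (y i - x i)) + L / 2 * (\<Sum>i<d. (y i - x i)\<^sup>2)"
proof -
  define w where "w = (\<lambda>i. y i - x i)"
  let ?p = "\<lambda>t. (\<lambda>i\<in>{..<d}. x i + t * w i)"
  have p0: "?p 0 = x" using restrict_Rd[OF x] by simp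
  have p1: "?p 1 = y" using restrict_Rd[OF y] by (simp add: w_def)
  have "U (?p 1) \<le> U (?p 0) + (\<Sum>i<d. D i (?p 0) * w i) + (L * (\<Sum>i<d. (w i)\<^sup>2)) / 2"
  proof (rule DERIV_quadratic_upper[where \<phi> = "\<lambda>t. U (?p t)"])
    fix t :: real
    assume t: "0 \<le> t"
    have nw: "norm_vec d (\<lambda>i. ?p t i - ?p 0 i) = t * norm_vec d w"
      using norm_vec_scale[of d t w] t by (subst norm_vec_cong[where y = "\<lambda>i. t * w i"]) auto
    have "(\<Sum>i<d. (D i (?p t) - D i (?p 0)) * w i) \<le> norm_vec d (\<lambda>i. D i (?p t) - D i (?p 0)) * norm_vec d w"
      by (rule sum_mult_le_norm_vec)
    also have "\<dots> \<le> (L * norm_vec d (\<lambda>i. ?p t i - ?p 0 i)) * norm_vec d w"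
      by (rule mult_right_mono[OF A2_norm[OF restrict_in_Rd restrict_in_Rd]]) simp
    also have "\<dots> = L * (norm_vec d w)\<^sup>2 * t" unfolding nw by (simp add: power2_eq_square)
    finally show "(\<Sum>i<d. D i (?p t) * w i) \<le> (\<Sum>i<d. D i (?p 0) * w i) + (L * (\<Sum>i<d. (w i)\<^sup>2)) * t"
      by (simp add: left_diff_distrib sum_subtractf norm_vec_power2 mult_ac(1))
  qed (rule U_line_DERIV)
  then show ?thesis unfolding p0 p1 by (simp add: w_def)
qed

text \<open>Tilting U by its gradient at x gives a convex function minimised at x. A gradient step
  of size 1 / L from y, which leads to z, lowers the tilted function by at least |g|^2 / (2 L), yet
  cannot go below its minimum.\<close>

lemma bregman_lower:
  assumes x: "x \<in> Rd d" and y: "y \<in> Rd d"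
  shows "U y - U x - (\<Sum>i<d. D i x * (y i - x i)) \<ge> (\<Sum>i<d. (D i y - D i x)\<^sup>2) / (2 * L)"
proof -
  define g where "g = (\<lambda>i. D i y - D i x)"
  define z where "z = (\<lambda>i\<in>{..<d}. y i - 1 / L * g i)"
  have z: "z \<in> Rd d" by (simp add: z_def)
  have "0 \<le> K / 2 * (\<Sum>i<d. (z i - x i)\<^sup>2)" using K_pos by (simp add: sum_nonneg)
  then have 1: "U z \<ge> U x + (\<Sum>i<d. D i x * (z i - x i))"
    using convex_lower[OF x z] by linarith
  have 2: "U z \<le> U y + (\<Sum>i<d. D i y * (z i - y i)) + L / 2 * (\<Sum>i<d. (z i - y i)\<^sup>2)"
    by (rule descent_upper[OF y z])
  have 3: "L / 2 * (\<Sum>i<d. (z i - y i)\<^sup>2) = (\<Sum>i<d. (g i)\<^sup>2) / (2 * L)"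
    using L_pos by (simp add: z_def power_divide power2_eq_square flip: sum_divide_distrib)
  have 4: "(\<Sum>i<d. D i y * (z i - y i)) - (\<Sum>i<d. D i x * (z i - x i)) =
     - (\<Sum>i<d. D i x * (y i - x i)) - (\<Sum>i<d. (g i)\<^sup>2) / L"
    unfolding sum_subtractf[symmetric] sum_negf[symmetric] sum_divide_distrib
    by (rule sum.cong) (use L_pos in \<open>auto simp: z_def g_def field_simps power2_eq_square\<close>)
  have 5: "(\<Sum>i<d. (g i)\<^sup>2) / (2 * L) = (\<Sum>i<d. (g i)\<^sup>2) / L / 2" by simp
  show ?thesis using 1 2 3 4 5 unfolding g_def by linarith
qed

text \<open>The Bregman bounds from x and from y are added; the function values cancel.\<close>

lemma cocoercive:
  assumes x: "x \<in> Rd d" and y: "y \<in> Rd d"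
  shows "(\<Sum>i<d. (D i x - D i y)\<^sup>2) \<le> L * (\<Sum>i<d. (D i x - D i y) * (x i - y i))"
proof -
  have 1: "(\<Sum>i<d. (D i y - D i x)\<^sup>2) = (\<Sum>i<d. (D i x - D i y)\<^sup>2)"
    by (simp add: power2_commute)
  have 2: "(\<Sum>i<d. (D i x - D i y) * (x i - y i)) =
     - (\<Sum>i<d. D i x * (y i - x i)) - (\<Sum>i<d. D i y * (x i - y i))"
    unfolding sum_subtractf[symmetric] sum_negf[symmetric]
    by (rule sum.cong) (auto simp: algebra_simps)
  have "(\<Sum>i<d. (D i x - D i y)\<^sup>2) / (2 * L) + (\<Sum>i<d. (D i x - D i y)\<^sup>2) / (2 * L)
     \<le> (\<Sum>i<d. (D i x - D i y) * (x i - y i))"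
    using bregman_lower[OF x y] bregman_lower[OF y x] unfolding 1 2 by linarith
  then show ?thesis using L_pos by (simp add: field_simps)
qed

lemma D_zero: "i < d \<Longrightarrow> D i (zero_vec d) = 0"
proof -
  assume i: "i < d"
  have "((\<lambda>t. U ((zero_vec d)(i := 0 + t * 1))) has_real_derivative D i ((zero_vec d)(i := 0 + 0 * 1)) * 1) (at 0)"
    by (rule partial_DERIV[OF C3 i]) simp
  moreover have z: "(zero_vec d)(i := 0) = zero_vec d" using i by (auto simp: zero_vec_def fun_eq_iff)
  ultimately have "((\<lambda>t. U ((zero_vec d)(i := t))) has_real_derivative D i (zero_vec d)) (at 0)"
    by simp
  then show ?thesis
    by (rule DERIV_local_min[where d = 1]) (auto simp: z U_zero intro!: U_nonneg fun_upd_in_Rd i)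
qed

lemma zero_vec_nth: "i < d \<Longrightarrow> zero_vec d i = 0"
  by (simp add: zero_vec_def)

lemma U_upper: "x \<in> Rd d \<Longrightarrow> U x \<le> L / 2 * (\<Sum>i<d. (x i)\<^sup>2)"
  using descent_upper[OF zero_vec_in_Rd, of x] by (simp add: D_zero U_zero zero_vec_nth)

lemma U_lower: "x \<in> Rd d \<Longrightarrow> K / 2 * (\<Sum>i<d. (x i)\<^sup>2) \<le> U x"
  using convex_lower[OF zero_vec_in_Rd, of x] by (simp add: D_zero U_zero zero_vec_nth)

text \<open>Controls the force by the energy alone, as \<open>energy_error\<close> needs: on {H
  \<le> R} its norm is at most sqrt (2 L R).\<close>

lemma grad_sq_le: "x \<in> Rd d \<Longrightarrow> (\<Sum>i<d. (D i x)\<^sup>2) \<le> 2 * L * U x"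
  using bregman_lower[OF zero_vec_in_Rd, of x] L_pos
  by (simp add: D_zero U_zero field_simps)

text \<open>In the difference of the values at c + w and c - w the even Taylor terms cancel, so only
  third derivatives remain beyond the linear term; the two remainders contribute L_H |w|^3 / 6
  each.\<close>

lemma third_order_midpoint:
  shows "\<bar>U (\<lambda>i\<in>{..<d}. c i + w i) - U (\<lambda>i\<in>{..<d}. c i - w i) - 2 * (\<Sum>i<d. D i (\<lambda>i\<in>{..<d}. c i) * w i)\<bar>
           \<le> L\<^sub>H * norm_vec d w ^ 3 / 3"
proof -
  let ?p = "\<lambda>t. (\<lambda>i\<in>{..<d}. c i + t * w i)"
  define \<phi>1 where "\<phi>1 t = (\<Sum>k<d. D k (?p t) * w k)" for t
  define \<phi>2 where "\<phi>2 t = (\<Sum>k<d. (\<Sum>j<d. partial j (partial k U) (?p t) * w j) * w k)" for t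
  define \<phi>3 where "\<phi>3 t = (\<Sum>k<d. (\<Sum>j<d. (\<Sum>i<d. partial i (partial j (partial k U)) (?p t) * w i) * w j) * w k)" for t
  have d2: "(\<phi>1 has_real_derivative \<phi>2 t) (at t)" for t
    unfolding \<phi>1_def \<phi>2_def
    by (intro DERIV_sum DERIV_cmult_right chain_rule[where n = "Suc 0"]) (use C3 in simp)
  have d3: "(\<phi>2 has_real_derivative \<phi>3 t) (at t)" for t
    unfolding \<phi>2_def \<phi>3_def
    by (intro DERIV_sum DERIV_cmult_right chain_rule[where n = 0]) (use C3 in simp)
  have b3: "\<bar>\<phi>3 t\<bar> \<le> L\<^sub>H * norm_vec d w ^ 3" for t
  proof -
    let ?w = "restrict w {..<d}"
    \<comment> \<open>The chain rule puts the index of the innermost derivative into the outermost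
      sum; three exchanges restore the order of assumption A.3.\<close>
    have eq: "\<phi>3 t = (\<Sum>i<d. \<Sum>j<d. \<Sum>k<d. partial i (partial j (partial k U)) (?p t) * ?w i * ?w j * ?w k)"
    proof -
      have "\<phi>3 t = (\<Sum>k<d. \<Sum>j<d. \<Sum>i<d. partial i (partial j (partial k U)) (?p t) * ?w i * ?w j * ?w k)"
        by (simp add: \<phi>3_def sum_distrib_right)
      also have "\<dots> = (\<Sum>k<d. \<Sum>i<d. \<Sum>j<d. partial i (partial j (partial k U)) (?p t) * ?w i * ?w j * ?w k)"
        by (rule sum.cong[OF refl], rule sum.swap)
      also have "\<dots> = (\<Sum>i<d. \<Sum>k<d. \<Sum>j<d. partial i (partial j (partial k U)) (?p t) * ?w i * ?w j * ?w k)"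
        by (rule sum.swap)
      also have "\<dots> = (\<Sum>i<d. \<Sum>j<d. \<Sum>k<d. partial i (partial j (partial k U)) (?p t) * ?w i * ?w j * ?w k)"
        by (rule sum.cong[OF refl], rule sum.swap)
      finally show ?thesis .
    qed
    have "\<bar>\<phi>3 t\<bar> \<le> L\<^sub>H * norm_vec d ?w * norm_vec d ?w * norm_vec d ?w"
      unfolding eq by (rule A3_sum[OF restrict_in_Rd restrict_in_Rd restrict_in_Rd restrict_in_Rd])
    then show ?thesis unfolding norm_vec_restrict by (simp only: power3_eq_cube mult.assoc)
  qed
  define \<phi>0 where "\<phi>0 t = U (?p t)" for t
  have d1: "(\<phi>0 has_real_derivative \<phi>1 t) (at t)" for t
    unfolding \<phi>0_def \<phi>1_def by (rule U_line_DERIV)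
  define diff where "diff m = (if m = (0::nat) then \<phi>0 else if m = 1 then \<phi>1 else if m = 2 then \<phi>2 else \<phi>3)" for m
  have diff0: "diff 0 = \<phi>0" by (simp add: diff_def)
  have dd: "\<forall>m t. m < 3 \<and> \<bar>t\<bar> \<le> \<bar>b\<bar> \<longrightarrow> (diff m has_real_derivative diff (Suc m) t) (at t)" for b :: real
  proof (intro allI impI)
    fix m :: nat and t :: real assume "m < 3 \<and> \<bar>t\<bar> \<le> \<bar>b\<bar>"
    then have "m = 0 \<or> m = 1 \<or> m = 2" by auto
    then show "(diff m has_real_derivative diff (Suc m) t) (at t)"
      using d1 d2 d3 by (auto simp: diff_def numeral_2_eq_2)
  qed
  obtain t1 where "\<phi>0 1 = (\<Sum>m<3. diff m 0 / fact m * 1 ^ m) + diff 3 t1 / fact 3 * 1 ^ 3"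
    using Maclaurin_bi_le[OF diff0 dd] by blast
  then have t1: "U (?p 1) = U (?p 0) + \<phi>1 0 + \<phi>2 0 / 2 + \<phi>3 t1 / 6"
    unfolding \<phi>0_def[symmetric] by (simp add: eval_nat_numeral diff_def)
  obtain t2 where "\<phi>0 (-1) = (\<Sum>m<3. diff m 0 / fact m * (-1) ^ m) + diff 3 t2 / fact 3 * (-1) ^ 3"
    using Maclaurin_bi_le[OF diff0 dd] by blast
  then have t2: "U (?p (-1)) = U (?p 0) - \<phi>1 0 + \<phi>2 0 / 2 - \<phi>3 t2 / 6"
    unfolding \<phi>0_def[symmetric] by (simp add: eval_nat_numeral diff_def)
  have p: "?p 1 = (\<lambda>i\<in>{..<d}. c i + w i)" "?p (-1) = (\<lambda>i\<in>{..<d}. c i - w i)" by auto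
  have "\<phi>1 0 = (\<Sum>i<d. D i (\<lambda>i\<in>{..<d}. c i) * w i)" by (simp add: \<phi>1_def)
  then have eq: "U (\<lambda>i\<in>{..<d}. c i + w i) - U (\<lambda>i\<in>{..<d}. c i - w i)
      - 2 * (\<Sum>i<d. D i (\<lambda>i\<in>{..<d}. c i) * w i) = (\<phi>3 t1 + \<phi>3 t2) / 6"
    unfolding p[symmetric] t1 t2 by (simp add: field_simps)
  have "\<bar>(a + b) / 6\<bar> \<le> Y / 3" if "\<bar>a\<bar> \<le> Y" "\<bar>b\<bar> \<le> Y" for a b Y :: real
    using that unfolding abs_le_iff by (simp add: field_simps)
  then show ?thesis unfolding eq using b3 by blast
qed

end

section \<open>Lebesgue and Gaussian measure\<close>

lemma product_sigma_finite_lborel: "product_sigma_finite (\<lambda>_::nat. lborel :: real measure)"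
  by (simp add: product_sigma_finite_def sigma_finite_lborel)

lemma space_lebesgue_Rd [simp]: "space (lebesgue_Rd d) = Rd d"
  by (simp add: lebesgue_Rd_def space_PiM Rd_def)

lemma sets_std_gaussian [simp, measurable_cong]: "sets (std_gaussian d) = sets (lebesgue_Rd d)"
  unfolding std_gaussian_def lebesgue_Rd_def by (intro sets_PiM_cong) auto

lemma space_std_gaussian [simp]: "space (std_gaussian d) = Rd d"
  using sets_eq_imp_space_eq[OF sets_std_gaussian] by simp

lemma space_phase_space [simp]: "space (phase_space d) = Rd d \<times> Rd d"
  by (simp add: phase_space_def space_pair_measure)

lemma sigma_finite_lebesgue_Rd: "sigma_finite_measure (lebesgue_Rd d)"
proof -
  interpret product_sigma_finite "\<lambda>_::nat. lborel :: real measure" by (rule product_sigma_finite_lborel)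
  show ?thesis unfolding lebesgue_Rd_def by (rule sigma_finite) simp
qed

lemma Rd_nonempty [simp]: "Rd d \<noteq> {}"
  using zero_vec_in_Rd by blast

lemma prob_space_std_normal: "prob_space (density lborel (\<lambda>x. ennreal (std_normal_density x)))"
  by (rule prob_space_normal_density) simp

lemma prob_space_std_gaussian: "prob_space (std_gaussian d)"
  unfolding std_gaussian_def by (intro prob_space_PiM prob_space_std_normal)

lemma emeasure_std_gaussian_Rd [simp]: "emeasure (std_gaussian d) (Rd d) = 1"
  using prob_space.emeasure_space_1[OF prob_space_std_gaussian] by simp

lemma product_sigma_finite_std_normal:
  "product_sigma_finite (\<lambda>_::nat. density lborel (\<lambda>x. ennreal (std_normal_density x)))"
  unfolding product_sigma_finite_def
  using prob_space_std_normal by (auto intro: prob_space_imp_sigma_finite)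

lemma measurable_Rd_component [measurable (raw)]:
  "f \<in> M \<rightarrow>\<^sub>M lebesgue_Rd d \<Longrightarrow> i < d \<Longrightarrow> (\<lambda>\<omega>. f \<omega> i) \<in> borel_measurable M"
proof -
  assume f: "f \<in> M \<rightarrow>\<^sub>M lebesgue_Rd d" and "i < d"
  then have "(\<lambda>x. x i) \<in> lebesgue_Rd d \<rightarrow>\<^sub>M lborel"
    unfolding lebesgue_Rd_def by (intro measurable_component_singleton) simp
  from measurable_compose[OF f this] show ?thesis by simp
qed

lemma measurable_Rd_restrict:
  assumes "\<And>i. i < d \<Longrightarrow> (\<lambda>\<omega>. f \<omega> i) \<in> borel_measurable M"
  shows "(\<lambda>\<omega>. \<lambda>i\<in>{..<d}. f \<omega> i) \<in> M \<rightarrow>\<^sub>M lebesgue_Rd d"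
  unfolding lebesgue_Rd_def by (rule measurable_restrict) (use assms in auto)

lemma measurable_norm_vec [measurable (raw)]:
  assumes [measurable]: "f \<in> M \<rightarrow>\<^sub>M lebesgue_Rd d"
  shows "(\<lambda>\<omega>. norm_vec d (f \<omega>)) \<in> borel_measurable M"
  unfolding norm_vec_def L2_set_def
  by (intro measurable_compose[OF _ borel_measurable_sqrt] borel_measurable_sum borel_measurable_power) auto

text \<open>Open sets of \<open>nat => real\<close> see all coordinates, but on \<open>Rd d\<close>
  those from d on are constant; hence ambient Borel sets have measurable traces.\<close>

lemma id_measurable_borel: "(\<lambda>x. x) \<in> lebesgue_Rd d \<rightarrow>\<^sub>M borel"
proof (rule measurable_coordinatewise_then_product)
  fix i
  show "(\<lambda>x. x i) \<in> borel_measurable (lebesgue_Rd d)"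
  proof (cases "i < d")
    case False
    then have "\<And>x. x \<in> space (lebesgue_Rd d) \<Longrightarrow> x i = undefined" by (simp add: Rd_undefined)
    then show ?thesis by (subst measurable_cong[where g = "\<lambda>_. undefined"]) auto
  qed (measurable)
qed

lemma continuous_on_Rd_measurable:
  assumes "continuous_on (Rd d) f"
  shows "f \<in> borel_measurable (lebesgue_Rd d)"
proof -
  have "(\<lambda>x. x) \<in> lebesgue_Rd d \<rightarrow>\<^sub>M restrict_space borel (Rd d)"
    by (rule measurable_restrict_space2) (auto simp: id_measurable_borel)
  from measurable_compose[OF this borel_measurable_continuous_on_restrict[OF assms]]
  show ?thesis .
qed

lemma nn_integral_lebesgue_Rd_prod:
  assumes "\<And>i. i < d \<Longrightarrow> f i \<in> borel_measurable borel"
  shows "(\<integral>\<^sup>+ x. (\<Prod>i<d. f i (x i)) \<partial>lebesgue_Rd d) = (\<Prod>i<d. \<integral>\<^sup>+ t. f i t \<partial>lborel)"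
proof -
  interpret product_sigma_finite "\<lambda>_::nat. lborel :: real measure" by (rule product_sigma_finite_lborel)
  show ?thesis unfolding lebesgue_Rd_def using assms by (intro product_nn_integral_prod) auto
qed

lemma nn_integral_std_gaussian_prod:
  assumes "\<And>i. i < d \<Longrightarrow> f i \<in> borel_measurable borel"
  shows "(\<integral>\<^sup>+ x. (\<Prod>i<d. f i (x i)) \<partial>std_gaussian d) =
    (\<Prod>i<d. \<integral>\<^sup>+ t. ennreal (std_normal_density t) * f i t \<partial>lborel)"
proof -
  interpret product_sigma_finite "\<lambda>_::nat. density lborel (\<lambda>x. ennreal (std_normal_density x))"
    by (rule product_sigma_finite_std_normal)
  have "(\<integral>\<^sup>+ x. (\<Prod>i<d. f i (x i)) \<partial>std_gaussian d) =
     (\<Prod>i<d. \<integral>\<^sup>+ t. f i t \<partial>density lborel (\<lambda>x. ennreal (std_normal_density x)))"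
    unfolding std_gaussian_def using assms by (intro product_nn_integral_prod) auto
  also have "\<dots> = (\<Prod>i<d. \<integral>\<^sup>+ t. ennreal (std_normal_density t) * f i t \<partial>lborel)"
    using assms by (intro prod.cong nn_integral_density) auto
  finally show ?thesis .
qed

lemma sets_Rd_PiE:
  "(\<And>i. i < d \<Longrightarrow> A i \<in> sets borel) \<Longrightarrow> Pi\<^sub>E {..<d} A \<in> sets (lebesgue_Rd d)"
  unfolding lebesgue_Rd_def by (rule sets_PiM_I_finite) auto

lemma indicator_PiE:
  assumes "x \<in> Rd d"
  shows "indicator (Pi\<^sub>E {..<d} A) x = (\<Prod>i<d. indicator (A i) (x i) :: ennreal)"
  using assms by (auto simp: Rd_def indicator_def PiE_def Pi_def extensional_def)

lemma emeasure_Rd_PiE: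
  assumes M: "sets M = sets (lebesgue_Rd d)" and A: "\<And>i. i < d \<Longrightarrow> A i \<in> sets borel"
  shows "emeasure M (Pi\<^sub>E {..<d} A) = (\<integral>\<^sup>+ x. (\<Prod>i<d. indicator (A i) (x i)) \<partial>M)"
proof -
  have "space M = Rd d" using sets_eq_imp_space_eq[OF M] by simp
  moreover have "Pi\<^sub>E {..<d} A \<in> sets M" unfolding M by (rule sets_Rd_PiE) (rule A)
  ultimately have "emeasure M (Pi\<^sub>E {..<d} A) = (\<integral>\<^sup>+ x. indicator (Pi\<^sub>E {..<d} A) x \<partial>M)" by simp
  also have "\<dots> = (\<integral>\<^sup>+ x. (\<Prod>i<d. indicator (A i) (x i)) \<partial>M)"
    using \<open>space M = Rd d\<close> by (intro nn_integral_cong) (simp add: indicator_PiE)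
  finally show ?thesis .
qed

text \<open>Boxes determine the measure, with the cubes [-n, n]^d as an exhausting sequence of
  finite measure. Writing a box as a product of indicators lets every integral split into
  one-dimensional ones.\<close>

lemma measure_eqI_Rd:
  assumes M: "sets M = sets (lebesgue_Rd d)" and N: "sets N = sets (lebesgue_Rd d)"
    and eq: "\<And>A. (\<And>i. i < d \<Longrightarrow> A i \<in> sets borel) \<Longrightarrow>
      (\<integral>\<^sup>+ x. (\<Prod>i<d. indicator (A i) (x i)) \<partial>M) = (\<integral>\<^sup>+ x. (\<Prod>i<d. indicator (A i) (x i)) \<partial>N)"
    and fin: "\<And>n::nat. (\<integral>\<^sup>+ x. (\<Prod>i<d. indicator {- real n..real n} (x i)) \<partial>M) \<noteq> \<infinity>"
  shows "M = N"
proof (rule measure_eqI_PiM_finite)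
  show "finite {..<d}" by simp
  show "sets M = sets (\<Pi>\<^sub>M i\<in>{..<d}. lborel :: real measure)" "sets N = sets (\<Pi>\<^sub>M i\<in>{..<d}. lborel :: real measure)"
    using M N by (auto simp: lebesgue_Rd_def)
  fix A :: "nat \<Rightarrow> real set" assume "\<And>i. i \<in> {..<d} \<Longrightarrow> A i \<in> sets lborel"
  then show "emeasure M (Pi\<^sub>E {..<d} A) = emeasure N (Pi\<^sub>E {..<d} A)"
    using eq[of A] by (simp add: emeasure_Rd_PiE[OF M] emeasure_Rd_PiE[OF N])
next
  let ?B = "\<lambda>n::nat. Pi\<^sub>E {..<d} (\<lambda>_. {- real n..real n})"
  show "range ?B \<subseteq> prod_algebra {..<d} (\<lambda>_. lborel)"
    by (auto intro!: prod_algebraI_finite)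
  show "(\<Union>n. ?B n) = space (\<Pi>\<^sub>M i\<in>{..<d}. lborel :: real measure)"
  proof (intro equalityI subsetI)
    fix x assume "x \<in> space (\<Pi>\<^sub>M i\<in>{..<d}. lborel :: real measure)"
    then have x: "x \<in> Rd d" by (simp add: space_PiM Rd_def)
    obtain n :: nat where n: "norm_vec d x \<le> real n" using real_arch_simple by blast
    have "x i \<in> {- real n..real n}" if "i < d" for i
      using norm_vec_component[OF that, of x] n by auto
    then have "x \<in> ?B n" using x by (auto simp: Rd_def PiE_def)
    then show "x \<in> (\<Union>n. ?B n)" by blast
  qed (auto simp: space_PiM)
  show "emeasure M (?B n) \<noteq> \<infinity>" for n
    using fin[of n] by (subst emeasure_Rd_PiE[OF M]) auto
qed

lemma fin_box: "(\<integral>\<^sup>+ x. (\<Prod>i<d. indicator {- real n..real n} (x i)) \<partial>lebesgue_Rd d) \<noteq> \<infinity>"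
  by (subst nn_integral_lebesgue_Rd_prod) (auto simp: power_eq_top_ennreal)

text \<open>On a box both sides factor over the coordinates, which reduces the scaling law to
  dimension one.\<close>

lemma lebesgue_Rd_affine:
  assumes t: "t > 0"
  shows "lebesgue_Rd d = density (distr (lebesgue_Rd d) (lebesgue_Rd d) (\<lambda>x. \<lambda>i\<in>{..<d}. c i + t * x i)) (\<lambda>_. ennreal (t ^ d))"
    (is "_ = density (distr _ _ ?T) _")
proof (rule measure_eqI_Rd[OF refl _ _ fin_box])
  have T [measurable]: "?T \<in> lebesgue_Rd d \<rightarrow>\<^sub>M lebesgue_Rd d"
    by (rule measurable_Rd_restrict) simp
  fix A :: "nat \<Rightarrow> real set" assume A: "\<And>i. i < d \<Longrightarrow> A i \<in> sets borel"
  have [measurable]: "(\<lambda>x. \<Prod>i<d. indicator (A i) (x i) :: ennreal) \<in> borel_measurable (lebesgue_Rd d)"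
    by (intro borel_measurable_prod_ennreal) (use A in measurable)
  have "(\<integral>\<^sup>+ x. (\<Prod>i<d. indicator (A i) (x i)) \<partial>density (distr (lebesgue_Rd d) (lebesgue_Rd d) ?T) (\<lambda>_. ennreal (t ^ d)))
     = ennreal (t ^ d) * (\<integral>\<^sup>+ x. (\<Prod>i<d. indicator (A i) (?T x i)) \<partial>lebesgue_Rd d)"
    by (simp add: nn_integral_density nn_integral_cmult nn_integral_distr)
  also have "(\<integral>\<^sup>+ x. (\<Prod>i<d. indicator (A i) (?T x i)) \<partial>lebesgue_Rd d)
     = (\<integral>\<^sup>+ x. (\<Prod>i<d. (\<lambda>s. indicator (A i) (c i + t * s)) (x i)) \<partial>lebesgue_Rd d)"
    by simp
  also have "\<dots> = (\<Prod>i<d. \<integral>\<^sup>+ s. indicator (A i) (c i + t * s) \<partial>lborel)"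
    by (rule nn_integral_lebesgue_Rd_prod) (use A in measurable)
  also have "ennreal (t ^ d) * \<dots> = (\<Prod>i<d. ennreal t * (\<integral>\<^sup>+ s. indicator (A i) (c i + t * s) \<partial>lborel))"
    using t by (simp add: prod.distrib ennreal_power)
  also have "\<dots> = (\<Prod>i<d. \<integral>\<^sup>+ s. indicator (A i) s \<partial>lborel)"
  proof (rule prod.cong[OF refl])
    fix i assume "i \<in> {..<d}"
    then have [measurable]: "A i \<in> sets borel" using A by simp
    show "ennreal t * (\<integral>\<^sup>+ s. indicator (A i) (c i + t * s) \<partial>lborel) = (\<integral>\<^sup>+ s. indicator (A i) s \<partial>lborel)"
      using t by (subst (2) nn_integral_real_affine[of _ t "c i"]) auto
  qed
  also have "\<dots> = (\<integral>\<^sup>+ x. (\<Prod>i<d. indicator (A i) (x i)) \<partial>lebesgue_Rd d)"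
    by (rule nn_integral_lebesgue_Rd_prod[symmetric]) (use A in measurable)
  finally show "(\<integral>\<^sup>+ x. (\<Prod>i<d. indicator (A i) (x i)) \<partial>lebesgue_Rd d) =
     (\<integral>\<^sup>+ x. (\<Prod>i<d. indicator (A i) (x i)) \<partial>density (distr (lebesgue_Rd d) (lebesgue_Rd d) ?T) (\<lambda>_. ennreal (t ^ d)))"
    by (rule sym)
qed simp

lemma nn_integral_Rd_affine:
  assumes t: "t > 0" and f [measurable]: "f \<in> borel_measurable (lebesgue_Rd d)"
  shows "(\<integral>\<^sup>+ x. f x \<partial>lebesgue_Rd d) = ennreal (t ^ d) * (\<integral>\<^sup>+ x. f (\<lambda>i\<in>{..<d}. c i + t * x i) \<partial>lebesgue_Rd d)"
proof -
  have T [measurable]: "(\<lambda>x. \<lambda>i\<in>{..<d}. c i + t * x i) \<in> lebesgue_Rd d \<rightarrow>\<^sub>M lebesgue_Rd d"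
    by (rule measurable_Rd_restrict) simp
  show ?thesis
    by (subst lebesgue_Rd_affine[OF t, of d c])
      (simp add: nn_integral_density nn_integral_distr nn_integral_cmult)
qed

lemma nn_integral_Rd_translate:
  assumes [measurable]: "f \<in> borel_measurable (lebesgue_Rd d)"
  shows "(\<integral>\<^sup>+ x. f (\<lambda>i\<in>{..<d}. x i + c i) \<partial>lebesgue_Rd d) = (\<integral>\<^sup>+ x. f x \<partial>lebesgue_Rd d)"
  using nn_integral_Rd_affine[of 1 f d c] by (simp add: add.commute)

lemma nn_integral_Rd_uminus:
  assumes f [measurable]: "f \<in> borel_measurable (lebesgue_Rd d)"
  shows "(\<integral>\<^sup>+ x. f (\<lambda>i\<in>{..<d}. - x i) \<partial>lebesgue_Rd d) = (\<integral>\<^sup>+ x. f x \<partial>lebesgue_Rd d)"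
proof -
  let ?T = "\<lambda>x. \<lambda>i\<in>{..<d}. - x i :: real"
  have T [measurable]: "?T \<in> lebesgue_Rd d \<rightarrow>\<^sub>M lebesgue_Rd d"
    by (rule measurable_Rd_restrict) simp
  have "lebesgue_Rd d = distr (lebesgue_Rd d) (lebesgue_Rd d) ?T"
  proof (rule measure_eqI_Rd[OF refl _ _ fin_box])
    fix A :: "nat \<Rightarrow> real set" assume A: "\<And>i. i < d \<Longrightarrow> A i \<in> sets borel"
    have [measurable]: "(\<lambda>x. \<Prod>i<d. indicator (A i) (x i) :: ennreal) \<in> borel_measurable (lebesgue_Rd d)"
      by (intro borel_measurable_prod_ennreal) (use A in measurable)
    have "(\<integral>\<^sup>+ x. (\<Prod>i<d. indicator (A i) (x i)) \<partial>distr (lebesgue_Rd d) (lebesgue_Rd d) ?T)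
      = (\<integral>\<^sup>+ x. (\<Prod>i<d. (\<lambda>s. indicator (A i) (- s)) (x i)) \<partial>lebesgue_Rd d)"
      by (simp add: nn_integral_distr)
    also have "\<dots> = (\<Prod>i<d. \<integral>\<^sup>+ s. indicator (A i) (- s) \<partial>lborel)"
      by (rule nn_integral_lebesgue_Rd_prod) (use A in measurable)
    also have "\<dots> = (\<Prod>i<d. \<integral>\<^sup>+ s. indicator (A i) s \<partial>lborel)"
    proof (rule prod.cong[OF refl])
      fix i assume "i \<in> {..<d}"
      then have [measurable]: "A i \<in> sets borel" using A by simp
      show "(\<integral>\<^sup>+ s. indicator (A i) (- s) \<partial>lborel) = (\<integral>\<^sup>+ s. indicator (A i) s \<partial>lborel)"
        by (subst (2) nn_integral_real_affine[of _ "-1" 0]) auto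
    qed
    also have "\<dots> = (\<integral>\<^sup>+ x. (\<Prod>i<d. indicator (A i) (x i)) \<partial>lebesgue_Rd d)"
      by (rule nn_integral_lebesgue_Rd_prod[symmetric]) (use A in measurable)
    finally show "(\<integral>\<^sup>+ x. (\<Prod>i<d. indicator (A i) (x i)) \<partial>lebesgue_Rd d) =
       (\<integral>\<^sup>+ x. (\<Prod>i<d. indicator (A i) (x i)) \<partial>distr (lebesgue_Rd d) (lebesgue_Rd d) ?T)" by simp
  qed simp
  then have "(\<integral>\<^sup>+ x. f x \<partial>lebesgue_Rd d) = (\<integral>\<^sup>+ x. f x \<partial>distr (lebesgue_Rd d) (lebesgue_Rd d) ?T)"
    by simp
  also have "\<dots> = (\<integral>\<^sup>+ x. f (?T x) \<partial>lebesgue_Rd d)" by (simp add: nn_integral_distr)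
  finally show ?thesis by simp
qed

section \<open>The standard Gaussian: density, rotation and moments\<close>

definition gauss_dens :: "nat \<Rightarrow> rvec \<Rightarrow> real" where
  "gauss_dens d x = (\<Prod>i<d. std_normal_density (x i))"

lemma gauss_dens_nonneg [simp]: "0 \<le> gauss_dens d x"
  by (simp add: gauss_dens_def prod_nonneg)

lemma measurable_gauss_dens [measurable]: "gauss_dens d \<in> borel_measurable (lebesgue_Rd d)"
  unfolding gauss_dens_def by measurable

lemma gauss_dens_eq: "gauss_dens d x = (1 / sqrt (2 * pi)) ^ d * exp (- (norm_vec d x)\<^sup>2 / 2)"
  by (simp add: gauss_dens_def std_normal_density_def norm_vec_power2 prod.distrib exp_sum[symmetric]
      sum_negf sum_divide_distrib prod_dividef power_divide)

lemma std_gaussian_eq_density: "std_gaussian d = density (lebesgue_Rd d) (\<lambda>x. ennreal (gauss_dens d x))"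
proof (rule measure_eqI_Rd)
  fix A :: "nat \<Rightarrow> real set" assume A: "\<And>i. i < d \<Longrightarrow> A i \<in> sets borel"
  have [measurable]: "(\<lambda>x. \<Prod>i<d. indicator (A i) (x i) :: ennreal) \<in> borel_measurable (lebesgue_Rd d)"
    by (intro borel_measurable_prod_ennreal) (use A in measurable)
  have "(\<integral>\<^sup>+ x. (\<Prod>i<d. indicator (A i) (x i)) \<partial>density (lebesgue_Rd d) (\<lambda>x. ennreal (gauss_dens d x)))
    = (\<integral>\<^sup>+ x. (\<Prod>i<d. (\<lambda>t. ennreal (std_normal_density t) * indicator (A i) t) (x i)) \<partial>lebesgue_Rd d)"
    by (simp add: nn_integral_density gauss_dens_def prod_ennreal[symmetric] prod.distrib)
  also have "\<dots> = (\<Prod>i<d. \<integral>\<^sup>+ t. ennreal (std_normal_density t) * indicator (A i) t \<partial>lborel)"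
    by (rule nn_integral_lebesgue_Rd_prod) (use A in measurable)
  also have "\<dots> = (\<integral>\<^sup>+ x. (\<Prod>i<d. indicator (A i) (x i)) \<partial>std_gaussian d)"
    by (rule nn_integral_std_gaussian_prod[symmetric]) (use A in measurable)
  finally show "(\<integral>\<^sup>+ x. (\<Prod>i<d. indicator (A i) (x i)) \<partial>std_gaussian d) =
    (\<integral>\<^sup>+ x. (\<Prod>i<d. indicator (A i) (x i)) \<partial>density (lebesgue_Rd d) (\<lambda>x. ennreal (gauss_dens d x)))" ..
next
  fix n :: nat
  interpret prob_space "std_gaussian d" by (rule prob_space_std_gaussian)
  have "(\<integral>\<^sup>+ x. (\<Prod>i<d. indicator {- real n..real n} (x i)) \<partial>std_gaussian d) \<le> (\<integral>\<^sup>+ x. 1 \<partial>std_gaussian d)"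
    by (intro nn_integral_mono prod_le_1) (auto simp: indicator_def)
  then show "(\<integral>\<^sup>+ x. (\<Prod>i<d. indicator {- real n..real n} (x i)) \<partial>std_gaussian d) \<noteq> \<infinity>"
    by (auto simp: emeasure_space_1 top_unique)
qed auto

lemma nn_integral_std_gaussian:
  assumes [measurable]: "f \<in> borel_measurable (lebesgue_Rd d)"
  shows "(\<integral>\<^sup>+ x. f x \<partial>std_gaussian d) = (\<integral>\<^sup>+ x. ennreal (gauss_dens d x) * f x \<partial>lebesgue_Rd d)"
  by (simp add: std_gaussian_eq_density nn_integral_density)

text \<open>The convolution of N(0, \<eta>^2) and N(0, \<sigma>^2) is standard normal when \<eta>^2
  + \<sigma>^2 = 1. This is why a partial velocity refreshment preserves the Gaussian law.\<close>

lemma std_normal_rotation: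
  assumes \<eta>: "0 < \<eta>" and \<sigma>: "0 < \<sigma>" and one: "\<eta>\<^sup>2 + \<sigma>\<^sup>2 = 1" and [measurable]: "g \<in> borel_measurable borel"
  shows "(\<integral>\<^sup>+ v. ennreal (std_normal_density v) * (\<integral>\<^sup>+ b. ennreal (std_normal_density b) * g (\<eta> * v + \<sigma> * b) \<partial>lborel) \<partial>lborel)
     = (\<integral>\<^sup>+ u. ennreal (std_normal_density u) * g u \<partial>lborel)"
proof -
  have nd: "ennreal c * ennreal (normal_density 0 c (c * b)) = ennreal (std_normal_density b)" if "0 < c" for b c
    using that by (simp add: normal_density_def ennreal_mult'[symmetric] power_mult_distrib real_sqrt_mult)
  have inner: "(\<integral>\<^sup>+ b. ennreal (std_normal_density b) * g (\<eta> * v + \<sigma> * b) \<partial>lborel)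
      = (\<integral>\<^sup>+ u. ennreal (normal_density 0 \<sigma> (u - \<eta> * v)) * g u \<partial>lborel)" for v
    by (subst (2) nn_integral_real_affine[of _ \<sigma> "\<eta> * v"])
      (use \<sigma> in \<open>auto simp: nn_integral_cmult[symmetric] mult.assoc[symmetric] nd\<close>)
  have conv: "(\<integral>\<^sup>+ v. ennreal (std_normal_density v) * ennreal (normal_density 0 \<sigma> (u - \<eta> * v)) \<partial>lborel)
      = ennreal (std_normal_density u)" for u
  proof -
    have "(\<integral>\<^sup>+ v. ennreal (std_normal_density v) * ennreal (normal_density 0 \<sigma> (u - \<eta> * v)) \<partial>lborel)
      = (\<integral>\<^sup>+ w. ennreal (normal_density 0 \<eta> w) * ennreal (normal_density 0 \<sigma> (u - w)) \<partial>lborel)"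
      by (subst (2) nn_integral_real_affine[of _ \<eta> 0])
        (use \<eta> in \<open>auto simp: nn_integral_cmult[symmetric] mult.assoc[symmetric] nd\<close>)
    also have "\<dots> = (\<integral>\<^sup>+ w. ennreal (normal_density 0 \<sigma> (u - w) * normal_density 0 \<eta> w) \<partial>lborel)"
      by (simp add: ennreal_mult'[symmetric] mult.commute)
    also have "\<dots> = normal_density 0 (sqrt (\<sigma>\<^sup>2 + \<eta>\<^sup>2)) u"
      using conv_normal_density_zero_mean[OF \<sigma> \<eta>] by (rule fun_cong)
    finally show ?thesis using one by (simp add: add.commute)
  qed
  have "(\<integral>\<^sup>+ v. ennreal (std_normal_density v) * (\<integral>\<^sup>+ b. ennreal (std_normal_density b) * g (\<eta> * v + \<sigma> * b) \<partial>lborel) \<partial>lborel)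
     = (\<integral>\<^sup>+ v. \<integral>\<^sup>+ u. ennreal (std_normal_density v) * ennreal (normal_density 0 \<sigma> (u - \<eta> * v)) * g u \<partial>lborel \<partial>lborel)"
    unfolding inner by (simp add: nn_integral_cmult[symmetric] mult.assoc)
  also have "\<dots> = (\<integral>\<^sup>+ u. \<integral>\<^sup>+ v. ennreal (std_normal_density v) * ennreal (normal_density 0 \<sigma> (u - \<eta> * v)) * g u \<partial>lborel \<partial>lborel)"
    by (rule lborel_pair.Fubini') measurable
  also have "\<dots> = (\<integral>\<^sup>+ u. ennreal (std_normal_density u) * g u \<partial>lborel)"
    by (simp add: nn_integral_multc conv)
  finally show ?thesis .
qed

lemma std_gaussian_rotation:
  assumes \<eta>: "0 < \<eta>" and \<sigma>: "0 < \<sigma>" and one: "\<eta>\<^sup>2 + \<sigma>\<^sup>2 = 1" and f [measurable]: "f \<in> borel_measurable (lebesgue_Rd d)"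
  shows "(\<integral>\<^sup>+ v. \<integral>\<^sup>+ b. f (\<lambda>i\<in>{..<d}. \<eta> * v i + \<sigma> * b i) \<partial>std_gaussian d \<partial>std_gaussian d) = (\<integral>\<^sup>+ v. f v \<partial>std_gaussian d)"
proof -
  interpret G: prob_space "std_gaussian d" by (rule prob_space_std_gaussian)
  define T where "T = (\<lambda>p. \<lambda>i\<in>{..<d}. \<eta> * (fst p i :: real) + \<sigma> * snd p i)"
  have T [measurable]: "T \<in> std_gaussian d \<Otimes>\<^sub>M std_gaussian d \<rightarrow>\<^sub>M lebesgue_Rd d"
    unfolding T_def by (rule measurable_Rd_restrict) measurable
  let ?M = "distr (std_gaussian d \<Otimes>\<^sub>M std_gaussian d) (lebesgue_Rd d) T"
  have M: "(\<integral>\<^sup>+ x. g x \<partial>?M) = (\<integral>\<^sup>+ v. \<integral>\<^sup>+ b. g (T (v, b)) \<partial>std_gaussian d \<partial>std_gaussian d)"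
    if [measurable]: "g \<in> borel_measurable (lebesgue_Rd d)" for g
    using G.nn_integral_fst[of "\<lambda>p. g (T p)" "std_gaussian d"] by (simp add: nn_integral_distr)
  have "std_gaussian d = ?M"
  proof (rule measure_eqI_Rd)
    fix A :: "nat \<Rightarrow> real set" assume A: "\<And>i. i < d \<Longrightarrow> A i \<in> sets borel"
    have Am [measurable]: "(\<lambda>x. \<Prod>i<d. indicator (A i) (x i) :: ennreal) \<in> borel_measurable (lebesgue_Rd d)"
      by (intro borel_measurable_prod_ennreal) (use A in measurable)
    define q where "q i v = (\<integral>\<^sup>+ b. ennreal (std_normal_density b) * indicator (A i) (\<eta> * v + \<sigma> * b) \<partial>lborel)" for i v
    have q [measurable]: "i < d \<Longrightarrow> q i \<in> borel_measurable borel" for i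
      unfolding q_def using A[of i] by measurable
    have "(\<integral>\<^sup>+ x. (\<Prod>i<d. indicator (A i) (x i)) \<partial>?M) =
       (\<integral>\<^sup>+ v. \<integral>\<^sup>+ b. (\<Prod>i<d. (\<lambda>i t. indicator (A i) (\<eta> * v i + \<sigma> * t)) i (b i)) \<partial>std_gaussian d \<partial>std_gaussian d)"
      by (subst M[OF Am]) (simp add: T_def)
    also have "\<dots> = (\<integral>\<^sup>+ v. (\<Prod>i<d. q i (v i)) \<partial>std_gaussian d)"
      unfolding q_def by (subst nn_integral_std_gaussian_prod) (use A in measurable)
    also have "\<dots> = (\<Prod>i<d. \<integral>\<^sup>+ v. ennreal (std_normal_density v) * q i v \<partial>lborel)"
      by (rule nn_integral_std_gaussian_prod) (rule q)
    also have "\<dots> = (\<Prod>i<d. \<integral>\<^sup>+ u. ennreal (std_normal_density u) * indicator (A i) u \<partial>lborel)"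
      unfolding q_def by (intro prod.cong refl std_normal_rotation \<eta> \<sigma> one) (use A in measurable)
    also have "\<dots> = (\<integral>\<^sup>+ x. (\<Prod>i<d. indicator (A i) (x i)) \<partial>std_gaussian d)"
      by (rule nn_integral_std_gaussian_prod[symmetric]) (use A in measurable)
    finally show "(\<integral>\<^sup>+ x. (\<Prod>i<d. indicator (A i) (x i)) \<partial>std_gaussian d) = (\<integral>\<^sup>+ x. (\<Prod>i<d. indicator (A i) (x i)) \<partial>?M)"
      by (rule sym)
  next
    fix n :: nat
    have "(\<integral>\<^sup>+ x. (\<Prod>i<d. indicator {- real n..real n} (x i)) \<partial>std_gaussian d) \<le> (\<integral>\<^sup>+ x. 1 \<partial>std_gaussian d)"
      by (intro nn_integral_mono prod_le_1) (auto simp: indicator_def)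
    then show "(\<integral>\<^sup>+ x. (\<Prod>i<d. indicator {- real n..real n} (x i)) \<partial>std_gaussian d) \<noteq> \<infinity>"
      by (auto simp: G.emeasure_space_1 top_unique)
  qed auto
  then have "(\<integral>\<^sup>+ v. f v \<partial>std_gaussian d) = (\<integral>\<^sup>+ v. f v \<partial>?M)" by simp
  also have "\<dots> = (\<integral>\<^sup>+ v. \<integral>\<^sup>+ b. f (T (v, b)) \<partial>std_gaussian d \<partial>std_gaussian d)" by (rule M[OF f])
  finally show ?thesis by (simp add: T_def)
qed

text \<open>Completing the square produces a normal density, and the coefficient of \<open>v\<^sup>2\<close> does not grow
  because \<open>\<eta>\<^sup>2 = 1 - \<sigma>\<^sup>2 \<le> 1 - \<sigma>\<^sup>2 / 8\<close>.\<close>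
lemma std_normal_exp_square:
  assumes \<eta>: "0 < \<eta>" and \<sigma>: "0 < \<sigma>" and one: "\<eta>\<^sup>2 + \<sigma>\<^sup>2 = 1"
  shows "(\<integral>\<^sup>+ b. ennreal (std_normal_density b) * ennreal (exp ((\<eta> * v + \<sigma> * b)\<^sup>2 / 16)) \<partial>lborel)
    \<le> ennreal (exp (\<sigma>\<^sup>2 / 8) * exp (v\<^sup>2 / 16))"
proof -
  have s1: "\<sigma>\<^sup>2 < 1" "\<sigma>\<^sup>2 > 0" using zero_less_power[OF \<eta>, of 2] zero_less_power[OF \<sigma>, of 2] one by linarith+
  \<comment> \<open>The exponent -b^2 / 2 + \<sigma>^2 b^2 / 16 has leading coefficient -r / 2, so 1
    / r is the variance of the tilted normal law and m below is its mean.\<close>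
  define r where "r = 1 - \<sigma>\<^sup>2 / 8"
  have r: "r > 0" "r \<le> 1" "\<eta>\<^sup>2 \<le> r" using s1 one unfolding r_def by linarith+
  define m where "m = \<eta> * \<sigma> * v / (8 * r)"
  have "ennreal (std_normal_density b) * ennreal (exp ((\<eta> * v + \<sigma> * b)\<^sup>2 / 16))
      = ennreal (1 / sqrt r * exp (\<eta>\<^sup>2 * v\<^sup>2 / (16 * r))) * ennreal (normal_density m (1 / sqrt r) b)" for b
  proof -
    have sq: "sqrt r * sqrt r = r" "(sqrt r)\<^sup>2 = r" using r by auto
    have "- b\<^sup>2 / 2 + (\<eta> * v + \<sigma> * b)\<^sup>2 / 16 = \<eta>\<^sup>2 * v\<^sup>2 / (16 * r) - (b - m)\<^sup>2 / (2 * (1 / sqrt r)\<^sup>2)"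
    proof -
      have "\<eta>\<^sup>2 * v\<^sup>2 / (16 * r) - (b - m)\<^sup>2 / (2 * (1 / sqrt r)\<^sup>2)
         = \<eta>\<^sup>2 * v\<^sup>2 / (16 * r) - r * (b - m)\<^sup>2 / 2" using r by (simp add: power_divide)
      also have "r * (b - m)\<^sup>2 = r * b\<^sup>2 - 2 * b * (r * m) + (r * m)\<^sup>2 / r"
        using r by (simp add: power2_eq_square field_simps)
      also have "r * m = \<eta> * \<sigma> * v / 8" using r by (simp add: m_def)
      also have "\<eta>\<^sup>2 * v\<^sup>2 / (16 * r) - (r * b\<^sup>2 - 2 * b * (\<eta> * \<sigma> * v / 8) + (\<eta> * \<sigma> * v / 8)\<^sup>2 / r) / 2
         = \<eta>\<^sup>2 * v\<^sup>2 * (8 - \<sigma>\<^sup>2) / (128 * r) - r * b\<^sup>2 / 2 + b * (\<eta> * \<sigma> * v / 8)"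
        using r by (simp add: power2_eq_square field_simps)
      also have "8 - \<sigma>\<^sup>2 = 8 * r" by (simp add: r_def)
      also have "\<eta>\<^sup>2 * v\<^sup>2 * (8 * r) / (128 * r) = \<eta>\<^sup>2 * v\<^sup>2 / 16" using r by simp
      also have "\<eta>\<^sup>2 * v\<^sup>2 / 16 - r * b\<^sup>2 / 2 + b * (\<eta> * \<sigma> * v / 8) = - b\<^sup>2 / 2 + (\<eta> * v + \<sigma> * b)\<^sup>2 / 16"
        by (simp add: r_def power2_eq_square field_simps)
      finally show ?thesis ..
    qed
    then have "exp (- b\<^sup>2 / 2) * exp ((\<eta> * v + \<sigma> * b)\<^sup>2 / 16)
       = exp (\<eta>\<^sup>2 * v\<^sup>2 / (16 * r)) * exp (- (b - m)\<^sup>2 / (2 * (1 / sqrt r)\<^sup>2))"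
      by (simp add: exp_add[symmetric])
    then show ?thesis using r
      by (simp add: normal_density_def ennreal_mult'[symmetric] real_sqrt_divide real_sqrt_mult power_divide field_simps)
  qed
  then have "(\<integral>\<^sup>+ b. ennreal (std_normal_density b) * ennreal (exp ((\<eta> * v + \<sigma> * b)\<^sup>2 / 16)) \<partial>lborel)
     = ennreal (1 / sqrt r * exp (\<eta>\<^sup>2 * v\<^sup>2 / (16 * r))) * (\<integral>\<^sup>+ b. ennreal (normal_density m (1 / sqrt r) b) \<partial>lborel)"
    by (simp add: nn_integral_cmult)
  also have "(\<integral>\<^sup>+ b. ennreal (normal_density m (1 / sqrt r) b) \<partial>lborel) = 1"
    using r by (subst nn_integral_eq_integral) auto
  also have "ennreal (1 / sqrt r * exp (\<eta>\<^sup>2 * v\<^sup>2 / (16 * r))) * 1 \<le> ennreal (exp (\<sigma>\<^sup>2 / 8) * exp (v\<^sup>2 / 16))"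
    unfolding mult_1_right
  proof (intro ennreal_leI mult_mono)
    \<comment> \<open>Taking square roots turns this into 1 / sqrt r \<le> exp (\<sigma>^2 / 8), the
      price of one refreshment per coordinate.\<close>
    have "exp (- (\<sigma>\<^sup>2 / 4)) \<le> r"
    proof -
      have p: "0 < 1 + \<sigma>\<^sup>2 / 4" using s1(2) by linarith
      have "exp (- (\<sigma>\<^sup>2 / 4)) = 1 / exp (\<sigma>\<^sup>2 / 4)" by (simp add: exp_minus inverse_eq_divide)
      also have "\<dots> \<le> 1 / (1 + \<sigma>\<^sup>2 / 4)" using exp_ge_add_one_self[of "\<sigma>\<^sup>2 / 4"] p
        by (intro divide_left_mono mult_pos_pos) auto
      also have "\<dots> \<le> 1 - \<sigma>\<^sup>2 / 8"
      proof -
        have "1 \<le> (1 - \<sigma>\<^sup>2 / 8) * (1 + \<sigma>\<^sup>2 / 4)"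
        proof -
          have "(1 - s / 8) * (1 + s / 4) = 1 + s / 8 * (1 - s / 4)" for s :: real
            by (simp add: field_simps)
          moreover have "0 \<le> \<sigma>\<^sup>2 / 8 * (1 - \<sigma>\<^sup>2 / 4)"
            using s1 by (intro mult_nonneg_nonneg) linarith+
          ultimately show ?thesis by simp
        qed
        then show ?thesis unfolding pos_divide_le_eq[OF p] .
      qed
      finally show ?thesis by (simp add: r_def)
    qed
    then have "sqrt (exp (- (\<sigma>\<^sup>2 / 4))) \<le> sqrt r" by simp
    moreover have "sqrt (exp (- (\<sigma>\<^sup>2 / 4))) = exp (- (\<sigma>\<^sup>2 / 8))"
      by (rule real_sqrt_unique) (auto simp: power2_eq_square exp_add[symmetric])
    ultimately have "1 / sqrt r \<le> 1 / exp (- (\<sigma>\<^sup>2 / 8))" by (intro divide_left_mono) (use r in auto)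
    then show "1 / sqrt r \<le> exp (\<sigma>\<^sup>2 / 8)" by (simp add: exp_minus inverse_eq_divide)
    have "\<eta>\<^sup>2 * v\<^sup>2 \<le> r * v\<^sup>2" using r by (intro mult_right_mono) auto
    then show "exp (\<eta>\<^sup>2 * v\<^sup>2 / (16 * r)) \<le> exp (v\<^sup>2 / 16)" using r by (simp add: field_simps)
  qed auto
  finally show ?thesis .
qed

lemma std_gaussian_exp_square:
  assumes \<eta>: "0 < \<eta>" and \<sigma>: "0 < \<sigma>" and one: "\<eta>\<^sup>2 + \<sigma>\<^sup>2 = 1"
  shows "(\<integral>\<^sup>+ b. ennreal (exp ((norm_vec d (\<lambda>i. \<eta> * v i + \<sigma> * b i))\<^sup>2 / 16)) \<partial>std_gaussian d)
    \<le> ennreal (exp (d * \<sigma>\<^sup>2 / 8) * exp ((norm_vec d v)\<^sup>2 / 16))"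
proof -
  have "(\<integral>\<^sup>+ b. ennreal (exp ((norm_vec d (\<lambda>i. \<eta> * v i + \<sigma> * b i))\<^sup>2 / 16)) \<partial>std_gaussian d)
    = (\<integral>\<^sup>+ b. (\<Prod>i<d. (\<lambda>i t. ennreal (exp ((\<eta> * v i + \<sigma> * t)\<^sup>2 / 16))) i (b i)) \<partial>std_gaussian d)"
    by (simp add: norm_vec_power2 sum_divide_distrib exp_sum prod_ennreal)
  also have "\<dots> = (\<Prod>i<d. \<integral>\<^sup>+ t. ennreal (std_normal_density t) * ennreal (exp ((\<eta> * v i + \<sigma> * t)\<^sup>2 / 16)) \<partial>lborel)"
    by (rule nn_integral_std_gaussian_prod) measurable
  also have "\<dots> \<le> (\<Prod>i<d. ennreal (exp (\<sigma>\<^sup>2 / 8) * exp ((v i)\<^sup>2 / 16)))"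
    by (intro prod_mono_ennreal std_normal_exp_square assms)
  also have "\<dots> = ennreal (exp (d * \<sigma>\<^sup>2 / 8) * exp ((norm_vec d v)\<^sup>2 / 16))"
    by (simp add: prod_ennreal prod.distrib norm_vec_power2 sum_divide_distrib exp_sum exp_of_nat_mult[symmetric])
  finally show ?thesis .
qed

lemma nn_integral_gauss_unnormalised:
  assumes c: "0 < c"
  shows "(\<integral>\<^sup>+ x. ennreal (exp (- c * (norm_vec d x)\<^sup>2 / 2)) \<partial>lebesgue_Rd d) = ennreal (sqrt (2 * pi / c) ^ d)"
proof -
  have 1: "(\<integral>\<^sup>+ t. ennreal (exp (- c * t\<^sup>2 / 2)) \<partial>lborel) = ennreal (sqrt (2 * pi / c))"
  proof -
    have "(\<integral>\<^sup>+ t. ennreal (exp (- c * t\<^sup>2 / 2)) \<partial>lborel)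
       = (\<integral>\<^sup>+ t. ennreal (sqrt (2 * pi / c)) * ennreal (normal_density 0 (1 / sqrt c) t) \<partial>lborel)"
      using c by (intro nn_integral_cong) (simp add: normal_density_def ennreal_mult'[symmetric] power_divide)
    also have "\<dots> = ennreal (sqrt (2 * pi / c)) * (\<integral>\<^sup>+ t. ennreal (normal_density 0 (1 / sqrt c) t) \<partial>lborel)"
      by (simp add: nn_integral_cmult)
    also have "(\<integral>\<^sup>+ t. ennreal (normal_density 0 (1 / sqrt c) t) \<partial>lborel) = 1"
      using c by (subst nn_integral_eq_integral) auto
    finally show ?thesis by simp
  qed
  have "(\<integral>\<^sup>+ x. ennreal (exp (- c * (norm_vec d x)\<^sup>2 / 2)) \<partial>lebesgue_Rd d)
     = (\<integral>\<^sup>+ x. (\<Prod>i<d. (\<lambda>i t. ennreal (exp (- c * t\<^sup>2 / 2))) i (x i)) \<partial>lebesgue_Rd d)"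
    by (simp add: norm_vec_power2 prod_ennreal exp_sum[symmetric] sum_distrib_left sum_negf sum_divide_distrib)
  also have "\<dots> = (\<Prod>i<d. \<integral>\<^sup>+ t. ennreal (exp (- c * t\<^sup>2 / 2)) \<partial>lborel)"
    by (rule nn_integral_lebesgue_Rd_prod) measurable
  finally show ?thesis unfolding 1 using c by (simp add: ennreal_power)
qed

lemma std_gaussian_second_moment:
  "(\<integral>\<^sup>+ b. ennreal ((norm_vec d b)\<^sup>2) \<partial>std_gaussian d) = ennreal d"
proof -
  have 1: "(\<integral>\<^sup>+ t. ennreal (std_normal_density t) \<partial>lborel) = 1"
    by (subst nn_integral_eq_integral) auto
  have 2: "(\<integral>\<^sup>+ t. ennreal (std_normal_density t) * ennreal (t\<^sup>2) \<partial>lborel) = 1"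
  proof -
    have "has_bochner_integral lborel (\<lambda>x. std_normal_density x * x\<^sup>2) 1"
      using std_normal_moment_even[of 1] by simp
    then have "(\<integral>\<^sup>+ t. ennreal (std_normal_density t * t\<^sup>2) \<partial>lborel) = ennreal 1"
      by (subst nn_integral_eq_integral) (auto simp: has_bochner_integral_iff)
    then show ?thesis by (simp add: ennreal_mult')
  qed
  have 3: "(\<integral>\<^sup>+ b. ennreal ((b i)\<^sup>2) \<partial>std_gaussian d) = 1" if i: "i < d" for i
  proof -
    have "(\<integral>\<^sup>+ b. ennreal ((b i)\<^sup>2) \<partial>std_gaussian d)
      = (\<integral>\<^sup>+ b. (\<Prod>j<d. (\<lambda>j t. if j = i then ennreal (t\<^sup>2) else 1) j (b j)) \<partial>std_gaussian d)"
      using i by (simp add: prod.delta)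
    also have "\<dots> = (\<Prod>j<d. \<integral>\<^sup>+ t. ennreal (std_normal_density t) * (if j = i then ennreal (t\<^sup>2) else 1) \<partial>lborel)"
      by (rule nn_integral_std_gaussian_prod) measurable
    also have "\<dots> = 1"
    proof (intro prod.neutral ballI)
      fix j show "(\<integral>\<^sup>+ t. ennreal (std_normal_density t) * (if j = i then ennreal (t\<^sup>2) else 1) \<partial>lborel) = 1"
        by (cases "j = i") (simp_all add: 1 2)
    qed
    finally show ?thesis .
  qed
  have "(\<integral>\<^sup>+ b. ennreal ((norm_vec d b)\<^sup>2) \<partial>std_gaussian d) = (\<integral>\<^sup>+ b. (\<Sum>i<d. ennreal ((b i)\<^sup>2)) \<partial>std_gaussian d)"
    by (simp add: norm_vec_power2)
  also have "\<dots> = (\<Sum>i<d. \<integral>\<^sup>+ b. ennreal ((b i)\<^sup>2) \<partial>std_gaussian d)"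
    by (rule nn_integral_sum) simp
  also have "\<dots> = ennreal d" by (simp add: 3 ennreal_of_nat_eq_real_of_nat)
  finally show ?thesis .
qed

text \<open>Jensen's inequality in elementary form: with s = sqrt d, each norm is at most s / 2 +
  |b|^2 / (2 s), and the mean of |b|^2 is d.\<close>

lemma std_gaussian_norm_le:
  assumes "d \<ge> 1"
  shows "(\<integral>\<^sup>+ b. ennreal (norm_vec d b) \<partial>std_gaussian d) \<le> ennreal (sqrt d)"
proof -
  interpret G: prob_space "std_gaussian d" by (rule prob_space_std_gaussian)
  have sd: "sqrt d > 0" using assms by simp
  have "(\<integral>\<^sup>+ b. ennreal (norm_vec d b) \<partial>std_gaussian d)
     \<le> (\<integral>\<^sup>+ b. ennreal (sqrt d / 2) + ennreal (1 / (2 * sqrt d)) * ennreal ((norm_vec d b)\<^sup>2) \<partial>std_gaussian d)"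
  proof (rule nn_integral_mono)
    fix b
    have "0 \<le> (sqrt d - norm_vec d b)\<^sup>2" by simp
    then have "norm_vec d b * (2 * sqrt d) \<le> sqrt d * sqrt d + (norm_vec d b)\<^sup>2"
      by (simp add: power2_eq_square algebra_simps)
    then have "norm_vec d b \<le> (sqrt d * sqrt d + (norm_vec d b)\<^sup>2) / (2 * sqrt d)"
      using sd by (subst pos_le_divide_eq) auto
    also have "\<dots> = sqrt d / 2 + 1 / (2 * sqrt d) * (norm_vec d b)\<^sup>2"
      using sd real_div_sqrt[of "real d"] by (simp add: add_divide_distrib)
    finally show "ennreal (norm_vec d b) \<le> ennreal (sqrt d / 2) + ennreal (1 / (2 * sqrt d)) * ennreal ((norm_vec d b)\<^sup>2)"
      using sd by (simp add: ennreal_plus[symmetric] ennreal_mult'[symmetric] del: ennreal_plus)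
  qed
  also have "\<dots> = ennreal (sqrt d / 2) + ennreal (1 / (2 * sqrt d)) * ennreal d"
    by (simp add: nn_integral_add nn_integral_cmult std_gaussian_second_moment G.emeasure_space_1)
  also have "\<dots> = ennreal (sqrt d / 2 + 1 / (2 * sqrt d) * d)"
    by (simp add: ennreal_plus[symmetric] ennreal_mult'[symmetric] del: ennreal_plus)
  also have "sqrt d / 2 + 1 / (2 * sqrt d) * d = sqrt d"
    using real_div_sqrt[of "real d"] by simp
  finally show ?thesis .
qed

section \<open>Gaussian measure under Lipschitz perturbations of the identity\<close>

text \<open>Connects the product topology with the Euclidean norm: otherwise a sequence approaching
  w in norm would stay outside N, although it converges to w in every coordinate.\<close>

lemma norm_vec_nhd:
  assumes w: "w \<in> Rd d" and N: "open N" "w \<in> N"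
  shows "\<exists>r>0. \<forall>u\<in>Rd d. norm_vec d (\<lambda>i. u i - w i) < r \<longrightarrow> u \<in> N"
proof (rule ccontr)
  assume neg: "\<not> ?thesis"
  have "\<exists>u. u \<in> Rd d \<and> norm_vec d (\<lambda>i. u i - w i) < 1 / Suc n \<and> u \<notin> N" for n
  proof -
    have "(0::real) < 1 / Suc n" by simp
    with neg show ?thesis by blast
  qed
  then obtain u where u: "\<And>n. u n \<in> Rd d" "\<And>n. norm_vec d (\<lambda>i. u n i - w i) < 1 / Suc n" "\<And>n. u n \<notin> N"
    by metis
  have "u \<longlonglongrightarrow> w"
  proof (rule tendsto_componentwise_fun)
    fix i
    have "(\<lambda>n. u n i - w i) \<longlonglongrightarrow> 0"
    proof (rule Lim_null_comparison)
      show "\<forall>\<^sub>F n in sequentially. norm (u n i - w i) \<le> 1 / Suc n"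
      proof (rule always_eventually, rule allI)
        fix n
        show "norm (u n i - w i) \<le> 1 / Suc n"
        proof (cases "i < d")
          case True
          then show ?thesis using norm_vec_component[OF True, of "\<lambda>i. u n i - w i"] u(2)[of n] by simp
        next
          case False
          then show ?thesis using Rd_undefined[OF u(1)[of n]] Rd_undefined[OF w] by simp
        qed
      qed
      show "(\<lambda>n. 1 / real (Suc n)) \<longlonglongrightarrow> 0"
        by (rule LIMSEQ_Suc[OF lim_1_over_n])
    qed
    then show "(\<lambda>n. u n i) \<longlonglongrightarrow> w i" by (simp add: LIM_zero_iff)
  qed
  from topological_tendstoD[OF this N] have "\<forall>\<^sub>F n in sequentially. u n \<in> N" .
  then show False using u(3) by (simp add: eventually_sequentially)
qed

definition vball :: "nat \<Rightarrow> rvec \<Rightarrow> real \<Rightarrow> rvec set" where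
  "vball d c r = {v \<in> Rd d. norm_vec d (\<lambda>i. v i - c i) < r}"

lemma vball_sets [measurable]: "vball d c r \<in> sets (lebesgue_Rd d)"
proof -
  have "(\<lambda>v. norm_vec d (\<lambda>i\<in>{..<d}. v i - c i)) \<in> borel_measurable (lebesgue_Rd d)"
    by (intro measurable_norm_vec measurable_Rd_restrict) measurable
  then have "(\<lambda>v. norm_vec d (\<lambda>i. v i - c i)) \<in> borel_measurable (lebesgue_Rd d)" by simp
  then have "{v \<in> space (lebesgue_Rd d). norm_vec d (\<lambda>i. v i - c i) < r} \<in> sets (lebesgue_Rd d)"
    by measurable
  then show ?thesis by (simp add: vball_def)
qed

lemma emeasure_vball:
  assumes r: "r > 0"
  shows "emeasure (lebesgue_Rd d) (vball d c r) = ennreal (r ^ d) * emeasure (lebesgue_Rd d) (vball d (\<lambda>_. 0) 1)"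
proof -
  have "emeasure (lebesgue_Rd d) (vball d c r) = (\<integral>\<^sup>+ x. indicator (vball d c r) x \<partial>lebesgue_Rd d)"
    by simp
  also have "\<dots> = ennreal (r ^ d) * (\<integral>\<^sup>+ x. indicator (vball d c r) (\<lambda>i\<in>{..<d}. c i + r * x i) \<partial>lebesgue_Rd d)"
    by (rule nn_integral_Rd_affine[OF r]) measurable
  also have "(\<integral>\<^sup>+ x. indicator (vball d c r) (\<lambda>i\<in>{..<d}. c i + r * x i) \<partial>lebesgue_Rd d)
      = (\<integral>\<^sup>+ x. indicator (vball d (\<lambda>_. 0) 1) x \<partial>lebesgue_Rd d)"
  proof (rule nn_integral_cong)
    fix x assume "x \<in> space (lebesgue_Rd d)"
    then have x: "x \<in> Rd d" by simp
    have "norm_vec d (\<lambda>i. (\<lambda>i\<in>{..<d}. c i + r * x i) i - c i) = norm_vec d (\<lambda>i. r * x i)"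
      by (rule norm_vec_cong) simp
    also have "\<dots> = r * norm_vec d x" using r by (simp add: norm_vec_scale)
    finally show "indicator (vball d c r) (\<lambda>i\<in>{..<d}. c i + r * x i) = (indicator (vball d (\<lambda>_. 0) 1) x :: ennreal)"
      using x r by (auto simp: vball_def indicator_def)
  qed
  finally show ?thesis by simp
qed

text \<open>The unit volume is divided out of the averages over balls in
  \<open>Lipschitz_preimage_open\<close>, which requires it to be neither zero nor infinite.\<close>

lemma emeasure_unit_vball: "emeasure (lebesgue_Rd d) (vball d (\<lambda>_. 0) 1) \<noteq> 0"
  "emeasure (lebesgue_Rd d) (vball d (\<lambda>_. 0) 1) \<noteq> \<infinity>"
proof -
  \<comment> \<open>Half the side of a cube that lies in the unit ball already by the l1 bound,
    since d \<delta> < 1.\<close>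
  define \<delta> :: real where "\<delta> = 1 / (d + 1)"
  have \<delta>: "\<delta> > 0" "d * \<delta> < 1" by (auto simp: \<delta>_def field_simps)
  let ?A = "Pi\<^sub>E {..<d} (\<lambda>_. {- \<delta>..\<delta>})" and ?B = "Pi\<^sub>E {..<d} (\<lambda>_. {- 1..1::real})"
  have box: "emeasure (lebesgue_Rd d) (Pi\<^sub>E {..<d} (\<lambda>_. {- s..s})) = ennreal (2 * s) ^ d" if "s \<ge> 0" for s
  proof -
    have "emeasure (lebesgue_Rd d) (Pi\<^sub>E {..<d} (\<lambda>_. {- s..s})) = (\<integral>\<^sup>+ x. (\<Prod>i<d. indicator {- s..s} (x i)) \<partial>lebesgue_Rd d)"
      by (rule emeasure_Rd_PiE) auto
    also have "\<dots> = (\<Prod>i<d. \<integral>\<^sup>+ t. indicator {- s..s} t \<partial>lborel)"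
      by (rule nn_integral_lebesgue_Rd_prod) auto
    finally show ?thesis using that by simp
  qed
  have "?A \<subseteq> vball d (\<lambda>_. 0) 1"
  proof
    fix x assume x: "x \<in> ?A"
    have "norm_vec d x \<le> (\<Sum>i<d. \<bar>x i\<bar>)" unfolding norm_vec_def by (rule L2_set_le_sum_abs)
    also have "\<dots> \<le> (\<Sum>i<d. \<delta>)" using x by (intro sum_mono) (auto simp: PiE_def Pi_def abs_le_iff)
    also have "\<dots> < 1" using \<delta> by simp
    finally show "x \<in> vball d (\<lambda>_. 0) 1" using x by (auto simp: vball_def Rd_def PiE_def)
  qed
  then have "emeasure (lebesgue_Rd d) ?A \<le> emeasure (lebesgue_Rd d) (vball d (\<lambda>_. 0) 1)"
    by (rule emeasure_mono) measurable
  moreover have "emeasure (lebesgue_Rd d) ?A \<noteq> 0" using \<delta> by (subst box) auto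
  ultimately show "emeasure (lebesgue_Rd d) (vball d (\<lambda>_. 0) 1) \<noteq> 0" by (metis le_zero_eq)
  have "vball d (\<lambda>_. 0) 1 \<subseteq> ?B"
  proof
    fix x assume "x \<in> vball d (\<lambda>_. 0) 1"
    then have x: "x \<in> Rd d" "norm_vec d x < 1" by (auto simp: vball_def)
    have "x i \<in> {-1..1}" if "i < d" for i using norm_vec_component[OF that, of x] x by auto
    then show "x \<in> ?B" using x(1) by (auto simp: Rd_def PiE_def)
  qed
  then have "emeasure (lebesgue_Rd d) (vball d (\<lambda>_. 0) 1) \<le> emeasure (lebesgue_Rd d) ?B"
    by (rule emeasure_mono) (rule sets_Rd_PiE, simp)
  also have "\<dots> < \<infinity>" by (subst box) (auto simp: power_less_top_ennreal)
  finally show "emeasure (lebesgue_Rd d) (vball d (\<lambda>_. 0) 1) \<noteq> \<infinity>" by simp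
qed

lemma continuous_on_gauss_dens: "continuous_on UNIV (gauss_dens d)"
proof -
  have "continuous_on UNIV (\<lambda>x. std_normal_density (x i))" for i :: nat
    unfolding std_normal_density_def
    by (intro continuous_intros continuous_on_product_coordinates) auto
  then show ?thesis unfolding gauss_dens_def by (intro continuous_on_prod)
qed

text \<open>Averaging \<open>F\<close> over small balls turns the bound on preimages of balls into a bound on
  \<open>\<integral> F \<circ> \<Phi>\<close> by Fubini; lower semicontinuity of \<open>F\<close> and Fatou's lemma remove the averaging.
  This replaces the change of variables formula, and no Jacobian is needed.\<close>
lemma Lipschitz_preimage_open:
  assumes \<Phi> [measurable]: "\<Phi> \<in> lebesgue_Rd d \<rightarrow>\<^sub>M lebesgue_Rd d" and \<Psi>: "\<And>u. u \<in> Rd d \<Longrightarrow> \<Psi> u \<in> Rd d"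
    and l: "\<l> > 0"
    and key: "\<And>b u. b \<in> Rd d \<Longrightarrow> u \<in> Rd d \<Longrightarrow> norm_vec d (\<lambda>i. b i - \<Psi> u i) \<le> \<l> * norm_vec d (\<lambda>i. \<Phi> b i - u i)"
    and A: "open A"
  shows "(\<integral>\<^sup>+ b. indicator A (\<Phi> b) * ennreal (gauss_dens d (\<Phi> b)) \<partial>lebesgue_Rd d)
    \<le> ennreal (\<l> ^ d) * (\<integral>\<^sup>+ u. indicator A u * ennreal (gauss_dens d u) \<partial>lebesgue_Rd d)"
proof -
  let ?M = "lebesgue_Rd d"
  interpret M: sigma_finite_measure ?M by (rule sigma_finite_lebesgue_Rd)
  interpret P: pair_sigma_finite ?M ?M by (simp add: pair_sigma_finite_def M.sigma_finite_measure_axioms)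
  define F where "F u = indicator A u * ennreal (gauss_dens d u)" for u
  have Am: "(indicator A :: rvec \<Rightarrow> ennreal) \<in> borel_measurable ?M"
    using measurable_compose[OF id_measurable_borel, of "indicator A :: rvec \<Rightarrow> ennreal" borel d] A
    by (simp add: borel_measurable_indicator)
  have F [measurable]: "F \<in> borel_measurable ?M"
    unfolding F_def using Am by measurable
  have \<Phi>R: "b \<in> Rd d \<Longrightarrow> \<Phi> b \<in> Rd d" for b using measurable_space[OF \<Phi>, of b] by simp
  have nm [measurable]: "(\<lambda>p. norm_vec d (\<lambda>i. fst p i - snd p i)) \<in> borel_measurable (?M \<Otimes>\<^sub>M ?M)"
  proof -
    have "(\<lambda>p. norm_vec d (\<lambda>i\<in>{..<d}. fst p i - snd p i)) \<in> borel_measurable (?M \<Otimes>\<^sub>M ?M)"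
      by (intro measurable_norm_vec measurable_Rd_restrict) measurable
    then show ?thesis by simp
  qed
  define G where "G r p = F (fst p) * indicator {p. norm_vec d (\<lambda>i. fst p i - snd p i) < r} p" for r and p :: "rvec \<times> rvec"
  have G [measurable]: "G r \<in> borel_measurable (?M \<Otimes>\<^sub>M ?M)" for r
    unfolding G_def by measurable
  define I where "I r w = (\<integral>\<^sup>+ u. G r (u, w) \<partial>?M)" for r w
  have I [measurable]: "I r \<in> borel_measurable ?M" for r
    unfolding I_def by measurable
  define \<beta> where "\<beta> = emeasure ?M (vball d (\<lambda>_. 0) 1)"
  have \<beta>: "\<beta> \<noteq> 0" "\<beta> \<noteq> \<infinity>" unfolding \<beta>_def by (rule emeasure_unit_vball)+
  define c where "c r = inverse (ennreal (r ^ d) * \<beta>)" for r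
  have c: "c r * (ennreal (r ^ d) * \<beta>) = 1" if "r > 0" for r
  proof -
    have "ennreal (r ^ d) * \<beta> \<noteq> 0" "ennreal (r ^ d) * \<beta> < top"
      using \<beta> that by (auto simp: ennreal_mult_eq_top_iff less_top[symmetric])
    then show ?thesis
      unfolding c_def using ennreal_divide_self[of "ennreal (r ^ d) * \<beta>"] by (simp add: divide_ennreal_def mult.commute)
  qed
  \<comment> \<open>A point b with \<open>\<Phi> b\<close> within r of u lies within \<l> r of
    \<open>\<Psi> u\<close>; after exchanging the integrals, the volume ratio of these balls is
    \<l>^d.\<close>
  have A1: "(\<integral>\<^sup>+ b. c r * I r (\<Phi> b) \<partial>?M) \<le> ennreal (\<l> ^ d) * (\<integral>\<^sup>+ u. F u \<partial>?M)" if r: "r > 0" for r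
  proof -
    have "(\<integral>\<^sup>+ b. I r (\<Phi> b) \<partial>?M) = (\<integral>\<^sup>+ b. \<integral>\<^sup>+ u. G r (u, \<Phi> b) \<partial>?M \<partial>?M)" by (simp add: I_def)
    also have "\<dots> = (\<integral>\<^sup>+ u. \<integral>\<^sup>+ b. G r (u, \<Phi> b) \<partial>?M \<partial>?M)"
      by (rule P.Fubini') measurable
    also have "\<dots> \<le> (\<integral>\<^sup>+ u. F u * (ennreal ((\<l> * r) ^ d) * \<beta>) \<partial>?M)"
    proof (rule nn_integral_mono)
      fix u assume "u \<in> space ?M"
      then have u: "u \<in> Rd d" by simp
      have "(\<integral>\<^sup>+ b. G r (u, \<Phi> b) \<partial>?M) \<le> (\<integral>\<^sup>+ b. F u * indicator (vball d (\<Psi> u) (\<l> * r)) b \<partial>?M)"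
      proof (rule nn_integral_mono)
        fix b assume "b \<in> space ?M"
        then have b: "b \<in> Rd d" by simp
        have "norm_vec d (\<lambda>i. b i - \<Psi> u i) < \<l> * r" if "norm_vec d (\<lambda>i. u i - \<Phi> b i) < r"
          using key[OF b u] mult_strict_left_mono[OF that l] by (simp add: norm_vec_minus_commute[of d u])
        then show "G r (u, \<Phi> b) \<le> F u * indicator (vball d (\<Psi> u) (\<l> * r)) b"
          using b by (auto simp: G_def vball_def indicator_def)
      qed
      also have "\<dots> = F u * emeasure ?M (vball d (\<Psi> u) (\<l> * r))"
        by (simp add: nn_integral_cmult)
      also have "\<dots> = F u * (ennreal ((\<l> * r) ^ d) * \<beta>)"
        using l r by (subst emeasure_vball) (auto simp: \<beta>_def)
      finally show "(\<integral>\<^sup>+ b. G r (u, \<Phi> b) \<partial>?M) \<le> F u * (ennreal ((\<l> * r) ^ d) * \<beta>)" .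
    qed
    also have "\<dots> = (\<integral>\<^sup>+ u. F u \<partial>?M) * (ennreal ((\<l> * r) ^ d) * \<beta>)"
      by (rule nn_integral_multc) measurable
    finally have "c r * (\<integral>\<^sup>+ b. I r (\<Phi> b) \<partial>?M) \<le> c r * ((\<integral>\<^sup>+ u. F u \<partial>?M) * (ennreal ((\<l> * r) ^ d) * \<beta>))"
      by (rule mult_left_mono) simp
    also have "\<dots> = ennreal (\<l> ^ d) * (\<integral>\<^sup>+ u. F u \<partial>?M) * (c r * (ennreal (r ^ d) * \<beta>))"
      using l r by (simp add: power_mult_distrib ennreal_mult mult_ac)
    finally show ?thesis using c[OF r] by (simp add: nn_integral_cmult)
  qed
  \<comment> \<open>For z below F w, F is at least z on a whole neighbourhood of w, since A is open
    and the density is continuous; hence so are the averages over all small balls.\<close>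
  have B1: "F w \<le> liminf (\<lambda>n. c (1 / Suc n) * I (1 / Suc n) w)" if w: "w \<in> Rd d" for w
  proof (cases "w \<in> A")
    case True
    show ?thesis unfolding le_Liminf_iff
    proof (intro allI impI)
      fix y assume "y < F w"
      then obtain z where z: "y < z" "z < F w" using dense by blast
      have Fw: "F w = ennreal (gauss_dens d w)" using True by (simp add: F_def)
      with z obtain z' where z': "z = ennreal z'" "0 \<le> z'" by (cases z) (auto simp: less_top[symmetric])
      let ?N = "A \<inter> {u. z' < gauss_dens d u}"
      have "open ?N"
        by (intro open_Int A open_Collect_less continuous_on_const continuous_on_gauss_dens)
      moreover have "w \<in> ?N" using True z z' Fw by (simp add: ennreal_less_iff)
      ultimately obtain r0 where r0: "r0 > 0" "\<And>u. u \<in> Rd d \<Longrightarrow> norm_vec d (\<lambda>i. u i - w i) < r0 \<Longrightarrow> u \<in> ?N"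
        using norm_vec_nhd[OF w] by metis
      have "\<forall>\<^sub>F n in sequentially. 1 / real (Suc n) < r0"
        using order_tendstoD(2)[OF LIMSEQ_Suc[OF lim_1_over_n] r0(1)] .
      then show "\<forall>\<^sub>F n in sequentially. y < c (1 / Suc n) * I (1 / Suc n) w"
      proof (rule eventually_mono)
        fix n assume n: "1 / real (Suc n) < r0"
        let ?r = "1 / real (Suc n)"
        have r: "?r > 0" by simp
        have "z * emeasure ?M (vball d w ?r) = (\<integral>\<^sup>+ u. z * indicator (vball d w ?r) u \<partial>?M)"
          by (simp add: nn_integral_cmult)
        also have "\<dots> \<le> I ?r w"
          unfolding I_def
        proof (rule nn_integral_mono)
          fix u assume "u \<in> space ?M"
          show "z * indicator (vball d w ?r) u \<le> G ?r (u, w)"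
          proof (cases "u \<in> vball d w ?r")
            case True
            then have u: "u \<in> Rd d" "norm_vec d (\<lambda>i. u i - w i) < ?r" by (auto simp: vball_def)
            then have "u \<in> ?N" using n by (intro r0(2)) linarith+
            then have "z \<le> F u" using z' by (auto simp: F_def intro!: ennreal_leI)
            then show ?thesis using True u by (simp add: G_def)
          qed simp
        qed
        finally have "c ?r * (z * (ennreal (?r ^ d) * \<beta>)) \<le> c ?r * I ?r w"
          unfolding emeasure_vball[OF r] \<beta>_def by (rule mult_left_mono) simp
        also have "c ?r * (z * (ennreal (?r ^ d) * \<beta>)) = z * (c ?r * (ennreal (?r ^ d) * \<beta>))"
          by (rule mult.left_commute)
        also have "\<dots> = z" unfolding c[OF r] by simp
        finally show "y < c ?r * I ?r w" using z(1) by (rule less_le_trans[rotated])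
      qed
    qed
  qed (simp add: F_def)
  have "(\<integral>\<^sup>+ b. F (\<Phi> b) \<partial>?M) \<le> (\<integral>\<^sup>+ b. liminf (\<lambda>n. c (1 / Suc n) * I (1 / Suc n) (\<Phi> b)) \<partial>?M)"
    by (intro nn_integral_mono B1 \<Phi>R) simp
  also have "\<dots> \<le> liminf (\<lambda>n. \<integral>\<^sup>+ b. c (1 / Suc n) * I (1 / Suc n) (\<Phi> b) \<partial>?M)"
    by (rule nn_integral_liminf) measurable
  also have "\<dots> \<le> limsup (\<lambda>n. \<integral>\<^sup>+ b. c (1 / Suc n) * I (1 / Suc n) (\<Phi> b) \<partial>?M)"
    by (rule Liminf_le_Limsup) simp
  also have "\<dots> \<le> ennreal (\<l> ^ d) * (\<integral>\<^sup>+ u. F u \<partial>?M)"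
    by (rule Limsup_bounded) (intro always_eventually allI A1, simp)
  finally show ?thesis by (simp add: F_def)
qed

text \<open>Outer regularity of the Gaussian law, viewed as a finite Borel measure on
  \<open>nat => real\<close>, extends the bound from open sets. The factor \<l>^d is moved to the
  left first, so that the bound can be compared with the infimum over open supersets.\<close>

lemma Lipschitz_preimage_borel:
  assumes \<Phi> [measurable]: "\<Phi> \<in> lebesgue_Rd d \<rightarrow>\<^sub>M lebesgue_Rd d" and \<Psi>: "\<And>u. u \<in> Rd d \<Longrightarrow> \<Psi> u \<in> Rd d"
    and l: "\<l> > 0"
    and key: "\<And>b u. b \<in> Rd d \<Longrightarrow> u \<in> Rd d \<Longrightarrow> norm_vec d (\<lambda>i. b i - \<Psi> u i) \<le> \<l> * norm_vec d (\<lambda>i. \<Phi> b i - u i)"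
    and B: "B \<in> sets (lebesgue_Rd d)"
  shows "(\<integral>\<^sup>+ b. indicator B (\<Phi> b) * ennreal (gauss_dens d (\<Phi> b)) \<partial>lebesgue_Rd d)
    \<le> ennreal (\<l> ^ d) * emeasure (std_gaussian d) B"
proof -
  let ?M = "lebesgue_Rd d"
  interpret G: prob_space "std_gaussian d" by (rule prob_space_std_gaussian)
  have \<Phi>R: "b \<in> Rd d \<Longrightarrow> \<Phi> b \<in> Rd d" for b using measurable_space[OF \<Phi>, of b] by simp
  have idm: "(\<lambda>x. x) \<in> std_gaussian d \<rightarrow>\<^sub>M borel"
    using id_measurable_borel[of d] by (simp cong: measurable_cong_sets)
  let ?N = "distr (std_gaussian d) borel (\<lambda>x. x)"
  interpret N: prob_space ?N by (rule G.prob_space_distr[OF idm])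
  have N: "emeasure ?N C = (\<integral>\<^sup>+ u. indicator C u * ennreal (gauss_dens d u) \<partial>?M)" if "C \<in> sets borel" for C
  proof -
    have C: "C \<inter> Rd d \<in> sets ?M" using measurable_sets[OF id_measurable_borel[of d] that] by simp
    have "emeasure ?N C = emeasure (std_gaussian d) (C \<inter> Rd d)"
      using emeasure_distr[OF idm that] by simp
    also have "\<dots> = (\<integral>\<^sup>+ u. indicator (C \<inter> Rd d) u \<partial>std_gaussian d)" using C by simp
    also have "\<dots> = (\<integral>\<^sup>+ u. ennreal (gauss_dens d u) * indicator (C \<inter> Rd d) u \<partial>?M)"
      by (rule nn_integral_std_gaussian) (use C in simp)
    also have "\<dots> = (\<integral>\<^sup>+ u. indicator C u * ennreal (gauss_dens d u) \<partial>?M)"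
      by (rule nn_integral_cong) (auto simp: indicator_def)
    finally show ?thesis .
  qed
  have rm: "(\<lambda>x. restrict x {..<d}) \<in> borel \<rightarrow>\<^sub>M ?M"
    by (rule measurable_Rd_restrict) (rule measurable_product_coordinates)
  \<comment> \<open>A Borel set of the ambient space that agrees with B on \<open>Rd d\<close>, so
    that regularity applies to it.\<close>
  define C where "C = (\<lambda>x. restrict x {..<d}) -` B"
  have C: "C \<in> sets borel" using measurable_sets[OF rm B] by (simp add: C_def)
  have CB: "x \<in> C \<longleftrightarrow> x \<in> B" if "x \<in> Rd d" for x using restrict_Rd[OF that] by (simp add: C_def)
  have NC: "emeasure ?N C = emeasure (std_gaussian d) B"
  proof -
    have "emeasure ?N C = emeasure (std_gaussian d) (C \<inter> Rd d)"
      using emeasure_distr[OF idm C] by simp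
    also have "C \<inter> Rd d = B" using CB sets.sets_into_space[OF B] by auto
    finally show ?thesis .
  qed
  have lp: "\<l> ^ d > 0" using l by simp
  let ?L = "\<integral>\<^sup>+ b. indicator B (\<Phi> b) * ennreal (gauss_dens d (\<Phi> b)) \<partial>?M"
  have inv: "ennreal (1 / \<l> ^ d) * (ennreal (\<l> ^ d) * y) = y" "ennreal (\<l> ^ d) * (ennreal (1 / \<l> ^ d) * y) = y" for y
    using lp l by (simp_all add: mult.assoc[symmetric] ennreal_mult'[symmetric])
  have "ennreal (1 / \<l> ^ d) * ?L \<le> (INF A\<in>{A. C \<subseteq> A \<and> open A}. emeasure ?N A)"
  proof (rule INF_greatest)
    fix A assume "A \<in> {A. C \<subseteq> A \<and> open A}"
    then have A: "C \<subseteq> A" "open A" by auto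
    have "?L \<le> (\<integral>\<^sup>+ b. indicator A (\<Phi> b) * ennreal (gauss_dens d (\<Phi> b)) \<partial>?M)"
      using A(1) CB \<Phi>R by (intro nn_integral_mono mult_right_mono) (auto simp: indicator_def)
    also have "\<dots> \<le> ennreal (\<l> ^ d) * (\<integral>\<^sup>+ u. indicator A u * ennreal (gauss_dens d u) \<partial>?M)"
      by (rule Lipschitz_preimage_open[OF \<Phi> \<Psi> l key A(2)])
    also have "\<dots> = ennreal (\<l> ^ d) * emeasure ?N A"
      using A(2) by (subst N) auto
    finally have "ennreal (1 / \<l> ^ d) * ?L \<le> ennreal (1 / \<l> ^ d) * (ennreal (\<l> ^ d) * emeasure ?N A)"
      by (rule mult_left_mono) simp
    then show "ennreal (1 / \<l> ^ d) * ?L \<le> emeasure ?N A" unfolding inv .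
  qed
  also have "\<dots> = emeasure ?N C"
    by (rule outer_regular[symmetric]) (use C N.emeasure_finite in auto)
  finally have "ennreal (\<l> ^ d) * (ennreal (1 / \<l> ^ d) * ?L) \<le> ennreal (\<l> ^ d) * emeasure ?N C"
    by (rule mult_left_mono) simp
  then show ?thesis unfolding inv NC .
qed

lemma Lipschitz_preimage_integral:
  assumes \<Phi> [measurable]: "\<Phi> \<in> lebesgue_Rd d \<rightarrow>\<^sub>M lebesgue_Rd d" and \<Psi>: "\<And>u. u \<in> Rd d \<Longrightarrow> \<Psi> u \<in> Rd d"
    and l: "\<l> > 0"
    and key: "\<And>b u. b \<in> Rd d \<Longrightarrow> u \<in> Rd d \<Longrightarrow> norm_vec d (\<lambda>i. b i - \<Psi> u i) \<le> \<l> * norm_vec d (\<lambda>i. \<Phi> b i - u i)"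
    and F [measurable]: "F \<in> borel_measurable (lebesgue_Rd d)"
  shows "(\<integral>\<^sup>+ b. F (\<Phi> b) * ennreal (gauss_dens d (\<Phi> b)) \<partial>lebesgue_Rd d)
    \<le> ennreal (\<l> ^ d) * (\<integral>\<^sup>+ u. F u \<partial>std_gaussian d)"
proof -
  let ?M = "lebesgue_Rd d"
  let ?A = "distr (density ?M (\<lambda>b. ennreal (gauss_dens d (\<Phi> b)))) ?M \<Phi>"
  let ?B = "density (std_gaussian d) (\<lambda>_. ennreal (\<l> ^ d))"
  have "?A \<le> ?B"
  proof (subst le_measure)
    show "\<forall>B\<in>sets ?A. emeasure ?A B \<le> emeasure ?B B"
    proof
      fix B assume "B \<in> sets ?A"
      then have B [measurable]: "B \<in> sets ?M" by simp
      have "emeasure ?A B = (\<integral>\<^sup>+ x. indicator B x \<partial>?A)" by simp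
      also have "\<dots> = (\<integral>\<^sup>+ b. indicator B (\<Phi> b) * ennreal (gauss_dens d (\<Phi> b)) \<partial>?M)"
        by (simp add: nn_integral_distr nn_integral_density mult.commute del: nn_integral_indicator)
      also have "\<dots> \<le> ennreal (\<l> ^ d) * emeasure (std_gaussian d) B"
        by (rule Lipschitz_preimage_borel[OF \<Phi> \<Psi> l key B])
      also have "\<dots> = emeasure ?B B"
        by (subst emeasure_density) (auto simp: nn_integral_cmult)
      finally show "emeasure ?A B \<le> emeasure ?B B" .
    qed
  qed simp
  then have "(\<integral>\<^sup>+ u. F u \<partial>?A) \<le> (\<integral>\<^sup>+ u. F u \<partial>?B)"
    by (intro nn_integral_mono_measure) simp_all
  then show ?thesis
    by (simp add: nn_integral_distr nn_integral_density nn_integral_multc mult.commute)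
qed

text \<open>The cost of replacing Gaussian noise b by \<open>\<Phi> b\<close>, where \<Phi>
  displaces points by at most e. The factor \<l>^d is the change of volume. The additive error is
  the change of density, which falls along the displacement by a relative amount of at most e |b| +
  e^2 / 2.\<close>

lemma gaussian_compare:
  assumes d: "d \<ge> 1" and \<Phi> [measurable]: "\<Phi> \<in> lebesgue_Rd d \<rightarrow>\<^sub>M lebesgue_Rd d" and \<Psi>: "\<And>u. u \<in> Rd d \<Longrightarrow> \<Psi> u \<in> Rd d"
    and l: "\<l> > 0"
    and key: "\<And>b u. b \<in> Rd d \<Longrightarrow> u \<in> Rd d \<Longrightarrow> norm_vec d (\<lambda>i. b i - \<Psi> u i) \<le> \<l> * norm_vec d (\<lambda>i. \<Phi> b i - u i)"
    and e: "e \<ge> 0" "\<And>b. b \<in> Rd d \<Longrightarrow> norm_vec d (\<lambda>i. \<Phi> b i - b i) \<le> e"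
    and F [measurable]: "F \<in> borel_measurable (lebesgue_Rd d)" and a: "a \<ge> 0" "\<And>x. x \<in> Rd d \<Longrightarrow> F x \<le> ennreal a"
  shows "(\<integral>\<^sup>+ b. F (\<Phi> b) \<partial>std_gaussian d)
    \<le> ennreal (\<l> ^ d) * (\<integral>\<^sup>+ b. F b \<partial>std_gaussian d) + ennreal (a * (e * sqrt d + e\<^sup>2 / 2))"
proof -
  let ?M = "lebesgue_Rd d"
  have \<Phi>R: "b \<in> Rd d \<Longrightarrow> \<Phi> b \<in> Rd d" for b using measurable_space[OF \<Phi>, of b] by simp
  \<comment> \<open>Half the increase from |b|^2 to (|b| + e)^2, hence a bound on the logarithmic
    loss of the density.\<close>
  define t where "t b = e * norm_vec d b + e\<^sup>2 / 2" for b
  have t0: "t b \<ge> 0" for b using e(1) by (simp add: t_def)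
  have [measurable]: "t \<in> borel_measurable ?M" unfolding t_def by measurable
  have g: "gauss_dens d b \<le> gauss_dens d (\<Phi> b) + gauss_dens d b * t b" if b: "b \<in> Rd d" for b
  proof -
    have "norm_vec d (\<Phi> b) \<le> norm_vec d b + e"
      using norm_vec_triangle[of d b "\<lambda>i. \<Phi> b i - b i"] e(2)[OF b] by simp
    then have "(norm_vec d (\<Phi> b))\<^sup>2 \<le> (norm_vec d b + e)\<^sup>2" by (intro power_mono) auto
    then have "(norm_vec d (\<Phi> b))\<^sup>2 \<le> (norm_vec d b)\<^sup>2 + 2 * t b"
      by (simp add: t_def power2_eq_square algebra_simps)
    then have "exp (- (norm_vec d b)\<^sup>2 / 2 - t b) \<le> exp (- (norm_vec d (\<Phi> b))\<^sup>2 / 2)" by simp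
    moreover have "(1 - t b) * exp (- (norm_vec d b)\<^sup>2 / 2) \<le> exp (- t b) * exp (- (norm_vec d b)\<^sup>2 / 2)"
      using exp_ge_add_one_self[of "- t b"] by (intro mult_right_mono) auto
    moreover have "exp (- t b) * exp (- (norm_vec d b)\<^sup>2 / 2) = exp (- (norm_vec d b)\<^sup>2 / 2 - t b)"
      by (simp add: exp_add[symmetric])
    ultimately have "(1 - t b) * exp (- (norm_vec d b)\<^sup>2 / 2) \<le> exp (- (norm_vec d (\<Phi> b))\<^sup>2 / 2)"
      by linarith
    then have "(1 / sqrt (2 * pi)) ^ d * ((1 - t b) * exp (- (norm_vec d b)\<^sup>2 / 2))
       \<le> (1 / sqrt (2 * pi)) ^ d * exp (- (norm_vec d (\<Phi> b))\<^sup>2 / 2)"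
      by (intro mult_left_mono) auto
    then have "(1 - t b) * gauss_dens d b \<le> gauss_dens d (\<Phi> b)"
      unfolding gauss_dens_eq by (simp only: mult_ac)
    then show ?thesis by (simp add: algebra_simps)
  qed
  have "(\<integral>\<^sup>+ b. F (\<Phi> b) \<partial>std_gaussian d) = (\<integral>\<^sup>+ b. ennreal (gauss_dens d b) * F (\<Phi> b) \<partial>?M)"
    by (rule nn_integral_std_gaussian) measurable
  also have "\<dots> \<le> (\<integral>\<^sup>+ b. F (\<Phi> b) * ennreal (gauss_dens d (\<Phi> b)) + ennreal a * (ennreal (gauss_dens d b) * ennreal (t b)) \<partial>?M)"
  proof (rule nn_integral_mono)
    fix b assume "b \<in> space ?M"
    then have b: "b \<in> Rd d" by simp
    have "ennreal (gauss_dens d b) \<le> ennreal (gauss_dens d (\<Phi> b)) + ennreal (gauss_dens d b) * ennreal (t b)"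
      using g[OF b] t0 by (simp add: ennreal_mult[symmetric] ennreal_plus[symmetric] del: ennreal_plus)
    then have "ennreal (gauss_dens d b) * F (\<Phi> b)
       \<le> (ennreal (gauss_dens d (\<Phi> b)) + ennreal (gauss_dens d b) * ennreal (t b)) * F (\<Phi> b)"
      by (rule mult_right_mono) simp
    also have "\<dots> = F (\<Phi> b) * ennreal (gauss_dens d (\<Phi> b)) + F (\<Phi> b) * (ennreal (gauss_dens d b) * ennreal (t b))"
      by (simp add: algebra_simps)
    also have "\<dots> \<le> F (\<Phi> b) * ennreal (gauss_dens d (\<Phi> b)) + ennreal a * (ennreal (gauss_dens d b) * ennreal (t b))"
      by (intro add_left_mono mult_right_mono a \<Phi>R b) simp
    finally show "ennreal (gauss_dens d b) * F (\<Phi> b) \<le> F (\<Phi> b) * ennreal (gauss_dens d (\<Phi> b)) + ennreal a * (ennreal (gauss_dens d b) * ennreal (t b))" .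
  qed
  also have "\<dots> = (\<integral>\<^sup>+ b. F (\<Phi> b) * ennreal (gauss_dens d (\<Phi> b)) \<partial>?M) + ennreal a * (\<integral>\<^sup>+ b. ennreal (gauss_dens d b) * ennreal (t b) \<partial>?M)"
    by (subst nn_integral_add) (auto simp: nn_integral_cmult)
  also have "(\<integral>\<^sup>+ b. ennreal (gauss_dens d b) * ennreal (t b) \<partial>?M) = (\<integral>\<^sup>+ b. ennreal (t b) \<partial>std_gaussian d)"
    by (rule nn_integral_std_gaussian[symmetric]) measurable
  also have "\<dots> = (\<integral>\<^sup>+ b. ennreal e * ennreal (norm_vec d b) + ennreal (e\<^sup>2 / 2) \<partial>std_gaussian d)"
    using e(1) by (intro nn_integral_cong) (simp add: t_def ennreal_plus[symmetric] ennreal_mult'[symmetric] del: ennreal_plus)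
  also have "\<dots> = ennreal e * (\<integral>\<^sup>+ b. ennreal (norm_vec d b) \<partial>std_gaussian d) + ennreal (e\<^sup>2 / 2)"
    by (subst nn_integral_add) (auto simp: nn_integral_cmult)
  finally have "(\<integral>\<^sup>+ b. F (\<Phi> b) \<partial>std_gaussian d) \<le> (\<integral>\<^sup>+ b. F (\<Phi> b) * ennreal (gauss_dens d (\<Phi> b)) \<partial>?M)
     + ennreal a * (ennreal e * (\<integral>\<^sup>+ b. ennreal (norm_vec d b) \<partial>std_gaussian d) + ennreal (e\<^sup>2 / 2))" .
  also have "\<dots> \<le> ennreal (\<l> ^ d) * (\<integral>\<^sup>+ b. F b \<partial>std_gaussian d)
     + ennreal a * (ennreal e * ennreal (sqrt d) + ennreal (e\<^sup>2 / 2))"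
    by (intro add_mono mult_left_mono std_gaussian_norm_le[OF d] Lipschitz_preimage_integral[OF \<Phi> \<Psi> l key F]) auto
  also have "ennreal a * (ennreal e * ennreal (sqrt d) + ennreal (e\<^sup>2 / 2)) = ennreal (a * (e * sqrt d + e\<^sup>2 / 2))"
    using e(1) a(1) by (simp add: ennreal_mult'[symmetric] ennreal_plus[symmetric] del: ennreal_plus)
  finally show ?thesis .
qed

section \<open>The transition operator and its invariant measure\<close>

lemma measurable_phase_Pair:
  assumes "f \<in> M \<rightarrow>\<^sub>M lebesgue_Rd d" "g \<in> M \<rightarrow>\<^sub>M lebesgue_Rd d"
  shows "(\<lambda>\<omega>. (f \<omega>, g \<omega>)) \<in> M \<rightarrow>\<^sub>M phase_space d"
  unfolding phase_space_def using assms by measurable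

lemma measurable_phase_fst [measurable (raw)]:
  "f \<in> M \<rightarrow>\<^sub>M phase_space d \<Longrightarrow> (\<lambda>\<omega>. fst (f \<omega>)) \<in> M \<rightarrow>\<^sub>M lebesgue_Rd d"
  unfolding phase_space_def by measurable

lemma measurable_phase_snd [measurable (raw)]:
  "f \<in> M \<rightarrow>\<^sub>M phase_space d \<Longrightarrow> (\<lambda>\<omega>. snd (f \<omega>)) \<in> M \<rightarrow>\<^sub>M lebesgue_Rd d"
  unfolding phase_space_def by measurable

lemma nn_integral_phase:
  assumes "f \<in> borel_measurable (phase_space d)"
  shows "(\<integral>\<^sup>+ z. f z \<partial>phase_space d) = (\<integral>\<^sup>+ x. \<integral>\<^sup>+ v. f (x, v) \<partial>lebesgue_Rd d \<partial>lebesgue_Rd d)"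
proof -
  interpret M: sigma_finite_measure "lebesgue_Rd d" by (rule sigma_finite_lebesgue_Rd)
  show ?thesis using assms unfolding phase_space_def by (simp add: M.nn_integral_fst)
qed

lemma nn_integral_phase_swap:
  assumes "f \<in> borel_measurable (phase_space d)"
  shows "(\<integral>\<^sup>+ z. f z \<partial>phase_space d) = (\<integral>\<^sup>+ v. \<integral>\<^sup>+ x. f (x, v) \<partial>lebesgue_Rd d \<partial>lebesgue_Rd d)"
proof -
  interpret M: sigma_finite_measure "lebesgue_Rd d" by (rule sigma_finite_lebesgue_Rd)
  interpret P: pair_sigma_finite "lebesgue_Rd d" "lebesgue_Rd d" by (simp add: pair_sigma_finite_def M.sigma_finite_measure_axioms)
  show ?thesis using assms unfolding phase_space_def by (simp add: P.nn_integral_snd)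
qed

text \<open>Invariance of Lebesgue measure in integral form. It composes by substitution, and for
  the shears of the Verlet scheme it follows from Fubini and translation invariance, without a
  Jacobian.\<close>

definition volume_preserving :: "nat \<Rightarrow> (phase \<Rightarrow> phase) \<Rightarrow> bool" where
  "volume_preserving d T \<longleftrightarrow> T \<in> phase_space d \<rightarrow>\<^sub>M phase_space d \<and>
     (\<forall>f\<in>borel_measurable (phase_space d). (\<integral>\<^sup>+ z. f (T z) \<partial>phase_space d) = (\<integral>\<^sup>+ z. f z \<partial>phase_space d))"

lemma volume_preserving_comp:
  assumes S: "volume_preserving d S" and T: "volume_preserving d T"
  shows "volume_preserving d (S \<circ> T)"
proof -
  have [measurable]: "S \<in> phase_space d \<rightarrow>\<^sub>M phase_space d" "T \<in> phase_space d \<rightarrow>\<^sub>M phase_space d"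
    using S T by (auto simp: volume_preserving_def)
  show ?thesis unfolding volume_preserving_def
  proof (intro conjI ballI)
    fix f :: "phase \<Rightarrow> ennreal" assume f [measurable]: "f \<in> borel_measurable (phase_space d)"
    have "(\<integral>\<^sup>+ z. f (S (T z)) \<partial>phase_space d) = (\<integral>\<^sup>+ z. f (S z) \<partial>phase_space d)"
      using T unfolding volume_preserving_def by (elim conjE bspec[of _ _ "\<lambda>z. f (S z)"]) measurable
    also have "\<dots> = (\<integral>\<^sup>+ z. f z \<partial>phase_space d)"
      using S f unfolding volume_preserving_def by blast
    finally show "(\<integral>\<^sup>+ z. f ((S \<circ> T) z) \<partial>phase_space d) = (\<integral>\<^sup>+ z. f z \<partial>phase_space d)" by simp
  qed (unfold comp_def, measurable)
qed

lemma nn_integral_phase_gauss: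
  assumes "a > 0" "b > 0"
  shows "(\<integral>\<^sup>+ z. ennreal (exp (- a * (norm_vec d (fst z))\<^sup>2 / 2 - b * (norm_vec d (snd z))\<^sup>2 / 2)) \<partial>phase_space d)
     = ennreal (sqrt (2 * pi / a) ^ d * sqrt (2 * pi / b) ^ d)"
proof -
  have "(\<integral>\<^sup>+ z. ennreal (exp (- a * (norm_vec d (fst z))\<^sup>2 / 2 - b * (norm_vec d (snd z))\<^sup>2 / 2)) \<partial>phase_space d)
     = (\<integral>\<^sup>+ x. \<integral>\<^sup>+ v. ennreal (exp (- a * (norm_vec d x)\<^sup>2 / 2)) * ennreal (exp (- b * (norm_vec d v)\<^sup>2 / 2)) \<partial>lebesgue_Rd d \<partial>lebesgue_Rd d)"
    by (subst nn_integral_phase) (auto intro!: nn_integral_cong simp: ennreal_mult'[symmetric] exp_add[symmetric])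
  also have "\<dots> = (\<integral>\<^sup>+ x. ennreal (exp (- a * (norm_vec d x)\<^sup>2 / 2)) * ennreal (sqrt (2 * pi / b) ^ d) \<partial>lebesgue_Rd d)"
    using nn_integral_gauss_unnormalised[OF assms(2), of d]
    by (intro nn_integral_cong) (subst nn_integral_cmult, auto)
  also have "\<dots> = ennreal (sqrt (2 * pi / a) ^ d) * ennreal (sqrt (2 * pi / b) ^ d)"
    using nn_integral_gauss_unnormalised[OF assms(1), of d] by (subst nn_integral_multc) auto
  finally show ?thesis using assms by (simp add: ennreal_mult')
qed

section \<open>Hamiltonian, normalising constant and target\<close>

context potential begin

lemma U_measurable [measurable]: "U \<in> borel_measurable (lebesgue_Rd d)"
  using C3 by (intro continuous_on_Rd_measurable) simp

lemma D_measurable: "i < d \<Longrightarrow> D i \<in> borel_measurable (lebesgue_Rd d)"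
  using C3 by (intro continuous_on_Rd_measurable) simp

lemma D_measurable' [measurable (raw)]:
  "f \<in> M \<rightarrow>\<^sub>M lebesgue_Rd d \<Longrightarrow> i < d \<Longrightarrow> (\<lambda>\<omega>. D i (f \<omega>)) \<in> borel_measurable M"
  using measurable_compose[OF _ D_measurable] .

abbreviation H :: "phase \<Rightarrow> real" where "H \<equiv> hamiltonian d U"

lemma H_eq: "H z = (norm_vec d (snd z))\<^sup>2 / 2 + U (fst z)"
  by (cases z) (simp add: hamiltonian_def)

lemma H_measurable [measurable]: "H \<in> borel_measurable (phase_space d)"
  unfolding H_eq[abs_def] by measurable

lemma H_nonneg: "z \<in> space (phase_space d) \<Longrightarrow> H z \<ge> 0"
  by (auto simp: H_eq intro!: add_nonneg_nonneg U_nonneg)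

lemma H_upper: "z \<in> space (phase_space d) \<Longrightarrow> H z \<le> L * (norm_vec d (fst z))\<^sup>2 / 2 + 1 * (norm_vec d (snd z))\<^sup>2 / 2"
  using U_upper[of "fst z"] by (auto simp: H_eq norm_vec_power2)

lemma H_lower: "z \<in> space (phase_space d) \<Longrightarrow> K * (norm_vec d (fst z))\<^sup>2 / 2 + 1 * (norm_vec d (snd z))\<^sup>2 / 2 \<le> H z"
  using U_lower[of "fst z"] by (auto simp: H_eq norm_vec_power2)

definition Z :: real where "Z = (\<integral>w. exp (- H w) \<partial>phase_space d)"

lemma nn_integral_exp_H_upper:
  assumes c: "c > 0"
  shows "(\<integral>\<^sup>+ z. ennreal (exp (- c * H z)) \<partial>phase_space d) \<le> ennreal (sqrt (2 * pi / (c * K)) ^ d * sqrt (2 * pi / c) ^ d)"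
proof -
  have "(\<integral>\<^sup>+ z. ennreal (exp (- c * H z)) \<partial>phase_space d) \<le>
     (\<integral>\<^sup>+ z. ennreal (exp (- (c * K) * (norm_vec d (fst z))\<^sup>2 / 2 - c * (norm_vec d (snd z))\<^sup>2 / 2)) \<partial>phase_space d)"
  proof (rule nn_integral_mono)
    fix z assume z: "z \<in> space (phase_space d)"
    have "c * (K * (norm_vec d (fst z))\<^sup>2 / 2 + 1 * (norm_vec d (snd z))\<^sup>2 / 2) \<le> c * H z"
      using c by (intro mult_left_mono H_lower z) simp
    then show "ennreal (exp (- c * H z)) \<le> ennreal (exp (- (c * K) * (norm_vec d (fst z))\<^sup>2 / 2 - c * (norm_vec d (snd z))\<^sup>2 / 2))"
      by (intro ennreal_leI) (simp add: algebra_simps)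
  qed
  also have "\<dots> = ennreal (sqrt (2 * pi / (c * K)) ^ d * sqrt (2 * pi / c) ^ d)"
    using c K_pos by (intro nn_integral_phase_gauss) auto
  finally show ?thesis .
qed

lemma nn_integral_exp_H_lower:
  "ennreal (sqrt (2 * pi / L) ^ d * sqrt (2 * pi) ^ d) \<le> (\<integral>\<^sup>+ z. ennreal (exp (- H z)) \<partial>phase_space d)"
proof -
  have "ennreal (sqrt (2 * pi / L) ^ d * sqrt (2 * pi / 1) ^ d) =
     (\<integral>\<^sup>+ z. ennreal (exp (- L * (norm_vec d (fst z))\<^sup>2 / 2 - 1 * (norm_vec d (snd z))\<^sup>2 / 2)) \<partial>phase_space d)"
    using L_pos by (intro nn_integral_phase_gauss[symmetric]) auto
  also have "\<dots> \<le> (\<integral>\<^sup>+ z. ennreal (exp (- H z)) \<partial>phase_space d)"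
    by (intro nn_integral_mono ennreal_leI) (use H_upper in fastforce)
  finally show ?thesis by simp
qed

lemma integrable_exp_H: "integrable (phase_space d) (\<lambda>w. exp (- H w))"
proof (rule integrableI_nonneg)
  have "(\<integral>\<^sup>+ z. ennreal (exp (- H z)) \<partial>phase_space d) \<le> ennreal (sqrt (2 * pi / (1 * K)) ^ d * sqrt (2 * pi / 1) ^ d)"
    using nn_integral_exp_H_upper[of 1] by simp
  also have "\<dots> < \<infinity>" by simp
  finally show "(\<integral>\<^sup>+ z. ennreal (exp (- H z)) \<partial>phase_space d) < \<infinity>" .
qed auto

lemma Z_eq: "ennreal Z = (\<integral>\<^sup>+ z. ennreal (exp (- H z)) \<partial>phase_space d)"
  unfolding Z_def by (rule nn_integral_eq_integral[symmetric]) (auto intro: integrable_exp_H)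

lemma Z_lower: "sqrt (2 * pi / L) ^ d * sqrt (2 * pi) ^ d \<le> Z"
proof -
  have "0 \<le> Z" unfolding Z_def by (rule integral_nonneg_AE) auto
  then show ?thesis using nn_integral_exp_H_lower unfolding Z_eq[symmetric] by simp
qed

lemma Z_pos: "Z > 0"
proof -
  have "0 < sqrt (2 * pi / L) ^ d * sqrt (2 * pi) ^ d" using L_pos by simp
  then show ?thesis using Z_lower by linarith
qed

lemma sets_target [simp, measurable_cong]: "sets (target d U) = sets (phase_space d)"
  by (simp add: target_def)

lemma space_target [simp]: "space (target d U) = Rd d \<times> Rd d"
  by (simp add: target_def)

lemma nn_integral_target:
  assumes [measurable]: "f \<in> borel_measurable (phase_space d)"
  shows "(\<integral>\<^sup>+ z. f z \<partial>target d U) = ennreal (1 / Z) * (\<integral>\<^sup>+ z. ennreal (exp (- H z)) * f z \<partial>phase_space d)"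
proof -
  have "(\<integral>\<^sup>+ z. f z \<partial>target d U) = (\<integral>\<^sup>+ z. ennreal (exp (- H z) / Z) * f z \<partial>phase_space d)"
    unfolding target_def Z_def[symmetric] by (subst nn_integral_density) auto
  also have "\<dots> = (\<integral>\<^sup>+ z. ennreal (1 / Z) * (ennreal (exp (- H z)) * f z) \<partial>phase_space d)"
    using Z_pos by (intro nn_integral_cong) (simp add: mult.assoc[symmetric] ennreal_mult'[symmetric])
  finally show ?thesis by (simp add: nn_integral_cmult)
qed

lemma prob_space_target: "prob_space (target d U)"
proof
  have "emeasure (target d U) (space (target d U)) = (\<integral>\<^sup>+ z. 1 \<partial>target d U)" by simp
  also have "\<dots> = ennreal (1 / Z) * (\<integral>\<^sup>+ z. ennreal (exp (- H z)) * 1 \<partial>phase_space d)"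
    by (rule nn_integral_target) simp
  also have "\<dots> = ennreal (1 / Z) * ennreal Z" by (simp add: Z_eq)
  also have "\<dots> = 1" using Z_pos by (simp add: ennreal_mult'[symmetric])
  finally show "emeasure (target d U) (space (target d U)) = 1" .
qed

text \<open>The weight becomes exp (- 7 H / 8) and is compared with Gaussians: strong convexity
  bounds its integral above, smoothness bounds Z below, and the quotient is (8 / 7 sqrt
  \<kappa>)^d.\<close>

lemma target_exp_moment:
  "(\<integral>\<^sup>+ z. ennreal (exp (H z / 8)) \<partial>target d U) \<le> ennreal ((8 / 7 * sqrt (L / K)) ^ d)"
proof -
  have "(\<integral>\<^sup>+ z. ennreal (exp (H z / 8)) \<partial>target d U)
     = ennreal (1 / Z) * (\<integral>\<^sup>+ z. ennreal (exp (- H z)) * ennreal (exp (H z / 8)) \<partial>phase_space d)"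
    by (rule nn_integral_target) measurable
  also have "(\<integral>\<^sup>+ z. ennreal (exp (- H z)) * ennreal (exp (H z / 8)) \<partial>phase_space d)
     = (\<integral>\<^sup>+ z. ennreal (exp (- (7 / 8) * H z)) \<partial>phase_space d)"
    by (simp add: ennreal_mult'[symmetric] exp_add[symmetric])
  also have "ennreal (1 / Z) * \<dots> \<le> ennreal (1 / (sqrt (2 * pi / L) ^ d * sqrt (2 * pi) ^ d))
      * ennreal (sqrt (2 * pi / (7 / 8 * K)) ^ d * sqrt (2 * pi / (7 / 8)) ^ d)"
    using L_pos Z_lower Z_pos
    by (intro mult_mono ennreal_leI divide_left_mono nn_integral_exp_H_upper) auto
  also have "\<dots> = ennreal ((8 / 7 * sqrt (L / K)) ^ d)"
  proof -
    have "1 / (sqrt (2 * pi / L) ^ d * sqrt (2 * pi) ^ d) * (sqrt (2 * pi / (7 / 8 * K)) ^ d * sqrt (2 * pi / (7 / 8)) ^ d)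
      = (sqrt (2 * pi / (7 / 8 * K)) * sqrt (2 * pi / (7 / 8)) / (sqrt (2 * pi / L) * sqrt (2 * pi))) ^ d"
      by (simp add: power_mult_distrib power_divide)
    also have "sqrt (2 * pi / (7 / 8 * K)) * sqrt (2 * pi / (7 / 8)) / (sqrt (2 * pi / L) * sqrt (2 * pi)) = 8 / 7 * sqrt (L / K)"
    proof -
      have "sqrt (2 * pi / (7 / 8 * K)) * sqrt (2 * pi / (7 / 8)) / (sqrt (2 * pi / L) * sqrt (2 * pi))
        = sqrt ((8 / 7)\<^sup>2 * (L / K))"
        unfolding real_sqrt_mult[symmetric] real_sqrt_divide[symmetric]
        using K_pos L_pos by (intro arg_cong[where f = sqrt]) (simp add: field_simps power2_eq_square)
      then show ?thesis by (simp only: real_sqrt_mult real_sqrt_abs)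
    qed
    finally show ?thesis using L_pos by (simp add: ennreal_mult'[symmetric])
  qed
  finally show ?thesis .
qed

end

text \<open>The bound on \<gamma> h is sharper than the one in A.4; \<open>mixing_core\<close>
  derives it from the restriction on the step size.\<close>

locale makla = potential +
  fixes \<gamma> h :: real
  assumes \<gamma>_pos: "\<gamma> > 0" and h_pos: "h > 0" and \<gamma>_large: "10 * sqrt L \<le> \<gamma>" and \<gamma>h: "\<gamma> * h \<le> 1 / 10"
begin

definition \<eta> :: real where "\<eta> = exp (- \<gamma> * (h / 2))"
definition \<sigma> :: real where "\<sigma> = sqrt (1 - exp (- 2 * \<gamma> * (h / 2)))"

lemma \<eta>_pos: "\<eta> > 0" by (simp add: \<eta>_def)
lemma \<sigma>_pos: "\<sigma> > 0" using \<gamma>_pos h_pos by (simp add: \<sigma>_def)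
lemma \<eta>2: "\<eta>\<^sup>2 = exp (- (\<gamma> * h))" by (simp add: \<eta>_def power2_eq_square exp_add[symmetric])
lemma \<eta>\<sigma>: "\<eta>\<^sup>2 + \<sigma>\<^sup>2 = 1"
  using \<gamma>_pos h_pos by (simp add: \<eta>2 \<sigma>_def)

abbreviation O1 :: "rvec \<Rightarrow> phase \<Rightarrow> phase" where "O1 \<equiv> O_step d \<gamma> (h / 2)"
abbreviation \<theta> :: "phase \<Rightarrow> phase" where "\<theta> \<equiv> verlet d U h"
abbreviation PS where "PS \<equiv> phase_space d"

lemma O1_eq: "O1 b z = (fst z, \<lambda>i\<in>{..<d}. \<eta> * snd z i + \<sigma> * b i)"
  by (cases z) (simp add: O_step_def \<eta>_def \<sigma>_def)

text \<open>The only point at which a Verlet step evaluates the force.\<close>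

definition mid :: "phase \<Rightarrow> rvec" where "mid z = (\<lambda>i\<in>{..<d}. fst z i + h / 2 * snd z i)"
definition vel :: "phase \<Rightarrow> rvec" where "vel z = (\<lambda>i\<in>{..<d}. snd z i - h * D i (mid z))"

lemma \<theta>_eq: "\<theta> z = (\<lambda>i\<in>{..<d}. mid z i + h / 2 * vel z i, vel z)"
  by (cases z) (auto simp: verlet_def A_step_def B_step_def mid_def vel_def restrict_def)

lemma mid_R [simp]: "mid z \<in> Rd d" and vel_R [simp]: "vel z \<in> Rd d"
  by (simp_all add: mid_def vel_def)

lemma O1_measurable2 [measurable]: "(\<lambda>p. O1 (snd p) (fst p)) \<in> PS \<Otimes>\<^sub>M std_gaussian d \<rightarrow>\<^sub>M PS"
  unfolding O1_eq by (intro measurable_phase_Pair measurable_Rd_restrict) measurable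

lemma O1_measurable [measurable (raw)]:
  assumes [measurable]: "f \<in> M \<rightarrow>\<^sub>M std_gaussian d" "g \<in> M \<rightarrow>\<^sub>M PS"
  shows "(\<lambda>\<omega>. O1 (f \<omega>) (g \<omega>)) \<in> M \<rightarrow>\<^sub>M PS"
  using measurable_compose[OF _ O1_measurable2, of "\<lambda>\<omega>. (g \<omega>, f \<omega>)" M] by simp

section \<open>Volume preservation and reversibility of the Verlet map\<close>

lemma A_step_vol: "volume_preserving d (A_step d s)"
proof -
  have eq: "A_step d s z = (\<lambda>i\<in>{..<d}. fst z i + s * snd z i, snd z)" for z
    by (cases z) (simp add: A_step_def)
  have [measurable]: "A_step d s \<in> PS \<rightarrow>\<^sub>M PS"
    unfolding eq[abs_def] by (intro measurable_phase_Pair measurable_Rd_restrict) measurable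
  show ?thesis unfolding volume_preserving_def
  proof (intro conjI ballI)
    fix f :: "phase \<Rightarrow> ennreal" assume f [measurable]: "f \<in> borel_measurable PS"
    have fm: "(\<lambda>x. f (x, v)) \<in> borel_measurable (lebesgue_Rd d)" if "v \<in> Rd d" for v
      using that by (intro measurable_compose[OF measurable_phase_Pair f]) auto
    have "(\<integral>\<^sup>+ z. f (A_step d s z) \<partial>PS) = (\<integral>\<^sup>+ v. \<integral>\<^sup>+ x. f (\<lambda>i\<in>{..<d}. x i + s * v i, v) \<partial>lebesgue_Rd d \<partial>lebesgue_Rd d)"
      by (subst nn_integral_phase_swap, measurable) (simp add: eq)
    also have "\<dots> = (\<integral>\<^sup>+ v. \<integral>\<^sup>+ x. f (x, v) \<partial>lebesgue_Rd d \<partial>lebesgue_Rd d)"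
      by (intro nn_integral_cong nn_integral_Rd_translate[of "\<lambda>x. f (x, _)"] fm) simp
    finally show "(\<integral>\<^sup>+ z. f (A_step d s z) \<partial>PS) = (\<integral>\<^sup>+ z. f z \<partial>PS)"
      by (subst (2) nn_integral_phase_swap) auto
  qed measurable
qed

lemma B_step_vol: "volume_preserving d (B_step d U s)"
proof -
  have eq: "B_step d U s z = (fst z, \<lambda>i\<in>{..<d}. snd z i + - (s * D i (fst z)))" for z
    by (cases z) (auto simp: B_step_def restrict_def)
  have [measurable]: "B_step d U s \<in> PS \<rightarrow>\<^sub>M PS"
    unfolding eq[abs_def] by (intro measurable_phase_Pair measurable_Rd_restrict) measurable
  show ?thesis unfolding volume_preserving_def
  proof (intro conjI ballI)
    fix f :: "phase \<Rightarrow> ennreal" assume f [measurable]: "f \<in> borel_measurable PS"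
    have fm: "(\<lambda>v. f (x, v)) \<in> borel_measurable (lebesgue_Rd d)" if "x \<in> Rd d" for x
      using that by (intro measurable_compose[OF measurable_phase_Pair f]) auto
    have "(\<integral>\<^sup>+ z. f (B_step d U s z) \<partial>PS) = (\<integral>\<^sup>+ x. \<integral>\<^sup>+ v. f (x, \<lambda>i\<in>{..<d}. v i + - (s * D i x)) \<partial>lebesgue_Rd d \<partial>lebesgue_Rd d)"
      by (subst nn_integral_phase, measurable) (simp add: eq)
    also have "\<dots> = (\<integral>\<^sup>+ x. \<integral>\<^sup>+ v. f (x, v) \<partial>lebesgue_Rd d \<partial>lebesgue_Rd d)"
      by (intro nn_integral_cong nn_integral_Rd_translate[of "\<lambda>v. f (_, v)"] fm) simp
    finally show "(\<integral>\<^sup>+ z. f (B_step d U s z) \<partial>PS) = (\<integral>\<^sup>+ z. f z \<partial>PS)"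
      by (subst (2) nn_integral_phase) auto
  qed measurable
qed

lemma flip_vol: "volume_preserving d (flip d)"
proof -
  have eq: "flip d z = (fst z, \<lambda>i\<in>{..<d}. - snd z i)" for z
    by (cases z) (simp add: flip_def)
  have [measurable]: "flip d \<in> PS \<rightarrow>\<^sub>M PS"
    unfolding eq[abs_def] by (intro measurable_phase_Pair measurable_Rd_restrict) measurable
  show ?thesis unfolding volume_preserving_def
  proof (intro conjI ballI)
    fix f :: "phase \<Rightarrow> ennreal" assume f [measurable]: "f \<in> borel_measurable PS"
    have fm: "(\<lambda>v. f (x, v)) \<in> borel_measurable (lebesgue_Rd d)" if "x \<in> Rd d" for x
      using that by (intro measurable_compose[OF measurable_phase_Pair f]) auto
    have "(\<integral>\<^sup>+ z. f (flip d z) \<partial>PS) = (\<integral>\<^sup>+ x. \<integral>\<^sup>+ v. f (x, \<lambda>i\<in>{..<d}. - v i) \<partial>lebesgue_Rd d \<partial>lebesgue_Rd d)"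
      by (subst nn_integral_phase, measurable) (simp add: eq)
    also have "\<dots> = (\<integral>\<^sup>+ x. \<integral>\<^sup>+ v. f (x, v) \<partial>lebesgue_Rd d \<partial>lebesgue_Rd d)"
      by (intro nn_integral_cong nn_integral_Rd_uminus[of "\<lambda>v. f (_, v)"] fm) simp
    finally show "(\<integral>\<^sup>+ z. f (flip d z) \<partial>PS) = (\<integral>\<^sup>+ z. f z \<partial>PS)"
      by (subst (2) nn_integral_phase) auto
  qed measurable
qed

lemma \<theta>_vol: "volume_preserving d \<theta>"
  unfolding verlet_def by (intro volume_preserving_comp A_step_vol B_step_vol)

lemma \<theta>_measurable [measurable]: "\<theta> \<in> PS \<rightarrow>\<^sub>M PS"
  using \<theta>_vol by (simp add: volume_preserving_def)

lemma flip_measurable [measurable]: "flip d \<in> PS \<rightarrow>\<^sub>M PS"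
  using flip_vol by (simp add: volume_preserving_def)

lemma O1_space: "z \<in> space PS \<Longrightarrow> O1 b z \<in> space PS"
  by (simp add: O1_eq mem_Times_iff)

lemma \<theta>_space: "\<theta> z \<in> space PS"
  by (simp add: \<theta>_eq)

lemma flip_eq: "flip d z = (fst z, \<lambda>i\<in>{..<d}. - snd z i)"
  by (cases z) (simp add: flip_def)

lemma flip_space: "z \<in> space PS \<Longrightarrow> flip d z \<in> space PS"
  by (simp add: flip_eq mem_Times_iff)

lemma H_flip: "H (flip d z) = H z"
  by (simp add: flip_eq H_eq norm_vec_power2)

text \<open>From the flipped end point the position half-step runs back to the same midpoint, so the
  same force is met and the kick is undone.\<close>

lemma \<theta>_reversible:
  assumes z: "z \<in> space PS"
  shows "\<theta> (flip d (\<theta> z)) = flip d z"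
proof -
  have m: "mid (flip d (\<theta> z)) = mid z"
    by (rule Rd_eqI[of _ d]) (simp_all add: flip_eq \<theta>_eq mid_def[of "flip d _"] mid_def[of "(_, _)"])
  have v: "vel (flip d (\<theta> z)) = (\<lambda>i\<in>{..<d}. - snd z i)"
    unfolding vel_def[of "flip d (\<theta> z)"] m
    by (rule Rd_eqI[of _ d]) (simp_all add: flip_eq \<theta>_eq vel_def)
  show ?thesis
    unfolding \<theta>_eq[of "flip d (\<theta> z)"] m v flip_eq[of z]
    using z by (auto simp: mem_Times_iff mid_def intro!: Rd_eqI[of _ d])
qed

definition acc :: "phase \<Rightarrow> real" where "acc z = exp (- max 0 (H (\<theta> z) - H z))"

lemma acc_measurable [measurable]: "acc \<in> borel_measurable PS"
  unfolding acc_def[abs_def] by measurable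

lemma acc_bounds: "0 < acc z" "acc z \<le> 1" by (auto simp: acc_def)

text \<open>A step is described by its action on functions rather than on measures. Values in
  \<open>ennreal\<close> make every integral meaningful, so measurability is the only side
  condition. \<open>Oop\<close> averages over the noise of a refreshment, \<open>Mop\<close> over
  the uniform variable.\<close>

definition Oop :: "(phase \<Rightarrow> ennreal) \<Rightarrow> phase \<Rightarrow> ennreal" where
  "Oop f z = (\<integral>\<^sup>+ b. f (O1 b z) \<partial>std_gaussian d)"
definition Mop :: "(phase \<Rightarrow> ennreal) \<Rightarrow> phase \<Rightarrow> ennreal" where
  "Mop f z = ennreal (acc z) * f (\<theta> z) + ennreal (1 - acc z) * f (flip d z)"
definition Kop :: "(phase \<Rightarrow> ennreal) \<Rightarrow> phase \<Rightarrow> ennreal" where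
  "Kop f = Oop (Mop (Oop f))"
text \<open>Every proposal is accepted here: the unadjusted chain.\<close>

definition Top :: "(phase \<Rightarrow> ennreal) \<Rightarrow> phase \<Rightarrow> ennreal" where
  "Top f = Oop (\<lambda>z. Oop f (\<theta> z))"

lemma Oop_measurable [measurable]:
  assumes [measurable]: "f \<in> borel_measurable PS"
  shows "Oop f \<in> borel_measurable PS"
proof -
  interpret G: prob_space "std_gaussian d" by (rule prob_space_std_gaussian)
  show ?thesis unfolding Oop_def[abs_def] by measurable
qed

lemma Mop_measurable [measurable]:
  assumes [measurable]: "f \<in> borel_measurable PS"
  shows "Mop f \<in> borel_measurable PS"
  unfolding Mop_def[abs_def] by measurable

lemma Kop_measurable [measurable]:
  assumes [measurable]: "f \<in> borel_measurable PS"
  shows "Kop f \<in> borel_measurable PS"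
  unfolding Kop_def by measurable

lemma Top_measurable [measurable]:
  assumes [measurable]: "f \<in> borel_measurable PS"
  shows "Top f \<in> borel_measurable PS"
  unfolding Top_def by measurable

lemma adjusted_eq: "adjusted_verlet d U h u z = (if u \<le> acc z then \<theta> z else flip d z)"
  by (simp add: adjusted_verlet_def acc_def)

lemma adjusted_measurable:
  "(\<lambda>p. adjusted_verlet d U h (fst p) (snd p)) \<in> borel \<Otimes>\<^sub>M PS \<rightarrow>\<^sub>M PS"
  unfolding adjusted_eq by (intro measurable_If) measurable

lemma Mop_uniform:
  "(\<integral>\<^sup>+ u. f (adjusted_verlet d U h u z) \<partial>uniform_measure lborel {0<..<1}) = Mop f z"
proof -
  let ?a = "acc z"
  have "(\<integral>\<^sup>+ u. f (adjusted_verlet d U h u z) \<partial>uniform_measure lborel {0<..<1})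
     = (\<integral>\<^sup>+ u. f (adjusted_verlet d U h u z) * indicator {0<..<1} u \<partial>lborel)"
    by (subst nn_integral_uniform_measure) (auto simp: adjusted_eq divide_ennreal_def)
  also have "\<dots> = (\<integral>\<^sup>+ u. f (\<theta> z) * indicator ({0<..<1} \<inter> {..?a}) u + f (flip d z) * indicator ({0<..<1} \<inter> {?a<..}) u \<partial>lborel)"
    by (intro nn_integral_cong) (auto simp: adjusted_eq indicator_def)
  also have "\<dots> = f (\<theta> z) * emeasure lborel ({0<..<1} \<inter> {..?a}) + f (flip d z) * emeasure lborel ({0<..<1} \<inter> {?a<..})"
    by (subst nn_integral_add) (auto simp: nn_integral_cmult)
  also have "emeasure lborel ({0<..<1} \<inter> {..?a}) = ennreal ?a"
  proof (cases "?a = 1")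
    case True
    then have "{0<..<1} \<inter> {..?a} = {0<..<1}" by auto
    then show ?thesis using True by simp
  next
    case False
    then have "{0<..<1} \<inter> {..?a} = {0<..?a}" using acc_bounds[of z] by auto
    then show ?thesis using acc_bounds[of z] by simp
  qed
  also have "{0<..<1} \<inter> {?a<..} = {?a<..<1}" using acc_bounds[of z] by auto
  also have "emeasure lborel {?a<..<1} = ennreal (1 - ?a)" using acc_bounds[of z] by simp
  finally show ?thesis by (simp add: Mop_def mult.commute)
qed

lemma prob_space_uniform: "prob_space (uniform_measure lborel {0<..<1::real})"
  by (rule prob_space_uniform_measure) auto

abbreviation noise where
  "noise \<equiv> std_gaussian d \<Otimes>\<^sub>M (uniform_measure lborel {0<..<1::real} \<Otimes>\<^sub>M std_gaussian d)"

lemma prob_space_noise: "prob_space noise"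
  by (intro prob_space_pair prob_space_std_gaussian prob_space_uniform)

lemma step_measurable: 
  "(\<lambda>p. O1 (snd (snd (snd p))) (adjusted_verlet d U h (fst (snd (snd p))) (O1 (fst (snd p)) (fst p)))) \<in> PS \<Otimes>\<^sub>M noise \<rightarrow>\<^sub>M PS"
proof -
  have [measurable]: "(\<lambda>p. adjusted_verlet d U h (fst (snd (snd p))) (O1 (fst (snd p)) (fst p))) \<in> PS \<Otimes>\<^sub>M noise \<rightarrow>\<^sub>M PS"
    by (rule measurable_compose[OF _ adjusted_measurable, of "\<lambda>p. (fst (snd (snd p)), O1 (fst (snd p)) (fst p))", simplified fst_conv snd_conv])
      measurable
  show ?thesis by measurable
qed

lemma kernel_measurable: "makla_kernel d U \<gamma> h \<in> PS \<rightarrow>\<^sub>M prob_algebra PS"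
  unfolding makla_kernel_def[abs_def]
proof (rule measurable_distr_prob_space2)
  show "(\<lambda>x. noise) \<in> PS \<rightarrow>\<^sub>M prob_algebra noise"
    by (rule measurable_const) (simp add: space_prob_algebra prob_space_noise)
  show "(\<lambda>(z, \<xi>\<^sub>1, u, \<xi>\<^sub>2). (O1 \<xi>\<^sub>2 \<circ> adjusted_verlet d U h u \<circ> O1 \<xi>\<^sub>1) z) \<in> PS \<Otimes>\<^sub>M noise \<rightarrow>\<^sub>M PS"
    using step_measurable by (simp add: case_prod_beta comp_def)
qed

lemma nn_integral_kernel:
  assumes f [measurable]: "f \<in> borel_measurable PS" and z: "z \<in> space PS"
  shows "(\<integral>\<^sup>+ w. f w \<partial>makla_kernel d U \<gamma> h z) = Kop f z"
proof -
  interpret G: prob_space "std_gaussian d" by (rule prob_space_std_gaussian)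
  interpret V: prob_space "uniform_measure lborel {0<..<1::real}" by (rule prob_space_uniform)
  interpret VG: prob_space "uniform_measure lborel {0<..<1::real} \<Otimes>\<^sub>M std_gaussian d"
    by (intro prob_space_pair prob_space_std_gaussian prob_space_uniform)
  let ?S = "\<lambda>p. O1 (snd (snd p)) (adjusted_verlet d U h (fst (snd p)) (O1 (fst p) z))"
  have S [measurable]: "?S \<in> noise \<rightarrow>\<^sub>M PS"
    using measurable_compose[OF measurable_Pair1'[OF z] step_measurable] by simp
  have S2: "(\<lambda>p. f (O1 (snd p) (adjusted_verlet d U h (fst p) y))) \<in> borel_measurable (uniform_measure lborel {0<..<1::real} \<Otimes>\<^sub>M std_gaussian d)"
    if y: "y \<in> space PS" for y
  proof -
    have [measurable]: "(\<lambda>p. adjusted_verlet d U h (fst p) y) \<in> uniform_measure lborel {0<..<1::real} \<Otimes>\<^sub>M std_gaussian d \<rightarrow>\<^sub>M PS"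
      by (rule measurable_compose[OF _ adjusted_measurable, of "\<lambda>p. (fst p, y)", simplified fst_conv snd_conv]) (use y in measurable)
    show ?thesis by measurable
  qed
  have "(\<integral>\<^sup>+ w. f w \<partial>makla_kernel d U \<gamma> h z) = (\<integral>\<^sup>+ p. f (?S p) \<partial>noise)"
    unfolding makla_kernel_def by (subst nn_integral_distr) (auto simp: case_prod_beta comp_def S)
  also have "\<dots> = (\<integral>\<^sup>+ b. \<integral>\<^sup>+ q. f (?S (b, q)) \<partial>(uniform_measure lborel {0<..<1::real} \<Otimes>\<^sub>M std_gaussian d) \<partial>std_gaussian d)"
    by (rule VG.nn_integral_fst[symmetric]) measurable
  also have "\<dots> = (\<integral>\<^sup>+ b. Mop (Oop f) (O1 b z) \<partial>std_gaussian d)"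
  proof (rule nn_integral_cong)
    fix b
    have "(\<integral>\<^sup>+ q. f (?S (b, q)) \<partial>(uniform_measure lborel {0<..<1::real} \<Otimes>\<^sub>M std_gaussian d))
       = (\<integral>\<^sup>+ u. \<integral>\<^sup>+ b'. f (?S (b, (u, b'))) \<partial>std_gaussian d \<partial>uniform_measure lborel {0<..<1::real})"
      using G.nn_integral_fst[OF S2[OF O1_space[OF z, of b]]] by simp
    also have "\<dots> = Mop (Oop f) (O1 b z)"
      by (simp add: Mop_uniform[symmetric] Oop_def)
    finally show "(\<integral>\<^sup>+ q. f (?S (b, q)) \<partial>(uniform_measure lborel {0<..<1::real} \<Otimes>\<^sub>M std_gaussian d)) = Mop (Oop f) (O1 b z)" .
  qed
  finally show ?thesis by (simp add: Kop_def Oop_def)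
qed

section \<open>Law of the chain and invariance of the target\<close>

lemma makla_law_Suc: "makla_law d U \<gamma> h \<nu> (Suc n) = makla_law d U \<gamma> h \<nu> n \<bind> makla_kernel d U \<gamma> h"
  by (simp add: makla_law_def)

lemma makla_law_prob_algebra:
  assumes \<nu>: "\<nu> \<in> space (prob_algebra PS)"
  shows "makla_law d U \<gamma> h \<nu> n \<in> space (prob_algebra PS)"
proof (induction n)
  case 0
  then show ?case using \<nu> by (simp add: makla_law_def)
next
  case (Suc n)
  have "prob_space (makla_law d U \<gamma> h \<nu> (Suc n))"
    unfolding makla_law_Suc by (rule prob_space_bind'[OF Suc kernel_measurable])
  moreover have "sets (makla_law d U \<gamma> h \<nu> (Suc n)) = sets PS"
    unfolding makla_law_Suc by (rule sets_bind'[OF Suc kernel_measurable])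
  ultimately show ?case by (simp add: space_prob_algebra)
qed

lemma Kop_pow_measurable [measurable]: "f \<in> borel_measurable PS \<Longrightarrow> (Kop ^^ n) f \<in> borel_measurable PS"
  by (induction n) auto

text \<open>The last step of the chain is the first operator applied to f, so the induction must
  vary f.\<close>

lemma nn_integral_makla_law:
  assumes \<nu>: "\<nu> \<in> space (prob_algebra PS)" and f: "f \<in> borel_measurable PS"
  shows "(\<integral>\<^sup>+ z. f z \<partial>makla_law d U \<gamma> h \<nu> n) = (\<integral>\<^sup>+ z. (Kop ^^ n) f z \<partial>\<nu>)"
  using f
proof (induction n arbitrary: f)
  case 0
  then show ?case by (simp add: makla_law_def)
next
  case (Suc n)
  note [measurable] = Suc.prems
  have law: "sets (makla_law d U \<gamma> h \<nu> n) = sets PS"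
    using makla_law_prob_algebra[OF \<nu>] by (simp add: space_prob_algebra)
  have "makla_kernel d U \<gamma> h \<in> makla_law d U \<gamma> h \<nu> n \<rightarrow>\<^sub>M subprob_algebra PS"
    using measurable_prob_algebraD[OF kernel_measurable] by (simp cong: measurable_cong_sets add: law)
  then have "(\<integral>\<^sup>+ z. f z \<partial>makla_law d U \<gamma> h \<nu> (Suc n))
     = (\<integral>\<^sup>+ z. \<integral>\<^sup>+ w. f w \<partial>makla_kernel d U \<gamma> h z \<partial>makla_law d U \<gamma> h \<nu> n)"
    unfolding makla_law_Suc by (intro nn_integral_bind[of _ PS]) auto
  also have "\<dots> = (\<integral>\<^sup>+ z. Kop f z \<partial>makla_law d U \<gamma> h \<nu> n)"
    using sets_eq_imp_space_eq[OF law] by (intro nn_integral_cong nn_integral_kernel) auto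
  also have "\<dots> = (\<integral>\<^sup>+ z. (Kop ^^ n) (Kop f) z \<partial>\<nu>)" by (rule Suc.IH) measurable
  finally show ?case by (simp add: funpow_swap1)
qed

text \<open>Given the position, the velocity is standard Gaussian under the target, and a
  refreshment rotates it with independent noise.\<close>

lemma Oop_invariant:
  assumes f [measurable]: "f \<in> borel_measurable PS"
  shows "(\<integral>\<^sup>+ z. Oop f z \<partial>target d U) = (\<integral>\<^sup>+ z. f z \<partial>target d U)"
proof -
  have g: "ennreal (exp (- H (x, v))) = ennreal (exp (- U x) * sqrt (2 * pi) ^ d) * ennreal (gauss_dens d v)" for x v
    by (simp add: ennreal_mult'[symmetric] gauss_dens_eq H_eq power_divide exp_add[symmetric])
  have main: "(\<integral>\<^sup>+ z. ennreal (exp (- H z)) * f' z \<partial>PS)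
     = (\<integral>\<^sup>+ x. ennreal (exp (- U x) * sqrt (2 * pi) ^ d) * (\<integral>\<^sup>+ v. f' (x, v) \<partial>std_gaussian d) \<partial>lebesgue_Rd d)"
    if f' [measurable]: "f' \<in> borel_measurable PS" for f'
  proof -
    have "(\<integral>\<^sup>+ z. ennreal (exp (- H z)) * f' z \<partial>PS) = (\<integral>\<^sup>+ x. \<integral>\<^sup>+ v. ennreal (exp (- H (x, v))) * f' (x, v) \<partial>lebesgue_Rd d \<partial>lebesgue_Rd d)"
      by (rule nn_integral_phase) measurable
    also have "\<dots> = (\<integral>\<^sup>+ x. ennreal (exp (- U x) * sqrt (2 * pi) ^ d) * (\<integral>\<^sup>+ v. f' (x, v) \<partial>std_gaussian d) \<partial>lebesgue_Rd d)"
    proof (rule nn_integral_cong)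
      fix x assume "x \<in> space (lebesgue_Rd d)"
      then have fm [measurable]: "(\<lambda>v. f' (x, v)) \<in> borel_measurable (lebesgue_Rd d)"
        by (intro measurable_compose[OF measurable_phase_Pair f']) auto
      show "(\<integral>\<^sup>+ v. ennreal (exp (- H (x, v))) * f' (x, v) \<partial>lebesgue_Rd d)
         = ennreal (exp (- U x) * sqrt (2 * pi) ^ d) * (\<integral>\<^sup>+ v. f' (x, v) \<partial>std_gaussian d)"
        unfolding g mult.assoc nn_integral_std_gaussian[OF fm] by (rule nn_integral_cmult) measurable
    qed
    finally show ?thesis .
  qed
  have "(\<integral>\<^sup>+ v. Oop f (x, v) \<partial>std_gaussian d) = (\<integral>\<^sup>+ v. f (x, v) \<partial>std_gaussian d)" if x: "x \<in> Rd d" for x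
  proof -
    have fm: "(\<lambda>v. f (x, v)) \<in> borel_measurable (lebesgue_Rd d)"
      using x by (intro measurable_compose[OF measurable_phase_Pair f]) auto
    show ?thesis
      using std_gaussian_rotation[OF \<eta>_pos \<sigma>_pos \<eta>\<sigma> fm] by (simp add: Oop_def O1_eq)
  qed
  then have "(\<integral>\<^sup>+ z. ennreal (exp (- H z)) * Oop f z \<partial>PS) = (\<integral>\<^sup>+ z. ennreal (exp (- H z)) * f z \<partial>PS)"
    by (subst (1 2) main) (auto intro!: nn_integral_cong)
  then show ?thesis by (simp add: nn_integral_target)
qed

text \<open>The map \<open>flip \<circ> \<theta>\<close> is a volume preserving involution that leaves
  \<open>J = min (exp (- H)) (exp (- H \<circ> \<theta>))\<close> invariant.\<close>
lemma Mop_invariant: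
  assumes f [measurable]: "f \<in> borel_measurable PS"
  shows "(\<integral>\<^sup>+ z. Mop f z \<partial>target d U) = (\<integral>\<^sup>+ z. f z \<partial>target d U)"
proof -
  define J where "J z = ennreal (exp (- H z)) * ennreal (acc z)" for z
  define J' where "J' z = ennreal (exp (- H z)) * ennreal (1 - acc z)" for z
  have [measurable]: "J \<in> borel_measurable PS" "J' \<in> borel_measurable PS"
    unfolding J_def[abs_def] J'_def[abs_def] by measurable
  have J_eq: "J z = ennreal (min (exp (- H z)) (exp (- H (\<theta> z))))" for z
  proof -
    have "exp (- H z) * acc z = min (exp (- H z)) (exp (- H (\<theta> z)))"
      by (auto simp: acc_def max_def min_def exp_add[symmetric])
    then show ?thesis by (simp add: J_def ennreal_mult'[symmetric])
  qed
  have J_inv: "J (flip d (\<theta> z)) = J z" if z: "z \<in> space PS" for z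
    unfolding J_eq by (simp add: \<theta>_reversible[OF z] H_flip min.commute)
  have JJ': "J z + J' z = ennreal (exp (- H z))" for z
    unfolding J_def J'_def using acc_bounds[of z]
    by (simp add: distrib_left[symmetric] ennreal_plus[symmetric] del: ennreal_plus)
  have vol: "volume_preserving d (flip d \<circ> \<theta>)"
    by (intro volume_preserving_comp flip_vol \<theta>_vol)
  \<comment> \<open>Substituting the involution turns an accepted move into a flip. Accepted and
    rejected mass together then flip the full weight exp (- H), which the flip leaves
    invariant.\<close>
  have "(\<integral>\<^sup>+ z. J z * f (\<theta> z) \<partial>PS) = (\<integral>\<^sup>+ z. (\<lambda>z. J z * f (\<theta> z)) ((flip d \<circ> \<theta>) z) \<partial>PS)"
    using vol unfolding volume_preserving_def
    by (elim conjE) (rule sym, erule bspec[of _ _ "\<lambda>z. J z * f (\<theta> z)"], measurable)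
  also have "\<dots> = (\<integral>\<^sup>+ z. J z * f (flip d z) \<partial>PS)"
    by (intro nn_integral_cong) (simp add: J_inv \<theta>_reversible del: space_phase_space)
  finally have 1: "(\<integral>\<^sup>+ z. J z * f (\<theta> z) \<partial>PS) = (\<integral>\<^sup>+ z. J z * f (flip d z) \<partial>PS)" .
  have "(\<integral>\<^sup>+ z. ennreal (exp (- H z)) * Mop f z \<partial>PS) = (\<integral>\<^sup>+ z. J z * f (\<theta> z) + J' z * f (flip d z) \<partial>PS)"
    by (intro nn_integral_cong) (simp add: Mop_def J_def J'_def algebra_simps)
  also have "\<dots> = (\<integral>\<^sup>+ z. J z * f (\<theta> z) \<partial>PS) + (\<integral>\<^sup>+ z. J' z * f (flip d z) \<partial>PS)"
    by (rule nn_integral_add) measurable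
  also have "\<dots> = (\<integral>\<^sup>+ z. J z * f (flip d z) + J' z * f (flip d z) \<partial>PS)"
    unfolding 1 by (rule nn_integral_add[symmetric]) measurable
  also have "\<dots> = (\<integral>\<^sup>+ z. (\<lambda>z. ennreal (exp (- H z)) * f z) (flip d z) \<partial>PS)"
    by (simp add: distrib_right[symmetric] JJ' H_flip)
  also have "\<dots> = (\<integral>\<^sup>+ z. ennreal (exp (- H z)) * f z \<partial>PS)"
    using flip_vol unfolding volume_preserving_def
    by (elim conjE) (erule bspec[of _ _ "\<lambda>z. ennreal (exp (- H z)) * f z"], measurable)
  finally show ?thesis by (simp add: nn_integral_target)
qed

lemma Kop_invariant:
  assumes [measurable]: "f \<in> borel_measurable PS"
  shows "(\<integral>\<^sup>+ z. (Kop ^^ n) f z \<partial>target d U) = (\<integral>\<^sup>+ z. f z \<partial>target d U)"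
proof (induction n)
  case (Suc n)
  have "(\<integral>\<^sup>+ z. (Kop ^^ Suc n) f z \<partial>target d U) = (\<integral>\<^sup>+ z. (Kop ^^ n) f z \<partial>target d U)"
    by (simp add: Kop_def Oop_invariant Mop_invariant)
  then show ?case using Suc by simp
qed simp

end

section \<open>Contraction under synchronous coupling and the energy error\<close>

lemma Lipschitz_continuous_on_Rd:
  fixes f :: "rvec \<Rightarrow> real"
  assumes "\<And>x y. x \<in> Rd d \<Longrightarrow> y \<in> Rd d \<Longrightarrow> \<bar>f x - f y\<bar> \<le> c * norm_vec d (\<lambda>i. x i - y i)"
  shows "continuous_on (Rd d) f"
  unfolding continuous_on_def
proof
  fix q assume q: "q \<in> Rd d"
  have "((\<lambda>x. f x - f q) \<longlongrightarrow> 0) (at q within Rd d)"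
  proof (rule Lim_null_comparison)
    show "\<forall>\<^sub>F x in at q within Rd d. norm (f x - f q) \<le> c * norm_vec d (\<lambda>i. x i - q i)"
      using assms[OF _ q] by (auto simp: eventually_at_filter)
    have co: "((\<lambda>x. x i) \<longlongrightarrow> q i) (at q within Rd d)" for i
      using continuous_on_subset[OF continuous_on_product_coordinates[of i] subset_UNIV[of "Rd d"]] q
      unfolding continuous_on_def by blast
    have "((\<lambda>x. norm_vec d (\<lambda>i. x i - q i)) \<longlongrightarrow> sqrt (\<Sum>i<d. (q i - q i)\<^sup>2)) (at q within Rd d)"
      unfolding norm_vec_def L2_set_def
      by (intro tendsto_real_sqrt tendsto_sum tendsto_power tendsto_diff co tendsto_const)
    then have "((\<lambda>x. norm_vec d (\<lambda>i. x i - q i)) \<longlongrightarrow> 0) (at q within Rd d)" by simp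
    then show "((\<lambda>x. c * norm_vec d (\<lambda>i. x i - q i)) \<longlongrightarrow> 0) (at q within Rd d)"
      by (rule tendsto_mult_right_zero)
  qed
  then show "(f \<longlongrightarrow> f q) (at q within Rd d)" by (simp add: LIM_zero_iff)
qed

text \<open>Here k g is the kick of the force difference and w - p the midpoint difference, so g (w
  - p) is the term with a favourable sign. The mixed term g p has no sign; Young's inequality splits
  it at the expense of part of the friction on p and of a multiple of g^2, which is left to
  cocoercivity.\<close>

lemma contraction_coordinate:
  fixes w p g q t k :: real
  assumes "0 \<le> q" "q \<le> 1" "0 < t" "0 \<le> k"
  shows "(w - k * g)\<^sup>2 + q * (p - k * g)\<^sup>2
     \<le> w\<^sup>2 + p\<^sup>2 - (1 - q - 4 / 5 * t) * p\<^sup>2 - 2 * k * (g * (w - p)) + (5 * k\<^sup>2 / t + 2 * k\<^sup>2) * g\<^sup>2"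
proof -
  have young: "- 2 * (1 + q) * (k * g) * p \<le> 4 / 5 * t * p\<^sup>2 + 5 * k\<^sup>2 / t * g\<^sup>2"
  proof -
    \<comment> \<open>\<open>V_contract\<close> has friction 1 - q \<ge> 9 / 5 t available; spending
      4 / 5 t on the mixed term leaves t.\<close>
    define s where "s = sqrt (4 / 5 * t)"
    have s: "s > 0" "s\<^sup>2 = 4 / 5 * t" using assms by (auto simp: s_def)
    have "0 \<le> (s * p + (1 + q) * (k * g) / s)\<^sup>2" by simp
    also have "\<dots> = s\<^sup>2 * p\<^sup>2 + 2 * (1 + q) * (k * g) * p + (1 + q)\<^sup>2 * (k * g)\<^sup>2 / s\<^sup>2"
      using s(1) by (simp add: power2_eq_square field_simps)
    finally have 1: "- 2 * (1 + q) * (k * g) * p \<le> 4 / 5 * t * p\<^sup>2 + (1 + q)\<^sup>2 * (k * g)\<^sup>2 / (4 / 5 * t)"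
      unfolding s(2) by linarith
    have "(1 + q)\<^sup>2 \<le> 2\<^sup>2" using assms by (intro power_mono) auto
    then have "(1 + q)\<^sup>2 * (k * g)\<^sup>2 \<le> 4 * (k * g)\<^sup>2" by (intro mult_right_mono) auto
    then have "(1 + q)\<^sup>2 * (k * g)\<^sup>2 / (4 / 5 * t) \<le> 4 * (k * g)\<^sup>2 / (4 / 5 * t)"
      using assms by (intro divide_right_mono) auto
    also have "\<dots> = 5 * k\<^sup>2 / t * g\<^sup>2" using assms by (simp add: power_mult_distrib)
    finally show ?thesis using 1 by linarith
  qed
  have "(1 + q) * (k * g)\<^sup>2 \<le> 2 * (k * g)\<^sup>2" using assms by (intro mult_right_mono) auto
  then have 2: "(1 + q) * (k * g)\<^sup>2 \<le> 2 * k\<^sup>2 * g\<^sup>2" by (simp add: power_mult_distrib)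
  have "(w - k * g)\<^sup>2 + q * (p - k * g)\<^sup>2 = w\<^sup>2 + q * p\<^sup>2 - 2 * k * (g * (w - p)) + (- 2 * (1 + q) * (k * g) * p) + (1 + q) * (k * g)\<^sup>2"
    by (simp add: power2_eq_square algebra_simps)
  also have "\<dots> \<le> w\<^sup>2 + q * p\<^sup>2 - 2 * k * (g * (w - p)) + (4 / 5 * t * p\<^sup>2 + 5 * k\<^sup>2 / t * g\<^sup>2) + 2 * k\<^sup>2 * g\<^sup>2"
    using young 2 by linarith
  also have "\<dots> = w\<^sup>2 + p\<^sup>2 - (1 - q - 4 / 5 * t) * p\<^sup>2 - 2 * k * (g * (w - p)) + (5 * k\<^sup>2 / t + 2 * k\<^sup>2) * g\<^sup>2"
    by (simp add: algebra_simps)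
  finally show ?thesis .
qed

section \<open>Twisted coordinates and contraction of the unadjusted chain\<close>

context makla begin

lemma fst_O1 [simp]: "fst (O1 b z) = fst z"
  and snd_O1: "i < d \<Longrightarrow> snd (O1 b z) i = \<eta> * snd z i + \<sigma> * b i"
  by (simp_all add: O1_eq)

lemma fst_\<theta>: "i < d \<Longrightarrow> fst (\<theta> z) i = mid z i + h / 2 * vel z i"
  and snd_\<theta>: "snd (\<theta> z) = vel z"
  by (simp_all add: \<theta>_eq)

lemma mid_nth: "i < d \<Longrightarrow> mid z i = fst z i + h / 2 * snd z i"
  and vel_nth: "i < d \<Longrightarrow> vel z i = snd z i - h * D i (mid z)"
  by (simp_all add: mid_def vel_def)

text \<open>Without force a step sends x to x + h \<eta> v and v to \<eta>^2 v, up to noise, and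
  \<alpha> is the value for which x + \<alpha> v is conserved. A force g at the midpoint then
  changes this combination by - h \<beta> g.\<close>

definition \<alpha> :: real where "\<alpha> = h * \<eta> / (1 - \<eta>\<^sup>2)"
definition \<beta> :: real where "\<beta> = h / 2 * (1 + \<eta>\<^sup>2) / (1 - \<eta>\<^sup>2)"

lemma \<eta>2_less: "\<eta>\<^sup>2 < 1" using \<eta>\<sigma> zero_less_power[OF \<sigma>_pos, of 2] by linarith

lemma \<alpha>_eq: "\<alpha> = h * \<eta> + \<alpha> * \<eta>\<^sup>2"
  using \<eta>2_less by (simp add: \<alpha>_def field_simps)
lemma \<beta>_eq: "\<beta> = h / 2 + \<alpha> * \<eta>"
  using \<eta>2_less by (simp add: \<alpha>_def \<beta>_def field_simps power2_eq_square)
lemma \<alpha>\<beta>: "\<alpha> = h / 2 * \<eta> + \<eta> * \<beta>"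
  using \<eta>2_less by (simp add: \<alpha>_def \<beta>_def field_simps power2_eq_square)

lemma \<eta>2_bounds: "\<eta>\<^sup>2 \<ge> 1 - \<gamma> * h" "\<eta>\<^sup>2 \<le> 1 - 19 / 20 * (\<gamma> * h)" "\<eta> \<ge> 19 / 20" "\<eta> \<le> 1" "\<eta> ^ 4 \<le> 1 - 9 / 5 * (\<gamma> * h)"
proof -
  let ?t = "\<gamma> * h"
  have t: "0 < ?t" "?t \<le> 1 / 10" using \<gamma>_pos h_pos \<gamma>h by auto
  \<comment> \<open>The quadratics 1 - s + s^2 / 2 and 1 + s + s^2 / 2 have product 1 + s^4 / 4, so
    the first bounds the reciprocal of exp s from above.\<close>
  have eu: "exp (- s) \<le> 1 - s + s\<^sup>2 / 2" if s: "0 \<le> s" for s :: real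
  proof -
    have "1 + s + s\<^sup>2 / 2 \<le> exp s" using exp_lower_Taylor_quadratic[OF s] .
    moreover have "1 \<le> (1 - s + s\<^sup>2 / 2) * (1 + s + s\<^sup>2 / 2)"
    proof -
      have "(1 - s + s\<^sup>2 / 2) * (1 + s + s\<^sup>2 / 2) = 1 + (s\<^sup>2 / 2)\<^sup>2" by (simp add: power2_eq_square field_simps)
      then show ?thesis by simp
    qed
    moreover have "0 < 1 - s + s\<^sup>2 / 2"
    proof -
      have "1 - s + s\<^sup>2 / 2 = (s - 1)\<^sup>2 / 2 + 1 / 2" by (simp add: power2_eq_square field_simps)
      then show ?thesis by (simp add: add_nonneg_pos)
    qed
    ultimately have "1 \<le> (1 - s + s\<^sup>2 / 2) * exp s"
      by (smt (verit) mult_left_mono)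
    then show ?thesis by (simp add: exp_minus inverse_eq_divide pos_divide_le_eq)
  qed
  show "\<eta>\<^sup>2 \<ge> 1 - ?t" unfolding \<eta>2 using exp_ge_add_one_self[of "- ?t"] by simp
  have "?t\<^sup>2 \<le> 1 / 10 * ?t" unfolding power2_eq_square using t by (intro mult_right_mono) linarith+
  then show "\<eta>\<^sup>2 \<le> 1 - 19 / 20 * ?t" using eu[of ?t] t unfolding \<eta>2 by simp
  have "\<eta> = exp (- (?t / 2))" by (simp add: \<eta>_def)
  then show "\<eta> \<ge> 19 / 20" using exp_ge_add_one_self[of "- (?t / 2)"] t by simp
  show "\<eta> \<le> 1" using t by (simp add: \<eta>_def)
  have "\<eta> ^ 4 = (\<eta>\<^sup>2)\<^sup>2" by simp
  also have "\<dots> = exp (- (2 * ?t))" unfolding \<eta>2 by (simp add: power2_eq_square exp_add[symmetric])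
  also have "\<dots> \<le> 1 - 2 * ?t + (2 * ?t)\<^sup>2 / 2" using t by (intro eu) simp
  also have "\<dots> \<le> 1 - 9 / 5 * ?t" using \<open>?t\<^sup>2 \<le> 1 / 10 * ?t\<close> by (simp add: power_mult_distrib)
  finally show "\<eta> ^ 4 \<le> 1 - 9 / 5 * ?t" .
qed

lemma \<beta>_bounds: "19 / 20 / \<gamma> \<le> \<beta>" "\<beta> \<le> 11 / 10 / \<gamma>" "\<beta> > 0"
proof -
  let ?t = "\<gamma> * h"
  have t: "0 < ?t" "?t \<le> 1 / 10" using \<gamma>_pos h_pos \<gamma>h by auto
  have p: "1 - \<eta>\<^sup>2 > 0" using \<eta>2_less by simp
  have "(19 / 20) * (1 - \<eta>\<^sup>2) \<le> ?t / 2 * (1 + \<eta>\<^sup>2)"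
  proof -
    have "(19 / 20) * (1 - \<eta>\<^sup>2) \<le> (19 / 20) * ?t" using \<eta>2_bounds(1) by simp
    also have "\<dots> \<le> ?t / 2 * (1 + \<eta>\<^sup>2)"
      using mult_left_mono[of "9 / 10" "\<eta>\<^sup>2" "?t / 2"] \<eta>2_bounds(1) t by (simp add: algebra_simps)
    finally show ?thesis .
  qed
  then have "(19 / 20) / \<gamma> * (1 - \<eta>\<^sup>2) \<le> h / 2 * (1 + \<eta>\<^sup>2)"
    using \<gamma>_pos by (simp add: field_simps)
  then show lo: "19 / 20 / \<gamma> \<le> \<beta>" using p by (simp add: \<beta>_def pos_le_divide_eq)
  have "?t / 2 * (1 + \<eta>\<^sup>2) \<le> 11 / 10 * (1 - \<eta>\<^sup>2)"
  proof -
    have "?t / 2 * (1 + \<eta>\<^sup>2) \<le> ?t / 2 * 2" using \<eta>2_less t by (intro mult_left_mono) auto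
    also have "\<dots> \<le> 11 / 10 * (19 / 20 * ?t)" using t by simp
    also have "\<dots> \<le> 11 / 10 * (1 - \<eta>\<^sup>2)" using \<eta>2_bounds(2) by simp
    finally show ?thesis .
  qed
  then have "h / 2 * (1 + \<eta>\<^sup>2) \<le> 11 / 10 / \<gamma> * (1 - \<eta>\<^sup>2)"
    using \<gamma>_pos by (simp add: field_simps)
  then show "\<beta> \<le> 11 / 10 / \<gamma>" using p by (simp add: \<beta>_def pos_divide_le_eq)
  have "0 < 19 / 20 / \<gamma>" using \<gamma>_pos by simp
  then show "\<beta> > 0" using lo by linarith
qed

definition wco :: "phase \<Rightarrow> nat \<Rightarrow> real" where "wco z i = fst z i + \<alpha> * snd z i"
definition pco :: "phase \<Rightarrow> nat \<Rightarrow> real" where "pco z i = \<eta> * \<beta> * snd z i"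
definition V :: "phase \<Rightarrow> phase \<Rightarrow> real" where
  "V z z' = (\<Sum>i<d. (wco z i - wco z' i)\<^sup>2 + (pco z i - pco z' i)\<^sup>2)"
definition \<rho> :: real where "\<rho> = h * K / (2 * \<gamma>)"

lemma V_nonneg: "V z z' \<ge> 0" by (simp add: V_def sum_nonneg)
lemma L_\<gamma>: "L \<le> \<gamma>\<^sup>2 / 100"
proof -
  have "(10 * sqrt L)\<^sup>2 \<le> \<gamma>\<^sup>2" using L_pos by (intro power_mono \<gamma>_large) auto
  then show ?thesis using L_pos by (simp add: power_mult_distrib)
qed

lemma \<rho>_bounds: "0 < \<rho>" "\<rho> \<le> 1 / 2000"
proof -
  show "0 < \<rho>" using h_pos K_pos \<gamma>_pos by (simp add: \<rho>_def)
  have "K \<le> \<gamma>\<^sup>2 / 100" using K_le_L L_\<gamma> by linarith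
  then have "\<rho> \<le> h * (\<gamma>\<^sup>2 / 100) / (2 * \<gamma>)" unfolding \<rho>_def using h_pos \<gamma>_pos by (intro divide_right_mono mult_left_mono) auto
  also have "\<dots> = \<gamma> * h / 200" using \<gamma>_pos by (simp add: power2_eq_square)
  finally show "\<rho> \<le> 1 / 2000" using \<gamma>h by simp
qed

text \<open>In the coordinates \<open>w = x + \<alpha> v\<close> and \<open>p = \<eta> \<beta> v\<close> the midpoint is \<open>w - p\<close>, and a step subtracts
  \<open>h \<beta> \<nabla>U\<close> from both, before \<open>p\<close> is contracted by \<open>\<eta>\<^sup>2\<close>.\<close>
lemma V_contract:
  assumes z: "z \<in> space PS" and z': "z' \<in> space PS"
  shows "V (O1 b' (\<theta> (O1 b z))) (O1 b' (\<theta> (O1 b z'))) \<le> (1 - \<rho>) * V z z'"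
proof -
  define t where "t = \<gamma> * h"
  define k where "k = h * \<beta>"
  define q where "q = \<eta> ^ 4"
  have t: "0 < t" "t \<le> 1 / 10" using \<gamma>_pos h_pos \<gamma>h by (auto simp: t_def)
  have k: "0 < k" using h_pos \<beta>_bounds by (simp add: k_def)
  have q: "0 \<le> q" "q \<le> 1" "q \<le> 1 - 9 / 5 * t" using \<eta>2_bounds \<eta>_pos t by (auto simp: q_def t_def)
  let ?m = "mid (O1 b z)" and ?m' = "mid (O1 b z')"
  define w where "w i = wco z i - wco z' i" for i
  define p where "p i = pco z i - pco z' i" for i
  define g where "g i = D i ?m - D i ?m'" for i
  define y where "y i = ?m i - ?m' i" for i
  have y: "y i = w i - p i" if "i < d" for i
  proof -
    have "y i = (fst z i - fst z' i) + h / 2 * \<eta> * (snd z i - snd z' i)"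
      using that by (simp add: y_def mid_def O1_eq field_simps)
    moreover have "w i - p i = (fst z i - fst z' i) + (\<alpha> - \<eta> * \<beta>) * (snd z i - snd z' i)"
      by (simp add: w_def p_def wco_def pco_def algebra_simps)
    ultimately show ?thesis using \<alpha>\<beta> by simp
  qed
  have v1: "snd (O1 b' (\<theta> (O1 b z))) i - snd (O1 b' (\<theta> (O1 b z'))) i = \<eta> * (\<eta> * (snd z i - snd z' i) - h * g i)" if "i < d" for i
    using that by (simp add: snd_\<theta> vel_nth snd_O1 g_def algebra_simps)
  have x1: "fst (O1 b' (\<theta> (O1 b z))) i - fst (O1 b' (\<theta> (O1 b z'))) i
     = (fst z i - fst z' i) + h * (\<eta> * (snd z i - snd z' i)) - h * h / 2 * g i" if "i < d" for i
    using that by (simp add: fst_\<theta> mid_nth vel_nth snd_O1 g_def field_simps)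
  have w1: "wco (O1 b' (\<theta> (O1 b z))) i - wco (O1 b' (\<theta> (O1 b z'))) i = w i - k * g i" if i: "i < d" for i
  proof -
    have "wco (O1 b' (\<theta> (O1 b z))) i - wco (O1 b' (\<theta> (O1 b z'))) i
       = (fst z i - fst z' i) + (h * \<eta> + \<alpha> * \<eta>\<^sup>2) * (snd z i - snd z' i) - h * (h / 2 + \<alpha> * \<eta>) * g i"
      unfolding wco_def using x1[OF i] v1[OF i] by (simp add: power2_eq_square algebra_simps) algebra
    then show ?thesis unfolding \<alpha>_eq[symmetric] \<beta>_eq[symmetric] by (simp add: w_def wco_def k_def algebra_simps)
  qed
  have p1: "pco (O1 b' (\<theta> (O1 b z))) i - pco (O1 b' (\<theta> (O1 b z'))) i = \<eta>\<^sup>2 * (p i - k * g i)" if i: "i < d" for i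
  proof -
    have "pco (O1 b' (\<theta> (O1 b z))) i - pco (O1 b' (\<theta> (O1 b z'))) i
      = \<eta> * \<beta> * (snd (O1 b' (\<theta> (O1 b z))) i - snd (O1 b' (\<theta> (O1 b z'))) i)"
      by (simp add: pco_def algebra_simps)
    also have "\<dots> = \<eta>\<^sup>2 * (p i - k * g i)"
      unfolding v1[OF i] by (simp add: p_def pco_def k_def power2_eq_square algebra_simps)
    finally show ?thesis .
  qed
  define W P Y G GY where "W = (\<Sum>i<d. (w i)\<^sup>2)" and "P = (\<Sum>i<d. (p i)\<^sup>2)" and "Y = (\<Sum>i<d. (y i)\<^sup>2)"
    and "G = (\<Sum>i<d. (g i)\<^sup>2)" and "GY = (\<Sum>i<d. g i * y i)"
  have nn: "W \<ge> 0" "P \<ge> 0" "Y \<ge> 0" "G \<ge> 0" by (auto simp: W_def P_def Y_def G_def sum_nonneg)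
  have KY: "K * Y \<le> GY" unfolding Y_def GY_def y_def g_def by (rule A1_sum) auto
  have LG: "G \<le> L * GY" unfolding G_def GY_def y_def g_def by (rule cocoercive) auto
  have GY0: "GY \<ge> 0" using KY nn K_pos by (meson mult_nonneg_nonneg less_imp_le order_trans)
  have VWP: "V z z' = W + P" by (simp add: V_def W_def P_def w_def p_def sum.distrib)
  \<comment> \<open>As w = y + p, this gives W + P \<le> 2 Y + 3 P, so it is enough to decrease by
    multiples of Y and P.\<close>
  have WYP: "W \<le> 2 * Y + 2 * P"
  proof -
    have "W \<le> (\<Sum>i<d. 2 * (y i)\<^sup>2 + 2 * (p i)\<^sup>2)" unfolding W_def
    proof (rule sum_mono)
      fix i assume "i \<in> {..<d}"
      then have "w i = y i + p i" using y by simp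
      then show "(w i)\<^sup>2 \<le> 2 * (y i)\<^sup>2 + 2 * (p i)\<^sup>2"
        using sum_squares_bound[of "y i" "p i"] by (simp add: power2_eq_square algebra_simps)
    qed
    then show ?thesis by (simp add: sum.distrib sum_distrib_left Y_def P_def)
  qed
  have "V (O1 b' (\<theta> (O1 b z))) (O1 b' (\<theta> (O1 b z')))
    \<le> (\<Sum>i<d. (w i)\<^sup>2 + (p i)\<^sup>2 - (1 - q - 4 / 5 * t) * (p i)\<^sup>2 - 2 * k * (g i * y i) + (5 * k\<^sup>2 / t + 2 * k\<^sup>2) * (g i)\<^sup>2)"
    unfolding V_def
  proof (rule sum_mono)
    fix i assume "i \<in> {..<d}"
    then have i: "i < d" by simp
    have "(wco (O1 b' (\<theta> (O1 b z))) i - wco (O1 b' (\<theta> (O1 b z'))) i)\<^sup>2 + (pco (O1 b' (\<theta> (O1 b z))) i - pco (O1 b' (\<theta> (O1 b z'))) i)\<^sup>2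
      = (w i - k * g i)\<^sup>2 + q * (p i - k * g i)\<^sup>2"
      unfolding w1[OF i] p1[OF i] q_def by (simp add: power_mult_distrib)
    also have "\<dots> \<le> (w i)\<^sup>2 + (p i)\<^sup>2 - (1 - q - 4 / 5 * t) * (p i)\<^sup>2 - 2 * k * (g i * y i) + (5 * k\<^sup>2 / t + 2 * k\<^sup>2) * (g i)\<^sup>2"
      unfolding y[OF i] using contraction_coordinate[of q t k "w i" "g i" "p i"] q t k by simp
    finally show "(wco (O1 b' (\<theta> (O1 b z))) i - wco (O1 b' (\<theta> (O1 b z'))) i)\<^sup>2 + (pco (O1 b' (\<theta> (O1 b z))) i - pco (O1 b' (\<theta> (O1 b z'))) i)\<^sup>2
      \<le> (w i)\<^sup>2 + (p i)\<^sup>2 - (1 - q - 4 / 5 * t) * (p i)\<^sup>2 - 2 * k * (g i * y i) + (5 * k\<^sup>2 / t + 2 * k\<^sup>2) * (g i)\<^sup>2" .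
  qed
  also have "\<dots> = W + P - (1 - q - 4 / 5 * t) * P - 2 * k * GY + (5 * k\<^sup>2 / t + 2 * k\<^sup>2) * G"
    by (simp add: W_def P_def G_def GY_def sum.distrib sum_subtractf sum_distrib_left)
  \<comment> \<open>A twentieth of the convexity term 2 k GY absorbs the whole G term: after
    cocoercivity the coefficient of the latter is at most 5.72 k L / \<gamma>^2, and L \<le>
    \<gamma>^2 / 100.\<close>
  also have "\<dots> \<le> W + P - t * P - 19 / 10 * k * GY"
  proof -
    have "t * P \<le> (1 - q - 4 / 5 * t) * P" using q nn by (intro mult_right_mono) auto
    moreover have "(5 * k\<^sup>2 / t + 2 * k\<^sup>2) * G \<le> 1 / 10 * k * GY"
    proof -
      have k1: "k \<le> 11 / 10 * (h / \<gamma>)" using mult_left_mono[OF \<beta>_bounds(2), of h] h_pos by (simp add: k_def)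
      have kt: "k / t \<le> 11 / 10 / \<gamma>\<^sup>2"
      proof -
        have "k / t \<le> 11 / 10 * (h / \<gamma>) / t" using t by (intro divide_right_mono k1) simp
        also have "\<dots> = 11 / 10 / \<gamma>\<^sup>2" using h_pos \<gamma>_pos by (simp add: t_def power2_eq_square)
        finally show ?thesis .
      qed
      have k2: "k \<le> 11 / 100 / \<gamma>\<^sup>2"
      proof -
        have "k = k / t * t" using t by simp
        also have "\<dots> \<le> 11 / 10 / \<gamma>\<^sup>2 * (1 / 10)" using t k by (intro mult_mono kt) auto
        finally show ?thesis by simp
      qed
      have "(5 * k\<^sup>2 / t + 2 * k\<^sup>2) * G = k * ((5 * (k / t) + 2 * k) * G)"
        by (simp add: power2_eq_square algebra_simps)
      also have "\<dots> \<le> k * ((5 * (11 / 10 / \<gamma>\<^sup>2) + 2 * (11 / 100 / \<gamma>\<^sup>2)) * (L * GY))"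
        using k kt k2 nn LG t by (intro mult_left_mono mult_mono add_mono) auto
      also have "\<dots> = k * (572 / 100 * (L / \<gamma>\<^sup>2) * GY)" by (simp add: field_simps)
      also have "\<dots> \<le> k * (572 / 100 * (1 / 100) * GY)"
        using L_\<gamma> \<gamma>_pos k GY0 by (intro mult_left_mono mult_right_mono) (auto simp: field_simps)
      also have "\<dots> \<le> 1 / 10 * k * GY" using k GY0 by simp
      finally show ?thesis .
    qed
    ultimately show ?thesis by linarith
  qed
  \<comment> \<open>Strong convexity enters here. As k \<ge> (19 / 20) h / \<gamma>, the remaining
    factor 19 / 10 leaves room for 2 \<rho> = h K / \<gamma>.\<close>
  also have "\<dots> \<le> W + P - t * P - 2 * \<rho> * Y"
  proof -
    have "19 / 20 * (h / \<gamma>) \<le> k" using mult_left_mono[OF \<beta>_bounds(1), of h] h_pos by (simp add: k_def)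
    then have "10 / 19 * (h / \<gamma>) \<le> k" using h_pos \<gamma>_pos divide_pos_pos[OF h_pos \<gamma>_pos] by linarith
    then have "10 / 19 * (h / \<gamma>) * (K * Y) \<le> k * GY" using KY k nn K_pos by (intro mult_mono) auto
    moreover have "2 * \<rho> * Y = h / \<gamma> * (K * Y)" using \<gamma>_pos by (simp add: \<rho>_def)
    ultimately show ?thesis by simp
  qed
  also have "\<dots> \<le> W + P - \<rho> * (2 * Y + 3 * P)"
  proof -
    have "3 * \<rho> \<le> t"
    proof -
      have "K \<le> \<gamma>\<^sup>2 / 100" using K_le_L L_\<gamma> by linarith
      then have "3 * (h * K / (2 * \<gamma>)) \<le> 3 * (h * (\<gamma>\<^sup>2 / 100) / (2 * \<gamma>))"
        using h_pos \<gamma>_pos by (intro mult_left_mono divide_right_mono) auto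
      also have "\<dots> = 3 / 200 * t" using \<gamma>_pos by (simp add: t_def power2_eq_square)
      finally show ?thesis unfolding \<rho>_def using t by linarith
    qed
    then have "3 * \<rho> * P \<le> t * P" using nn by (intro mult_right_mono) auto
    then show ?thesis by (simp add: algebra_simps)
  qed
  also have "\<dots> \<le> W + P - \<rho> * (W + P)"
    using WYP \<rho>_bounds(1) mult_left_mono[of "W + P" "2 * Y + 3 * P" \<rho>] by linarith
  also have "\<dots> = (1 - \<rho>) * V z z'" unfolding VWP by (simp add: algebra_simps)
  finally show ?thesis .
qed

section \<open>Energy error of one Verlet step\<close>

definition \<Delta>E :: "real \<Rightarrow> real" where "\<Delta>E R = h ^ 3 * (2 * L\<^sub>H * (R * sqrt R) + 2 * (L * sqrt L) * R)"

text \<open>The kinetic energy changes by exactly - h grad U(y) . u, with y the midpoint and u the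
  mean of the old and the new velocity. Old and new position are symmetric about c with
  half-difference w = h u / 2, so the potential changes by h grad U(c) . u up to third order.
  Finally c and y differ by h^2 / 4 times the force, which again costs order h^3.\<close>

lemma energy_error:
  assumes z: "z \<in> space PS" and R: "H z \<le> R"
  shows "H (\<theta> z) - H z \<le> \<Delta>E R"
proof -
  define x v where "x = fst z" and "v = snd z"
  have x: "x \<in> Rd d" and v: "v \<in> Rd d" using z by (auto simp: x_def v_def)
  define y where "y = mid z"
  have y: "y \<in> Rd d" by (simp add: y_def)
  have yi: "y i = x i + h / 2 * v i" if "i < d" for i using that by (simp add: y_def mid_def x_def v_def)
  define u where "u = (\<lambda>i. v i - h / 2 * D i y)"
  define c where "c = (\<lambda>i. x i + h / 2 * u i)"
  define w where "w = (\<lambda>i. h / 2 * u i)"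
  \<comment> \<open>On {H \<le> R} this bounds the speed, and sqrt L times it bounds the force at
    x.\<close>
  define n where "n = sqrt (2 * R)"
  have R0: "R \<ge> 0" using R H_nonneg[OF z] by linarith
  have n: "n \<ge> 0" "n\<^sup>2 = 2 * R" using R0 by (auto simp: n_def)
  have sL: "sqrt L > 0" "(sqrt L)\<^sup>2 = L" using L_pos by auto
  have hL: "h * sqrt L \<le> 1 / 100"
  proof -
    have "h * sqrt L \<le> h * (\<gamma> / 10)" using \<gamma>_large h_pos by (intro mult_left_mono) auto
    then show ?thesis using \<gamma>h by (simp add: mult.commute)
  qed
  have Ux: "U x \<ge> 0" "U x \<le> R" "(norm_vec d v)\<^sup>2 \<le> n\<^sup>2"
    using R U_nonneg[OF x] n zero_le_power2[of "norm_vec d v"]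
    unfolding H_eq x_def[symmetric] v_def[symmetric] by linarith+
  have nv: "norm_vec d v \<le> n" using Ux(3) n(1) by (rule power2_le_imp_le)
  have nD: "norm_vec d (\<lambda>i. D i x) \<le> sqrt L * n"
  proof (rule power2_le_imp_le)
    have "(norm_vec d (\<lambda>i. D i x))\<^sup>2 \<le> 2 * L * U x" using grad_sq_le[OF x] by (simp add: norm_vec_power2)
    also have "\<dots> \<le> 2 * L * R" using Ux L_pos by simp
    also have "\<dots> = (sqrt L * n)\<^sup>2" using n sL by (simp add: power_mult_distrib)
    finally show "(norm_vec d (\<lambda>i. D i x))\<^sup>2 \<le> (sqrt L * n)\<^sup>2" .
  qed (use n sL in simp)
  have nDy: "norm_vec d (\<lambda>i. D i y) \<le> 3 / 2 * (sqrt L * n)"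
  proof -
    have "norm_vec d (\<lambda>i. D i y - D i x) \<le> L * norm_vec d (\<lambda>i. y i - x i)" by (rule A2_norm[OF y x])
    also have "norm_vec d (\<lambda>i. y i - x i) = norm_vec d (\<lambda>i. h / 2 * v i)" by (rule norm_vec_cong) (simp add: yi)
    also have "\<dots> = h / 2 * norm_vec d v" unfolding norm_vec_scale using h_pos by simp
    also have "L * (h / 2 * norm_vec d v) \<le> L * (h / 2 * n)" using nv h_pos L_pos by simp
    also have "\<dots> = 1 / 2 * (h * sqrt L) * (sqrt L * n)" using sL by (simp add: power2_eq_square algebra_simps)
    also have "\<dots> \<le> 1 / 2 * (1 / 100) * (sqrt L * n)" using hL n sL by (intro mult_right_mono mult_left_mono) auto
    finally have "norm_vec d (\<lambda>i. D i y - D i x) \<le> 1 / 200 * (sqrt L * n)" by simp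
    moreover have "norm_vec d (\<lambda>i. D i y) \<le> norm_vec d (\<lambda>i. D i x) + norm_vec d (\<lambda>i. D i y - D i x)"
      using norm_vec_triangle[of d "\<lambda>i. D i x" "\<lambda>i. D i y - D i x"] by simp
    moreover have "0 \<le> sqrt L * n" using n sL by simp
    ultimately show ?thesis using nD by linarith
  qed
  have nu: "norm_vec d u \<le> 2 * n"
  proof -
    have "norm_vec d u \<le> norm_vec d v + norm_vec d (\<lambda>i. h / 2 * D i y)"
      unfolding u_def by (rule norm_vec_triangle_diff)
    also have "norm_vec d (\<lambda>i. h / 2 * D i y) = h / 2 * norm_vec d (\<lambda>i. D i y)" unfolding norm_vec_scale using h_pos by simp
    also have "\<dots> \<le> h / 2 * (3 / 2 * (sqrt L * n))" using nDy h_pos by simp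
    also have "\<dots> = 3 / 4 * (h * sqrt L) * n" by simp
    also have "\<dots> \<le> 3 / 4 * (1 / 100) * n" using hL n by (intro mult_right_mono mult_left_mono) auto
    finally show ?thesis using nv n by simp
  qed
  have vel: "vel z i = v i - h * D i y" if "i < d" for i using that by (simp add: vel_def v_def y_def)
  have e1: "fst (\<theta> z) = (\<lambda>i\<in>{..<d}. c i + w i)"
    by (rule Rd_eqI[of _ d]) (simp_all add: \<theta>_eq vel y_def[symmetric] yi c_def w_def u_def field_simps)
  have e0: "x = (\<lambda>i\<in>{..<d}. c i - w i)"
    by (rule Rd_eqI[OF x]) (auto simp: c_def w_def)
  have kin: "(norm_vec d (vel z))\<^sup>2 - (norm_vec d v)\<^sup>2 = - 2 * h * (\<Sum>i<d. D i y * u i)"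
  proof -
    have "(norm_vec d (vel z))\<^sup>2 - (norm_vec d v)\<^sup>2 = (\<Sum>i<d. (vel z i)\<^sup>2 - (v i)\<^sup>2)"
      by (simp add: norm_vec_power2 sum_subtractf)
    also have "\<dots> = (\<Sum>i<d. (- 2 * h) * (D i y * u i))"
      by (rule sum.cong) (auto simp: vel u_def power2_eq_square field_simps)
    finally show ?thesis by (simp add: sum_distrib_left)
  qed
  let ?c = "\<lambda>i\<in>{..<d}. c i"
  have sDw: "(\<Sum>i<d. D i ?c * w i) = h / 2 * (\<Sum>i<d. D i ?c * u i)"
    by (simp add: w_def sum_distrib_left algebra_simps)
  have "H (\<theta> z) - H z = ((norm_vec d (vel z))\<^sup>2 - (norm_vec d v)\<^sup>2) / 2 + (U (\<lambda>i\<in>{..<d}. c i + w i) - U (\<lambda>i\<in>{..<d}. c i - w i))"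
    unfolding H_eq e1 e0[symmetric] by (simp add: x_def v_def \<theta>_eq field_simps)
  also have "\<dots> = (U (\<lambda>i\<in>{..<d}. c i + w i) - U (\<lambda>i\<in>{..<d}. c i - w i) - 2 * (\<Sum>i<d. D i ?c * w i))
     + h * (\<Sum>i<d. (D i ?c - D i y) * u i)"
    unfolding kin sDw by (simp add: left_diff_distrib sum_subtractf algebra_simps)
  also have "\<dots> \<le> L\<^sub>H * norm_vec d w ^ 3 / 3 + h * (norm_vec d (\<lambda>i. D i ?c - D i y) * norm_vec d u)"
    using h_pos
    by (intro add_mono order_trans[OF abs_ge_self third_order_midpoint] mult_left_mono sum_mult_le_norm_vec) auto
  also have "\<dots> \<le> h ^ 3 * (2 * L\<^sub>H * (R * sqrt R)) + h ^ 3 * (2 * (L * sqrt L) * R)"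
  proof (rule add_mono)
    have "norm_vec d w = h / 2 * norm_vec d u" unfolding w_def norm_vec_scale using h_pos by simp
    also have "\<dots> \<le> h * n" using nu h_pos by simp
    finally have "norm_vec d w ^ 3 \<le> (h * n) ^ 3" by (intro power_mono) auto
    also have "(h * n) ^ 3 = h ^ 3 * (n * n\<^sup>2)" by (simp add: power_mult_distrib power3_eq_cube power2_eq_square)
    also have "n * n\<^sup>2 = 2 * sqrt 2 * (R * sqrt R)" using n by (simp add: n_def real_sqrt_mult)
    also have "h ^ 3 * (2 * sqrt 2 * (R * sqrt R)) \<le> h ^ 3 * (2 * 2 * (R * sqrt R))"
    proof -
      have "sqrt 2 \<le> (2::real)" by (rule real_le_lsqrt) auto
      then show ?thesis using h_pos R0 by (intro mult_left_mono mult_right_mono) auto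
    qed
    finally have "L\<^sub>H * norm_vec d w ^ 3 \<le> L\<^sub>H * (h ^ 3 * (4 * (R * sqrt R)))"
      using LH_nonneg by (intro mult_left_mono) auto
    moreover have "0 \<le> L\<^sub>H * (h ^ 3 * (R * sqrt R))" using LH_nonneg h_pos R0 by simp
    ultimately show "L\<^sub>H * norm_vec d w ^ 3 / 3 \<le> h ^ 3 * (2 * L\<^sub>H * (R * sqrt R))"
      by (simp add: algebra_simps)
    have cy: "norm_vec d (\<lambda>i. D i cc - D i y) \<le> L * (h * h / 4 * (3 / 2 * (sqrt L * n)))" if cc: "cc = ?c" for cc
    proof -
      have "norm_vec d (\<lambda>i. D i cc - D i y) \<le> L * norm_vec d (\<lambda>i. cc i - y i)"
        by (rule A2_norm[OF _ y]) (simp add: cc)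
      also have "norm_vec d (\<lambda>i. cc i - y i) = norm_vec d (\<lambda>i. - (h * h / 4) * D i y)"
        by (rule norm_vec_cong) (simp add: cc yi c_def u_def field_simps)
      also have "\<dots> = h * h / 4 * norm_vec d (\<lambda>i. D i y)" unfolding norm_vec_scale by simp
      also have "L * (h * h / 4 * norm_vec d (\<lambda>i. D i y)) \<le> L * (h * h / 4 * (3 / 2 * (sqrt L * n)))"
        using nDy L_pos h_pos by (intro mult_left_mono) auto
      finally show ?thesis .
    qed
    have "norm_vec d (\<lambda>i. D i ?c - D i y) * norm_vec d u \<le> L * (h * h / 4 * (3 / 2 * (sqrt L * n))) * (2 * n)"
      by (rule mult_mono[OF cy[OF refl] nu]) (use n L_pos h_pos in auto)
    also have "\<dots> = 3 / 4 * (h * h * (L * sqrt L)) * n\<^sup>2" by (simp add: power2_eq_square)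
    also have "\<dots> = 3 / 2 * (h * h * (L * sqrt L) * R)" using n by simp
    also have "\<dots> \<le> 2 * (h * h * (L * sqrt L) * R)" using L_pos h_pos R0 by (intro mult_right_mono) auto
    finally have "h * (norm_vec d (\<lambda>i. D i ?c - D i y) * norm_vec d u) \<le> h * (2 * (h * h * (L * sqrt L) * R))"
      using h_pos by (intro mult_left_mono) auto
    then show "h * (norm_vec d (\<lambda>i. D i ?c - D i y) * norm_vec d u) \<le> h ^ 3 * (2 * (L * sqrt L) * R)"
      by (simp add: power3_eq_cube algebra_simps)
  qed
  also have "\<dots> = \<Delta>E R" by (simp add: \<Delta>E_def algebra_simps)
  finally show ?thesis .
qed

end

section \<open>Regularisation by one step\<close>

lemma geometric_increments_converge:
  fixes y :: "nat \<Rightarrow> real"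
  assumes "\<And>n. \<bar>y (Suc n) - y n\<bar> \<le> c * (1 / 2) ^ n"
  shows "convergent y"
proof -
  have "summable (\<lambda>n. c * (1 / 2 :: real) ^ n)" by (intro summable_mult summable_geometric) simp
  then have "summable (\<lambda>n. y (Suc n) - y n)"
    by (rule summable_comparison_test'[of _ 0]) (use assms in simp)
  then have "(\<lambda>n. \<Sum>k<n. y (Suc k) - y k) \<longlonglongrightarrow> (\<Sum>k. y (Suc k) - y k)" by (rule summable_LIMSEQ)
  then have "(\<lambda>n. y n - y 0) \<longlonglongrightarrow> (\<Sum>k. y (Suc k) - y k)" by (simp add: sum_lessThan_telescope)
  then have "(\<lambda>n. y n - y 0 + y 0) \<longlonglongrightarrow> (\<Sum>k. y (Suc k) - y k) + y 0" by (intro tendsto_intros)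
  then show ?thesis by (auto simp: convergent_def)
qed

context makla begin

lemma hhL: "h * h * L \<le> 1 / 10000"
proof -
  have "h * h * L \<le> h * h * (\<gamma>\<^sup>2 / 100)" using L_\<gamma> h_pos by (intro mult_left_mono) auto
  also have "\<dots> = (\<gamma> * h) * (\<gamma> * h) / 100" by (simp add: power2_eq_square)
  also have "\<dots> \<le> (1 / 10) * (1 / 10) / 100"
    using \<gamma>h \<gamma>_pos h_pos by (intro divide_right_mono mult_mono) auto
  finally show ?thesis by simp
qed

text \<open>Reaching a prescribed position amounts to solving \<open>T0 y = q\<close> for the
  midpoint y. As h^2 L is tiny, \<open>T0\<close> is a small perturbation of twice the identity,
  hence bi-Lipschitz and invertible.\<close>

definition T0 :: "rvec \<Rightarrow> nat \<Rightarrow> real" where "T0 y i = 2 * y i - h * h / 2 * D i y"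

lemma T0_upper:
  assumes "y \<in> Rd d" "y' \<in> Rd d"
  shows "norm_vec d (\<lambda>i. T0 y i - T0 y' i) \<le> (2 + h * h * L / 2) * norm_vec d (\<lambda>i. y i - y' i)"
proof -
  have "norm_vec d (\<lambda>i. T0 y i - T0 y' i) = norm_vec d (\<lambda>i. 2 * (y i - y' i) - h * h / 2 * (D i y - D i y'))"
    by (rule norm_vec_cong) (simp add: T0_def algebra_simps)
  also have "\<dots> \<le> norm_vec d (\<lambda>i. 2 * (y i - y' i)) + norm_vec d (\<lambda>i. h * h / 2 * (D i y - D i y'))"
    by (rule norm_vec_triangle_diff)
  also have "\<dots> = 2 * norm_vec d (\<lambda>i. y i - y' i) + h * h / 2 * norm_vec d (\<lambda>i. D i y - D i y')"
    unfolding norm_vec_scale by simp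
  also have "\<dots> \<le> 2 * norm_vec d (\<lambda>i. y i - y' i) + h * h / 2 * (L * norm_vec d (\<lambda>i. y i - y' i))"
    by (intro add_left_mono mult_left_mono A2_norm assms) auto
  finally show ?thesis by (simp add: algebra_simps)
qed

lemma T0_lower:
  assumes "y \<in> Rd d" "y' \<in> Rd d"
  shows "(2 - h * h * L / 2) * norm_vec d (\<lambda>i. y i - y' i) \<le> norm_vec d (\<lambda>i. T0 y i - T0 y' i)"
proof -
  have "2 * norm_vec d (\<lambda>i. y i - y' i) = norm_vec d (\<lambda>i. 2 * (y i - y' i))"
    unfolding norm_vec_scale by simp
  also have "\<dots> = norm_vec d (\<lambda>i. (T0 y i - T0 y' i) + h * h / 2 * (D i y - D i y'))"
    by (rule norm_vec_cong) (simp add: T0_def algebra_simps)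
  also have "\<dots> \<le> norm_vec d (\<lambda>i. T0 y i - T0 y' i) + norm_vec d (\<lambda>i. h * h / 2 * (D i y - D i y'))"
    by (rule norm_vec_triangle)
  also have "norm_vec d (\<lambda>i. h * h / 2 * (D i y - D i y')) = h * h / 2 * norm_vec d (\<lambda>i. D i y - D i y')"
    unfolding norm_vec_scale by simp
  also have "\<dots> \<le> h * h / 2 * (L * norm_vec d (\<lambda>i. y i - y' i))"
    by (intro mult_left_mono A2_norm assms) auto
  finally show ?thesis by (simp add: algebra_simps)
qed

text \<open>Banach iteration for y = (q + h^2 / 2 grad U(y)) / 2. The contraction factor h^2 L / 4
  is relaxed to 1 / 2, and the limit is taken coordinate by coordinate.\<close>

lemma T0_surj:
  assumes q: "q \<in> Rd d"
  shows "\<exists>y\<in>Rd d. \<forall>i<d. T0 y i = q i"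
proof -
  define g where "g y = (\<lambda>i\<in>{..<d}. (q i + h * h / 2 * D i y) / 2)" for y
  define y where "y n = (g ^^ n) (zero_vec d)" for n
  have yS: "y (Suc n) = g (y n)" for n by (simp add: y_def)
  have yR: "y n \<in> Rd d" for n by (cases n) (auto simp: y_def g_def)
  have gl: "norm_vec d (\<lambda>i. g a i - g b i) \<le> 1 / 2 * norm_vec d (\<lambda>i. a i - b i)" if "a \<in> Rd d" "b \<in> Rd d" for a b
  proof -
    have "norm_vec d (\<lambda>i. g a i - g b i) = norm_vec d (\<lambda>i. (h * h / 4) * (D i a - D i b))"
      by (rule norm_vec_cong) (simp add: g_def field_simps)
    also have "\<dots> = h * h / 4 * norm_vec d (\<lambda>i. D i a - D i b)" unfolding norm_vec_scale by simp
    also have "\<dots> \<le> h * h / 4 * (L * norm_vec d (\<lambda>i. a i - b i))"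
      by (intro mult_left_mono A2_norm that) auto
    also have "\<dots> = (h * h * L / 4) * norm_vec d (\<lambda>i. a i - b i)" by simp
    also have "\<dots> \<le> 1 / 2 * norm_vec d (\<lambda>i. a i - b i)"
      by (rule mult_right_mono[OF _ norm_vec_nonneg]) (use hhL in linarith)
    finally show ?thesis .
  qed
  define c where "c = norm_vec d (\<lambda>i. y (Suc 0) i - y 0 i)"
  have inc: "norm_vec d (\<lambda>i. y (Suc n) i - y n i) \<le> c * (1 / 2) ^ n" for n
  proof (induction n)
    case (Suc n)
    have "norm_vec d (\<lambda>i. y (Suc (Suc n)) i - y (Suc n) i) \<le> 1 / 2 * norm_vec d (\<lambda>i. y (Suc n) i - y n i)"
      using gl[OF yR[of "Suc n"] yR[of n]] unfolding yS[symmetric] .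
    also have "\<dots> \<le> 1 / 2 * (c * (1 / 2) ^ n)" using Suc by simp
    finally show ?case by simp
  qed (simp add: c_def)
  have conv: "convergent (\<lambda>n. y n i)" if "i < d" for i
    by (rule geometric_increments_converge[of _ c])
      (rule order_trans[OF norm_vec_component[OF that, of "\<lambda>i. y (Suc _) i - y _ i"] inc])
  define z where "z = (\<lambda>i\<in>{..<d}. lim (\<lambda>n. y n i))"
  have zR: "z \<in> Rd d" by (simp add: z_def)
  have zi: "(\<lambda>n. y n i) \<longlonglongrightarrow> z i" if "i < d" for i
    using conv[OF that] that by (simp add: z_def convergent_LIMSEQ_iff)
  have yz: "y \<longlonglongrightarrow> z"
  proof (rule tendsto_componentwise_fun)
    fix i show "(\<lambda>n. y n i) \<longlonglongrightarrow> z i"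
    proof (cases "i < d")
      case False
      then show ?thesis using Rd_undefined[OF yR] Rd_undefined[OF zR] by simp
    qed (rule zi)
  qed
  have "T0 z i = q i" if i: "i < d" for i
  proof -
    have "continuous_on (Rd d) (D i)" using C3 i by simp
    then have "(\<lambda>n. D i (y n)) \<longlonglongrightarrow> D i z"
      by (rule continuous_on_tendsto_compose[OF _ yz zR]) (simp add: yR)
    then have "(\<lambda>n. (q i + h * h / 2 * D i (y n)) / 2) \<longlonglongrightarrow> (q i + h * h / 2 * D i z) / 2"
      by (intro tendsto_intros) auto
    moreover have "(\<lambda>n. y (Suc n) i) = (\<lambda>n. (q i + h * h / 2 * D i (y n)) / 2)"
      using i by (simp add: yS g_def)
    moreover have "(\<lambda>n. y (Suc n) i) \<longlonglongrightarrow> z i" by (rule LIMSEQ_Suc[OF zi[OF i]])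
    ultimately have "z i = (q i + h * h / 2 * D i z) / 2" using LIMSEQ_unique by metis
    then show ?thesis by (simp add: T0_def field_simps)
  qed
  then show ?thesis using zR by blast
qed

definition S :: "rvec \<Rightarrow> rvec" where
  "S q = (SOME y. y \<in> Rd d \<and> (\<forall>i<d. T0 y i = q i))"

lemma S:
  assumes "q \<in> Rd d"
  shows "S q \<in> Rd d" "i < d \<Longrightarrow> T0 (S q) i = q i"
proof -
  have "\<exists>y. y \<in> Rd d \<and> (\<forall>i<d. T0 y i = q i)" using T0_surj[OF assms] by blast
  from someI_ex[OF this] show "S q \<in> Rd d" "i < d \<Longrightarrow> T0 (S q) i = q i"
    unfolding S_def by blast+
qed

lemma T0_expands:
  assumes "y \<in> Rd d" "y' \<in> Rd d"
  shows "norm_vec d (\<lambda>i. y i - y' i) \<le> norm_vec d (\<lambda>i. T0 y i - T0 y' i)"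
proof -
  have "1 * norm_vec d (\<lambda>i. y i - y' i) \<le> (2 - h * h * L / 2) * norm_vec d (\<lambda>i. y i - y' i)"
    using hhL by (intro mult_right_mono) auto
  then show ?thesis using T0_lower[OF assms] by simp
qed

lemma S_nonexpansive:
  assumes "q \<in> Rd d" "q' \<in> Rd d"
  shows "norm_vec d (\<lambda>i. S q i - S q' i) \<le> norm_vec d (\<lambda>i. q i - q' i)"
proof -
  have "norm_vec d (\<lambda>i. T0 (S q) i - T0 (S q') i) = norm_vec d (\<lambda>i. q i - q' i)"
    by (rule norm_vec_cong) (simp add: S assms)
  then show ?thesis using T0_expands[OF S(1)[OF assms(1)] S(1)[OF assms(2)]] by simp
qed

text \<open>The choice by \<open>SOME\<close> says nothing about measurability; nonexpansiveness
  supplies it by making every coordinate continuous.\<close>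

lemma S_measurable [measurable]: "S \<in> lebesgue_Rd d \<rightarrow>\<^sub>M lebesgue_Rd d"
proof -
  have "(\<lambda>q. \<lambda>i\<in>{..<d}. S q i) \<in> lebesgue_Rd d \<rightarrow>\<^sub>M lebesgue_Rd d"
  proof (intro measurable_Rd_restrict continuous_on_Rd_measurable Lipschitz_continuous_on_Rd[where c = 1])
    fix i x y assume i: "i < d" "x \<in> Rd d" "y \<in> Rd d"
    show "\<bar>S x i - S y i\<bar> \<le> 1 * norm_vec d (\<lambda>i. x i - y i)"
      using norm_vec_component[OF i(1), of "\<lambda>i. S x i - S y i"] S_nonexpansive[OF i(2,3)] by linarith
  qed
  then show ?thesis
    by (rule measurable_cong[THEN iffD1, rotated]) (use S(1) restrict_Rd in force)
qed

text \<open>\<open>match z z'\<close> transports the noise of a step from \<open>z\<close> to noise for a step from \<open>z'\<close> that reaches the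
  same position; the new position is \<open>T0 (mid z) - x\<close>.\<close>
definition other_mid :: "phase \<Rightarrow> phase \<Rightarrow> rvec \<Rightarrow> rvec" where
  "other_mid z z' b = S (\<lambda>i\<in>{..<d}. T0 (mid (O1 b z)) i + (fst z' i - fst z i))"

definition match :: "phase \<Rightarrow> phase \<Rightarrow> rvec \<Rightarrow> rvec" where
  "match z z' b = (\<lambda>i\<in>{..<d}. (2 / h * (other_mid z z' b i - fst z' i) - \<eta> * snd z' i) / \<sigma>)"

lemma other_mid:
  shows "other_mid z z' b \<in> Rd d" "i < d \<Longrightarrow> T0 (other_mid z z' b) i = T0 (mid (O1 b z)) i + (fst z' i - fst z i)"
  unfolding other_mid_def by (simp_all add: S)

lemma mid_O1: "i < d \<Longrightarrow> mid (O1 b z) i = fst z i + h / 2 * (\<eta> * snd z i + \<sigma> * b i)"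
  by (simp add: mid_nth snd_O1)

lemma mid_match:
  assumes "z' \<in> space PS"
  shows "mid (O1 (match z z' b) z') = other_mid z z' b"
  by (rule Rd_eqI[OF mid_R other_mid(1)])
    (use \<sigma>_pos h_pos in \<open>simp add: mid_O1 match_def field_simps\<close>)

lemma match_R: "match z z' b \<in> Rd d"
  by (simp add: match_def)

lemma match_measurable:
  assumes "z \<in> space PS" "z' \<in> space PS"
  shows "match z z' \<in> lebesgue_Rd d \<rightarrow>\<^sub>M lebesgue_Rd d"
proof -
  have [measurable]: "(\<lambda>b. mid (O1 b z)) \<in> lebesgue_Rd d \<rightarrow>\<^sub>M lebesgue_Rd d"
  proof -
    have "(\<lambda>b. \<lambda>i\<in>{..<d}. fst z i + h / 2 * (\<eta> * snd z i + \<sigma> * b i)) \<in> lebesgue_Rd d \<rightarrow>\<^sub>M lebesgue_Rd d"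
      by (rule measurable_Rd_restrict) measurable
    moreover have "(\<lambda>b. mid (O1 b z)) = (\<lambda>b. \<lambda>i\<in>{..<d}. fst z i + h / 2 * (\<eta> * snd z i + \<sigma> * b i))"
      by (rule ext, rule Rd_eqI[OF mid_R restrict_in_Rd]) (simp add: mid_O1)
    ultimately show ?thesis by simp
  qed
  have [measurable]: "other_mid z z' \<in> lebesgue_Rd d \<rightarrow>\<^sub>M lebesgue_Rd d"
    unfolding other_mid_def[abs_def] T0_def
    by (rule measurable_compose[OF _ S_measurable], rule measurable_Rd_restrict) measurable
  show ?thesis unfolding match_def[abs_def] by (rule measurable_Rd_restrict) measurable
qed

text \<open>Ratio of the upper to the lower Lipschitz constant of \<open>T0\<close>, which bounds
  the distortion of the noise under \<open>match\<close>.\<close>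

definition \<l> :: real where "\<l> = (2 + h * h * L / 2) / (2 - h * h * L / 2)"

lemma \<l>_pos: "\<l> > 0"
proof -
  have "0 < h * h * L" using h_pos L_pos by simp
  then show ?thesis using hhL by (simp add: \<l>_def add_pos_pos)
qed

lemma norm_noise_diff:
  "norm_vec d (\<lambda>i. b i - b' i) = 2 / (h * \<sigma>) * norm_vec d (\<lambda>i. mid (O1 b z) i - mid (O1 b' z) i)"
proof -
  have "norm_vec d (\<lambda>i. b i - b' i) = norm_vec d (\<lambda>i. 2 / (h * \<sigma>) * (mid (O1 b z) i - mid (O1 b' z) i))"
  proof (rule norm_vec_cong)
    fix i assume i: "i < d"
    show "b i - b' i = 2 / (h * \<sigma>) * (mid (O1 b z) i - mid (O1 b' z) i)"
      using h_pos \<sigma>_pos by (simp add: mid_O1[OF i] field_simps)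
  qed
  also have "\<dots> = 2 / (h * \<sigma>) * norm_vec d (\<lambda>i. mid (O1 b z) i - mid (O1 b' z) i)"
    unfolding norm_vec_scale using h_pos \<sigma>_pos by simp
  finally show ?thesis .
qed

text \<open>The hypothesis \<open>key\<close> of \<open>gaussian_compare\<close>, with
  \<open>match z' z\<close> in the role of \<Psi>. Passing from noise to midpoints scales distances
  equally on both sides, and the values of \<open>T0\<close> on the two sides differ by a fixed
  translation, so only its two Lipschitz constants enter.\<close>

lemma match_key:
  assumes z: "z \<in> space PS" and z': "z' \<in> space PS" and b: "b \<in> Rd d" and u: "u \<in> Rd d"
  shows "norm_vec d (\<lambda>i. b i - match z' z u i) \<le> \<l> * norm_vec d (\<lambda>i. match z z' b i - u i)"
proof -
  define A B A2 B2 where "A = mid (O1 b z)" and "B = mid (O1 (match z' z u) z)"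
    and "A2 = mid (O1 (match z z' b) z')" and "B2 = mid (O1 u z')"
  have R: "A \<in> Rd d" "B \<in> Rd d" "A2 \<in> Rd d" "B2 \<in> Rd d" by (simp_all add: A_def B_def A2_def B2_def)
  have TA: "T0 A2 i = T0 A i + (fst z' i - fst z i)" if "i < d" for i
    unfolding A2_def A_def mid_match[OF z'] using other_mid(2)[OF that] .
  have TB: "T0 B i = T0 B2 i + (fst z i - fst z' i)" if "i < d" for i
    unfolding B2_def B_def mid_match[OF z] using other_mid(2)[OF that] .
  have eq: "norm_vec d (\<lambda>i. T0 A i - T0 B i) = norm_vec d (\<lambda>i. T0 A2 i - T0 B2 i)"
    by (rule norm_vec_cong) (simp add: TA TB)
  have pos: "2 - h * h * L / 2 > 0" using hhL by simp
  have "(2 - h * h * L / 2) * norm_vec d (\<lambda>i. A i - B i) \<le> (2 + h * h * L / 2) * norm_vec d (\<lambda>i. A2 i - B2 i)"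
    using T0_lower[OF R(1,2)] T0_upper[OF R(3,4)] eq by linarith
  then have "norm_vec d (\<lambda>i. A i - B i) \<le> \<l> * norm_vec d (\<lambda>i. A2 i - B2 i)"
    unfolding \<l>_def times_divide_eq_left pos_le_divide_eq[OF pos] by (simp only: mult.commute)
  then have "2 / (h * \<sigma>) * norm_vec d (\<lambda>i. A i - B i) \<le> 2 / (h * \<sigma>) * (\<l> * norm_vec d (\<lambda>i. A2 i - B2 i))"
    using h_pos \<sigma>_pos by (intro mult_left_mono) auto
  then show ?thesis
    unfolding norm_noise_diff[of b "match z' z u" z] norm_noise_diff[of "match z z' b" u z']
    by (simp add: A_def B_def A2_def B2_def mult.left_commute)
qed

lemma other_mid_close:
  "norm_vec d (\<lambda>i. other_mid z z' b i - mid (O1 b z) i) \<le> norm_vec d (\<lambda>i. fst z i - fst z' i)"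
proof -
  have "norm_vec d (\<lambda>i. other_mid z z' b i - mid (O1 b z) i) \<le> norm_vec d (\<lambda>i. T0 (other_mid z z' b) i - T0 (mid (O1 b z)) i)"
    by (rule T0_expands) (simp_all add: other_mid)
  also have "\<dots> = norm_vec d (\<lambda>i. fst z' i - fst z i)"
    by (rule norm_vec_cong) (simp add: other_mid)
  finally show ?thesis unfolding norm_vec_minus_commute[of d "fst z'" "fst z"] .
qed

text \<open>A bound on how far \<open>match\<close> moves the noise. The position difference counts
  twice with weight 2 / h, once for the different start and once for the shifted midpoint; dividing
  by \<sigma> converts velocity into noise.\<close>

definition gap :: "phase \<Rightarrow> phase \<Rightarrow> real" where
  "gap z z' = (4 / h * norm_vec d (\<lambda>i. fst z i - fst z' i) + norm_vec d (\<lambda>i. snd z i - snd z' i)) / \<sigma>"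

lemma gap_nonneg: "gap z z' \<ge> 0"
  using h_pos \<sigma>_pos by (simp add: gap_def)

lemma match_close: "norm_vec d (\<lambda>i. match z z' b i - b i) \<le> gap z z'"
proof -
  let ?m = "\<lambda>i. other_mid z z' b i - mid (O1 b z) i"
  have "norm_vec d (\<lambda>i. match z z' b i - b i)
    = norm_vec d (\<lambda>i. 1 / \<sigma> * ((2 / h * ?m i + 2 / h * (fst z i - fst z' i)) + \<eta> * (snd z i - snd z' i)))"
  proof (rule norm_vec_cong)
    fix i assume i: "i < d"
    show "match z z' b i - b i = 1 / \<sigma> * ((2 / h * ?m i + 2 / h * (fst z i - fst z' i)) + \<eta> * (snd z i - snd z' i))"
      using i h_pos \<sigma>_pos by (simp add: match_def mid_O1 field_simps)
  qed
  also have "\<dots> = 1 / \<sigma> * norm_vec d (\<lambda>i. (2 / h * ?m i + 2 / h * (fst z i - fst z' i)) + \<eta> * (snd z i - snd z' i))"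
    unfolding norm_vec_scale using \<sigma>_pos by simp
  also have "\<dots> \<le> 1 / \<sigma> * ((norm_vec d (\<lambda>i. 2 / h * ?m i) + norm_vec d (\<lambda>i. 2 / h * (fst z i - fst z' i))) + norm_vec d (\<lambda>i. \<eta> * (snd z i - snd z' i)))"
    using \<sigma>_pos by (intro mult_left_mono order_trans[OF norm_vec_triangle] add_mono norm_vec_triangle order_refl) auto
  also have "\<dots> = 1 / \<sigma> * ((2 / h * norm_vec d ?m + 2 / h * norm_vec d (\<lambda>i. fst z i - fst z' i)) + \<eta> * norm_vec d (\<lambda>i. snd z i - snd z' i))"
    unfolding norm_vec_scale using h_pos \<eta>_pos by simp
  also have "\<dots> \<le> 1 / \<sigma> * ((2 / h * norm_vec d (\<lambda>i. fst z i - fst z' i) + 2 / h * norm_vec d (\<lambda>i. fst z i - fst z' i)) + 1 * norm_vec d (\<lambda>i. snd z i - snd z' i))"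
    using h_pos \<sigma>_pos \<eta>2_bounds(4) by (intro mult_left_mono add_mono mult_right_mono other_mid_close) auto
  also have "\<dots> = gap z z'" by (simp add: gap_def algebra_simps add_divide_distrib)
  finally show ?thesis .
qed

text \<open>Positions agree exactly, while a velocity difference remains; the second refreshment of
  the step removes it through \<open>Oop_velocity_shift\<close>.\<close>

lemma match_position:
  assumes z: "z \<in> space PS" and z': "z' \<in> space PS"
  shows "fst (\<theta> (O1 (match z z' b) z')) = fst (\<theta> (O1 b z))"
    and "norm_vec d (\<lambda>i. vel (O1 b z) i - vel (O1 (match z z' b) z') i) \<le> 2 / h * norm_vec d (\<lambda>i. fst z i - fst z' i)"
proof -
  have pos: "fst (\<theta> (O1 b z)) i = T0 (mid (O1 b z)) i - fst z i" if "i < d" for b z i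
    using that by (simp add: fst_\<theta> vel_nth snd_O1 T0_def mid_O1 field_simps)
  have vl: "vel (O1 b z) i = 2 / h * (T0 (mid (O1 b z)) i - fst z i - mid (O1 b z) i)" if "i < d" for b z i
    using that h_pos by (simp add: vel_nth snd_O1 T0_def mid_O1 field_simps)
  show "fst (\<theta> (O1 (match z z' b) z')) = fst (\<theta> (O1 b z))"
  proof (rule Rd_eqI[of _ d])
    fix i assume i: "i < d"
    show "fst (\<theta> (O1 (match z z' b) z')) i = fst (\<theta> (O1 b z)) i"
      unfolding pos[OF i] mid_match[OF z'] other_mid(2)[OF i] by simp
  qed (simp_all add: \<theta>_eq)
  have "norm_vec d (\<lambda>i. vel (O1 b z) i - vel (O1 (match z z' b) z') i) = norm_vec d (\<lambda>i. 2 / h * (other_mid z z' b i - mid (O1 b z) i))"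
  proof (rule norm_vec_cong)
    fix i assume i: "i < d"
    show "vel (O1 b z) i - vel (O1 (match z z' b) z') i = 2 / h * (other_mid z z' b i - mid (O1 b z) i)"
      unfolding vl[OF i] mid_match[OF z'] other_mid(2)[OF i] by (simp add: algebra_simps)
  qed
  also have "\<dots> = 2 / h * norm_vec d (\<lambda>i. other_mid z z' b i - mid (O1 b z) i)"
    unfolding norm_vec_scale using h_pos by simp
  also have "\<dots> \<le> 2 / h * norm_vec d (\<lambda>i. fst z i - fst z' i)"
    using h_pos by (intro mult_left_mono other_mid_close) auto
  finally show "norm_vec d (\<lambda>i. vel (O1 b z) i - vel (O1 (match z z' b) z') i) \<le> 2 / h * norm_vec d (\<lambda>i. fst z i - fst z' i)" .
qed

section \<open>Dependence of the unadjusted step on its starting point\<close>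

lemma Oop_le: "(\<And>z. z \<in> space PS \<Longrightarrow> f z \<le> a) \<Longrightarrow> z \<in> space PS \<Longrightarrow> Oop f z \<le> a"
proof -
  assume f: "\<And>z. z \<in> space PS \<Longrightarrow> f z \<le> a" and z: "z \<in> space PS"
  have "Oop f z \<le> (\<integral>\<^sup>+ b. a \<partial>std_gaussian d)"
    unfolding Oop_def using f O1_space[OF z] by (intro nn_integral_mono) auto
  then show ?thesis by simp
qed

text \<open>A velocity difference is a translation of the refreshment noise, so
  \<open>gaussian_compare\<close> applies with distortion 1.\<close>

lemma Oop_velocity_shift:
  assumes f [measurable]: "f \<in> borel_measurable PS" and a: "a \<ge> 0" "\<And>z. z \<in> space PS \<Longrightarrow> f z \<le> ennreal a"
    and x: "x \<in> Rd d" and v: "v \<in> Rd d" "v' \<in> Rd d" and e: "norm_vec d (\<lambda>i. v i - v' i) / \<sigma> \<le> e"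
  shows "Oop f (x, v) \<le> Oop f (x, v') + ennreal (a * (e * sqrt d + e\<^sup>2 / 2))"
proof -
  define s where "s = (\<lambda>i. \<eta> * (v i - v' i) / \<sigma>)"
  define F where "F b = f (O1 b (x, v'))" for b
  have F [measurable]: "F \<in> borel_measurable (lebesgue_Rd d)"
  proof -
    have [measurable]: "(\<lambda>b. O1 b (x, v')) \<in> lebesgue_Rd d \<rightarrow>\<^sub>M PS"
      unfolding O1_eq using x v by (intro measurable_phase_Pair measurable_Rd_restrict) auto
    show ?thesis unfolding F_def by measurable
  qed
  have sh: "O1 b (x, v) = O1 (\<lambda>i\<in>{..<d}. b i + s i) (x, v')" for b
    unfolding O1_eq using \<sigma>_pos by (auto simp: s_def fun_eq_iff field_simps)
  have "Oop f (x, v) = (\<integral>\<^sup>+ b. F (\<lambda>i\<in>{..<d}. b i + s i) \<partial>std_gaussian d)"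
    by (simp add: Oop_def F_def sh)
  also have "\<dots> \<le> ennreal (1 ^ d) * (\<integral>\<^sup>+ b. F b \<partial>std_gaussian d) + ennreal (a * (e * sqrt d + e\<^sup>2 / 2))"
  proof (rule gaussian_compare[OF d_pos _ _ zero_less_one, where \<Psi> = "\<lambda>u. \<lambda>i\<in>{..<d}. u i - s i"])
    show "(\<lambda>b. \<lambda>i\<in>{..<d}. b i + s i) \<in> lebesgue_Rd d \<rightarrow>\<^sub>M lebesgue_Rd d"
      by (rule measurable_Rd_restrict) measurable
    show "norm_vec d (\<lambda>i. b i - (\<lambda>i\<in>{..<d}. u i - s i) i) \<le> 1 * norm_vec d (\<lambda>i. (\<lambda>i\<in>{..<d}. b i + s i) i - u i)" for b u
      unfolding mult_1_left by (rule eq_refl, rule norm_vec_cong) simp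
    have n: "norm_vec d (\<lambda>i. v i - v' i) / \<sigma> \<ge> 0" using \<sigma>_pos by simp
    then show "0 \<le> e" using e by linarith
    show "norm_vec d (\<lambda>i. (\<lambda>i\<in>{..<d}. b i + s i) i - b i) \<le> e" for b
    proof -
      have "norm_vec d (\<lambda>i. (\<lambda>i\<in>{..<d}. b i + s i) i - b i) = norm_vec d (\<lambda>i. \<eta> / \<sigma> * (v i - v' i))"
        by (rule norm_vec_cong) (simp add: s_def)
      also have "\<dots> = \<eta> * (norm_vec d (\<lambda>i. v i - v' i) / \<sigma>)"
        unfolding norm_vec_scale using \<eta>_pos \<sigma>_pos by simp
      also have "\<dots> \<le> 1 * (norm_vec d (\<lambda>i. v i - v' i) / \<sigma>)"
        using \<eta>2_bounds(4) n by (intro mult_right_mono) auto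
      finally show ?thesis using e by linarith
    qed
    show "F b \<le> ennreal a" if "b \<in> Rd d" for b
      unfolding F_def using x v by (intro a O1_space) auto
  qed (use a in auto)
  finally show ?thesis by (simp add: Oop_def F_def)
qed

text \<open>\<l>^d is at most exp of this quantity, which therefore has to be small even for large
  d.\<close>

definition small :: real where "small = d * (h * h * L)"

lemma \<l>_power: 
  assumes "small \<le> 1 / 32"
  shows "\<l> ^ d \<le> 1 + 1 / 8"
proof -
  have hp: "0 < h * h * L" using h_pos L_pos by simp
  have "(2 + s / 2) / (2 - s / 2) \<le> 1 + s" if s: "0 < s" "s \<le> 1 / 10000" for s :: real
  proof -
    have "s * s \<le> s * 1" using s by (intro mult_left_mono) auto
    moreover have "(1 + s) * (2 - s / 2) = 2 + 3 / 2 * s - s * s / 2" by (simp add: field_simps)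
    ultimately have "2 + s / 2 \<le> (1 + s) * (2 - s / 2)" using s by linarith
    then show ?thesis using s by (subst pos_divide_le_eq) auto
  qed
  from this[OF hp hhL] have "\<l> \<le> 1 + h * h * L" unfolding \<l>_def .
  also have "\<dots> \<le> exp (h * h * L)" by (rule exp_ge_add_one_self)
  finally have "\<l> ^ d \<le> exp (h * h * L) ^ d" using \<l>_pos by (intro power_mono) auto
  also have "\<dots> = exp small" by (simp add: small_def exp_of_nat_mult[symmetric])
  also have "\<dots> \<le> 1 + 2 * small"
    using exp_bound_lemma[of small] assms hp by (simp add: small_def)
  finally show ?thesis using assms by simp
qed

text \<open>The first noise aligns the positions through \<open>match\<close>, the second aligns the
  velocities. Distortion of volume causes the 1 / 8, the two displacements cause the term linear in
  \<open>gap\<close>. The constant part does not vanish as z' approaches z, which is harmless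
  because oscillations only have to be halved.\<close>

lemma Top_regularise:
  assumes f [measurable]: "f \<in> borel_measurable PS" and a: "a \<ge> 0" "\<And>z. z \<in> space PS \<Longrightarrow> f z \<le> ennreal a"
    and z: "z \<in> space PS" and z': "z' \<in> space PS" and small: "small \<le> 1 / 32"
  shows "Top f z \<le> Top f z' + ennreal (a * (1 / 8 + 3 * gap z z' * sqrt d))"
proof (cases "gap z z' * sqrt d \<le> 1")
  \<comment> \<open>For a large gap the error term already exceeds the bound a on f.\<close>
  case False
  have "Top f z \<le> ennreal a"
    unfolding Top_def using z \<theta>_space by (intro Oop_le a) auto
  also have "\<dots> \<le> ennreal (a * (1 / 8 + 3 * gap z z' * sqrt d))"
    using a(1) False mult_left_mono[of 1 "1 / 8 + 3 * gap z z' * sqrt d" a] by (intro ennreal_leI) auto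
  finally show ?thesis by (rule order_trans) simp
next
  case True
  define E where "E = gap z z'"
  have E: "0 \<le> E" "E * sqrt d \<le> 1" using gap_nonneg True by (auto simp: E_def)
  have sd: "sqrt d \<ge> 1" using d_pos by simp
  \<comment> \<open>E sqrt d \<le> 1 and d \<ge> 1 force E \<le> 1, so the linear error dominates
    the quadratic one.\<close>
  have E1: "E\<^sup>2 \<le> E * sqrt d"
  proof -
    have "E * 1 \<le> E * sqrt d" using E sd by (intro mult_left_mono) auto
    then have "E * E \<le> E * 1" using E by (intro mult_left_mono) auto
    then show ?thesis using \<open>E * 1 \<le> E * sqrt d\<close> by (simp add: power2_eq_square)
  qed
  define G where "G b = Oop f (\<theta> (O1 b z'))" for b
  have [measurable]: "(\<lambda>b. O1 b z') \<in> lebesgue_Rd d \<rightarrow>\<^sub>M PS" "(\<lambda>b. O1 b z) \<in> lebesgue_Rd d \<rightarrow>\<^sub>M PS"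
    unfolding O1_eq using z z' by (auto intro!: measurable_phase_Pair measurable_Rd_restrict simp: mem_Times_iff)
  have G [measurable]: "G \<in> borel_measurable (lebesgue_Rd d)" unfolding G_def by measurable
  have m [measurable]: "match z z' \<in> lebesgue_Rd d \<rightarrow>\<^sub>M lebesgue_Rd d" by (rule match_measurable[OF z z'])
  have Ga: "G b \<le> ennreal a" for b unfolding G_def using \<theta>_space by (intro Oop_le a) auto
  let ?e = "a * (E * sqrt d + E\<^sup>2 / 2)"
  have "Top f z = (\<integral>\<^sup>+ b. Oop f (\<theta> (O1 b z)) \<partial>std_gaussian d)" by (simp add: Top_def Oop_def[of "\<lambda>z. Oop f (\<theta> z)"])
  also have "\<dots> \<le> (\<integral>\<^sup>+ b. G (match z z' b) + ennreal ?e \<partial>std_gaussian d)"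
  proof (rule nn_integral_mono)
    fix b
    have e: "norm_vec d (\<lambda>i. vel (O1 b z) i - vel (O1 (match z z' b) z') i) / \<sigma> \<le> E"
    proof -
      have "norm_vec d (\<lambda>i. vel (O1 b z) i - vel (O1 (match z z' b) z') i) / \<sigma> \<le> (2 / h * norm_vec d (\<lambda>i. fst z i - fst z' i)) / \<sigma>"
        using \<sigma>_pos by (intro divide_right_mono match_position(2)[OF z z']) auto
      also have "\<dots> \<le> E" unfolding E_def gap_def using \<sigma>_pos h_pos
        by (intro divide_right_mono add_increasing2 mult_right_mono) (auto simp: divide_right_mono)
      finally show ?thesis .
    qed
    have "Oop f (fst (\<theta> (O1 b z)), vel (O1 b z)) \<le> Oop f (fst (\<theta> (O1 b z)), vel (O1 (match z z' b) z')) + ennreal ?e"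
      by (rule Oop_velocity_shift[OF f a _ _ _ e]) (auto simp: \<theta>_eq)
    moreover have "\<theta> (O1 b z) = (fst (\<theta> (O1 b z)), vel (O1 b z))" by (simp add: \<theta>_eq)
    moreover have "\<theta> (O1 (match z z' b) z') = (fst (\<theta> (O1 b z)), vel (O1 (match z z' b) z'))"
      using match_position(1)[OF z z', of b] by (simp add: \<theta>_eq)
    ultimately show "Oop f (\<theta> (O1 b z)) \<le> G (match z z' b) + ennreal ?e" by (simp add: G_def)
  qed
  also have "\<dots> = (\<integral>\<^sup>+ b. G (match z z' b) \<partial>std_gaussian d) + ennreal ?e"
    by (subst nn_integral_add) auto
  finally have 1: "Top f z \<le> (\<integral>\<^sup>+ b. G (match z z' b) \<partial>std_gaussian d) + ennreal ?e" .
  have "(\<integral>\<^sup>+ b. G (match z z' b) \<partial>std_gaussian d) \<le> ennreal (\<l> ^ d) * (\<integral>\<^sup>+ b. G b \<partial>std_gaussian d) + ennreal ?e"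
    by (rule gaussian_compare[OF d_pos m match_R \<l>_pos match_key[OF z z'] E(1) _ G a(1) Ga])
      (auto simp: E_def match_close)
  also have "(\<integral>\<^sup>+ b. G b \<partial>std_gaussian d) = Top f z'" by (simp add: G_def Top_def Oop_def[of "\<lambda>z. Oop f (\<theta> z)"])
  also have "ennreal (\<l> ^ d) * Top f z' \<le> ennreal (1 + 1 / 8) * Top f z'"
    by (intro mult_right_mono ennreal_leI \<l>_power[OF small]) simp
  also have "ennreal (1 + 1 / 8) * Top f z' = Top f z' + ennreal (1 / 8) * Top f z'"
    by (subst ennreal_plus) (auto simp: distrib_right)
  finally have 2: "(\<integral>\<^sup>+ b. G (match z z' b) \<partial>std_gaussian d) \<le> Top f z' + ennreal (1 / 8) * Top f z' + ennreal ?e"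
    by (simp add: add_right_mono)
  have "Top f z' \<le> ennreal a" unfolding Top_def using z' \<theta>_space by (intro Oop_le a) auto
  then have 3: "ennreal (1 / 8) * Top f z' \<le> ennreal (1 / 8) * ennreal a" by (rule mult_left_mono) simp
  have "Top f z \<le> (Top f z' + ennreal (1 / 8) * Top f z' + ennreal ?e) + ennreal ?e"
    by (rule order_trans[OF 1 add_right_mono[OF 2]])
  also have "\<dots> \<le> (Top f z' + ennreal (1 / 8) * ennreal a + ennreal ?e) + ennreal ?e"
    by (intro add_right_mono add_left_mono 3)
  also have "\<dots> = Top f z' + ennreal (a / 8 + ?e + ?e)"
    using a(1) E by (simp add: ennreal_mult'[symmetric] ennreal_plus[symmetric] add.assoc del: ennreal_plus)
  also have "\<dots> \<le> Top f z' + ennreal (a * (1 / 8 + 3 * gap z z' * sqrt d))"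
  proof (intro add_left_mono ennreal_leI)
    have "a * (2 * (E * sqrt d + E\<^sup>2 / 2)) \<le> a * (3 * (E * sqrt d))" using E1 a(1) by (intro mult_left_mono) auto
    then show "a / 8 + ?e + ?e \<le> a * (1 / 8 + 3 * gap z z' * sqrt d)" by (simp add: E_def algebra_simps)
  qed
  finally show ?thesis .
qed

section \<open>Comparison of \<open>V\<close> with the Euclidean distance and with the
  energy\<close>

lemma \<alpha>_bounds: "\<alpha> \<le> 2 * (\<eta> * \<beta>)" "\<alpha> > 0"
  proof -
    show "\<alpha> > 0" using \<eta>2_less h_pos \<eta>_pos by (simp add: \<alpha>_def)
    have "h / 2 \<le> \<beta>"
    proof -
      have "h / 2 \<le> 1 / 20 / \<gamma>" using \<gamma>h \<gamma>_pos by (simp add: field_simps)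
      also have "\<dots> \<le> 19 / 20 / \<gamma>" using \<gamma>_pos by (intro divide_right_mono) auto
      finally show ?thesis using \<beta>_bounds(1) by linarith
    qed
    then show "\<alpha> \<le> 2 * (\<eta> * \<beta>)" using \<alpha>\<beta> mult_left_mono[of "h / 2" \<beta> \<eta>] \<eta>_pos by (simp add: mult.commute)
  qed

text \<open>The factor 1 / (h \<sigma>) is large, but it multiplies a distance that decays
  exponentially, so it lengthens an epoch only by a logarithmic factor.\<close>

lemma gap_le_V: "gap z z' \<le> 20 / (h * \<sigma>) * sqrt (V z z')"
proof -
  define s where "s = sqrt (V z z')"
  have W: "(\<Sum>i<d. (wco z i - wco z' i)\<^sup>2) + (\<Sum>i<d. (pco z i - pco z' i)\<^sup>2) = s\<^sup>2"
    unfolding s_def using V_nonneg[of z z'] by (simp add: V_def sum.distrib)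
  have s0: "s \<ge> 0" using V_nonneg by (simp add: s_def)
  have Wn: "0 \<le> (\<Sum>i<d. (wco z i - wco z' i)\<^sup>2)" "0 \<le> (\<Sum>i<d. (pco z i - pco z' i)\<^sup>2)"
    by (simp_all add: sum_nonneg)
  have nw: "norm_vec d (\<lambda>i. wco z i - wco z' i) \<le> s"
    by (rule power2_le_imp_le[OF _ s0]) (use W Wn in \<open>unfold norm_vec_power2, linarith\<close>)
  have np: "norm_vec d (\<lambda>i. pco z i - pco z' i) \<le> s"
    by (rule power2_le_imp_le[OF _ s0]) (use W Wn in \<open>unfold norm_vec_power2, linarith\<close>)
  have eb: "\<eta> * \<beta> > 0" using \<eta>_pos \<beta>_bounds by simp
  have nv: "\<eta> * \<beta> * norm_vec d (\<lambda>i. snd z i - snd z' i) \<le> s"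
  proof -
    have "\<eta> * \<beta> * norm_vec d (\<lambda>i. snd z i - snd z' i) = norm_vec d (\<lambda>i. \<eta> * \<beta> * (snd z i - snd z' i))"
      unfolding norm_vec_scale using eb by simp
    also have "\<dots> = norm_vec d (\<lambda>i. pco z i - pco z' i)"
      by (rule norm_vec_cong) (simp add: pco_def algebra_simps)
    finally show ?thesis using np by simp
  qed
  note a2 = \<alpha>_bounds
  have nx: "norm_vec d (\<lambda>i. fst z i - fst z' i) \<le> 3 * s"
  proof -
    have "norm_vec d (\<lambda>i. fst z i - fst z' i) = norm_vec d (\<lambda>i. (wco z i - wco z' i) - \<alpha> * (snd z i - snd z' i))"
      by (rule norm_vec_cong) (simp add: wco_def algebra_simps)
    also have "\<dots> \<le> norm_vec d (\<lambda>i. wco z i - wco z' i) + norm_vec d (\<lambda>i. \<alpha> * (snd z i - snd z' i))"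
      by (rule norm_vec_triangle_diff)
    also have "norm_vec d (\<lambda>i. \<alpha> * (snd z i - snd z' i)) = \<alpha> * norm_vec d (\<lambda>i. snd z i - snd z' i)"
      unfolding norm_vec_scale using a2 by simp
    also have "\<dots> \<le> 2 * (\<eta> * \<beta>) * norm_vec d (\<lambda>i. snd z i - snd z' i)" using a2 by (intro mult_right_mono) auto
    also have "\<dots> \<le> 2 * s" using nv by simp
    finally show ?thesis using nw by simp
  qed
  have nv2: "norm_vec d (\<lambda>i. snd z i - snd z' i) \<le> 2 / h * s"
  proof -
    have "h / 2 \<le> \<eta> * \<beta>"
    proof -
      have "h / 2 \<le> 1 / 20 / \<gamma>" using \<gamma>h \<gamma>_pos by (simp add: field_simps)
      also have "\<dots> \<le> 19 / 20 * (19 / 20 / \<gamma>)" using \<gamma>_pos by (simp add: field_simps)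
      also have "\<dots> \<le> \<eta> * \<beta>" using \<beta>_bounds(1) \<eta>2_bounds(3) \<gamma>_pos by (intro mult_mono) auto
      finally show ?thesis .
    qed
    then have "h / 2 * norm_vec d (\<lambda>i. snd z i - snd z' i) \<le> \<eta> * \<beta> * norm_vec d (\<lambda>i. snd z i - snd z' i)"
      by (intro mult_right_mono) auto
    then have "h / 2 * norm_vec d (\<lambda>i. snd z i - snd z' i) \<le> s" using nv by linarith
    then show ?thesis using h_pos by (simp add: field_simps)
  qed
  have "gap z z' \<le> (4 / h * (3 * s) + 2 / h * s) / \<sigma>"
    unfolding gap_def using h_pos \<sigma>_pos by (intro divide_right_mono add_mono mult_left_mono nx nv2) auto
  also have "\<dots> = 14 / (h * \<sigma>) * s" using h_pos \<sigma>_pos by (simp add: field_simps)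
  also have "\<dots> \<le> 20 / (h * \<sigma>) * s" using h_pos \<sigma>_pos s0 by (intro mult_right_mono divide_right_mono) auto
  finally show ?thesis by (simp add: s_def)
qed

lemma \<sigma>_lower: "\<sigma> \<ge> \<gamma> * h / 2"
proof -
  have t: "0 < \<gamma> * h" "\<gamma> * h \<le> 1 / 10" using \<gamma>_pos h_pos \<gamma>h by auto
  have "(\<gamma> * h / 2)\<^sup>2 \<le> 19 / 20 * (\<gamma> * h)"
  proof -
    have "(\<gamma> * h) * (\<gamma> * h) \<le> 1 / 10 * (\<gamma> * h)" using t by (intro mult_right_mono) linarith+
    moreover have "(\<gamma> * h / 2)\<^sup>2 = (\<gamma> * h) * (\<gamma> * h) / 4" by (simp add: power2_eq_square)
    ultimately show ?thesis using t by linarith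
  qed
  also have "\<dots> \<le> \<sigma>\<^sup>2" using \<eta>2_bounds(2) \<eta>\<sigma> by linarith
  finally show ?thesis by (rule power2_le_imp_le) (use \<sigma>_pos in simp)
qed

lemma \<sigma>2_upper: "\<sigma>\<^sup>2 \<le> \<gamma> * h"
  using \<eta>2_bounds(1) \<eta>\<sigma> by linarith

text \<open>Strong convexity bounds positions by sqrt (2 R / K); squared velocities carry a weight
  of order 1 / \<gamma>^2, and \<gamma>^2 \<ge> 100 K.\<close>

lemma V_le_H:
  assumes z: "z \<in> space PS" "H z \<le> R" and z': "z' \<in> space PS" "H z' \<le> R"
  shows "V z z' \<le> 40 * R / K"
proof -
  define e where "e = (\<eta> * \<beta>)\<^sup>2"
  have eb: "\<eta> * \<beta> > 0" using \<eta>_pos \<beta>_bounds by simp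
  have e: "0 \<le> e" "e \<le> 2 / \<gamma>\<^sup>2"
  proof -
    have "\<eta> * \<beta> \<le> 1 * (11 / 10 / \<gamma>)" using \<eta>2_bounds \<beta>_bounds by (intro mult_mono) auto
    then have "e \<le> (11 / 10 / \<gamma>)\<^sup>2" unfolding e_def using eb by (intro power_mono) auto
    also have "\<dots> \<le> 2 / \<gamma>\<^sup>2" using \<gamma>_pos by (simp add: power_divide field_simps)
    finally show "e \<le> 2 / \<gamma>\<^sup>2" .
  qed (simp add: e_def)
  have \<alpha>2: "\<alpha>\<^sup>2 \<le> 4 * e"
  proof -
    have "\<alpha>\<^sup>2 \<le> (2 * (\<eta> * \<beta>))\<^sup>2" using \<alpha>_bounds by (intro power_mono) auto
    then show ?thesis by (simp add: e_def power_mult_distrib)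
  qed
  have sq: "(a - b)\<^sup>2 \<le> 2 * a\<^sup>2 + 2 * b\<^sup>2" for a b :: real
    using zero_le_power2[of "a + b"] by (simp add: power2_eq_square algebra_simps)
  have sq': "(a + b)\<^sup>2 \<le> 2 * a\<^sup>2 + 2 * b\<^sup>2" for a b :: real
    using zero_le_power2[of "a - b"] by (simp add: power2_eq_square algebra_simps)
  have pt: "(wco z i - wco z' i)\<^sup>2 + (pco z i - pco z' i)\<^sup>2
    \<le> 4 * ((fst z i)\<^sup>2 + (fst z' i)\<^sup>2) + 18 * e * ((snd z i)\<^sup>2 + (snd z' i)\<^sup>2)" for i
  proof -
    have "(wco z i - wco z' i)\<^sup>2 = ((fst z i - fst z' i) + \<alpha> * (snd z i - snd z' i))\<^sup>2"
      by (simp add: wco_def algebra_simps)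
    also have "\<dots> \<le> 2 * (fst z i - fst z' i)\<^sup>2 + 2 * (\<alpha> * (snd z i - snd z' i))\<^sup>2" by (rule sq')
    also have "(\<alpha> * (snd z i - snd z' i))\<^sup>2 = \<alpha>\<^sup>2 * (snd z i - snd z' i)\<^sup>2" by (simp add: power_mult_distrib)
    also have "\<dots> \<le> (4 * e) * (snd z i - snd z' i)\<^sup>2" by (intro mult_right_mono \<alpha>2) simp
    finally have 1: "(wco z i - wco z' i)\<^sup>2 \<le> 2 * (fst z i - fst z' i)\<^sup>2 + 8 * (e * (snd z i - snd z' i)\<^sup>2)" by simp
    have 2: "(pco z i - pco z' i)\<^sup>2 = e * (snd z i - snd z' i)\<^sup>2"
      by (simp add: pco_def e_def power_mult_distrib right_diff_distrib[symmetric])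
    define r q where "r = e * (snd z i - snd z' i)\<^sup>2" and "q = e * ((snd z i)\<^sup>2 + (snd z' i)\<^sup>2)"
    have "r \<le> e * (2 * (snd z i)\<^sup>2 + 2 * (snd z' i)\<^sup>2)" unfolding r_def by (intro mult_left_mono sq e)
    then have 3: "r \<le> 2 * q" by (simp add: q_def algebra_simps)
    have 4: "18 * e * ((snd z i)\<^sup>2 + (snd z' i)\<^sup>2) = 18 * q" by (simp add: q_def)
    have "A + P \<le> 4 * (a + b) + 18 * q"
      if "A \<le> 2 * B + 8 * r" "P = r" "B \<le> 2 * a + 2 * b" for A P B a b :: real
      using that 3 by argo
    from this[OF 1[folded r_def] 2[folded r_def] sq] show ?thesis unfolding 4 .
  qed
  have "V z z' \<le> (\<Sum>i<d. 4 * ((fst z i)\<^sup>2 + (fst z' i)\<^sup>2) + 18 * e * ((snd z i)\<^sup>2 + (snd z' i)\<^sup>2))"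
    unfolding V_def by (intro sum_mono pt)
  also have "\<dots> = 4 * ((\<Sum>i<d. (fst z i)\<^sup>2) + (\<Sum>i<d. (fst z' i)\<^sup>2)) + 18 * e * ((\<Sum>i<d. (snd z i)\<^sup>2) + (\<Sum>i<d. (snd z' i)\<^sup>2))"
    by (simp add: sum.distrib sum_distrib_left distrib_left)
  also have "\<dots> \<le> 4 * (2 * R / K + 2 * R / K) + 18 * (2 / \<gamma>\<^sup>2) * (2 * R + 2 * R)"
  proof -
    have x: "(\<Sum>i<d. (fst z i)\<^sup>2) \<le> 2 * R / K" "(\<Sum>i<d. (snd z i)\<^sup>2) \<le> 2 * R"
      if z: "z \<in> space PS" "H z \<le> R" for z
    proof -
      have "K * (\<Sum>i<d. (fst z i)\<^sup>2) / 2 + 1 * (\<Sum>i<d. (snd z i)\<^sup>2) / 2 \<le> R"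
        using H_lower[OF z(1)] z(2) unfolding norm_vec_power2 by linarith
      moreover have "0 \<le> K * (\<Sum>i<d. (fst z i)\<^sup>2)" "0 \<le> (\<Sum>i<d. (snd z i)\<^sup>2)" using K_pos by (simp_all add: sum_nonneg)
      ultimately have "K * (\<Sum>i<d. (fst z i)\<^sup>2) \<le> 2 * R" "(\<Sum>i<d. (snd z i)\<^sup>2) \<le> 2 * R" by linarith+
      then show "(\<Sum>i<d. (fst z i)\<^sup>2) \<le> 2 * R / K" "(\<Sum>i<d. (snd z i)\<^sup>2) \<le> 2 * R"
        using K_pos by (simp_all add: pos_le_divide_eq mult.commute)
    qed
    show ?thesis
      by (intro add_mono mult_mono mult_left_mono x z z') (use e in \<open>auto simp: sum_nonneg\<close>)
  qed
  also have "\<dots> = 16 * R / K + 144 * (R / \<gamma>\<^sup>2)" by simp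
  also have "\<dots> \<le> 16 * R / K + 144 * (R / (100 * K))"
  proof -
    have R0: "R \<ge> 0" using H_nonneg[OF z(1)] z(2) by linarith
    have "100 * K \<le> \<gamma>\<^sup>2" using K_le_L L_\<gamma> by linarith
    then show ?thesis using R0 K_pos \<gamma>_pos by (intro add_left_mono mult_left_mono divide_left_mono mult_pos_pos) auto
  qed
  also have "\<dots> \<le> 40 * R / K"
  proof -
    have "R / K \<ge> 0" using H_nonneg[OF z(1)] z(2) K_pos by simp
    then show ?thesis by simp
  qed
  finally show ?thesis .
qed

end

section \<open>Mixing in epochs\<close>

text \<open>The constant is the infimum of f + W. Capping it at 1 keeps it finite, which lets
  \<open>epochs\<close> subtract it in \<open>ennreal\<close>.\<close>

lemma oscillation_constant:
  fixes f W :: "'a \<Rightarrow> ennreal"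
  assumes osc: "\<And>z z'. z \<in> X \<Longrightarrow> z' \<in> X \<Longrightarrow> f z \<le> f z' + A + W z + W z'" and f1: "\<And>z. z \<in> X \<Longrightarrow> f z \<le> 1"
  shows "\<exists>c\<le>1. \<forall>z\<in>X. c \<le> f z + W z \<and> f z \<le> c + A + W z"
proof -
  define i where "i = (INF z'\<in>X. f z' + W z')"
  have lo: "i \<le> f z + W z" if "z \<in> X" for z unfolding i_def using that by (rule INF_lower)
  have hi: "f z \<le> i + A + W z" if z: "z \<in> X" for z
  proof (cases "A + W z = top")
    case True
    then have t: "i + A + W z = top" by (simp only: add.assoc) simp
    show ?thesis unfolding t by simp
  next
    case False
    have "f z - (A + W z) \<le> i" unfolding i_def
    proof (rule INF_greatest)
      fix z' assume "z' \<in> X"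
      then have "f z \<le> (A + W z) + (f z' + W z')" using osc[OF z, of z'] by (simp add: algebra_simps)
      then show "f z - (A + W z) \<le> f z' + W z'" using False by (simp add: ennreal_minus_le_iff)
    qed
    then have "f z \<le> (A + W z) + i" using False by (simp add: ennreal_minus_le_iff)
    then show ?thesis by (simp add: algebra_simps)
  qed
  have "min i 1 \<le> f z + W z" if "z \<in> X" for z using lo[OF that] by (rule min.coboundedI1)
  moreover have "f z \<le> min i 1 + A + W z" if z: "z \<in> X" for z
  proof (cases "i \<le> 1")
    case True then show ?thesis using hi[OF z] by (simp add: min_absorb1)
  next
    case False
    have "f z \<le> 1 + (A + W z)" using f1[OF z] by (rule order_trans) simp
    then show ?thesis using False by (simp add: min_def add.assoc)
  qed
  ultimately show ?thesis by (intro exI[of _ "min i 1"]) auto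
qed

section \<open>Monotonicity and linearity of the transition operators\<close>

context makla begin

lemma Oop_mono: "(\<And>z. z \<in> space PS \<Longrightarrow> f z \<le> g z) \<Longrightarrow> z \<in> space PS \<Longrightarrow> Oop f z \<le> Oop g z"
  unfolding Oop_def by (intro nn_integral_mono) (metis O1_space)

lemma Mop_mono: "(\<And>z. z \<in> space PS \<Longrightarrow> f z \<le> g z) \<Longrightarrow> z \<in> space PS \<Longrightarrow> Mop f z \<le> Mop g z"
  unfolding Mop_def using \<theta>_space flip_space by (intro add_mono mult_left_mono) auto

lemma Kop_mono: "(\<And>z. z \<in> space PS \<Longrightarrow> f z \<le> g z) \<Longrightarrow> z \<in> space PS \<Longrightarrow> Kop f z \<le> Kop g z"
  unfolding Kop_def by (intro Oop_mono Mop_mono)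

lemma O1_meas_noise: "z \<in> space PS \<Longrightarrow> (\<lambda>b. O1 b z) \<in> std_gaussian d \<rightarrow>\<^sub>M PS"
  unfolding O1_eq by (intro measurable_phase_Pair measurable_Rd_restrict) (auto simp: mem_Times_iff)

lemma Oop_add:
  assumes [measurable]: "f \<in> borel_measurable PS" "g \<in> borel_measurable PS" and z: "z \<in> space PS"
  shows "Oop (\<lambda>z. f z + g z) z = Oop f z + Oop g z"
proof -
  note [measurable] = O1_meas_noise[OF z]
  show ?thesis unfolding Oop_def by (rule nn_integral_add) measurable
qed

lemma Oop_cmult:
  assumes [measurable]: "f \<in> borel_measurable PS" and z: "z \<in> space PS"
  shows "Oop (\<lambda>z. c * f z) z = c * Oop f z"
proof -
  note [measurable] = O1_meas_noise[OF z]
  show ?thesis unfolding Oop_def by (rule nn_integral_cmult) measurable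
qed

lemma Oop_const [simp]: "Oop (\<lambda>_. c) z = c"
  by (simp add: Oop_def)

lemma Mop_const [simp]: "Mop (\<lambda>_. c) z = c"
proof -
  have "Mop (\<lambda>_. c) z = (ennreal (acc z) + ennreal (1 - acc z)) * c" by (simp add: Mop_def distrib_right)
  also have "ennreal (acc z) + ennreal (1 - acc z) = 1"
    using acc_bounds[of z] by (simp add: ennreal_plus[symmetric] del: ennreal_plus)
  finally show ?thesis by simp
qed

lemma Oop_cong: "(\<And>z. z \<in> space PS \<Longrightarrow> f z = g z) \<Longrightarrow> z \<in> space PS \<Longrightarrow> Oop f z = Oop g z"
  unfolding Oop_def using O1_space by (intro nn_integral_cong) auto

lemma Mop_add: "Mop (\<lambda>z. f z + g z) z = Mop f z + Mop g z"
  by (simp add: Mop_def algebra_simps)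

lemma Mop_cmult: "Mop (\<lambda>z. c * f z) z = c * Mop f z"
  by (simp add: Mop_def algebra_simps)

lemma Mop_cong: "(\<And>z. z \<in> space PS \<Longrightarrow> f z = g z) \<Longrightarrow> z \<in> space PS \<Longrightarrow> Mop f z = Mop g z"
  unfolding Mop_def using \<theta>_space flip_space by auto

lemma Kop_const [simp]: "Kop (\<lambda>_. c) z = c"
proof -
  have "Oop (\<lambda>_. c) = (\<lambda>_. c)" "Mop (\<lambda>_. c) = (\<lambda>_. c)" by auto
  then show ?thesis by (simp add: Kop_def)
qed

lemma Kop_add:
  assumes [measurable]: "f \<in> borel_measurable PS" "g \<in> borel_measurable PS" and z: "z \<in> space PS"
  shows "Kop (\<lambda>z. f z + g z) z = Kop f z + Kop g z"
proof -
  have "Kop (\<lambda>z. f z + g z) z = Oop (\<lambda>z. Mop (Oop f) z + Mop (Oop g) z) z"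
    unfolding Kop_def
  proof (rule Oop_cong[OF _ z])
    fix y assume y: "y \<in> space PS"
    have "Mop (Oop (\<lambda>z. f z + g z)) y = Mop (\<lambda>z. Oop f z + Oop g z) y"
      by (intro Mop_cong Oop_add y) measurable
    then show "Mop (Oop (\<lambda>z. f z + g z)) y = Mop (Oop f) y + Mop (Oop g) y" by (simp add: Mop_add)
  qed
  also have "\<dots> = Kop f z + Kop g z" unfolding Kop_def by (rule Oop_add[OF _ _ z]) measurable
  finally show ?thesis .
qed

lemma Kop_cmult:
  assumes [measurable]: "f \<in> borel_measurable PS" and z: "z \<in> space PS"
  shows "Kop (\<lambda>z. c * f z) z = c * Kop f z"
proof -
  have "Kop (\<lambda>z. c * f z) z = Oop (\<lambda>z. c * Mop (Oop f) z) z"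
    unfolding Kop_def
  proof (rule Oop_cong[OF _ z])
    fix y assume y: "y \<in> space PS"
    have "Mop (Oop (\<lambda>z. c * f z)) y = Mop (\<lambda>z. c * Oop f z) y"
      by (intro Mop_cong Oop_cmult y) measurable
    then show "Mop (Oop (\<lambda>z. c * f z)) y = c * Mop (Oop f) y" by (simp add: Mop_cmult)
  qed
  also have "\<dots> = c * Kop f z" unfolding Kop_def by (rule Oop_cmult[OF _ z]) measurable
  finally show ?thesis .
qed

lemma Kop_pow_mono:
  "(\<And>z. z \<in> space PS \<Longrightarrow> f z \<le> g z) \<Longrightarrow> z \<in> space PS \<Longrightarrow> (Kop ^^ n) f z \<le> (Kop ^^ n) g z"
proof (induction n arbitrary: z)
  case (Suc n)
  then show ?case by (auto intro!: Kop_mono simp del: space_phase_space)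
qed simp

lemma Kop_cong: "(\<And>z. z \<in> space PS \<Longrightarrow> f z = g z) \<Longrightarrow> z \<in> space PS \<Longrightarrow> Kop f z = Kop g z"
  by (intro antisym Kop_mono) auto

lemma Kop_pow_add:
  assumes [measurable]: "f \<in> borel_measurable PS" "g \<in> borel_measurable PS" and z: "z \<in> space PS"
  shows "(Kop ^^ n) (\<lambda>z. f z + g z) z = (Kop ^^ n) f z + (Kop ^^ n) g z"
  using z
proof (induction n arbitrary: z)
  case (Suc n)
  have "(Kop ^^ Suc n) (\<lambda>z. f z + g z) z = Kop (\<lambda>z. (Kop ^^ n) f z + (Kop ^^ n) g z) z"
    using Suc by (auto intro!: Kop_cong simp del: space_phase_space)
  also have "\<dots> = (Kop ^^ Suc n) f z + (Kop ^^ Suc n) g z"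
    using Suc.prems by (simp add: Kop_add del: space_phase_space)
  finally show ?case .
qed simp

lemma Kop_pow_const [simp]: "(Kop ^^ n) (\<lambda>_. c) z = c"
proof (induction n arbitrary: z)
  case (Suc n)
  then have "(Kop ^^ n) (\<lambda>_. c) = (\<lambda>_. c)" by auto
  then show ?case by simp
qed simp

lemma Kop_pow_sum:
  fixes m :: nat
  shows "(\<And>i. i < m \<Longrightarrow> f i \<in> borel_measurable PS) \<Longrightarrow> z \<in> space PS \<Longrightarrow>
    (Kop ^^ n) (\<lambda>z. \<Sum>i<m. f i z) z = (\<Sum>i<m. (Kop ^^ n) (f i) z)"
proof (induction m)
  case 0
  then show ?case by simp
next
  case (Suc m)
  note z = Suc.prems(2)
  have [measurable]: "f m \<in> borel_measurable PS" by (rule Suc.prems) simp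
  have [measurable]: "(\<lambda>z. \<Sum>i<m. f i z) \<in> borel_measurable PS"
    by (rule borel_measurable_sum) (use Suc.prems in auto)
  show ?case using Suc by (simp add: Kop_pow_add[OF _ _ z] del: space_phase_space)
qed

lemma Kop_pow_le: "(\<And>z. z \<in> space PS \<Longrightarrow> f z \<le> a) \<Longrightarrow> z \<in> space PS \<Longrightarrow> (Kop ^^ n) f z \<le> a"
  using Kop_pow_mono[of f "\<lambda>_. a" z n] by simp

lemma Top_le: "(\<And>z. z \<in> space PS \<Longrightarrow> f z \<le> a) \<Longrightarrow> z \<in> space PS \<Longrightarrow> Top f z \<le> a"
  unfolding Top_def using \<theta>_space by (intro Oop_le) auto

lemma Top_pow_measurable [measurable]: "f \<in> borel_measurable PS \<Longrightarrow> (Top ^^ n) f \<in> borel_measurable PS"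
  by (induction n) auto

lemma Top_pow_le: "(\<And>z. z \<in> space PS \<Longrightarrow> f z \<le> a) \<Longrightarrow> z \<in> space PS \<Longrightarrow> (Top ^^ n) f z \<le> a"
proof (induction n arbitrary: z)
  case (Suc n)
  then show ?case by (auto intro!: Top_le simp del: space_phase_space)
qed simp

definition ind :: "real \<Rightarrow> phase \<Rightarrow> ennreal" where "ind R z = indicator {z. R < H z} z"
text \<open>The probability that the energy exceeds R when the Verlet move starts, that is, after
  the first refreshment.\<close>

definition bad :: "real \<Rightarrow> phase \<Rightarrow> ennreal" where "bad R = Oop (ind R)"

lemma ind_measurable [measurable]: "ind R \<in> borel_measurable PS"
  unfolding ind_def[abs_def] by measurable

lemma bad_measurable [measurable]: "bad R \<in> borel_measurable PS"
  unfolding bad_def by measurable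

lemma ind_le_1: "ind R z \<le> 1" by (simp add: ind_def indicator_def)

lemma bad_le_1: "z \<in> space PS \<Longrightarrow> bad R z \<le> 1"
  unfolding bad_def by (rule Oop_le) (auto simp: ind_le_1)

section \<open>Distance between the adjusted and the unadjusted chain\<close>

lemma \<Delta>E_nonneg: "0 \<le> R \<Longrightarrow> 0 \<le> \<Delta>E R"
  using h_pos LH_nonneg L_pos by (simp add: \<Delta>E_def)

lemma rejection_le:
  assumes z: "z \<in> space PS" and R: "R \<ge> 0"
  shows "ennreal (1 - acc z) \<le> ennreal (\<Delta>E R) + ind R z"
proof (cases "H z \<le> R")
  case True
  have "max 0 (H (\<theta> z) - H z) \<le> \<Delta>E R" using energy_error[OF z True] \<Delta>E_nonneg[OF R] by simp
  then have "1 - acc z \<le> \<Delta>E R"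
    using exp_ge_add_one_self[of "- max 0 (H (\<theta> z) - H z)"] unfolding acc_def by linarith
  then show ?thesis by (intro add_increasing2 ennreal_leI) auto
next
  case False
  have "ennreal (1 - acc z) \<le> 1" using acc_bounds[of z] by (simp add: ennreal_le_1)
  also have "1 = ind R z" using False by (simp add: ind_def)
  finally show ?thesis by (rule add_increasing[OF zero_le])
qed

lemma Mop_near:
  assumes f: "\<And>z. z \<in> space PS \<Longrightarrow> f z \<le> a" and z: "z \<in> space PS"
  shows "Mop f z \<le> f (\<theta> z) + a * ennreal (1 - acc z)" "f (\<theta> z) \<le> Mop f z + a * ennreal (1 - acc z)"
proof -
  have acc: "ennreal (acc z) \<le> 1" using acc_bounds[of z] by simp
  have "Mop f z \<le> 1 * f (\<theta> z) + ennreal (1 - acc z) * a"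
    unfolding Mop_def using f[OF flip_space[OF z]] acc by (intro add_mono mult_right_mono mult_left_mono) auto
  then show "Mop f z \<le> f (\<theta> z) + a * ennreal (1 - acc z)" by (simp add: mult.commute)
  have "f (\<theta> z) = (ennreal (acc z) + ennreal (1 - acc z)) * f (\<theta> z)"
    using acc_bounds[of z] by (simp add: ennreal_plus[symmetric] del: ennreal_plus)
  also have "\<dots> = ennreal (acc z) * f (\<theta> z) + ennreal (1 - acc z) * f (\<theta> z)" by (rule distrib_right)
  also have "\<dots> \<le> Mop f z + ennreal (1 - acc z) * a"
    unfolding Mop_def using f[OF \<theta>_space] by (intro add_mono mult_left_mono add_increasing2) auto
  finally show "f (\<theta> z) \<le> Mop f z + a * ennreal (1 - acc z)" by (simp add: mult.commute)
qed

lemma Kop_near_Top: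
  assumes f [measurable]: "f \<in> borel_measurable PS" and fa: "\<And>z. z \<in> space PS \<Longrightarrow> f z \<le> a"
    and z: "z \<in> space PS" and R: "R \<ge> 0"
  shows "Kop f z \<le> Top f z + a * (ennreal (\<Delta>E R) + bad R z)" "Top f z \<le> Kop f z + a * (ennreal (\<Delta>E R) + bad R z)"
proof -
  have Oa: "\<And>z. z \<in> space PS \<Longrightarrow> Oop f z \<le> a" by (rule Oop_le[OF fa])
  let ?r = "\<lambda>z. a * (ennreal (\<Delta>E R) + ind R z)"
  have 1: "Oop (\<lambda>y. g y + ?r y) z = Oop g z + a * (ennreal (\<Delta>E R) + bad R z)"
    if [measurable]: "g \<in> borel_measurable PS" for g
  proof -
    have "Oop (\<lambda>y. g y + ?r y) z = Oop g z + Oop ?r z" by (rule Oop_add[OF _ _ z]) measurable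
    also have "Oop ?r z = a * Oop (\<lambda>z. ennreal (\<Delta>E R) + ind R z) z" by (rule Oop_cmult[OF _ z]) measurable
    also have "Oop (\<lambda>z. ennreal (\<Delta>E R) + ind R z) z = Oop (\<lambda>_. ennreal (\<Delta>E R)) z + Oop (ind R) z"
      by (rule Oop_add[OF _ _ z]) measurable
    finally show ?thesis by (simp add: bad_def)
  qed
  have "Kop f z \<le> Oop (\<lambda>y. Oop f (\<theta> y) + ?r y) z"
    unfolding Kop_def
  proof (rule Oop_mono[OF _ z])
    fix y assume y: "y \<in> space PS"
    show "Mop (Oop f) y \<le> Oop f (\<theta> y) + ?r y"
    proof (rule order_trans)
      show "Mop (Oop f) y \<le> Oop f (\<theta> y) + a * ennreal (1 - acc y)" by (rule Mop_near(1)[OF _ y]) (rule Oa)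
    qed (intro add_left_mono mult_left_mono rejection_le[OF y R], simp)
  qed
  also have "\<dots> = Top f z + a * (ennreal (\<Delta>E R) + bad R z)" unfolding Top_def by (rule 1) measurable
  finally show "Kop f z \<le> Top f z + a * (ennreal (\<Delta>E R) + bad R z)" .
  have "Top f z \<le> Oop (\<lambda>y. Mop (Oop f) y + ?r y) z"
    unfolding Top_def
  proof (rule Oop_mono[OF _ z])
    fix y assume y: "y \<in> space PS"
    show "Oop f (\<theta> y) \<le> Mop (Oop f) y + ?r y"
    proof (rule order_trans)
      show "Oop f (\<theta> y) \<le> Mop (Oop f) y + a * ennreal (1 - acc y)" by (rule Mop_near(2)[OF _ y]) (rule Oa)
    qed (intro add_left_mono mult_left_mono rejection_le[OF y R], simp)
  qed
  also have "\<dots> = Kop f z + a * (ennreal (\<Delta>E R) + bad R z)" unfolding Kop_def by (rule 1) measurable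
  finally show "Top f z \<le> Kop f z + a * (ennreal (\<Delta>E R) + bad R z)" .
qed

text \<open>Expected number of steps, among the first n of the adjusted chain, whose Verlet move
  starts above R.\<close>

definition badsum :: "real \<Rightarrow> nat \<Rightarrow> phase \<Rightarrow> ennreal" where
  "badsum R n z = (\<Sum>j<n. (Kop ^^ j) (bad R) z)"

lemma badsum_measurable [measurable]: "badsum R n \<in> borel_measurable PS"
  unfolding badsum_def[abs_def] by measurable

lemma badsum_Suc: "z \<in> space PS \<Longrightarrow> badsum R (Suc n) z = bad R z + Kop (badsum R n) z"
  unfolding badsum_def[abs_def] sum.lessThan_Suc_shift
  using Kop_pow_sum[of n "\<lambda>j. (Kop ^^ j) (bad R)" z 1] by simp

text \<open>Telescoping in the order that lets the adjusted chain carry the accumulated error, so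
  excursions are counted along the chain whose energy moments are controlled later.\<close>

lemma Kop_pow_near_Top:
  assumes f [measurable]: "f \<in> borel_measurable PS" and fa: "\<And>z. z \<in> space PS \<Longrightarrow> f z \<le> a"
    and z: "z \<in> space PS" and R: "R \<ge> 0"
  shows "(Kop ^^ n) f z \<le> (Top ^^ n) f z + a * (of_nat n * ennreal (\<Delta>E R) + badsum R n z)"
    and "(Top ^^ n) f z \<le> (Kop ^^ n) f z + a * (of_nat n * ennreal (\<Delta>E R) + badsum R n z)"
  using z
proof (induction n arbitrary: z)
  case (Suc n)
  let ?e = "ennreal (\<Delta>E R)"
  let ?r = "\<lambda>z. a * (of_nat n * ?e + badsum R n z)"
  { case 1
    have "(Kop ^^ Suc n) f z = Kop ((Kop ^^ n) f) z" by simp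
    also have "\<dots> \<le> Kop (\<lambda>z. (Top ^^ n) f z + ?r z) z" by (rule Kop_mono[OF Suc.IH(1) 1])
    also have "\<dots> = Kop ((Top ^^ n) f) z + Kop ?r z" by (rule Kop_add[OF _ _ 1]) measurable
    also have "Kop ?r z = a * Kop (\<lambda>z. of_nat n * ?e + badsum R n z) z" by (rule Kop_cmult[OF _ 1]) measurable
    also have "Kop (\<lambda>z. of_nat n * ?e + badsum R n z) z = Kop (\<lambda>_. of_nat n * ?e) z + Kop (badsum R n) z"
      by (rule Kop_add[OF _ _ 1]) measurable
    also have "Kop ((Top ^^ n) f) z + a * (Kop (\<lambda>_. of_nat n * ?e) z + Kop (badsum R n) z)
      \<le> (Top ((Top ^^ n) f) z + a * (?e + bad R z)) + a * (Kop (\<lambda>_. of_nat n * ?e) z + Kop (badsum R n) z)"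
      by (intro add_right_mono Kop_near_Top(1)[OF _ _ 1 R] Top_pow_le fa) auto
    also have "\<dots> = (Top ^^ Suc n) f z + a * (of_nat (Suc n) * ?e + badsum R (Suc n) z)"
      by (simp add: badsum_Suc[OF 1] algebra_simps)
    finally show ?case .
  next
    case 2
    have "(Top ^^ Suc n) f z = Top ((Top ^^ n) f) z" by simp
    also have "\<dots> \<le> Kop ((Top ^^ n) f) z + a * (?e + bad R z)"
      by (intro Kop_near_Top(2)[OF _ _ 2 R] Top_pow_le fa) auto
    also have "Kop ((Top ^^ n) f) z \<le> Kop (\<lambda>z. (Kop ^^ n) f z + ?r z) z" by (rule Kop_mono[OF Suc.IH(2) 2])
    also have "Kop (\<lambda>z. (Kop ^^ n) f z + ?r z) z = Kop ((Kop ^^ n) f) z + Kop ?r z" by (rule Kop_add[OF _ _ 2]) measurable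
    also have "Kop ?r z = a * Kop (\<lambda>z. of_nat n * ?e + badsum R n z) z" by (rule Kop_cmult[OF _ 2]) measurable
    also have "Kop (\<lambda>z. of_nat n * ?e + badsum R n z) z = Kop (\<lambda>_. of_nat n * ?e) z + Kop (badsum R n) z"
      by (rule Kop_add[OF _ _ 2]) measurable
    also have "Kop ((Kop ^^ n) f) z + a * (Kop (\<lambda>_. of_nat n * ?e) z + Kop (badsum R n) z) + a * (?e + bad R z)
      = (Kop ^^ Suc n) f z + a * (of_nat (Suc n) * ?e + badsum R (Suc n) z)"
      by (simp add: badsum_Suc[OF 2] algebra_simps)
    finally show ?case by (simp add: add_right_mono) }
qed (simp_all add: badsum_def)

section \<open>Contraction over an epoch and over several epochs\<close>

lemma Top_contract:
  assumes F [measurable]: "F \<in> borel_measurable PS" and C: "A \<ge> 0" "C \<ge> 0"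
    and lip: "\<And>z z'. z \<in> space PS \<Longrightarrow> z' \<in> space PS \<Longrightarrow> F z \<le> F z' + ennreal (A + C * sqrt (V z z'))"
    and z: "z \<in> space PS" and z': "z' \<in> space PS"
  shows "Top F z \<le> Top F z' + ennreal (A + C * exp (- \<rho> / 2) * sqrt (V z z'))"
proof -
  let ?e = "ennreal (A + C * exp (- \<rho> / 2) * sqrt (V z z'))"
  note [measurable] = O1_meas_noise
  have s: "sqrt (V (O1 b' (\<theta> (O1 b z))) (O1 b' (\<theta> (O1 b z')))) \<le> exp (- \<rho> / 2) * sqrt (V z z')" for b b'
  proof -
    have "V (O1 b' (\<theta> (O1 b z))) (O1 b' (\<theta> (O1 b z'))) \<le> (1 - \<rho>) * V z z'" by (rule V_contract[OF z z'])
    also have "\<dots> \<le> exp (- \<rho>) * V z z'" using exp_ge_add_one_self[of "- \<rho>"] V_nonneg by (intro mult_right_mono) auto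
    also have "\<dots> = (exp (- \<rho> / 2))\<^sup>2 * V z z'" by (simp add: power2_eq_square exp_add[symmetric])
    finally have "sqrt (V (O1 b' (\<theta> (O1 b z))) (O1 b' (\<theta> (O1 b z')))) \<le> sqrt ((exp (- \<rho> / 2))\<^sup>2 * V z z')" by simp
    then show ?thesis by (simp only: real_sqrt_mult real_sqrt_abs abs_exp_cancel)
  qed
  have "Oop F (\<theta> (O1 b z)) \<le> Oop F (\<theta> (O1 b z')) + ?e" for b
  proof -
    have "Oop F (\<theta> (O1 b z)) \<le> (\<integral>\<^sup>+ b'. F (O1 b' (\<theta> (O1 b z'))) + ?e \<partial>std_gaussian d)"
      unfolding Oop_def
    proof (rule nn_integral_mono)
      fix b'
      have "F (O1 b' (\<theta> (O1 b z))) \<le> F (O1 b' (\<theta> (O1 b z'))) + ennreal (A + C * sqrt (V (O1 b' (\<theta> (O1 b z))) (O1 b' (\<theta> (O1 b z')))))"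
        by (intro lip O1_space \<theta>_space)
      also have "\<dots> \<le> F (O1 b' (\<theta> (O1 b z'))) + ?e"
        using mult_left_mono[OF s[of b' b] C(2)] by (intro add_left_mono ennreal_leI) (simp add: mult.assoc)
      finally show "F (O1 b' (\<theta> (O1 b z))) \<le> F (O1 b' (\<theta> (O1 b z'))) + ?e" .
    qed
    also have "\<dots> = Oop F (\<theta> (O1 b z')) + ?e"
      unfolding Oop_def using O1_meas_noise[OF \<theta>_space[of "O1 b z'"]] by (subst nn_integral_add) auto
    finally show ?thesis .
  qed
  then have "Top F z \<le> (\<integral>\<^sup>+ b. Oop F (\<theta> (O1 b z')) + ?e \<partial>std_gaussian d)"
    unfolding Top_def Oop_def[of "\<lambda>z. Oop F (\<theta> z)"] by (intro nn_integral_mono)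
  also have "\<dots> = Top F z' + ?e"
    unfolding Top_def Oop_def[of "\<lambda>z. Oop F (\<theta> z)"] using O1_meas_noise[OF z'] by (subst nn_integral_add) auto
  finally show ?thesis .
qed

text \<open>Only the Lipschitz part contracts. The defect A, which the regularisation leaves behind,
  is carried along without growing.\<close>

lemma Top_pow_contract:
  assumes F [measurable]: "F \<in> borel_measurable PS" and C: "A \<ge> 0" "C \<ge> 0"
    and lip: "\<And>z z'. z \<in> space PS \<Longrightarrow> z' \<in> space PS \<Longrightarrow> F z \<le> F z' + ennreal (A + C * sqrt (V z z'))"
    and z: "z \<in> space PS" and z': "z' \<in> space PS"
  shows "(Top ^^ m) F z \<le> (Top ^^ m) F z' + ennreal (A + C * exp (- \<rho> / 2) ^ m * sqrt (V z z'))"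
  using z z'
proof (induction m arbitrary: z z')
  case 0
  then show ?case using lip by simp
next
  case (Suc m)
  have "Top ((Top ^^ m) F) z \<le> Top ((Top ^^ m) F) z' + ennreal (A + (C * exp (- \<rho> / 2) ^ m) * exp (- \<rho> / 2) * sqrt (V z z'))"
    by (rule Top_contract[OF _ C(1) _ Suc.IH Suc.prems]) (use C in auto)
  then show ?case by (simp add: mult_ac)
qed

text \<open>Lipschitz constant of \<open>Top f\<close> with respect to sqrt V, up to the defect, for
  f bounded by 1; 60 is the 3 of \<open>Top_regularise\<close> times the 20 of
  \<open>gap_le_V\<close>.\<close>

definition Creg :: real where "Creg = 60 * sqrt d / (h * \<sigma>)"

text \<open>The innermost \<open>Top\<close> regularises f and the m others contract. The defect and
  the contracted distance contribute a / 8 each.\<close>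

lemma Top_epoch:
  assumes f [measurable]: "f \<in> borel_measurable PS" and a: "a \<ge> 0" "\<And>z. z \<in> space PS \<Longrightarrow> f z \<le> ennreal a"
    and small: "small \<le> 1 / 32" and z: "z \<in> space PS" "H z \<le> R" and z': "z' \<in> space PS" "H z' \<le> R"
    and mix: "Creg * exp (- \<rho> / 2) ^ m * sqrt (40 * R / K) \<le> 1 / 8"
  shows "(Top ^^ Suc m) f z \<le> (Top ^^ Suc m) f z' + ennreal (a / 4)"
proof -
  have Cr: "Creg \<ge> 0" using h_pos \<sigma>_pos by (simp add: Creg_def)
  have lip: "Top f y \<le> Top f y' + ennreal (a / 8 + (a * Creg) * sqrt (V y y'))"
    if y: "y \<in> space PS" "y' \<in> space PS" for y y'
  proof -
    have "3 * gap y y' * sqrt d \<le> 3 * (20 / (h * \<sigma>) * sqrt (V y y')) * sqrt d"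
      by (intro mult_right_mono mult_left_mono gap_le_V) auto
    also have "\<dots> = Creg * sqrt (V y y')" by (simp add: Creg_def)
    finally have "a * (1 / 8 + 3 * gap y y' * sqrt d) \<le> a * (1 / 8 + Creg * sqrt (V y y'))"
      using a(1) by (intro mult_left_mono add_left_mono) auto
    then have "ennreal (a * (1 / 8 + 3 * gap y y' * sqrt d)) \<le> ennreal (a / 8 + (a * Creg) * sqrt (V y y'))"
      by (intro ennreal_leI) (simp add: algebra_simps)
    then show ?thesis using Top_regularise[OF f a y small] by (meson add_left_mono order_trans)
  qed
  have "(Top ^^ Suc m) f z = (Top ^^ m) (Top f) z" by (simp add: funpow_swap1)
  also have "\<dots> \<le> (Top ^^ m) (Top f) z' + ennreal (a / 8 + (a * Creg) * exp (- \<rho> / 2) ^ m * sqrt (V z z'))"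
    by (rule Top_pow_contract[OF _ _ _ lip z(1) z'(1)]) (use a Cr in auto)
  also have "\<dots> \<le> (Top ^^ m) (Top f) z' + ennreal (a / 4)"
  proof (intro add_left_mono ennreal_leI)
    have "Creg * exp (- \<rho> / 2) ^ m * sqrt (V z z') \<le> Creg * exp (- \<rho> / 2) ^ m * sqrt (40 * R / K)"
      using V_le_H[OF z z'] Cr by (intro mult_left_mono) auto
    with mix have "a * (Creg * exp (- \<rho> / 2) ^ m * sqrt (V z z')) \<le> a * (1 / 8)"
      using a(1) by (intro mult_left_mono) auto
    then show "a / 8 + (a * Creg) * exp (- \<rho> / 2) ^ m * sqrt (V z z') \<le> a / 4" by (simp add: mult.assoc)
  qed
  finally show ?thesis by (simp add: funpow_swap1)
qed

definition excess :: "real \<Rightarrow> nat \<Rightarrow> phase \<Rightarrow> ennreal" where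
  "excess R n z = badsum R n z + ind R z"

lemma excess_measurable [measurable]: "excess R n \<in> borel_measurable PS"
  unfolding excess_def[abs_def] by measurable

text \<open>The budget a / 2 consists of a / 4 for the unadjusted chain and a / 8 for the rejections
  from either start. If a start lies above R, the indicator in \<open>excess\<close> alone dominates
  the left-hand side.\<close>

lemma Kop_epoch:
  assumes f [measurable]: "f \<in> borel_measurable PS" and a: "a \<ge> 0" "a \<le> 1" "\<And>z. z \<in> space PS \<Longrightarrow> f z \<le> ennreal a"
    and small: "small \<le> 1 / 32" and R: "R \<ge> 0" and z: "z \<in> space PS" and z': "z' \<in> space PS"
    and mix: "Creg * exp (- \<rho> / 2) ^ m * sqrt (40 * R / K) \<le> 1 / 8" and n: "n = Suc m"
    and rej: "n * \<Delta>E R \<le> 1 / 8"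
  shows "(Kop ^^ n) f z \<le> (Kop ^^ n) f z' + ennreal (a / 2) + excess R n z + excess R n z'"
proof (cases "H z \<le> R \<and> H z' \<le> R")
  case True
  have a1: "ennreal a \<le> 1" using a by (simp add: ennreal_le_1)
  have r: "ennreal a * (of_nat n * ennreal (\<Delta>E R) + badsum R n y) \<le> ennreal (a / 8) + excess R n y" for y
  proof -
    have "of_nat n * ennreal (\<Delta>E R) = ennreal (n * \<Delta>E R)"
      using \<Delta>E_nonneg[OF R] by (simp add: ennreal_of_nat_eq_real_of_nat ennreal_mult)
    also have "\<dots> \<le> ennreal (1 / 8)" by (rule ennreal_leI[OF rej])
    finally have "ennreal a * (of_nat n * ennreal (\<Delta>E R)) \<le> ennreal a * ennreal (1 / 8)" by (rule mult_left_mono) simp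
    also have "\<dots> = ennreal (a / 8)" using a(1) by (simp add: ennreal_mult'[symmetric])
    finally have 1: "ennreal a * (of_nat n * ennreal (\<Delta>E R)) \<le> ennreal (a / 8)" .
    have "ennreal a * badsum R n y \<le> 1 * badsum R n y" by (rule mult_right_mono[OF a1]) simp
    also have "\<dots> \<le> excess R n y" by (simp add: excess_def)
    finally show ?thesis using 1 by (simp add: distrib_left add_mono)
  qed
  have "(Kop ^^ n) f z \<le> (Top ^^ n) f z + ennreal a * (of_nat n * ennreal (\<Delta>E R) + badsum R n z)"
    by (rule Kop_pow_near_Top(1)[OF f a(3) z R])
  also have "\<dots> \<le> (Top ^^ n) f z + (ennreal (a / 8) + excess R n z)" by (intro add_left_mono r)
  also have "\<dots> \<le> ((Top ^^ n) f z' + ennreal (a / 4)) + (ennreal (a / 8) + excess R n z)"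
    unfolding n by (intro add_right_mono Top_epoch[OF f a(1,3) small z _ z' _ mix]) (use True in auto)
  also have "(Top ^^ n) f z' \<le> (Kop ^^ n) f z' + ennreal a * (of_nat n * ennreal (\<Delta>E R) + badsum R n z')"
    by (rule Kop_pow_near_Top(2)[OF f a(3) z' R])
  also have "\<dots> \<le> (Kop ^^ n) f z' + (ennreal (a / 8) + excess R n z')" by (intro add_left_mono r)
  finally have "(Kop ^^ n) f z \<le> (Kop ^^ n) f z' + (ennreal (a / 8) + excess R n z') + ennreal (a / 4) + (ennreal (a / 8) + excess R n z)"
    by (simp add: add_right_mono)
  also have "\<dots> = (Kop ^^ n) f z' + (ennreal (a / 8) + ennreal (a / 4) + ennreal (a / 8)) + excess R n z + excess R n z'"
    by (simp only: add_ac)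
  also have "ennreal (a / 8) + ennreal (a / 4) + ennreal (a / 8) = ennreal (a / 2)"
    using a(1) by (simp add: ennreal_plus[symmetric] del: ennreal_plus)
  finally show ?thesis .
next
  case False
  have "(Kop ^^ n) f z \<le> ennreal a" by (rule Kop_pow_le[OF a(3) z])
  also have "\<dots> \<le> 1" using a by (simp add: ennreal_le_1)
  also have "1 \<le> excess R n z + excess R n z'"
  proof -
    have "1 \<le> ind R z + ind R z'" using False by (auto simp: ind_def indicator_def add_increasing)
    also have "\<dots> \<le> excess R n z + excess R n z'" unfolding excess_def by (intro add_mono) auto
    finally show ?thesis .
  qed
  also have "\<dots> \<le> (Kop ^^ n) f z' + ennreal (a / 2) + (excess R n z + excess R n z')" by simp
  finally show ?thesis by (simp add: add.assoc)
qed

text \<open>Excursion weights of k epochs, each transported back to the start by the epochs before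
  it.\<close>

definition Wsum :: "real \<Rightarrow> nat \<Rightarrow> nat \<Rightarrow> phase \<Rightarrow> ennreal" where
  "Wsum R n k z = (\<Sum>i<k. (Kop ^^ (n * i)) (excess R n) z)"

lemma Wsum_measurable [measurable]: "Wsum R n k \<in> borel_measurable PS"
  unfolding Wsum_def[abs_def] by measurable

lemma Wsum_Suc: "z \<in> space PS \<Longrightarrow> Wsum R n (Suc k) z = excess R n z + (Kop ^^ n) (Wsum R n k) z"
  unfolding Wsum_def[abs_def] sum.lessThan_Suc_shift
  by (subst Kop_pow_sum) (auto simp: funpow_add)

text \<open>Up to the weight \<open>Wsum\<close>, which collects the excursions of the energy above \<open>R\<close>, the oscillation
  of a function halves in each epoch of \<open>n\<close> steps.\<close>
lemma epochs:
  assumes f [measurable]: "f \<in> borel_measurable PS" and f1: "\<And>z. z \<in> space PS \<Longrightarrow> f z \<le> 1"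
    and small: "small \<le> 1 / 32" and R: "R \<ge> 0"
    and mix: "Creg * exp (- \<rho> / 2) ^ m * sqrt (40 * R / K) \<le> 1 / 8" and n: "n = Suc m"
    and rej: "n * \<Delta>E R \<le> 1 / 8"
  shows "\<exists>c\<le>1. \<forall>z\<in>space PS. c \<le> (Kop ^^ (n * k)) f z + Wsum R n k z
     \<and> (Kop ^^ (n * k)) f z \<le> c + ennreal ((1 / 2) ^ k) + Wsum R n k z"
proof (induction k)
  case 0
  have "f z \<le> 0 + ennreal ((1 / 2) ^ 0) + Wsum R n 0 z" if "z \<in> space PS" for z
    using f1[OF that] by (simp add: Wsum_def)
  then show ?case by (intro exI[of _ 0]) auto
next
  case (Suc k)
  then obtain c where c: "c \<le> 1" and lo: "\<And>z. z \<in> space PS \<Longrightarrow> c \<le> (Kop ^^ (n * k)) f z + Wsum R n k z"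
    and hi: "\<And>z. z \<in> space PS \<Longrightarrow> (Kop ^^ (n * k)) f z \<le> c + ennreal ((1 / 2) ^ k) + Wsum R n k z"
    by blast
  define a :: real where "a = (1 / 2) ^ k"
  have a: "0 \<le> a" "a \<le> 1" by (auto simp: a_def power_le_one)
  define fk where "fk = (Kop ^^ (n * k)) f"
  have [measurable]: "fk \<in> borel_measurable PS" unfolding fk_def by measurable
  have cf: "c \<noteq> top" using c by (auto simp: top_unique)
  \<comment> \<open>\<open>Kop_epoch\<close> needs a function bounded by a, but fk may leave
    [c, c + a] by as much as \<open>Wsum\<close>. Clipping it to this interval and subtracting c
    gives g; the weight absorbs the clipping error.\<close>
  define g where "g z = min (fk z) (c + ennreal a) - c" for z
  have g [measurable]: "g \<in> borel_measurable PS" unfolding g_def by measurable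
  have ga: "g z \<le> ennreal a" for z
    unfolding g_def using cf by (simp add: ennreal_minus_le_iff)
  have g1: "fk z \<le> (c + g z) + Wsum R n k z" if z: "z \<in> space PS" for z
  proof (cases "fk z \<le> c + ennreal a")
    case True
    have "fk z \<le> c + (fk z - c)" using ennreal_minus_le_iff[of "fk z" c "fk z - c"] by simp
    also have "\<dots> = c + g z" using True by (simp add: g_def min_absorb1)
    finally show ?thesis by (rule order_trans) simp
  next
    case False
    then have "g z = ennreal a" using cf by (simp add: g_def min_absorb2)
    then show ?thesis using hi[OF z] by (simp add: fk_def a_def)
  qed
  have g2: "c + g z \<le> fk z + Wsum R n k z" if z: "z \<in> space PS" for z
  proof (cases "c \<le> fk z")
    case True
    then have "c + g z = min (fk z) (c + ennreal a)"
      unfolding g_def using cf by (intro add_diff_inverse_ennreal) auto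
    also have "\<dots> \<le> fk z" by simp
    finally show ?thesis by (rule order_trans) simp
  next
    case False
    then have "g z \<le> 0" unfolding g_def ennreal_minus_le_iff using cf by (auto simp: min_le_iff_disj)
    then show ?thesis using lo[OF z] by (simp add: fk_def)
  qed
  have fS: "(Kop ^^ (n * Suc k)) f = (Kop ^^ n) fk" by (simp add: fk_def funpow_add)
  have K1: "(Kop ^^ n) fk z \<le> c + (Kop ^^ n) g z + (Kop ^^ n) (Wsum R n k) z" if z: "z \<in> space PS" for z
  proof -
    have "(Kop ^^ n) fk z \<le> (Kop ^^ n) (\<lambda>z. (c + g z) + Wsum R n k z) z" by (rule Kop_pow_mono[OF g1 z])
    also have "\<dots> = (Kop ^^ n) (\<lambda>z. c + g z) z + (Kop ^^ n) (Wsum R n k) z" by (rule Kop_pow_add[OF _ _ z]) measurable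
    also have "(Kop ^^ n) (\<lambda>z. c + g z) z = (Kop ^^ n) (\<lambda>_. c) z + (Kop ^^ n) g z" by (rule Kop_pow_add[OF _ _ z]) measurable
    finally show ?thesis by simp
  qed
  have K2: "c + (Kop ^^ n) g z \<le> (Kop ^^ n) fk z + (Kop ^^ n) (Wsum R n k) z" if z: "z \<in> space PS" for z
  proof -
    have "c + (Kop ^^ n) g z = (Kop ^^ n) (\<lambda>_. c) z + (Kop ^^ n) g z" by simp
    also have "\<dots> = (Kop ^^ n) (\<lambda>z. c + g z) z" by (rule Kop_pow_add[OF _ _ z, symmetric]) measurable
    also have "\<dots> \<le> (Kop ^^ n) (\<lambda>z. fk z + Wsum R n k z) z" by (rule Kop_pow_mono[OF g2 z])
    also have "\<dots> = (Kop ^^ n) fk z + (Kop ^^ n) (Wsum R n k) z" by (rule Kop_pow_add[OF _ _ z]) measurable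
    finally show ?thesis .
  qed
  have osc: "(Kop ^^ n) fk z \<le> (Kop ^^ n) fk z' + ennreal (a / 2) + Wsum R n (Suc k) z + Wsum R n (Suc k) z'"
    if z: "z \<in> space PS" and z': "z' \<in> space PS" for z z'
  proof -
    let ?W = "(Kop ^^ n) (Wsum R n k)"
    have "(Kop ^^ n) fk z \<le> c + (Kop ^^ n) g z + ?W z" by (rule K1[OF z])
    also have "\<dots> \<le> c + ((Kop ^^ n) g z' + ennreal (a / 2) + excess R n z + excess R n z') + ?W z"
      by (intro add_right_mono add_left_mono Kop_epoch[OF g a ga small R z z' mix n rej])
    also have "\<dots> = (c + (Kop ^^ n) g z') + (ennreal (a / 2) + excess R n z + excess R n z' + ?W z)"
      by (simp only: add_ac)
    also have "\<dots> \<le> ((Kop ^^ n) fk z' + ?W z') + (ennreal (a / 2) + excess R n z + excess R n z' + ?W z)"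
      by (intro add_right_mono K2[OF z'])
    also have "\<dots> = (Kop ^^ n) fk z' + ennreal (a / 2) + Wsum R n (Suc k) z + Wsum R n (Suc k) z'"
      unfolding Wsum_Suc[OF z] Wsum_Suc[OF z'] by (simp only: add_ac)
    finally show ?thesis .
  qed
  have "(Kop ^^ n) fk z \<le> 1" if "z \<in> space PS" for z
    unfolding fk_def by (intro Kop_pow_le f1 that)
  from oscillation_constant[of "space PS" "(Kop ^^ n) fk" "ennreal (a / 2)" "Wsum R n (Suc k)", OF osc this]
  show ?case unfolding fS by (simp add: a_def)
qed

section \<open>Exponential moments and excursions of the energy\<close>

definition G :: "phase \<Rightarrow> ennreal" where "G z = ennreal (exp (H z / 8))"
text \<open>Growth factor per step below R: exp (d \<sigma>^2 / 8) for each of the two refreshments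
  and exp (\<open>\<Delta>E R\<close> / 8) for the Verlet move.\<close>

definition q :: "real \<Rightarrow> real" where "q R = exp (d * \<sigma>\<^sup>2 / 4 + \<Delta>E R / 8)"

lemma G_measurable [measurable]: "G \<in> borel_measurable PS"
  unfolding G_def[abs_def] by measurable

lemma Oop_G:
  assumes z: "z \<in> space PS"
  shows "Oop G z \<le> ennreal (exp (d * \<sigma>\<^sup>2 / 8)) * G z"
proof -
  have "Oop G z = (\<integral>\<^sup>+ b. ennreal (exp (U (fst z) / 8)) * ennreal (exp ((norm_vec d (\<lambda>i. \<eta> * snd z i + \<sigma> * b i))\<^sup>2 / 16)) \<partial>std_gaussian d)"
    unfolding Oop_def by (intro nn_integral_cong) (simp add: G_def H_eq O1_eq ennreal_mult'[symmetric] exp_add[symmetric] add_divide_distrib)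
  also have "\<dots> = ennreal (exp (U (fst z) / 8)) * (\<integral>\<^sup>+ b. ennreal (exp ((norm_vec d (\<lambda>i. \<eta> * snd z i + \<sigma> * b i))\<^sup>2 / 16)) \<partial>std_gaussian d)"
  proof (rule nn_integral_cmult)
    have "(\<lambda>b. norm_vec d (\<lambda>i\<in>{..<d}. \<eta> * snd z i + \<sigma> * b i)) \<in> borel_measurable (std_gaussian d)"
      by (intro measurable_norm_vec measurable_Rd_restrict) measurable
    then have [measurable]: "(\<lambda>b. norm_vec d (\<lambda>i. \<eta> * snd z i + \<sigma> * b i)) \<in> borel_measurable (std_gaussian d)" by simp
    show "(\<lambda>b. ennreal (exp ((norm_vec d (\<lambda>i. \<eta> * snd z i + \<sigma> * b i))\<^sup>2 / 16))) \<in> borel_measurable (std_gaussian d)"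
      by measurable
  qed
  also have "\<dots> \<le> ennreal (exp (U (fst z) / 8)) * ennreal (exp (d * \<sigma>\<^sup>2 / 8) * exp ((norm_vec d (snd z))\<^sup>2 / 16))"
    by (intro mult_left_mono std_gaussian_exp_square \<eta>_pos \<sigma>_pos \<eta>\<sigma>) simp
  also have "\<dots> = ennreal (exp (d * \<sigma>\<^sup>2 / 8)) * G z"
    by (simp add: G_def H_eq ennreal_mult'[symmetric] exp_add[symmetric] add_divide_distrib)
  finally show ?thesis .
qed

lemma ind_le_G: "ind R z \<le> ennreal (exp (- R / 8)) * G z"
  by (auto simp: ind_def G_def indicator_def ennreal_mult'[symmetric] exp_add[symmetric])

lemma bad_le_G:
  assumes z: "z \<in> space PS"
  shows "bad R z \<le> ennreal (exp (- R / 8) * exp (d * \<sigma>\<^sup>2 / 8)) * G z"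
proof -
  have "bad R z \<le> Oop (\<lambda>z. ennreal (exp (- R / 8)) * G z) z"
    unfolding bad_def by (rule Oop_mono[OF _ z]) (rule ind_le_G)
  also have "\<dots> = ennreal (exp (- R / 8)) * Oop G z" by (rule Oop_cmult[OF _ z]) measurable
  also have "\<dots> \<le> ennreal (exp (- R / 8)) * (ennreal (exp (d * \<sigma>\<^sup>2 / 8)) * G z)"
    by (intro mult_left_mono Oop_G z) simp
  finally show ?thesis by (simp add: ennreal_mult' mult.assoc)
qed

text \<open>The energy error is controlled only below R, hence so is the growth of \<open>G\<close>.
  Above R the bound f \<le> 1 takes over and costs \<open>bad R z\<close>; this is why bounded
  functions dominated by \<open>G\<close> are iterated instead of \<open>G\<close> itself.\<close>

lemma Kop_Lyapunov:
  assumes f [measurable]: "f \<in> borel_measurable PS" and f1: "\<And>z. z \<in> space PS \<Longrightarrow> f z \<le> 1"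
    and fB: "\<And>z. z \<in> space PS \<Longrightarrow> f z \<le> ennreal B * G z" and B: "B \<ge> 0" and R: "R \<ge> 0" and z: "z \<in> space PS"
  shows "Kop f z \<le> ennreal (B * q R) * G z + bad R z"
proof -
  define e where "e = exp (d * \<sigma>\<^sup>2 / 8)"
  define e' where "e' = exp (\<Delta>E R / 8)"
  have e: "e > 0" "e' \<ge> 1" using \<Delta>E_nonneg[OF R] by (auto simp: e_def e'_def)
  have O: "Oop f y \<le> ennreal (B * e) * G y" if y: "y \<in> space PS" for y
  proof -
    have "Oop f y \<le> Oop (\<lambda>z. ennreal B * G z) y" by (rule Oop_mono[OF fB y])
    also have "\<dots> = ennreal B * Oop G y" by (rule Oop_cmult[OF _ y]) measurable
    also have "\<dots> \<le> ennreal B * (ennreal e * G y)" unfolding e_def by (intro mult_left_mono Oop_G y) simp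
    finally show ?thesis using B by (simp add: ennreal_mult' mult.assoc)
  qed
  have M: "Mop (Oop f) y \<le> ennreal (B * e * e') * G y + ind R y" if y: "y \<in> space PS" for y
  proof (cases "H y \<le> R")
    case True
    have "G (\<theta> y) \<le> ennreal e' * G y"
      using energy_error[OF y True] by (simp add: G_def e'_def ennreal_mult'[symmetric] exp_add[symmetric])
    moreover have "G (flip d y) \<le> ennreal e' * G y"
    proof -
      have "1 * G y \<le> ennreal e' * G y" using e by (intro mult_right_mono) auto
      then show ?thesis by (simp add: G_def H_flip)
    qed
    ultimately have "Mop G y \<le> ennreal (acc y) * (ennreal e' * G y) + ennreal (1 - acc y) * (ennreal e' * G y)"
      unfolding Mop_def by (intro add_mono mult_left_mono) auto
    also have "\<dots> = Mop (\<lambda>_. ennreal e' * G y) y" by (simp only: Mop_def)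
    finally have MG: "Mop G y \<le> ennreal e' * G y" by simp
    have "Mop (Oop f) y \<le> Mop (\<lambda>z. ennreal (B * e) * G z) y" by (rule Mop_mono[OF O y])
    also have "\<dots> = ennreal (B * e) * Mop G y" by (rule Mop_cmult)
    also have "\<dots> \<le> ennreal (B * e) * (ennreal e' * G y)" by (intro mult_left_mono MG) simp
    also have "\<dots> = ennreal (B * e * e') * G y" using B e by (simp add: ennreal_mult' mult.assoc)
    finally show ?thesis by (rule order_trans) simp
  next
    case False
    have "Mop (Oop f) y \<le> Mop (\<lambda>_. 1) y" by (rule Mop_mono[OF Oop_le[OF f1] y])
    also have "\<dots> = ind R y" using False by (simp add: ind_def)
    finally show ?thesis by (rule order_trans) simp
  qed
  have "Kop f z \<le> Oop (\<lambda>y. ennreal (B * e * e') * G y + ind R y) z"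
    unfolding Kop_def by (rule Oop_mono[OF M z])
  also have "\<dots> = Oop (\<lambda>y. ennreal (B * e * e') * G y) z + bad R z"
    unfolding bad_def by (rule Oop_add[OF _ _ z]) measurable
  also have "Oop (\<lambda>y. ennreal (B * e * e') * G y) z = ennreal (B * e * e') * Oop G z"
    by (rule Oop_cmult[OF _ z]) measurable
  also have "\<dots> \<le> ennreal (B * e * e') * (ennreal e * G z)"
    unfolding e_def by (intro mult_left_mono Oop_G z) simp
  also have "\<dots> = ennreal (B * q R) * G z"
  proof -
    have "B * e * e' * e = B * q R"
      unfolding e_def e'_def q_def by (simp add: exp_add[symmetric] mult.assoc add_divide_distrib[symmetric])
    moreover have "ennreal (B * e * e') * (ennreal e * G z) = ennreal (B * e * e' * e) * G z"
      using e by (subst ennreal_mult''[of e]) (auto simp: mult.assoc)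
    ultimately show ?thesis by (simp only:)
  qed
  finally show ?thesis by (simp add: add_right_mono)
qed

text \<open>Each step multiplies the previous bound by \<open>q R\<close> and adds a fresh term of
  size exp (- R / 8) from \<open>bad\<close>. Enlarging all terms to the same power leaves m + 1
  equal ones.\<close>

lemma Kop_pow_Lyapunov:
  assumes f [measurable]: "f \<in> borel_measurable PS" and f1: "\<And>z. z \<in> space PS \<Longrightarrow> f z \<le> 1"
    and fB: "\<And>z. z \<in> space PS \<Longrightarrow> f z \<le> ennreal (exp (- R / 8) * q R) * G z" and R: "R \<ge> 0" and z: "z \<in> space PS"
  shows "(Kop ^^ m) f z \<le> ennreal (real (Suc m) * exp (- R / 8) * q R ^ Suc m) * G z"
  using z
proof (induction m arbitrary: z)
  case 0
  then show ?case using fB by simp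
next
  case (Suc m)
  let ?E = "exp (- R / 8)"
  have q1: "q R \<ge> 1" using \<Delta>E_nonneg[OF R] by (simp add: q_def)
  have "bad R z \<le> ennreal (?E * exp (d * \<sigma>\<^sup>2 / 8)) * G z" by (rule bad_le_G[OF Suc.prems])
  also have "\<dots> \<le> ennreal (?E * q R ^ Suc (Suc m)) * G z"
  proof (intro mult_right_mono ennreal_leI mult_left_mono)
    have "exp (d * \<sigma>\<^sup>2 / 8) \<le> q R" using \<Delta>E_nonneg[OF R] by (simp add: q_def field_simps add_increasing2)
    also have "\<dots> \<le> q R ^ Suc (Suc m)" using q1 power_increasing[of 1 "Suc (Suc m)" "q R"] by simp
    finally show "exp (d * \<sigma>\<^sup>2 / 8) \<le> q R ^ Suc (Suc m)" .
  qed auto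
  finally have b: "bad R z \<le> ennreal (?E * q R ^ Suc (Suc m)) * G z" .
  have "(Kop ^^ Suc m) f z = Kop ((Kop ^^ m) f) z" by simp
  also have "\<dots> \<le> ennreal (real (Suc m) * ?E * q R ^ Suc m * q R) * G z + bad R z"
    by (rule Kop_Lyapunov[OF _ Kop_pow_le[OF f1] Suc.IH _ R Suc.prems]) (use q1 in auto)
  also have "\<dots> \<le> ennreal (real (Suc m) * ?E * q R ^ Suc m * q R) * G z + ennreal (?E * q R ^ Suc (Suc m)) * G z"
    by (intro add_left_mono b)
  also have "\<dots> = ennreal (real (Suc m) * ?E * q R ^ Suc m * q R + ?E * q R ^ Suc (Suc m)) * G z"
    using q1 by (subst ennreal_plus) (auto simp: distrib_right)
  also have "real (Suc m) * ?E * q R ^ Suc m * q R + ?E * q R ^ Suc (Suc m) = real (Suc (Suc m)) * ?E * q R ^ Suc (Suc m)"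
    by (simp add: algebra_simps)
  finally show ?case .
qed

text \<open>The sum has k (n + 1) \<le> 2 n k terms, each at most \<open>B\<close> times
  \<open>G z\<close>, and \<open>B\<close> itself contains a factor n k; hence the square.\<close>

lemma Wsum_le:
  assumes R: "R \<ge> 0" and z: "z \<in> space PS" and n: "n \<ge> 1"
  shows "Wsum R n k z \<le> ennreal (2 * (real (n * k))\<^sup>2 * exp (- R / 8) * q R ^ (n * k)) * G z"
proof -
  let ?E = "exp (- R / 8)" and ?N = "n * k"
  have q1: "q R \<ge> 1" using \<Delta>E_nonneg[OF R] by (simp add: q_def)
  define B where "B = real ?N * ?E * q R ^ ?N"
  have B: "B \<ge> 0" using q1 by (simp add: B_def)
  have le: "(Kop ^^ m) f z \<le> ennreal B * G z"
    if [measurable]: "f \<in> borel_measurable PS" and f1: "\<And>z. z \<in> space PS \<Longrightarrow> f z \<le> 1"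
      and fB: "\<And>z. z \<in> space PS \<Longrightarrow> f z \<le> ennreal (?E * q R) * G z" and m: "m < ?N" for f m
  proof -
    have "(Kop ^^ m) f z \<le> ennreal (real (Suc m) * ?E * q R ^ Suc m) * G z"
      by (rule Kop_pow_Lyapunov[OF _ f1 fB R z]) measurable
    also have "\<dots> \<le> ennreal B * G z"
    proof (intro mult_right_mono ennreal_leI)
      have s: "real (Suc m) \<le> real ?N" using m unfolding of_nat_le_iff by simp
      show "real (Suc m) * ?E * q R ^ Suc m \<le> B"
        unfolding B_def using m q1 by (intro mult_mono s power_increasing) auto
    qed simp
    finally show ?thesis .
  qed
  have eq: "exp (d * \<sigma>\<^sup>2 / 8) \<le> q R" using \<Delta>E_nonneg[OF R] by (simp add: q_def field_simps add_increasing2)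
  have badB: "bad R y \<le> ennreal (?E * q R) * G y" if "y \<in> space PS" for y
    by (rule order_trans[OF bad_le_G[OF that]]) (intro mult_right_mono ennreal_leI mult_left_mono eq, auto)
  have indB: "ind R y \<le> ennreal (?E * q R) * G y" for y
    using mult_left_mono[OF q1, of ?E] by (intro order_trans[OF ind_le_G] mult_right_mono ennreal_leI) auto
  have ex: "(Kop ^^ (n * i)) (excess R n) z \<le> ennreal (2 * real n * B) * G z" if i: "i < k" for i
  proof -
    have ni: "n * i + j < ?N" if "j < n" for j
    proof -
      have "n * i + j < n * i + n" using that by simp
      also have "\<dots> = n * Suc i" by simp
      also have "\<dots> \<le> n * k" using i by (intro mult_le_mono2) simp
      finally show ?thesis .
    qed
    have "(Kop ^^ (n * i)) (excess R n) z = (Kop ^^ (n * i)) (badsum R n) z + (Kop ^^ (n * i)) (ind R) z"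
      unfolding excess_def[abs_def] by (rule Kop_pow_add[OF _ _ z]) measurable
    also have "(Kop ^^ (n * i)) (badsum R n) z = (\<Sum>j<n. (Kop ^^ (n * i)) ((Kop ^^ j) (bad R)) z)"
      unfolding badsum_def[abs_def] by (rule Kop_pow_sum[OF _ z]) measurable
    also have "\<dots> = (\<Sum>j<n. (Kop ^^ (n * i + j)) (bad R) z)" by (simp add: funpow_add)
    also have "\<dots> \<le> (\<Sum>j<n. ennreal B * G z)"
      by (intro sum_mono le bad_le_1 badB ni) auto
    also have "(Kop ^^ (n * i)) (ind R) z \<le> ennreal B * G z"
      using ni[of 0] n by (intro le ind_le_1 indB) auto
    finally have "(Kop ^^ (n * i)) (excess R n) z \<le> of_nat n * (ennreal B * G z) + ennreal B * G z"
      by (simp add: add_mono)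
    also have "\<dots> = ennreal (real n * B + B) * G z"
      using B by (simp add: ennreal_plus ennreal_mult ennreal_of_nat_eq_real_of_nat distrib_right mult.assoc)
    also have "\<dots> \<le> ennreal (2 * real n * B) * G z"
      using n B mult_right_mono[of 1 "real n" B] by (intro mult_right_mono ennreal_leI) (auto simp: mult.commute)
    finally show ?thesis .
  qed
  have "Wsum R n k z \<le> (\<Sum>i<k. ennreal (2 * real n * B) * G z)"
    unfolding Wsum_def by (intro sum_mono ex) simp
  also have "\<dots> = ennreal (real k * (2 * real n * B)) * G z"
    using B by (simp add: ennreal_mult ennreal_of_nat_eq_real_of_nat mult.assoc)
  also have "real k * (2 * real n * B) = 2 * (real ?N)\<^sup>2 * ?E * q R ^ ?N"
    by (simp add: B_def power2_eq_square mult_ac)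
  finally show ?thesis .
qed

text \<open>Up to the weight, \<open>epochs\<close> puts the probability of B after n k steps near
  one constant for every start. Integrated against \<nu> this concerns the law of the chain;
  integrated against the target it concerns, by invariance, the target itself. Both are thus close
  to the same number.\<close>

lemma tv_bound:
  assumes \<nu>: "\<nu> \<in> space (prob_algebra PS)"
    and small: "small \<le> 1 / 32" and R: "R \<ge> 0"
    and mix: "Creg * exp (- \<rho> / 2) ^ m * sqrt (40 * R / K) \<le> 1 / 8" and n: "n = Suc m"
    and rej: "n * \<Delta>E R \<le> 1 / 8"
    and M1: "(\<integral>\<^sup>+ z. G z \<partial>\<nu>) \<le> ennreal M1" "M1 \<ge> 0" and M2: "(\<integral>\<^sup>+ z. G z \<partial>target d U) \<le> ennreal M2" "M2 \<ge> 0"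
    and fin: "(1 / 2) ^ k + 2 * (real (n * k))\<^sup>2 * exp (- R / 8) * q R ^ (n * k) * (M1 + M2) \<le> \<epsilon>"
  shows "tv_dist (makla_law d U \<gamma> h \<nu> (n * k)) (target d U) \<le> \<epsilon>"
proof -
  let ?N = "n * k"
  let ?L = "makla_law d U \<gamma> h \<nu> ?N"
  interpret nu: prob_space \<nu> using \<nu> by (simp add: space_prob_algebra)
  interpret mu: prob_space "target d U" by (rule prob_space_target)
  have sL: "sets ?L = sets PS" and pL: "prob_space ?L"
    using makla_law_prob_algebra[OF \<nu>] by (auto simp: space_prob_algebra)
  interpret la: prob_space ?L by (rule pL)
  have s\<nu> [measurable_cong]: "sets \<nu> = sets PS" using \<nu> by (simp add: space_prob_algebra)
  have sp\<nu>: "space \<nu> = space PS" by (rule sets_eq_imp_space_eq[OF s\<nu>])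
  have spt: "space (target d U) = space PS" by simp
  define c0 where "c0 = 2 * (real ?N)\<^sup>2 * exp (- R / 8) * q R ^ ?N"
  have q1: "q R \<ge> 1" using \<Delta>E_nonneg[OF R] by (simp add: q_def)
  have c0: "c0 \<ge> 0" using q1 by (simp add: c0_def)
  have W: "(\<integral>\<^sup>+ z. Wsum R n k z \<partial>\<eta>') \<le> ennreal (c0 * M)"
    if s: "sets \<eta>' = sets PS" and M: "(\<integral>\<^sup>+ z. G z \<partial>\<eta>') \<le> ennreal M" "M \<ge> 0" for \<eta>' :: "phase measure" and M
  proof -
    have [measurable]: "G \<in> borel_measurable \<eta>'" using G_measurable s by (simp cong: measurable_cong_sets)
    have "(\<integral>\<^sup>+ z. Wsum R n k z \<partial>\<eta>') \<le> (\<integral>\<^sup>+ z. ennreal c0 * G z \<partial>\<eta>')"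
      unfolding c0_def using sets_eq_imp_space_eq[OF s] n by (intro nn_integral_mono Wsum_le R) auto
    also have "\<dots> = ennreal c0 * (\<integral>\<^sup>+ z. G z \<partial>\<eta>')" by (rule nn_integral_cmult) measurable
    also have "\<dots> \<le> ennreal c0 * ennreal M" by (intro mult_left_mono M) simp
    finally show ?thesis using c0 M by (simp add: ennreal_mult)
  qed
  have key: "emeasure ?L B \<le> emeasure (target d U) B + ennreal \<epsilon>" "emeasure (target d U) B \<le> emeasure ?L B + ennreal \<epsilon>"
    if B: "B \<in> sets PS" for B
  proof -
    let ?f = "indicator B :: phase \<Rightarrow> ennreal"
    have f [measurable]: "?f \<in> borel_measurable PS" using B by simp
    have f1: "?f z \<le> 1" for z by (simp add: indicator_def)
    obtain c where lo: "\<And>z. z \<in> space PS \<Longrightarrow> c \<le> (Kop ^^ ?N) ?f z + Wsum R n k z"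
      and hi: "\<And>z. z \<in> space PS \<Longrightarrow> (Kop ^^ ?N) ?f z \<le> c + ennreal ((1 / 2) ^ k) + Wsum R n k z"
      using epochs[OF f f1 small R mix n rej, of k] by blast
    have L: "emeasure ?L B = (\<integral>\<^sup>+ z. (Kop ^^ ?N) ?f z \<partial>\<nu>)"
      using nn_integral_makla_law[OF \<nu> f, of ?N] B sL by simp
    have T: "emeasure (target d U) B = (\<integral>\<^sup>+ z. (Kop ^^ ?N) ?f z \<partial>target d U)"
      using Kop_invariant[OF f, of ?N] B by simp
    have up: "(\<integral>\<^sup>+ z. (Kop ^^ ?N) ?f z \<partial>\<eta>') \<le> c + ennreal ((1 / 2) ^ k) + ennreal (c0 * M)"
      if p: "prob_space \<eta>'" and s: "sets \<eta>' = sets PS" and M: "(\<integral>\<^sup>+ z. G z \<partial>\<eta>') \<le> ennreal M" "M \<ge> 0" for \<eta>' :: "phase measure" and M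
    proof -
      have [measurable]: "Wsum R n k \<in> borel_measurable \<eta>'" using Wsum_measurable s by (simp cong: measurable_cong_sets)
      have "(\<integral>\<^sup>+ z. (Kop ^^ ?N) ?f z \<partial>\<eta>') \<le> (\<integral>\<^sup>+ z. (c + ennreal ((1 / 2) ^ k)) + Wsum R n k z \<partial>\<eta>')"
        using sets_eq_imp_space_eq[OF s] hi by (intro nn_integral_mono) auto
      also have "\<dots> = (\<integral>\<^sup>+ z. c + ennreal ((1 / 2) ^ k) \<partial>\<eta>') + (\<integral>\<^sup>+ z. Wsum R n k z \<partial>\<eta>')"
        by (rule nn_integral_add) measurable
      also have "(\<integral>\<^sup>+ z. c + ennreal ((1 / 2) ^ k) \<partial>\<eta>') = c + ennreal ((1 / 2) ^ k)"
        using prob_space.emeasure_space_1[OF p] by simp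
      finally show ?thesis using W[OF s M] by (meson add_left_mono order_trans)
    qed
    have dn: "c \<le> (\<integral>\<^sup>+ z. (Kop ^^ ?N) ?f z \<partial>\<eta>') + ennreal (c0 * M)"
      if p: "prob_space \<eta>'" and s: "sets \<eta>' = sets PS" and M: "(\<integral>\<^sup>+ z. G z \<partial>\<eta>') \<le> ennreal M" "M \<ge> 0" for \<eta>' :: "phase measure" and M
    proof -
      have [measurable]: "Wsum R n k \<in> borel_measurable \<eta>'" "(Kop ^^ ?N) ?f \<in> borel_measurable \<eta>'"
        using Wsum_measurable Kop_pow_measurable[OF f, of ?N] s by (simp_all cong: measurable_cong_sets)
      have "c = (\<integral>\<^sup>+ z. c \<partial>\<eta>')" using prob_space.emeasure_space_1[OF p] by simp
      also have "\<dots> \<le> (\<integral>\<^sup>+ z. (Kop ^^ ?N) ?f z + Wsum R n k z \<partial>\<eta>')"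
        using sets_eq_imp_space_eq[OF s] lo by (intro nn_integral_mono) auto
      also have "\<dots> = (\<integral>\<^sup>+ z. (Kop ^^ ?N) ?f z \<partial>\<eta>') + (\<integral>\<^sup>+ z. Wsum R n k z \<partial>\<eta>')"
        by (rule nn_integral_add) measurable
      finally show ?thesis using W[OF s M] by (meson add_left_mono order_trans)
    qed
    have sum: "ennreal ((1 / 2) ^ k) + ennreal (c0 * M1) + ennreal (c0 * M2) \<le> ennreal \<epsilon>"
    proof -
      have "ennreal ((1 / 2) ^ k) + ennreal (c0 * M1) + ennreal (c0 * M2) = ennreal ((1 / 2) ^ k + c0 * (M1 + M2))"
        using c0 M1(2) M2(2) by (simp add: ennreal_plus[symmetric] distrib_left add.assoc del: ennreal_plus)
      then show ?thesis using fin by (simp add: c0_def ennreal_leI)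
    qed
    have "emeasure ?L B \<le> c + ennreal ((1 / 2) ^ k) + ennreal (c0 * M1)"
      unfolding L by (rule up[OF nu.prob_space_axioms s\<nu> M1])
    also have "\<dots> \<le> (emeasure (target d U) B + ennreal (c0 * M2)) + ennreal ((1 / 2) ^ k) + ennreal (c0 * M1)"
      unfolding T by (intro add_right_mono dn[OF mu.prob_space_axioms sets_target M2])
    also have "\<dots> = emeasure (target d U) B + (ennreal ((1 / 2) ^ k) + ennreal (c0 * M1) + ennreal (c0 * M2))"
      by (simp only: add_ac)
    also have "\<dots> \<le> emeasure (target d U) B + ennreal \<epsilon>" by (intro add_left_mono sum)
    finally show "emeasure ?L B \<le> emeasure (target d U) B + ennreal \<epsilon>" .
    have "emeasure (target d U) B \<le> c + ennreal ((1 / 2) ^ k) + ennreal (c0 * M2)"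
      unfolding T by (rule up[OF mu.prob_space_axioms sets_target M2])
    also have "\<dots> \<le> (emeasure ?L B + ennreal (c0 * M1)) + ennreal ((1 / 2) ^ k) + ennreal (c0 * M2)"
      unfolding L by (intro add_right_mono dn[OF nu.prob_space_axioms s\<nu> M1])
    also have "\<dots> = emeasure ?L B + (ennreal ((1 / 2) ^ k) + ennreal (c0 * M1) + ennreal (c0 * M2))"
      by (simp only: add_ac)
    also have "\<dots> \<le> emeasure ?L B + ennreal \<epsilon>" by (intro add_left_mono sum)
    finally show "emeasure (target d U) B \<le> emeasure ?L B + ennreal \<epsilon>" .
  qed
  have \<epsilon>: "\<epsilon> \<ge> 0"
  proof -
    have "0 \<le> (1 / 2 :: real) ^ k" by simp
    moreover have "0 \<le> 2 * (real ?N)\<^sup>2 * exp (- R / 8) * q R ^ ?N * (M1 + M2)"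
      using mult_nonneg_nonneg[OF c0, of "M1 + M2"] M1(2) M2(2) unfolding c0_def by simp
    ultimately show ?thesis using fin by linarith
  qed
  show ?thesis unfolding tv_dist_def
  proof (rule cSUP_least)
    show "sets ?L \<noteq> {}" by auto
    fix B assume "B \<in> sets ?L"
    then have "B \<in> sets PS" by (simp add: sL)
    from key[OF this] show "\<bar>measure ?L B - measure (target d U) B\<bar> \<le> \<epsilon>"
      using \<epsilon> by (simp add: la.emeasure_eq_measure mu.emeasure_eq_measure ennreal_plus[symmetric] abs_le_iff del: ennreal_plus)
  qed
qed

end

section \<open>Choice of the parameters\<close>

context potential begin

text \<open>All parameters are polynomially bounded in \<open>exp Y\<close>, and \<open>Q\<close> stands for \<open>\<kappa> d M\<close>. The energy level
  is \<open>R = 100 l \<Lambda> Q\<close>, so that \<open>exp (- R / 8)\<close> beats the growth of the moment of \<open>exp (H / 8)\<close>.\<close>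
lemma mixing_core:
  fixes Y \<gamma> h \<epsilon> l \<Lambda> Q m\<^sub>\<nu> :: real
  assumes Y: "Y \<ge> 1" and dY: "real d \<le> exp Y" and LY: "1 / L \<le> exp Y" and KY: "1 / K \<le> exp Y" and \<kappa>Y: "L / K \<le> exp Y"
    and h: "h > 0" "1 / h \<le> exp Y" and \<gamma>: "\<gamma> > 0" "10 * sqrt L \<le> \<gamma>"
    and \<epsilon>: "0 < \<epsilon>" "\<epsilon> \<le> 1 / 2" and l_def: "l = ln (1 / \<epsilon>)" and \<Lambda>_def: "\<Lambda> = 200 * Y"
    and Q: "d * \<gamma>\<^sup>2 / K \<le> Q" "m\<^sub>\<nu> \<le> Q" "Q \<le> exp (4 * Y)"
    and step: "h\<^sup>2 * (40000 * \<Lambda> ^ 4 * l\<^sup>2 * (\<gamma> / K) * (L\<^sub>H * (Q * sqrt Q) + L * sqrt L * Q)) \<le> 1"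
    and \<nu>: "\<nu> \<in> space (prob_algebra (phase_space d))"
    and moment: "(\<integral>\<^sup>+ z. ennreal (exp (H z / 8)) \<partial>\<nu>) \<le> ennreal (exp m\<^sub>\<nu>)"
  shows "\<exists>N. tv_dist (makla_law d U \<gamma> h \<nu> N) (target d U) \<le> \<epsilon> \<and> real N \<le> 10 * \<Lambda> * (1 / h * (1 / K) * \<gamma> * l)"
proof -
  note Kp = K_pos and Lp = L_pos
  have l: "l \<ge> 2 / 3"
  proof -
    have "ln 2 \<le> ln (1 / \<epsilon>)" using \<epsilon> by (intro ln_mono) (auto simp: field_simps)
    then show ?thesis using ln2_ge_two_thirds by (simp add: l_def)
  qed
  have \<Lambda>: "\<Lambda> \<ge> 200" using Y by (simp add: \<Lambda>_def)
  have l\<Lambda>: "l * \<Lambda> \<ge> 1" using mult_mono[of "2 / 3" l 200 \<Lambda>] l \<Lambda> by simp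
  have L\<gamma>: "100 * L \<le> \<gamma>\<^sup>2"
  proof -
    have "(10 * sqrt L)\<^sup>2 \<le> \<gamma>\<^sup>2" using Lp by (intro power_mono \<gamma>) auto
    then show ?thesis using Lp by (simp add: power_mult_distrib)
  qed
  have d1: "real d \<ge> 1" using d_pos by simp
  have Qd: "100 * real d \<le> Q"
  proof -
    have "100 * K \<le> \<gamma>\<^sup>2" using L\<gamma> K_le_L by linarith
    then have "real d * (100 * K) \<le> real d * \<gamma>\<^sup>2" by (intro mult_left_mono) auto
    then have "100 * real d \<le> real d * \<gamma>\<^sup>2 / K" using Kp by (simp add: pos_le_divide_eq)
    then show ?thesis using Q(1) by simp
  qed
  then have Q100: "Q \<ge> 100" using d1 by linarith
  define Sz where "Sz = L\<^sub>H * (Q * sqrt Q) + L * sqrt L * Q"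
  have S0: "Sz \<ge> 0" using LH_nonneg Lp Q100 by (auto simp: Sz_def)
  \<comment> \<open>The second summand of \<open>Sz\<close> suffices, because \<open>Q\<close> \<ge>
    d \<gamma>^2 / K and \<gamma> sqrt L \<ge> 10 K. Hence the hypothesis \<open>step\<close> also
    controls \<gamma> h and d h^2 L.\<close>
  have S1: "10 * (real d * \<gamma>\<^sup>2) \<le> \<gamma> / K * Sz"
  proof -
    have "10 * sqrt L * sqrt L \<le> \<gamma> * sqrt L" using \<gamma> Lp by (intro mult_right_mono) auto
    then have "10 * L \<le> \<gamma> * sqrt L" using Lp by (simp add: mult.assoc)
    moreover have "10 * K \<le> 10 * L" using K_le_L by simp
    ultimately have a: "10 * K \<le> \<gamma> * sqrt L" by linarith
    have "10 * (real d * \<gamma>\<^sup>2) = (10 * K / K) * (L / L) * (real d * \<gamma>\<^sup>2)" using Kp Lp by simp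
    also have "\<dots> \<le> (\<gamma> * sqrt L / K) * (L / K) * (real d * \<gamma>\<^sup>2)"
    proof (rule mult_right_mono)
      have b: "10 * K / K \<le> \<gamma> * sqrt L / K" by (rule divide_right_mono[OF a]) (use Kp in simp)
      have c: "L / L \<le> L / K" by (rule divide_left_mono[OF K_le_L]) (use Kp Lp in auto)
      show "10 * K / K * (L / L) \<le> \<gamma> * sqrt L / K * (L / K)"
        by (rule mult_mono[OF b c]) (use Kp Lp \<gamma> in auto)
    qed simp
    also have "\<dots> = \<gamma> / K * (L * sqrt L * (d * \<gamma>\<^sup>2 / K))" by simp
    also have "\<dots> \<le> \<gamma> / K * (L * sqrt L * Q)"
      using Q(1) Kp Lp \<gamma> by (intro mult_left_mono) auto
    also have "\<dots> \<le> \<gamma> / K * Sz"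
      using LH_nonneg Kp \<gamma> Q100 by (intro mult_left_mono) (auto simp: Sz_def)
    finally show ?thesis .
  qed
  \<comment> \<open>The square root of the constant 40000 \<Lambda>^4 l^2 in
    \<open>step\<close>.\<close>
  define P where "P = 200 * \<Lambda>\<^sup>2 * l"
  have P1: "P \<ge> 200"
  proof -
    have "1 * 1 \<le> \<Lambda> * (l * \<Lambda>)" using l\<Lambda> \<Lambda> by (intro mult_mono) auto
    then show ?thesis by (simp add: P_def power2_eq_square mult_ac)
  qed
  have stepP: "h\<^sup>2 * P\<^sup>2 * (\<gamma> / K * Sz) \<le> 1"
    using step by (simp add: P_def Sz_def power_mult_distrib mult_ac)
  have hd: "h\<^sup>2 * P\<^sup>2 * (10 * (real d * \<gamma>\<^sup>2)) \<le> 1"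
    by (rule order_trans[OF mult_left_mono[OF S1] stepP]) simp
  have hP: "h * P * \<gamma> \<le> 1"
  proof (rule power2_le_imp_le)
    have "(h * P * \<gamma>)\<^sup>2 * 1 \<le> (h * P * \<gamma>)\<^sup>2 * (10 * real d)" using d1 by (intro mult_left_mono) auto
    also have "\<dots> = h\<^sup>2 * P\<^sup>2 * (10 * (real d * \<gamma>\<^sup>2))" by (simp add: power_mult_distrib)
    finally show "(h * P * \<gamma>)\<^sup>2 \<le> 1\<^sup>2" using hd by simp
  qed simp
  have \<gamma>h: "\<gamma> * h \<le> 1 / 200"
  proof -
    have "200 * (\<gamma> * h) \<le> P * (\<gamma> * h)" using P1 \<gamma> h by (intro mult_right_mono) auto
    then show ?thesis using hP by (simp add: mult_ac)
  qed
  interpret makla d K L L\<^sub>H U \<gamma> h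
    by unfold_locales (use \<gamma> h \<gamma>h in auto)
  \<comment> \<open>The tolerance \<epsilon> has no lower bound of its own; the step size condition
    makes l at most 1 / (\<gamma> h), hence polynomial in exp Y.\<close>
  have l\<gamma>: "l * \<gamma> \<le> 1 / h"
  proof -
    have "l * 1 \<le> l * (200 * \<Lambda>\<^sup>2)" using l \<Lambda> mult_mono[of 1 \<Lambda> 1 \<Lambda>]
      by (intro mult_left_mono) (auto simp: power2_eq_square)
    then have "l \<le> P" by (simp add: P_def mult_ac)
    then have "l * (\<gamma> * h) \<le> P * (\<gamma> * h)" using \<gamma> h by (intro mult_right_mono) auto
    then have "l * \<gamma> * h \<le> 1" using hP by (simp add: mult_ac)
    then show ?thesis using h by (simp add: pos_le_divide_eq)
  qed
  have inv\<gamma>: "1 / \<gamma> \<le> exp Y / 10"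
  proof -
    have "sqrt (1 / L) \<le> exp Y"
    proof (rule real_le_lsqrt)
      have "exp Y * 1 \<le> exp Y * exp Y" using Y by (intro mult_left_mono) auto
      then show "1 / L \<le> (exp Y)\<^sup>2" unfolding power2_eq_square using LY by linarith
    qed (use Lp in auto)
    moreover have "1 / \<gamma> \<le> 1 / (10 * sqrt L)" using \<gamma> Lp by (intro divide_left_mono) auto
    moreover have "1 / (10 * sqrt L) = sqrt (1 / L) / 10" by (simp add: real_sqrt_divide)
    ultimately show ?thesis by linarith
  qed
  have lY: "l \<le> exp (2 * Y)"
  proof -
    have "l = l * \<gamma> * (1 / \<gamma>)" using \<gamma> by simp
    also have "\<dots> \<le> 1 / h * (exp Y / 10)" using l\<gamma> inv\<gamma> \<gamma> h by (intro mult_mono) auto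
    also have "\<dots> \<le> exp Y * exp Y" using h by (intro mult_mono) auto
    finally show ?thesis by (simp add: exp_add[symmetric])
  qed
  have \<gamma>Y: "\<gamma> \<le> exp Y"
  proof -
    have "\<gamma> * h \<le> 1" using \<gamma>h by simp
    then have "\<gamma> \<le> 1 / h" using h by (simp add: pos_le_divide_eq)
    then show ?thesis using h by linarith
  qed
  have YY: "Y \<le> exp Y" using exp_ge_add_one_self[of Y] by linarith
  \<comment> \<open>Length of the contraction phase of an epoch. With \<Lambda> = 200 Y it makes T
    \<rho> / 2 = 50 Y, and exp (- 50 Y) beats the prefactors in \<open>mix\<close>.\<close>
  define T where "T = \<Lambda> * \<gamma> / (h * K)"
  have T: "T \<ge> 2"
  proof -
    have "h * K \<le> h * (\<gamma>\<^sup>2)" using L\<gamma> K_le_L Kp h by (intro mult_left_mono) auto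
    also have "\<dots> = \<gamma> * h * \<gamma>" by (simp add: power2_eq_square)
    also have "\<dots> \<le> 1 * \<gamma>" using \<gamma>h \<gamma> by (intro mult_right_mono) auto
    finally have "h * K \<le> 1 * \<gamma>" .
    moreover have "200 * \<gamma> \<le> \<Lambda> * \<gamma>" by (rule mult_right_mono[OF \<Lambda>]) (use \<gamma> in simp)
    ultimately have "2 * (h * K) \<le> \<Lambda> * \<gamma>" using \<gamma>(1) by linarith
    then show ?thesis unfolding T_def using h Kp by (simp add: pos_le_divide_eq)
  qed
  define m where "m = nat \<lceil>T\<rceil>"
  have m: "T \<le> real m" "real m \<le> T + 1" using T unfolding m_def by linarith+
  define n where "n = Suc m"
  have n: "real n \<le> 2 * T" using m T by (simp add: n_def)
  \<comment> \<open>As ln 2 \<ge> 1 / 2, at least 2 l halvings bring the oscillation down to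
    \<epsilon>; the additional one gives \<epsilon> / 2.\<close>
  define k where "k = Suc (nat \<lceil>2 * l\<rceil>)"
  have k: "2 * l + 1 \<le> real k" "real k \<le> 5 * l" using l unfolding k_def by linarith+
  have N: "real (n * k) \<le> 10 * l * T"
  proof -
    have "real n * real k \<le> (2 * T) * (5 * l)" using n k T l by (intro mult_mono) auto
    then show ?thesis by (simp add: mult_ac)
  qed
  have Neq: "10 * l * T = 10 * \<Lambda> * (1 / h * (1 / K) * \<gamma> * l)" by (simp add: T_def)
  define W where "W = l * \<Lambda> * Q"
  \<comment> \<open>R / 8 = 25 W / 2 has to exceed the sum of the exponents W, 7 W / 2 and W that
    bound the squared step count, the moment growth and the initial moments, with at least l \<le> W
    to spare for \<epsilon>.\<close>
  define R where "R = 100 * W"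
  have W0: "W \<ge> Q" using mult_right_mono[OF l\<Lambda>, of Q] Q100 unfolding W_def by linarith
  have R0: "R \<ge> 0" using W0 Q100 unfolding R_def by linarith
  have \<Delta>: "\<Delta>E R \<le> h ^ 3 * (2000 * (l * \<Lambda>)\<^sup>2 * Sz)"
  proof -
    define x where "x = l * \<Lambda>"
    have x: "x \<ge> 1" using l\<Lambda> unfolding x_def .
    have xx: "x \<le> x\<^sup>2" using mult_left_mono[of 1 x x] x unfolding power2_eq_square by linarith
    have sx: "sqrt x \<le> x" by (rule real_le_lsqrt[OF _ xx]) (use x in linarith)
    have sR: "sqrt R = 10 * (sqrt x * sqrt Q)"
      by (simp add: R_def W_def x_def real_sqrt_mult)
    have "R * sqrt R = 1000 * (x * sqrt x * (Q * sqrt Q))"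
      unfolding sR by (simp add: R_def W_def x_def)
    also have "\<dots> \<le> 1000 * (x * x * (Q * sqrt Q))"
      using sx x Q100 by (intro mult_left_mono mult_right_mono) auto
    finally have "R * sqrt R \<le> 1000 * x\<^sup>2 * (Q * sqrt Q)" by (simp add: power2_eq_square)
    then have 1: "2 * L\<^sub>H * (R * sqrt R) \<le> 2 * L\<^sub>H * (1000 * x\<^sup>2 * (Q * sqrt Q))"
      using LH_nonneg by (intro mult_left_mono) auto
    have "R = 100 * (x * Q)" by (simp add: R_def W_def x_def)
    also have "\<dots> \<le> 1000 * (x\<^sup>2 * Q)" using xx x Q100 by (intro mult_mono) auto
    finally have 2: "2 * (L * sqrt L) * R \<le> 2 * (L * sqrt L) * (1000 * (x\<^sup>2 * Q))"
      using Lp by (intro mult_left_mono) auto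
    have "2 * L\<^sub>H * (R * sqrt R) + 2 * (L * sqrt L) * R \<le> 2 * L\<^sub>H * (1000 * x\<^sup>2 * (Q * sqrt Q)) + 2 * (L * sqrt L) * (1000 * (x\<^sup>2 * Q))"
      by (rule add_mono[OF 1 2])
    also have "\<dots> = 2000 * x\<^sup>2 * Sz" by (simp add: Sz_def algebra_simps)
    finally show ?thesis unfolding \<Delta>E_def x_def[symmetric] using h by (intro mult_left_mono) auto
  qed
  \<comment> \<open>Steps per epoch times rejections per step. One factor of h^3 cancels against T,
    and the power of \<Lambda> in \<open>P\<close> leaves 1 / \<Lambda> to spare.\<close>
  have rej: "real n * \<Delta>E R \<le> 1 / 8"
  proof -
    have "real n * \<Delta>E R \<le> (2 * T) * (h ^ 3 * (2000 * (l * \<Lambda>)\<^sup>2 * Sz))"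
      using n \<Delta> T \<Delta>E_nonneg[OF R0] by (intro mult_mono) auto
    also have "\<dots> = 1 / 10 * (1 / \<Lambda>) * (h\<^sup>2 * P\<^sup>2 * (\<gamma> / K * Sz))"
      using h Kp \<Lambda> by (simp add: T_def P_def power_mult_distrib power2_eq_square power3_eq_cube field_simps)
    also have "\<dots> \<le> 1 / 10 * (1 / \<Lambda>) * 1" using \<Lambda> by (intro mult_left_mono stepP) auto
    also have "\<dots> \<le> 1 / 8" using \<Lambda> by (simp add: field_simps)
    finally show ?thesis .
  qed
  have small: "small \<le> 1 / 32"
  proof -
    have "real d * (h * h * L) \<le> real d * (h * h * (\<gamma>\<^sup>2 / 100))"
      using L\<gamma> h by (intro mult_left_mono) auto
    also have "\<dots> = 1 / 1000 * (h\<^sup>2 * 1 * (10 * (real d * \<gamma>\<^sup>2)))" by (simp add: power2_eq_square)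
    also have "\<dots> \<le> 1 / 1000 * (h\<^sup>2 * P\<^sup>2 * (10 * (real d * \<gamma>\<^sup>2)))"
      using P1 by (intro mult_left_mono mult_right_mono) (auto simp: power2_eq_square intro!: mult_mono[of 1 P 1 P, simplified])
    also have "\<dots> \<le> 1 / 1000 * 1" by (intro mult_left_mono hd) simp
    finally show ?thesis by (simp add: small_def)
  qed
  have e17: "131072 \<le> exp (17 * Y)" and e25: "33554432 \<le> exp (25 * Y)"
  proof -
    have "2 \<le> exp Y" using exp_ge_add_one_self[of Y] Y by linarith
    then have "2 ^ 17 \<le> exp Y ^ 17" "2 ^ 25 \<le> exp Y ^ 25" by (intro power_mono; simp)+
    then show "131072 \<le> exp (17 * Y)" "33554432 \<le> exp (25 * Y)" by (simp_all add: exp_of_nat_mult[symmetric])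
  qed
  have mix: "Creg * exp (- \<rho> / 2) ^ m * sqrt (40 * R / K) \<le> 1 / 8"
  proof -
    have "exp (- \<rho> / 2) ^ m = exp (real m * (- \<rho> / 2))" by (rule exp_of_nat_mult[symmetric])
    also have "\<dots> \<le> exp (- (50 * Y))"
    proof -
      have "50 * Y = T * (\<rho> / 2)" using \<gamma> h Kp by (simp add: T_def \<rho>_def \<Lambda>_def)
      also have "\<dots> \<le> real m * (\<rho> / 2)" using m \<rho>_bounds by (intro mult_right_mono) auto
      finally show ?thesis by simp
    qed
    finally have E: "exp (- \<rho> / 2) ^ m \<le> exp (- (50 * Y))" .
    have C: "Creg \<le> 12 * exp (4 * Y)"
    proof -
      have "Creg \<le> 60 * sqrt d / (h * (\<gamma> * h / 2))"
        unfolding Creg_def using h \<gamma> \<sigma>_lower \<sigma>_pos by (intro divide_left_mono mult_left_mono) auto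
      also have "\<dots> = 120 * sqrt d * (1 / \<gamma>) * (1 / h) * (1 / h)" by simp
      also have "\<dots> \<le> 120 * exp Y * (exp Y / 10) * exp Y * exp Y"
      proof (intro mult_mono inv\<gamma> h)
        have "sqrt d \<le> d" using d1 by (intro real_le_lsqrt) (auto simp: power2_eq_square)
        then show "sqrt d \<le> exp Y" using dY by linarith
      qed (use \<gamma> h in auto)
      also have "\<dots> = 12 * exp (4 * Y)" by (simp add: exp_add[symmetric])
      finally show ?thesis .
    qed
    have sq: "sqrt (40 * R / K) \<le> 900 * exp (4 * Y)"
    proof (rule real_le_lsqrt)
      have "40 * R / K = 4000 * (l * \<Lambda> * Q * (1 / K))" by (simp add: R_def W_def)
      also have "\<dots> \<le> 4000 * (exp (2 * Y) * (200 * exp Y) * exp (4 * Y) * exp Y)"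
        using l \<Lambda> Q100 YY Kp by (intro mult_left_mono mult_mono lY Q KY) (auto simp: \<Lambda>_def)
      also have "\<dots> = 800000 * exp (8 * Y)" by (simp add: exp_add[symmetric])
      also have "\<dots> \<le> 810000 * exp (8 * Y)" by simp
      also have "\<dots> = (900 * exp (4 * Y))\<^sup>2" by (simp add: power_mult_distrib power2_eq_square exp_add[symmetric])
      finally show "40 * R / K \<le> (900 * exp (4 * Y))\<^sup>2" .
    qed (use R0 Kp in auto)
    have "Creg * exp (- \<rho> / 2) ^ m * sqrt (40 * R / K) \<le> 12 * exp (4 * Y) * exp (- (50 * Y)) * (900 * exp (4 * Y))"
      using C E sq R0 Kp by (intro mult_mono) auto
    also have "\<dots> = 10800 * exp (- (42 * Y))" by (simp add: exp_add[symmetric])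
    also have "\<dots> \<le> exp (17 * Y) / 8 * exp (- (42 * Y))" using e17 by (intro mult_right_mono) auto
    also have "\<dots> = exp (- (25 * Y)) / 8" by (simp add: exp_add[symmetric])
    also have "\<dots> \<le> 1 / 8" using Y by simp
    finally show ?thesis .
  qed
  have WY: "100 * (Y * real d) \<le> W"
  proof -
    have "(2 / 3) * (200 * Y) * (100 * real d) \<le> l * \<Lambda> * Q"
      using l \<Lambda> Qd Y by (intro mult_mono) (auto simp: \<Lambda>_def)
    moreover have "0 \<le> Y * real d" using Y by simp
    ultimately show ?thesis by (simp add: W_def mult_ac)
  qed
  have WY': "100 * Y \<le> W"
  proof -
    have "Y * 1 \<le> Y * real d" by (rule mult_left_mono[OF d1]) (use Y in simp)
    then show ?thesis using WY by linarith
  qed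
  have Wl: "l \<le> W"
  proof -
    have "l * (1 * 1) \<le> l * (\<Lambda> * Q)" using l \<Lambda> Q100 by (intro mult_left_mono mult_mono) auto
    then show ?thesis by (simp add: W_def)
  qed
  \<comment> \<open>The price of having no dissipation. As \<sigma>^2 \<le> \<gamma> h cancels the 1
    / h in T, the refreshments of all steps contribute at most 5 / 2 l \<Lambda> d \<gamma>^2 / K,
    and \<open>Q\<close> \<ge> d \<gamma>^2 / K turns this into a multiple of W.\<close>
  have qN: "q R ^ (n * k) \<le> exp (7 / 2 * W)"
  proof -
    have "q R ^ (n * k) = exp (real (n * k) * (d * \<sigma>\<^sup>2 / 4 + \<Delta>E R / 8))"
      unfolding q_def exp_of_nat_mult[symmetric] by simp
    also have "\<dots> \<le> exp (7 / 2 * W)"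
    proof -
      have "real (n * k) * (d * \<sigma>\<^sup>2 / 4) \<le> (10 * l * T) * (d * (\<gamma> * h) / 4)"
        using N \<sigma>2_upper l T by (intro mult_mono divide_right_mono mult_left_mono) auto
      also have "\<dots> = 5 / 2 * (l * \<Lambda> * (d * \<gamma>\<^sup>2 / K))" using h by (simp add: T_def power2_eq_square)
      also have "\<dots> \<le> 5 / 2 * W" unfolding W_def using Q(1) l \<Lambda> by (intro mult_left_mono) auto
      finally have 1: "real (n * k) * (d * \<sigma>\<^sup>2 / 4) \<le> 5 / 2 * W" .
      have "real (n * k) * (\<Delta>E R / 8) = real k * (real n * \<Delta>E R) / 8" by simp
      also have "\<dots> \<le> (5 * l) * (1 / 8) / 8"
        using k l rej \<Delta>E_nonneg[OF R0] by (intro divide_right_mono mult_mono) auto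
      also have "\<dots> \<le> W" using Wl l by simp
      finally have "real (n * k) * (\<Delta>E R / 8) \<le> W" .
      with 1 have "real (n * k) * (d * \<sigma>\<^sup>2 / 4) + real (n * k) * (\<Delta>E R / 8) \<le> 7 / 2 * W" by linarith
      then show ?thesis by (simp only: distrib_left exp_le_cancel_iff)
    qed
    finally show ?thesis .
  qed
  define M2 where "M2 = (8 / 7 * sqrt (L / K)) ^ d"
  have \<kappa>1: "L / K \<ge> 1" using K_le_L Kp by simp
  have M2: "0 \<le> M2" "M2 \<le> exp W"
  proof -
    show "0 \<le> M2" using Kp Lp by (simp add: M2_def)
    have "sqrt (L / K) \<le> L / K"
    proof (rule real_le_lsqrt)
      have "L / K * 1 \<le> L / K * (L / K)" by (rule mult_left_mono[OF \<kappa>1]) (use \<kappa>1 in linarith)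
      then show "L / K \<le> (L / K)\<^sup>2" unfolding power2_eq_square by linarith
    qed (use \<kappa>1 in linarith)
    then have "sqrt (L / K) \<le> exp Y" using \<kappa>Y by linarith
    moreover have "8 / 7 \<le> exp Y" using exp_ge_add_one_self[of Y] Y by linarith
    ultimately have "8 / 7 * sqrt (L / K) \<le> exp Y * exp Y" using Kp Lp by (intro mult_mono) auto
    then have "M2 \<le> (exp Y * exp Y) ^ d" unfolding M2_def using Kp Lp by (intro power_mono) auto
    also have "\<dots> = exp (real d * (2 * Y))" by (simp add: exp_add[symmetric] exp_of_nat_mult)
    also have "\<dots> \<le> exp W"
    proof -
      have "0 \<le> Y * real d" using Y by simp
      then have "real d * (2 * Y) \<le> W" using WY by (simp add: mult_ac)
      then show ?thesis by simp
    qed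
    finally show "M2 \<le> exp W" .
  qed
  have M1: "exp m\<^sub>\<nu> \<le> exp W" using Q(2) W0 by simp
  have N2: "8 * (real (n * k))\<^sup>2 \<le> exp W"
  proof -
    have "real (n * k) \<le> 10 * (l * \<Lambda> * \<gamma> * (1 / h) * (1 / K))" using N by (simp add: T_def)
    also have "\<dots> \<le> 10 * (exp (2 * Y) * (200 * exp Y) * exp Y * exp Y * exp Y)"
      using l \<Lambda> YY Kp \<gamma> h by (intro mult_left_mono mult_mono lY KY \<gamma>Y) (auto simp: \<Lambda>_def)
    also have "\<dots> = 2000 * exp (6 * Y)" by (simp add: exp_add[symmetric])
    finally have "(real (n * k))\<^sup>2 \<le> (2000 * exp (6 * Y))\<^sup>2" by (intro power_mono) auto
    also have "\<dots> = 4000000 * exp (12 * Y)" by (simp add: power_mult_distrib power2_eq_square exp_add[symmetric])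
    finally have "8 * (real (n * k))\<^sup>2 \<le> 32000000 * exp (12 * Y)" by simp
    also have "\<dots> \<le> exp (25 * Y) * exp (12 * Y)" using e25 by (intro mult_right_mono) auto
    also have "\<dots> \<le> exp W" using WY' Y by (simp add: exp_add[symmetric])
    finally show ?thesis .
  qed
  have half: "(1 / 2) ^ k \<le> \<epsilon> / 2"
  proof -
    have ln2: "ln (2::real) \<ge> 1 / 2" using ln2_ge_two_thirds by linarith
    have "(1 / 2 :: real) ^ k = exp (- (real k * ln 2))"
      by (simp add: exp_minus exp_of_nat_mult inverse_eq_divide power_divide)
    also have "\<dots> \<le> exp (- (l + ln 2))"
    proof -
      have "2 * l * (1 / 2) \<le> 2 * l * ln 2" using ln2 l by (intro mult_left_mono) auto
      moreover have "(2 * l + 1) * ln 2 \<le> real k * ln 2" using k ln2 by (intro mult_right_mono) auto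
      ultimately show ?thesis by (simp add: distrib_right)
    qed
    also have "\<dots> = exp (- l) * exp (- ln 2)" unfolding exp_add[symmetric] by simp
    also have "\<dots> = \<epsilon> / 2" using \<epsilon> by (simp add: l_def exp_minus)
    finally show ?thesis .
  qed
  have "2 * (real (n * k))\<^sup>2 * exp (- R / 8) * q R ^ (n * k) * (exp m\<^sub>\<nu> + M2) \<le> \<epsilon> / 2"
  proof -
    have q0: "0 \<le> q R ^ (n * k)" by (simp add: q_def)
    have "2 * (real (n * k))\<^sup>2 * exp (- R / 8) * q R ^ (n * k) * (exp m\<^sub>\<nu> + M2)
       \<le> (exp W / 4) * exp (- R / 8) * exp (7 / 2 * W) * (2 * exp W)"
    proof -
      have "exp m\<^sub>\<nu> + M2 \<le> 2 * exp W" using M1 M2 by linarith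
      then show ?thesis using N2 qN M2 q0 by (intro mult_mono add_nonneg_nonneg) auto
    qed
    also have "\<dots> = exp (- (7 * W)) / 2"
      by (simp add: R_def exp_add[symmetric])
    also have "\<dots> \<le> exp (- l) / 2" using Wl l by simp
    also have "\<dots> = \<epsilon> / 2" using \<epsilon> by (simp add: l_def exp_minus)
    finally show ?thesis .
  qed
  with half have fin: "(1 / 2) ^ k + 2 * (real (n * k))\<^sup>2 * exp (- R / 8) * q R ^ (n * k) * (exp m\<^sub>\<nu> + M2) \<le> \<epsilon>"
    by linarith
  have "tv_dist (makla_law d U \<gamma> h \<nu> (n * k)) (target d U) \<le> \<epsilon>"
    by (rule tv_bound[OF \<nu> small R0 mix n_def rej _ _ _ M2(1) fin])
      (use moment target_exp_moment in \<open>auto simp: G_def[abs_def] M2_def\<close>)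
  then show ?thesis using N unfolding Neq by blast
qed

end

text \<open>For x = 0 the convention ln 0 = 0 makes the bound 1, which dominates
  \<open>0 powi n\<close> for every integer n; this covers L_H = 0.\<close>

lemma powi_le_exp:
  fixes x :: real
  assumes "x \<ge> 0"
  shows "x powi n \<le> exp (\<bar>real_of_int n\<bar> * \<bar>ln x\<bar>)" "x powi n \<ge> 0"
proof -
  show "x powi n \<ge> 0" using assms by simp
  show "x powi n \<le> exp (\<bar>real_of_int n\<bar> * \<bar>ln x\<bar>)"
  proof (cases "x = 0")
    case True
    then show ?thesis by (simp add: power_int_0_left_if)
  next
    case False
    then have "x powi n = x powr real_of_int n" using assms by (simp add: powr_real_of_int')
    also have "\<dots> = exp (real_of_int n * ln x)" using False by (simp add: powr_def)
    also have "\<dots> \<le> exp (\<bar>real_of_int n\<bar> * \<bar>ln x\<bar>)"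
      unfolding abs_mult[symmetric] by simp
    finally show ?thesis .
  qed
qed

lemma powr_three_halves: "x \<ge> 0 \<Longrightarrow> x powr (3 / 2) = x * sqrt (x::real)"
  using powr_add[of x 1 "1 / 2"] by (simp add: powr_half_sqrt)

text \<open>The origin of the shape of \<open>hbar\<close>: squaring the expression of the theorem
  and dropping the cross term leaves the two parts of the energy error per epoch, with \<kappa>, d
  and M collected in \<open>Q\<close>.\<close>

lemma step_bound_square:
  fixes K L L\<^sub>H d M \<gamma> :: real
  assumes pos: "K > 0" "L > 0" "L\<^sub>H \<ge> 0" "d > 0" "M > 0" "\<gamma> > 0"
  defines "Q \<equiv> L / K * d * M"
  shows "\<gamma> / K * (L\<^sub>H * (Q * sqrt Q) + L * sqrt L * Q) \<le>
    ((sqrt L / \<gamma>) powr (- 1 / 2) * (L / K) *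
       (L\<^sub>H powr (1 / 2) * K powr (- 1 / 4) * d powr (3 / 4) * M powr (3 / 4)
        + L powr (1 / 2) * d powr (1 / 2) * M powr (1 / 2)))\<^sup>2"
proof -
  define A where "A = (sqrt L / \<gamma>) powr (- 1 / 2) * (L / K)"
  define B1 where "B1 = L\<^sub>H powr (1 / 2) * K powr (- 1 / 4) * d powr (3 / 4) * M powr (3 / 4)"
  define B2 where "B2 = L powr (1 / 2) * d powr (1 / 2) * M powr (1 / 2)"
  have sq: "(x powr a)\<^sup>2 = x powr (2 * a)" for x a :: real
    by (simp add: power2_eq_square powr_add[symmetric])
  have A2: "A\<^sup>2 = \<gamma> / sqrt L * (L / K)\<^sup>2"
  proof -
    have "((sqrt L / \<gamma>) powr (- 1 / 2))\<^sup>2 = (sqrt L / \<gamma>) powr (- 1)" unfolding sq by simp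
    also have "\<dots> = \<gamma> / sqrt L" using pos by (simp add: powr_minus field_simps)
    finally show ?thesis unfolding A_def power_mult_distrib by (simp only:)
  qed
  have B1': "B1\<^sup>2 = L\<^sub>H / sqrt K * (d * M * sqrt (d * M))"
  proof -
    have "B1\<^sup>2 = L\<^sub>H powr 1 * K powr (- (1 / 2)) * d powr (3 / 2) * M powr (3 / 2)"
      unfolding B1_def power_mult_distrib sq by simp
    also have "K powr (- (1 / 2)) = 1 / sqrt K" using pos by (simp add: powr_minus powr_half_sqrt inverse_eq_divide)
    finally show ?thesis using pos by (simp add: powr_three_halves real_sqrt_mult)
  qed
  have B2': "B2\<^sup>2 = L * d * M"
    unfolding B2_def power_mult_distrib sq using pos by simp
  have sK: "sqrt K > 0" "sqrt L > 0" "sqrt K * sqrt K = K" "sqrt L * sqrt L = L" using pos by auto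
  have sQ: "sqrt Q = sqrt L / sqrt K * sqrt (d * M)"
    unfolding Q_def by (simp add: real_sqrt_mult real_sqrt_divide)
  have 1: "A\<^sup>2 * B1\<^sup>2 = \<gamma> / K * (L\<^sub>H * (Q * sqrt Q))"
  proof -
    have "A\<^sup>2 * B1\<^sup>2 = \<gamma> * L\<^sub>H * (d * M) * sqrt (d * M) * (L * (sqrt L * sqrt L)) / (K * K * sqrt K * sqrt L)"
      unfolding A2 B1' sK using sK by (simp add: power2_eq_square mult_ac)
    also have "\<dots> = \<gamma> * L\<^sub>H * (d * M) * sqrt (d * M) * L * sqrt L / (K * K * sqrt K)"
      using sK by (simp add: field_simps)
    also have "\<dots> = \<gamma> / K * (L\<^sub>H * (Q * sqrt Q))"
      unfolding sQ unfolding Q_def by (simp add: mult_ac)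
    finally show ?thesis .
  qed
  have 2: "A\<^sup>2 * B2\<^sup>2 = \<gamma> / K * (L * sqrt L * Q)"
  proof -
    have "A\<^sup>2 * B2\<^sup>2 = \<gamma> * (L / sqrt L) * L * (L * d * M) / (K * K)"
      unfolding A2 B2' by (simp add: power2_eq_square)
    also have "L / sqrt L = sqrt L" using pos by (simp add: real_div_sqrt)
    also have "\<gamma> * sqrt L * L * (L * d * M) / (K * K) = \<gamma> / K * (L * sqrt L * Q)"
      by (simp add: Q_def mult_ac)
    finally show ?thesis .
  qed
  have "A\<^sup>2 * B1\<^sup>2 + A\<^sup>2 * B2\<^sup>2 \<le> (A * (B1 + B2))\<^sup>2"
  proof -
    have "0 \<le> 2 * A\<^sup>2 * (B1 * B2)" by (simp add: B1_def B2_def)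
    moreover have "(A * (B1 + B2))\<^sup>2 = A\<^sup>2 * B1\<^sup>2 + A\<^sup>2 * B2\<^sup>2 + 2 * A\<^sup>2 * (B1 * B2)"
      by (simp add: power2_eq_square algebra_simps)
    ultimately show ?thesis by linarith
  qed
  then show ?thesis unfolding 1 2 by (simp add: A_def B1_def B2_def distrib_left mult.assoc)
qed

section \<open>Logarithmic factors and the final assembly\<close>

definition log_size :: "nat \<Rightarrow> real \<Rightarrow> real \<Rightarrow> real \<Rightarrow> real" where
  "log_size d K L L\<^sub>H = 1 + ln (real d) + \<bar>ln K\<bar> + \<bar>ln L\<bar> + \<bar>ln L\<^sub>H\<bar>"

lemma at_most_log_power:
  assumes "c > 0"
  shows "at_most_log (\<lambda>d K L L\<^sub>H. c * log_size d K L L\<^sub>H ^ p)"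
  unfolding at_most_log_def
proof (intro exI[of _ c] exI[of _ p] allI impI conjI)
  fix d :: nat and K L L\<^sub>H :: real
  assume "d \<ge> 1 \<and> K > 0 \<and> L > 0 \<and> L\<^sub>H \<ge> 0"
  then have "ln (real d) \<ge> 0" by simp
  then have "log_size d K L L\<^sub>H > 0" unfolding log_size_def by linarith
  then show "0 < c * log_size d K L L\<^sub>H ^ p" using assms by simp
qed (simp add: log_size_def)

text \<open>The soft-O hypotheses of A.4 become given functions \<open>C\<^sub>\<nu>\<close> and
  \<open>C\<^sub>h\<close>; the factors of the conclusion are chosen before the model and the
  hyperparameters, and this order of quantifiers expresses uniformity.\<close>

theorem theorem2:
  fixes n\<^sub>1 n\<^sub>2 n\<^sub>3 n\<^sub>4 :: int
    and C\<^sub>\<nu> C\<^sub>h :: "nat \<Rightarrow> real \<Rightarrow> real \<Rightarrow> real \<Rightarrow> real"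
  assumes "at_most_log C\<^sub>\<nu>" and "at_most_log C\<^sub>h"
  shows "\<exists>C\<^sub>1 C\<^sub>2. at_most_log C\<^sub>1 \<and> at_most_log C\<^sub>2 \<and>
    (\<forall>(d::nat) (K::real) (L::real) (L\<^sub>H::real) (U::rvec \<Rightarrow> real)
       (\<epsilon>::real) (\<nu>::phase measure) (\<gamma>::real).
       d \<ge> 1 \<and> assumption_A1 d K U \<and> assumption_A2 d L U \<and> assumption_A3 d L\<^sub>H U \<and>
       0 < \<epsilon> \<and> \<epsilon> \<le> 1 / 2 \<and>
       \<nu> \<in> space (prob_algebra (phase_space d)) \<and>
       integrable \<nu> (\<lambda>z. exp (hamiltonian d U z / 8)) \<and>
       log_exp_moment d U \<nu> \<le> C\<^sub>\<nu> d K L L\<^sub>H *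
         (real d powi n\<^sub>1 * K powi n\<^sub>2 * L powi n\<^sub>3 * L\<^sub>H powi n\<^sub>4) \<and>
       \<gamma> > 0 \<and> sqrt L / \<gamma> \<le> 1 / 10 \<longrightarrow>
       (\<exists>hbar>0.
          1 / hbar \<le> C\<^sub>1 d K L L\<^sub>H *
            ((sqrt L / \<gamma>) powr (- 1 / 2) * (L / K) * ln (1 / \<epsilon>) *
             (L\<^sub>H powr (1 / 2) * K powr (- 1 / 4) * real d powr (3 / 4)
                * M_const d K L U \<gamma> \<nu> powr (3 / 4)
              + L powr (1 / 2) * real d powr (1 / 2) * M_const d K L U \<gamma> \<nu> powr (1 / 2))) \<and>
          (\<forall>h. 0 < h \<and> h \<le> hbar \<and> \<gamma> * h \<le> 1 \<and> ln (1 / h) \<le> C\<^sub>h d K L L\<^sub>H * 1 \<longrightarrow>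
             ereal_of_enat (mixing_time d U \<gamma> h \<epsilon> \<nu>)
               \<le> ereal (C\<^sub>2 d K L L\<^sub>H * (1 / h * (1 / K) * \<gamma> * ln (1 / \<epsilon>))))))"
proof -
  obtain c\<^sub>\<nu> p\<^sub>\<nu> where c\<nu>: "\<forall>d K L L\<^sub>H. d \<ge> 1 \<and> K > 0 \<and> L > 0 \<and> L\<^sub>H \<ge> 0 \<longrightarrow>
       0 < C\<^sub>\<nu> d K L L\<^sub>H \<and> C\<^sub>\<nu> d K L L\<^sub>H \<le> c\<^sub>\<nu> * log_size d K L L\<^sub>H ^ p\<^sub>\<nu>"
    using assms(1) unfolding at_most_log_def log_size_def by (elim exE)
  obtain c\<^sub>h p\<^sub>h where ch: "\<forall>d K L L\<^sub>H. d \<ge> 1 \<and> K > 0 \<and> L > 0 \<and> L\<^sub>H \<ge> 0 \<longrightarrow>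
       0 < C\<^sub>h d K L L\<^sub>H \<and> C\<^sub>h d K L L\<^sub>H \<le> c\<^sub>h * log_size d K L L\<^sub>H ^ p\<^sub>h"
    using assms(2) unfolding at_most_log_def log_size_def by (elim exE)
  have \<nu>: "0 < C\<^sub>\<nu> d K L L\<^sub>H \<and> C\<^sub>\<nu> d K L L\<^sub>H \<le> c\<^sub>\<nu> * log_size d K L L\<^sub>H ^ p\<^sub>\<nu>"
    and h: "C\<^sub>h d K L L\<^sub>H \<le> c\<^sub>h * log_size d K L L\<^sub>H ^ p\<^sub>h"
    if "d \<ge> 1" "K > 0" "L > 0" "L\<^sub>H \<ge> 0" for d K L L\<^sub>H
    using c\<nu> ch that by simp_all
  define ni where "ni = \<bar>real_of_int n\<^sub>1\<bar> + \<bar>real_of_int n\<^sub>2\<bar> + \<bar>real_of_int n\<^sub>3\<bar> + \<bar>real_of_int n\<^sub>4\<bar>"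
  define c where "c = 1 + \<bar>c\<^sub>\<nu>\<bar> + \<bar>c\<^sub>h\<bar> + ni"
  define p where "p = 1 + p\<^sub>\<nu> + p\<^sub>h"
  have ni0: "ni \<ge> 0" by (simp add: ni_def)
  have c1: "c \<ge> 1" using ni0 by (simp add: c_def)
  \<comment> \<open>One logarithmic quantity for which exp Y bounds d, 1 / K, 1 / L, \<kappa> and 1
    / h, and exp (2 Y) the initial log moment. The coefficient c and the exponent p are sums, so
    that Y dominates each of the given bounds.\<close>
  define Y where "Y = (\<lambda>d K L L\<^sub>H. c * log_size d K L L\<^sub>H ^ p)"
  \<comment> \<open>This is 200 \<Lambda>^2 with \<Lambda> = 200 Y; its square is the constant 40000
    \<Lambda>^4 of \<open>mixing_core\<close>.\<close>
  define C\<^sub>1 where "C\<^sub>1 = (\<lambda>d K L L\<^sub>H. (200 * (200 * c)\<^sup>2) * log_size d K L L\<^sub>H ^ (2 * p))"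
  define C\<^sub>2 where "C\<^sub>2 = (\<lambda>d K L L\<^sub>H. (10 * 200 * c) * log_size d K L L\<^sub>H ^ p)"
  have C\<^sub>1_eq: "C\<^sub>1 d K L L\<^sub>H = 200 * (200 * Y d K L L\<^sub>H)\<^sup>2" for d K L L\<^sub>H
    by (simp add: C\<^sub>1_def Y_def power_mult_distrib power_even_eq[symmetric] mult.commute)
  have C\<^sub>2_eq: "C\<^sub>2 d K L L\<^sub>H = 10 * (200 * Y d K L L\<^sub>H)" for d K L L\<^sub>H
    by (simp add: C\<^sub>2_def Y_def)
  have "at_most_log C\<^sub>1" "at_most_log C\<^sub>2"
    unfolding C\<^sub>1_def C\<^sub>2_def using c1 by (intro at_most_log_power; simp)+
  moreover have "\<exists>hbar>0.
          1 / hbar \<le> C\<^sub>1 d K L L\<^sub>H *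
            ((sqrt L / \<gamma>) powr (- 1 / 2) * (L / K) * ln (1 / \<epsilon>) *
             (L\<^sub>H powr (1 / 2) * K powr (- 1 / 4) * real d powr (3 / 4)
                * M_const d K L U \<gamma> \<nu> powr (3 / 4)
              + L powr (1 / 2) * real d powr (1 / 2) * M_const d K L U \<gamma> \<nu> powr (1 / 2))) \<and>
          (\<forall>h. 0 < h \<and> h \<le> hbar \<and> \<gamma> * h \<le> 1 \<and> ln (1 / h) \<le> C\<^sub>h d K L L\<^sub>H * 1 \<longrightarrow>
             ereal_of_enat (mixing_time d U \<gamma> h \<epsilon> \<nu>)
               \<le> ereal (C\<^sub>2 d K L L\<^sub>H * (1 / h * (1 / K) * \<gamma> * ln (1 / \<epsilon>))))"
    if d: "d \<ge> 1" and A: "assumption_A1 d K U" "assumption_A2 d L U" "assumption_A3 d L\<^sub>H U"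
      and \<epsilon>: "0 < \<epsilon>" "\<epsilon> \<le> 1 / 2" and \<nu>_prob: "\<nu> \<in> space (prob_algebra (phase_space d))"
      and int: "integrable \<nu> (\<lambda>z. exp (hamiltonian d U z / 8))"
      and mom: "log_exp_moment d U \<nu> \<le> C\<^sub>\<nu> d K L L\<^sub>H * (real d powi n\<^sub>1 * K powi n\<^sub>2 * L powi n\<^sub>3 * L\<^sub>H powi n\<^sub>4)"
      and \<gamma>: "\<gamma> > 0" "sqrt L / \<gamma> \<le> 1 / 10"
    for d :: nat and K L L\<^sub>H :: real and U \<epsilon> \<nu> \<gamma>
  proof -
    interpret potential d K L L\<^sub>H U by unfold_locales (fact d A)+
    note pos = K_pos L_pos LH_nonneg
    define s where "s = log_size d K L L\<^sub>H"
    define y where "y = Y d K L L\<^sub>H"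
    have lnd: "ln (real d) \<ge> 0" using d by simp
    have s1: "s \<ge> 1" unfolding s_def log_size_def using lnd by simp
    have y: "y = c * s ^ p" by (simp add: y_def Y_def s_def)
    have mono: "a * s ^ i \<le> y" if "a \<le> c" "i \<le> p" for a i
      unfolding y using that s1 c1 by (intro mult_mono power_increasing) auto
    have sy: "s \<le> y" using mono[of 1 1] c1 by (simp add: p_def)
    have y1: "y \<ge> 1" using sy s1 by linarith
    have C\<^sub>\<nu>: "0 < C\<^sub>\<nu> d K L L\<^sub>H" "C\<^sub>\<nu> d K L L\<^sub>H \<le> y"
    proof -
      show "0 < C\<^sub>\<nu> d K L L\<^sub>H" using \<nu>[OF d pos] by simp
      have "C\<^sub>\<nu> d K L L\<^sub>H \<le> c\<^sub>\<nu> * s ^ p\<^sub>\<nu>" using \<nu>[OF d pos] by (simp add: s_def)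
      also have "\<dots> \<le> y" using ni0 by (intro mono) (auto simp: c_def p_def)
      finally show "C\<^sub>\<nu> d K L L\<^sub>H \<le> y" .
    qed
    have C\<^sub>h: "C\<^sub>h d K L L\<^sub>H \<le> y"
    proof -
      have "C\<^sub>h d K L L\<^sub>H \<le> c\<^sub>h * s ^ p\<^sub>h" using h[OF d pos] by (simp add: s_def)
      also have "\<dots> \<le> y" using ni0 by (intro mono) (auto simp: c_def p_def)
      finally show ?thesis .
    qed
    have logs: "ln d \<le> s" "\<bar>ln K\<bar> + \<bar>ln L\<bar> \<le> s" "\<bar>ln K\<bar> \<le> s" "\<bar>ln L\<bar> \<le> s" "\<bar>ln L\<^sub>H\<bar> \<le> s"
      unfolding s_def log_size_def using lnd by linarith+
    have dY: "real d \<le> exp y"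
    proof -
      have "real d = exp (ln d)" using d by simp
      also have "\<dots> \<le> exp y" using logs(1) sy by simp
      finally show ?thesis .
    qed
    have inv: "1 / x \<le> exp y" if "x > 0" "\<bar>ln x\<bar> \<le> s" for x
    proof -
      have "1 / x = exp (- ln x)" using that by (simp add: exp_minus inverse_eq_divide)
      also have "\<dots> \<le> exp y" using that sy by simp
      finally show ?thesis .
    qed
    have LY: "1 / L \<le> exp y" and KY: "1 / K \<le> exp y" using inv logs pos by auto
    have \<kappa>Y: "L / K \<le> exp y"
    proof -
      have "L / K = exp (ln L - ln K)" using pos by (simp add: exp_diff)
      also have "\<dots> \<le> exp y" using logs(2) sy by simp
      finally show ?thesis .
    qed
    define m where "m = log_exp_moment d U \<nu>"
    have my: "m \<le> exp (2 * y)"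
    proof -
      have "real d powi n\<^sub>1 * K powi n\<^sub>2 * L powi n\<^sub>3 * L\<^sub>H powi n\<^sub>4
         \<le> exp (\<bar>real_of_int n\<^sub>1\<bar> * \<bar>ln d\<bar>) * exp (\<bar>real_of_int n\<^sub>2\<bar> * \<bar>ln K\<bar>) * exp (\<bar>real_of_int n\<^sub>3\<bar> * \<bar>ln L\<bar>) * exp (\<bar>real_of_int n\<^sub>4\<bar> * \<bar>ln L\<^sub>H\<bar>)"
        using pos by (intro mult_mono powi_le_exp mult_nonneg_nonneg) auto
      also have "\<dots> = exp (\<bar>real_of_int n\<^sub>1\<bar> * \<bar>ln d\<bar> + \<bar>real_of_int n\<^sub>2\<bar> * \<bar>ln K\<bar> + \<bar>real_of_int n\<^sub>3\<bar> * \<bar>ln L\<bar> + \<bar>real_of_int n\<^sub>4\<bar> * \<bar>ln L\<^sub>H\<bar>)"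
        by (simp add: exp_add)
      also have "\<dots> \<le> exp (\<bar>real_of_int n\<^sub>1\<bar> * s + \<bar>real_of_int n\<^sub>2\<bar> * s + \<bar>real_of_int n\<^sub>3\<bar> * s + \<bar>real_of_int n\<^sub>4\<bar> * s)"
        unfolding exp_le_cancel_iff using logs lnd by (intro add_mono mult_left_mono) auto
      also have "\<dots> = exp (ni * s ^ 1)" by (simp add: ni_def algebra_simps)
      also have "\<dots> \<le> exp y" unfolding exp_le_cancel_iff by (rule mono) (simp_all add: c_def p_def)
      finally have "real d powi n\<^sub>1 * K powi n\<^sub>2 * L powi n\<^sub>3 * L\<^sub>H powi n\<^sub>4 \<le> exp y" .
      then have "C\<^sub>\<nu> d K L L\<^sub>H * (real d powi n\<^sub>1 * K powi n\<^sub>2 * L powi n\<^sub>3 * L\<^sub>H powi n\<^sub>4) \<le> y * exp y"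
        using C\<^sub>\<nu> pos y1 by (intro mult_mono) auto
      also have "\<dots> \<le> exp y * exp y"
      proof (rule mult_right_mono)
        show "y \<le> exp y" using exp_ge_add_one_self[of y] by linarith
      qed simp
      finally show ?thesis using mom by (simp add: m_def exp_add[symmetric])
    qed
    have sets\<nu>: "sets \<nu> = sets (phase_space d)" and prob\<nu>: "prob_space \<nu>"
      using \<nu>_prob by (auto simp: space_prob_algebra)
    interpret nu: prob_space \<nu> by (rule prob\<nu>)
    have moment: "(\<integral>\<^sup>+ z. ennreal (exp (H z / 8)) \<partial>\<nu>) \<le> ennreal (exp m)"
    proof -
      have eq: "(\<integral>\<^sup>+ z. ennreal (exp (H z / 8)) \<partial>\<nu>) = ennreal (\<integral>z. exp (H z / 8) \<partial>\<nu>)"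
        by (rule nn_integral_eq_integral[OF int]) simp
      \<comment> \<open>As H \<ge> 0, the expectation is at least 1, so \<open>exp\<close> inverts
        the logarithm.\<close>
      have "(\<integral>z. 1 \<partial>\<nu>) \<le> (\<integral>z. exp (H z / 8) \<partial>\<nu>)"
        using sets_eq_imp_space_eq[OF sets\<nu>] H_nonneg by (intro integral_mono int) auto
      then have "(\<integral>z. exp (H z / 8) \<partial>\<nu>) \<ge> 1" by (simp add: nu.prob_space)
      then have "exp m = (\<integral>z. exp (H z / 8) \<partial>\<nu>)" by (simp add: m_def log_exp_moment_def)
      then show ?thesis unfolding eq by simp
    qed
    define l where "l = ln (1 / \<epsilon>)"
    have l: "l > 0" using \<epsilon> by (simp add: l_def)
    define M where "M = M_const d K L U \<gamma> \<nu>"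
    have M_eq: "M = max (\<gamma>\<^sup>2 / L) (m / (L / K * real d))"
    proof -
      have "(sqrt L / \<gamma>) powr (- 2) = \<gamma>\<^sup>2 / L"
        using pos \<gamma> by (simp add: powr_minus power_divide)
      then show ?thesis by (simp add: M_def M_const_def m_def)
    qed
    have Mpos: "M > 0" using pos \<gamma> by (simp add: M_eq less_max_iff_disj)
    define Q where "Q = L / K * real d * M"
    have \<kappa>d: "L / K * real d > 0" using pos d by simp
    \<comment> \<open>Multiplying M by \<kappa> d restores the two quantities that
      \<open>mixing_core\<close> compares with \<open>Q\<close>, the friction term and the log
      moment.\<close>
    have Q_eq: "Q = max (d * \<gamma>\<^sup>2 / K) m"
    proof -
      have "Q = max (L / K * real d * (\<gamma>\<^sup>2 / L)) (L / K * real d * (m / (L / K * real d)))"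
        unfolding Q_def M_eq using \<kappa>d by (intro max_mult_distrib_left[THEN trans]) auto
      then show ?thesis using \<kappa>d pos d by simp
    qed
    define X where "X = (sqrt L / \<gamma>) powr (- 1 / 2) * (L / K) *
       (L\<^sub>H powr (1 / 2) * K powr (- 1 / 4) * real d powr (3 / 4) * M powr (3 / 4)
        + L powr (1 / 2) * real d powr (1 / 2) * M powr (1 / 2))"
    have X: "\<gamma> / K * (L\<^sub>H * (Q * sqrt Q) + L * sqrt L * Q) \<le> X\<^sup>2"
      unfolding X_def Q_def using pos d Mpos \<gamma> by (intro step_bound_square) auto
    have Xpos: "X > 0"
      unfolding X_def using pos d Mpos \<gamma> by (intro mult_pos_pos add_nonneg_pos) auto
    \<comment> \<open>The claimed bound on 1 / \<open>hbar\<close> is taken as an equality.\<close>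
    define hbar where "hbar = 1 / (C\<^sub>1 d K L L\<^sub>H * (l * X))"
    have C1: "C\<^sub>1 d K L L\<^sub>H > 0" using y1 by (simp add: C\<^sub>1_eq y_def[symmetric])
    have "hbar > 0" using C1 l Xpos by (simp add: hbar_def)
    moreover have "1 / hbar \<le> C\<^sub>1 d K L L\<^sub>H *
            ((sqrt L / \<gamma>) powr (- 1 / 2) * (L / K) * l *
             (L\<^sub>H powr (1 / 2) * K powr (- 1 / 4) * real d powr (3 / 4) * M powr (3 / 4)
              + L powr (1 / 2) * real d powr (1 / 2) * M powr (1 / 2)))"
      by (simp add: hbar_def X_def mult_ac)
    moreover have "ereal_of_enat (mixing_time d U \<gamma> h \<epsilon> \<nu>) \<le> ereal (C\<^sub>2 d K L L\<^sub>H * (1 / h * (1 / K) * \<gamma> * l))"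
      if h: "0 < h" "h \<le> hbar" "\<gamma> * h \<le> 1" "ln (1 / h) \<le> C\<^sub>h d K L L\<^sub>H * 1" for h
    proof -
      have hY: "1 / h \<le> exp y"
      proof -
        have "1 / h = exp (ln (1 / h))" using h by simp
        also have "\<dots> \<le> exp y" using h(4) C\<^sub>h by simp
        finally show ?thesis .
      qed
      have \<gamma>Y: "\<gamma> \<le> exp y"
      proof -
        have "\<gamma> \<le> 1 / h" using h by (simp add: pos_le_divide_eq)
        then show ?thesis using hY by linarith
      qed
      have Q4: "Q \<le> exp (4 * y)"
      proof -
        have "d * \<gamma>\<^sup>2 / K = real d * (\<gamma> * \<gamma>) * (1 / K)" by (simp add: power2_eq_square)
        also have "\<dots> \<le> exp y * (exp y * exp y) * exp y"
          using \<gamma> pos by (intro mult_mono dY \<gamma>Y KY) auto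
        also have "\<dots> = exp (4 * y)" by (simp add: exp_add[symmetric])
        finally have "d * \<gamma>\<^sup>2 / K \<le> exp (4 * y)" .
        moreover have "m \<le> exp (4 * y)"
        proof -
          have "exp (2 * y) \<le> exp (4 * y)" using y1 by simp
          then show ?thesis using my by linarith
        qed
        ultimately show ?thesis by (simp add: Q_eq)
      qed
      have step: "h\<^sup>2 * (40000 * (200 * y) ^ 4 * l\<^sup>2 * (\<gamma> / K) * (L\<^sub>H * (Q * sqrt Q) + L * sqrt L * Q)) \<le> 1"
      proof -
        have "h * (C\<^sub>1 d K L L\<^sub>H * (l * X)) \<le> hbar * (C\<^sub>1 d K L L\<^sub>H * (l * X))"
          using h C1 l Xpos by (intro mult_right_mono) auto
        also have "\<dots> = 1" using C1 l Xpos by (simp add: hbar_def)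
        finally have "h * (C\<^sub>1 d K L L\<^sub>H * (l * X)) \<le> 1" .
        then have a: "(h * (C\<^sub>1 d K L L\<^sub>H * (l * X)))\<^sup>2 \<le> 1" using h C1 l Xpos by (intro power_le_one) auto
        have "h\<^sup>2 * (40000 * (200 * y) ^ 4 * l\<^sup>2 * (\<gamma> / K) * (L\<^sub>H * (Q * sqrt Q) + L * sqrt L * Q))
          = (h\<^sup>2 * (40000 * (200 * y) ^ 4) * l\<^sup>2) * (\<gamma> / K * (L\<^sub>H * (Q * sqrt Q) + L * sqrt L * Q))"
          by (simp only: mult_ac)
        also have "\<dots> \<le> (h\<^sup>2 * (40000 * (200 * y) ^ 4) * l\<^sup>2) * X\<^sup>2" by (intro mult_left_mono X) simp
        also have "\<dots> = (h * (C\<^sub>1 d K L L\<^sub>H * (l * X)))\<^sup>2"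
          unfolding C\<^sub>1_eq y_def[symmetric] by (simp add: power_mult_distrib)
        finally show ?thesis using a by linarith
      qed
      have \<gamma>10: "10 * sqrt L \<le> \<gamma>" using \<gamma> by (simp add: field_simps)
      obtain N where N: "tv_dist (makla_law d U \<gamma> h \<nu> N) (target d U) \<le> \<epsilon>"
        "real N \<le> 10 * (200 * y) * (1 / h * (1 / K) * \<gamma> * l)"
        using mixing_core[OF y1 dY LY KY \<kappa>Y h(1) hY \<gamma>(1) \<gamma>10 \<epsilon> l_def refl _ _ Q4 step \<nu>_prob moment]
        by (auto simp: Q_eq)
      have "mixing_time d U \<gamma> h \<epsilon> \<nu> \<le> enat N"
        unfolding mixing_time_def using N(1) by (intro INF_lower) simp
      then have "ereal_of_enat (mixing_time d U \<gamma> h \<epsilon> \<nu>) \<le> ereal_of_enat (enat N)"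
        by (subst ereal_of_enat_le_iff)
      also have "\<dots> \<le> ereal (C\<^sub>2 d K L L\<^sub>H * (1 / h * (1 / K) * \<gamma> * l))"
        using N(2) by (simp add: C\<^sub>2_eq y_def)
      finally show ?thesis .
    qed
    ultimately show ?thesis unfolding l_def M_def by blast
  qed
  ultimately show ?thesis by blast
qed

end
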